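(* Assume that $G$ is a real form of $U^{\mathbb C}$ and that $x\in Z$ is such that $X=U^{\mathbb C}\cdot x$ is compact. Let $\mathcal O$ be the unique closed $G$-orbit in $X$ and let $\beta\in\mathfrak p$. Then the set $\max_{\mathcal O}(\beta)=\{p\in\mathcal O:\ \mu_{\mathfrak p}^\beta(p)=\max_{z\in\mathcal O}\mu_{\mathfrak p}^\beta(z)\}$ is the unique closed orbit of $G^{\beta+}$ acting on $X$. This orbit is connected and it is a $(K^\beta)^o$-orbit.
   Context: Let $U$ be a compact connected Lie group with Lie algebra $\mathfrak u$ and let $U^{\mathbb C}$ be its complexification, with Lie algebra $\mathfrak u^{\mathbb C}=\mathfrak u\oplus i\mathfrak u$. Let $G\subset U^{\mathbb C}$ be a connected compatible subgroup with Lie algebra $\mathfrak g$; compatible means that $G$ is closed and, with $K:=G\cap U$ and $\mathfrak p:=\mathfrak g\cap i\mathfrak u$, the map $K\times\mathfrak p\to G$, $(k,\beta)\mapsto k\exp(\beta)$, is a diffeomorphism. Then $\mathfrak g=\mathfrak k\oplus\mathfrak p$, where $\mathfrak k$ is the Lie algebra of $K$. That $G$ is a real form of $U^{\mathbb C}$ means $\mathfrak u=\mathfrak k\oplus i\mathfrak p$, so that $\mathfrak g^{\mathbb C}=\mathfrak u^{\mathbb C}$. Let $(Z,\omega)$ be a Kähler manifold with complex structure $J$ and Kähler metric $(v,w)=\omega(v,Jw)$, with a holomorphic action of $U^{\mathbb C}$ such that $\omega$ is $U$-invariant, and let $\mu:Z\to\mathfrak u^*$ be a $U$-equivariant momentum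 map: $d\mu^\xi=i_{\xi_Z}\omega$ for all $\xi\in\mathfrak u$, where $\mu^\xi(z)=\langle\mu(z),\xi\rangle$ and $\xi_Z(z)=\frac{d}{dt}\big|_{t=0}\exp(t\xi)\cdot z$. For $\beta\in\mathfrak p$ put $\mu_{\mathfrak p}^\beta:=\mu^{-i\beta}$. It is a known result (Wolf) that when $G$ is a real form and $U^{\mathbb C}\cdot x$ is compact, $G$ has a unique closed orbit in $U^{\mathbb C}\cdot x$. For $\beta\in\mathfrak p$: $G^{\beta+}:=\{g\in G:\ \lim_{t\to-\infty}\exp(t\beta)\,g\,\exp(-t\beta)\text{ exists (in }G)\}$, $K^\beta:=\{k\in K:\ \mathrm{Ad}(k)(\beta)=\beta\}$, and $(K^\beta)^o$ is the identity component of $K^\beta$. *)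

theory Defs
  imports "HOL-Analysis.Analysis" "HOL-Algebra.Group_Action"
begin

section \<open>Finite-dimensional complex vector spaces\<close>

text \<open>
  Model spaces of complex manifolds: finite-dimensional real normed spaces with a complex
  structure \<open>times_i\<close> (multiplication by the imaginary unit). Unlike \<open>complex^'n\<close>
  this includes dimension zero. All norms on such a space are equivalent, so none of the notions
  below depends on the norm.
\<close>

class fin_dim_complex = real_normed_vector +
  fixes times_i :: "'a \<Rightarrow> 'a"
  assumes times_i_add: "times_i (x + y) = times_i x + times_i y"
    and times_i_scaleR: "times_i (r *\<^sub>R x) = r *\<^sub>R times_i x"
    and times_i_times_i: "times_i (times_i x) = - x"
    and finite_spanning_set: "\<exists>B. finite B \<and> (\<forall>x. \<exists>r. x = (\<Sum>b\<in>B. r b *\<^sub>R b))"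

lemma finite_spanning_set_iff:
  "(\<exists>B::'a::real_vector set. finite B \<and> (\<forall>x. \<exists>r. x = (\<Sum>b\<in>B. r b *\<^sub>R b)))
     \<longleftrightarrow> (\<exists>B::'a set. finite B \<and> span B = UNIV)"
proof (rule ex_cong1, rule conj_cong[OF refl])
  fix B :: "'a set" assume "finite B"
  show "(\<forall>x. \<exists>r. x = (\<Sum>b\<in>B. r b *\<^sub>R b)) \<longleftrightarrow> span B = UNIV"
    unfolding span_finite[OF \<open>finite B\<close>] surj_def by (rule refl)
qed

instantiation complex :: fin_dim_complex
begin
definition "times_i_complex (z::complex) = \<i> * z"
instance
proof
  have "finite (Basis :: complex set) \<and> span (Basis :: complex set) = UNIV"
    by (simp add: span_Basis)
  then show "\<exists>B::complex set. finite B \<and> (\<forall>x. \<exists>r. x = (\<Sum>b\<in>B. r b *\<^sub>R b))"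
    unfolding finite_spanning_set_iff by blast
qed (auto simp: times_i_complex_def algebra_simps scaleR_conv_of_real)
end

instantiation prod :: (fin_dim_complex, fin_dim_complex) fin_dim_complex
begin
definition "times_i_prod (z::'a \<times> 'b) = (times_i (fst z), times_i (snd z))"
instance
proof
  obtain B1 :: "'a set" where B1: "finite B1" "span B1 = UNIV"
    using finite_spanning_set[unfolded finite_spanning_set_iff] by blast
  obtain B2 :: "'b set" where B2: "finite B2" "span B2 = UNIV"
    using finite_spanning_set[unfolded finite_spanning_set_iff] by blast
  let ?B = "(\<lambda>b. (b, 0::'b)) ` B1 \<union> (\<lambda>b. (0::'a, b)) ` B2"
  have lin1: "linear (\<lambda>b::'a. (b, 0::'b))" and lin2: "linear (\<lambda>b::'b. (0::'a, b))"
    by (auto intro!: linearI)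
  have 1: "(a, 0) \<in> span ?B" for a
    using linear_span_image[OF lin1, of B1] B1(2) span_mono[of "(\<lambda>b. (b, 0::'b)) ` B1" ?B] by blast
  have 2: "(0, b) \<in> span ?B" for b
    using linear_span_image[OF lin2, of B2] B2(2) span_mono[of "(\<lambda>b. (0::'a, b)) ` B2" ?B] by blast
  have "(a, b) \<in> span ?B" for a b
    using span_add[OF 1 2, of a b] by simp
  then have "finite ?B \<and> span ?B = UNIV" using B1 B2 by auto
  then show "\<exists>B::('a \<times> 'b) set. finite B \<and> (\<forall>x. \<exists>r. x = (\<Sum>b\<in>B. r b *\<^sub>R b))"
    unfolding finite_spanning_set_iff by blast
qed (auto simp: times_i_prod_def times_i_add times_i_scaleR times_i_times_i)
end

section \<open>Smooth and holomorphic maps between model spaces\<close>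

primrec Ck_on :: "nat \<Rightarrow> ('a::real_normed_vector \<Rightarrow> 'b::real_normed_vector) \<Rightarrow> 'a set \<Rightarrow> bool" where
  "Ck_on 0 f S \<longleftrightarrow> continuous_on S f"
| "Ck_on (Suc k) f S \<longleftrightarrow> (\<forall>x\<in>S. f differentiable (at x)) \<and>
     (\<forall>v. Ck_on k (\<lambda>x. frechet_derivative f (at x) v) S)"

text \<open>To be used on open \<open>S\<close> only.\<close>

definition Cinf_on :: "('a::real_normed_vector \<Rightarrow> 'b::real_normed_vector) \<Rightarrow> 'a set \<Rightarrow> bool" where
  "Cinf_on f S \<longleftrightarrow> (\<forall>k. Ck_on k f S)"

definition holo_on :: "('a::fin_dim_complex \<Rightarrow> 'b::fin_dim_complex) \<Rightarrow> 'a set \<Rightarrow> bool" where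
  "holo_on f S \<longleftrightarrow> (\<forall>x\<in>S. \<exists>D. (f has_derivative D) (at x) \<and>
     (\<forall>v. D (times_i v) = times_i (D v)))"

section \<open>Manifolds\<close>

text \<open>
  A manifold is a whole type \<open>'m\<close> together with an atlas, which need not be maximal. A chart is
  a pair of a domain and a coordinate function that is meaningful on that domain.
\<close>

type_synonym ('m, 'e) chart = "'m set \<times> ('m \<Rightarrow> 'e)"
type_synonym ('m, 'e) atlas = "('m, 'e) chart set"

definition chart_inv :: "('m, 'e) chart \<Rightarrow> 'e \<Rightarrow> 'm" where
  "chart_inv c = inv_into (fst c) (snd c)"

definition is_chart :: "('m::topological_space, 'e::real_normed_vector) chart \<Rightarrow> bool" where
  "is_chart c \<longleftrightarrow> open (fst c) \<and> open (snd c ` fst c) \<and>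
     homeomorphism (fst c) (snd c ` fst c) (snd c) (chart_inv c)"

definition complex_atlas :: "('m::topological_space, 'e::fin_dim_complex) atlas \<Rightarrow> bool" where
  "complex_atlas A \<longleftrightarrow> (\<forall>c\<in>A. is_chart c) \<and> (\<Union>c\<in>A. fst c) = UNIV \<and>
     (\<forall>c\<in>A. \<forall>d\<in>A. holo_on (snd d \<circ> chart_inv c) (snd c ` (fst c \<inter> fst d)))"

definition vector_space_atlas :: "('e, 'e) atlas" where
  "vector_space_atlas = {(UNIV, id)}"

definition prod_atlas :: "('m, 'e) atlas \<Rightarrow> ('n, 'f) atlas \<Rightarrow> ('m \<times> 'n, 'e \<times> 'f) atlas" where
  "prod_atlas A B = {(fst c \<times> fst d, map_prod (snd c) (snd d)) | c d. c \<in> A \<and> d \<in> B}"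

definition holomorphic_map ::
  "('m::topological_space, 'e::fin_dim_complex) atlas \<Rightarrow> ('n::topological_space, 'f::fin_dim_complex) atlas
    \<Rightarrow> ('m \<Rightarrow> 'n) \<Rightarrow> bool" where
  "holomorphic_map A B f \<longleftrightarrow> continuous_on UNIV f \<and>
     (\<forall>c\<in>A. \<forall>d\<in>B. holo_on (snd d \<circ> f \<circ> chart_inv c) (snd c ` (fst c \<inter> f -` fst d)))"

definition smooth_on_open ::
  "('m::topological_space, 'e::real_normed_vector) atlas \<Rightarrow> ('n::topological_space, 'f::real_normed_vector) atlas
    \<Rightarrow> 'm set \<Rightarrow> ('m \<Rightarrow> 'n) \<Rightarrow> bool" where
  "smooth_on_open A B W f \<longleftrightarrow> open W \<and> continuous_on W f \<and>
     (\<forall>c\<in>A. \<forall>d\<in>B. Cinf_on (snd d \<circ> f \<circ> chart_inv c) (snd c ` (fst c \<inter> W \<inter> f -` fst d)))"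

text \<open>
  Smoothness on an arbitrary subset means local extendability to smooth maps on open sets. If the
  subset is an embedded submanifold (such as a closed subgroup of a Lie group, a linear subspace,
  or a product of these), this is smoothness with respect to its own manifold structure.
\<close>

definition smooth_on_subset ::
  "('m::topological_space, 'e::real_normed_vector) atlas \<Rightarrow> ('n::topological_space, 'f::real_normed_vector) atlas
    \<Rightarrow> 'm set \<Rightarrow> ('m \<Rightarrow> 'n) \<Rightarrow> bool" where
  "smooth_on_subset A B S f \<longleftrightarrow>
     (\<forall>p\<in>S. \<exists>W F. p \<in> W \<and> smooth_on_open A B W F \<and> (\<forall>q\<in>S \<inter> W. F q = f q))"

definition diffeomorphism ::
  "('m::topological_space, 'e::real_normed_vector) atlas \<Rightarrow> ('n::topological_space, 'f::real_normed_vector) atlas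
    \<Rightarrow> 'm set \<Rightarrow> 'n set \<Rightarrow> ('m \<Rightarrow> 'n) \<Rightarrow> bool" where
  "diffeomorphism A B S T f \<longleftrightarrow> bij_betw f S T \<and>
     smooth_on_subset A B S f \<and> smooth_on_subset B A T (inv_into S f)"

text \<open>
  The tangent space at \<open>p\<close> is the model space, a tangent vector being identified with its
  coordinates in the preferred chart \<open>chart_at A p\<close>. The complex structure of the tangent space
  is \<open>times_i\<close>, independently of the chart, since coordinate changes are holomorphic.
\<close>

definition chart_at :: "('m, 'e) atlas \<Rightarrow> 'm \<Rightarrow> ('m, 'e) chart" where
  "chart_at A p = (SOME c. c \<in> A \<and> p \<in> fst c)"

definition tangent_map ::
  "('m, 'e::real_normed_vector) atlas \<Rightarrow> ('n, 'f::real_normed_vector) atlas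
    \<Rightarrow> ('m \<Rightarrow> 'n) \<Rightarrow> 'm \<Rightarrow> 'e \<Rightarrow> 'f" where
  "tangent_map A B f p = frechet_derivative
     (snd (chart_at B (f p)) \<circ> f \<circ> chart_inv (chart_at A p)) (at (snd (chart_at A p) p))"

definition velocity :: "('m, 'e::real_normed_vector) atlas \<Rightarrow> (real \<Rightarrow> 'm) \<Rightarrow> 'e" where
  "velocity A \<gamma> = vector_derivative (snd (chart_at A (\<gamma> 0)) \<circ> \<gamma>) (at 0)"

section \<open>Lie groups\<close>

definition complex_Lie_group ::
  "'g::{t2_space,second_countable_topology} monoid \<Rightarrow> ('g, 'e::fin_dim_complex) atlas \<Rightarrow> bool" where
  "complex_Lie_group L A \<longleftrightarrow> group L \<and> carrier L = UNIV \<and> complex_atlas A \<and>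
     holomorphic_map (prod_atlas A A) A (\<lambda>(g, h). g \<otimes>\<^bsub>L\<^esub> h) \<and>
     holomorphic_map A A (\<lambda>g. inv\<^bsub>L\<^esub> g)"

text \<open>The Lie algebra is the tangent space at the unit, so it is the model space \<open>'e\<close>.\<close>

definition one_param_subgroup ::
  "'g::topological_space monoid \<Rightarrow> ('g, 'e::real_normed_vector) atlas \<Rightarrow> 'e \<Rightarrow> (real \<Rightarrow> 'g) \<Rightarrow> bool" where
  "one_param_subgroup L A \<xi> \<gamma> \<longleftrightarrow> continuous_on UNIV \<gamma> \<and>
     (\<forall>s t. \<gamma> (s + t) = \<gamma> s \<otimes>\<^bsub>L\<^esub> \<gamma> t) \<and>
     ((snd (chart_at A \<one>\<^bsub>L\<^esub>) \<circ> \<gamma>) has_vector_derivative \<xi>) (at 0)"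

definition lie_exp ::
  "'g::topological_space monoid \<Rightarrow> ('g, 'e::real_normed_vector) atlas \<Rightarrow> 'e \<Rightarrow> 'g" where
  "lie_exp L A \<xi> = (THE \<gamma>. one_param_subgroup L A \<xi> \<gamma>) 1"

definition Ad :: "'g monoid \<Rightarrow> ('g, 'e::real_normed_vector) atlas \<Rightarrow> 'g \<Rightarrow> 'e \<Rightarrow> 'e" where
  "Ad L A g = tangent_map A A (\<lambda>h. g \<otimes>\<^bsub>L\<^esub> h \<otimes>\<^bsub>L\<^esub> inv\<^bsub>L\<^esub> g) \<one>\<^bsub>L\<^esub>"

text \<open>To be used for closed subgroups \<open>H\<close> only.\<close>

definition lie_algebra_of ::
  "'g::topological_space monoid \<Rightarrow> ('g, 'e::real_normed_vector) atlas \<Rightarrow> 'g set \<Rightarrow> 'e set" where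
  "lie_algebra_of L A H = {\<xi>. \<forall>t::real. lie_exp L A (t *\<^sub>R \<xi>) \<in> H}"

definition is_direct_sum :: "'e::real_vector set \<Rightarrow> 'e set \<Rightarrow> 'e set \<Rightarrow> bool" where
  "is_direct_sum V A B \<longleftrightarrow> subspace A \<and> subspace B \<and> V = {a + b | a b. a \<in> A \<and> b \<in> B} \<and> A \<inter> B = {0}"

text \<open>
  \<open>L\<close> is the complexification of its compact subgroup \<open>U\<close>: the Lie algebra of \<open>L\<close> is the
  complexification of that of \<open>U\<close>, and the polar decomposition holds. The polar decomposition
  singles out the universal complexification; the Lie algebra condition alone would also allow, for
  instance, a circle inside an elliptic curve.
\<close>

definition complexification_of ::
  "'g::{t2_space,second_countable_topology} monoid \<Rightarrow> ('g, 'e::fin_dim_complex) atlas \<Rightarrow> 'g set \<Rightarrow> bool" where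
  "complexification_of L A U \<longleftrightarrow> complex_Lie_group L A \<and> subgroup U L \<and> compact U \<and>
     is_direct_sum UNIV (lie_algebra_of L A U) (times_i ` lie_algebra_of L A U) \<and>
     diffeomorphism (prod_atlas A vector_space_atlas) A
       (U \<times> times_i ` lie_algebra_of L A U) UNIV
       (\<lambda>(u, \<eta>). u \<otimes>\<^bsub>L\<^esub> lie_exp L A \<eta>)"

definition compact_part :: "'g set \<Rightarrow> 'g set \<Rightarrow> 'g set" where
  "compact_part U G = G \<inter> U"

definition noncompact_part ::
  "'g::topological_space monoid \<Rightarrow> ('g, 'e::fin_dim_complex) atlas \<Rightarrow> 'g set \<Rightarrow> 'g set \<Rightarrow> 'e set" where
  "noncompact_part L A U G = lie_algebra_of L A G \<inter> times_i ` lie_algebra_of L A U"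

definition compatible_subgroup ::
  "'g::topological_space monoid \<Rightarrow> ('g, 'e::fin_dim_complex) atlas \<Rightarrow> 'g set \<Rightarrow> 'g set \<Rightarrow> bool" where
  "compatible_subgroup L A U G \<longleftrightarrow> subgroup G L \<and> closed G \<and>
     diffeomorphism (prod_atlas A vector_space_atlas) A
       (compact_part U G \<times> noncompact_part L A U G) G
       (\<lambda>(k, \<beta>). k \<otimes>\<^bsub>L\<^esub> lie_exp L A \<beta>)"

definition real_form ::
  "'g::topological_space monoid \<Rightarrow> ('g, 'e::fin_dim_complex) atlas \<Rightarrow> 'g set \<Rightarrow> 'g set \<Rightarrow> bool" where
  "real_form L A U G \<longleftrightarrow> is_direct_sum (lie_algebra_of L A U)
     (lie_algebra_of L A (compact_part U G)) (times_i ` noncompact_part L A U G)"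

definition G_beta_plus ::
  "'g::topological_space monoid \<Rightarrow> ('g, 'e::real_normed_vector) atlas \<Rightarrow> 'g set \<Rightarrow> 'e \<Rightarrow> 'g set" where
  "G_beta_plus L A G \<beta> = {g \<in> G. \<exists>l\<in>G.
     ((\<lambda>t::real. lie_exp L A (t *\<^sub>R \<beta>) \<otimes>\<^bsub>L\<^esub> g \<otimes>\<^bsub>L\<^esub> lie_exp L A (- t *\<^sub>R \<beta>)) \<longlongrightarrow> l) at_bot}"

definition K_beta ::
  "'g monoid \<Rightarrow> ('g, 'e::real_normed_vector) atlas \<Rightarrow> 'g set \<Rightarrow> 'e \<Rightarrow> 'g set" where
  "K_beta L A K \<beta> = {k \<in> K. Ad L A k \<beta> = \<beta>}"

definition identity_component :: "'g::topological_space monoid \<Rightarrow> 'g set \<Rightarrow> 'g set" where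
  "identity_component L H = connected_component_set H \<one>\<^bsub>L\<^esub>"

section \<open>Kaehler manifolds, actions and momentum maps\<close>

text \<open>
  A 2-form assigns to each point a bilinear form on the tangent space there; \<open>form_in_chart\<close>
  is its coordinate expression in a chart \<open>c\<close>.
\<close>

definition form_in_chart ::
  "('m, 'f::real_normed_vector) atlas \<Rightarrow> ('m \<Rightarrow> 'f \<Rightarrow> 'f \<Rightarrow> real) \<Rightarrow> ('m, 'f) chart \<Rightarrow> 'f \<Rightarrow> 'f \<Rightarrow> 'f \<Rightarrow> real" where
  "form_in_chart B \<omega> c y v w =
     (let p = chart_inv c y; T = frechet_derivative (snd (chart_at B p) \<circ> chart_inv c) (at y)
      in \<omega> p (T v) (T w))"

definition smooth_2form :: "('m, 'f::real_normed_vector) atlas \<Rightarrow> ('m \<Rightarrow> 'f \<Rightarrow> 'f \<Rightarrow> real) \<Rightarrow> bool" where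
  "smooth_2form B \<omega> \<longleftrightarrow> (\<forall>p. bilinear (\<omega> p) \<and> (\<forall>v. \<omega> p v v = 0)) \<and>
     (\<forall>c\<in>B. \<forall>v w. Cinf_on (\<lambda>y. form_in_chart B \<omega> c y v w) (snd c ` fst c))"

definition closed_2form :: "('m, 'f::real_normed_vector) atlas \<Rightarrow> ('m \<Rightarrow> 'f \<Rightarrow> 'f \<Rightarrow> real) \<Rightarrow> bool" where
  "closed_2form B \<omega> \<longleftrightarrow> (\<forall>c\<in>B. \<forall>y \<in> snd c ` fst c. \<forall>u v w.
     frechet_derivative (\<lambda>y. form_in_chart B \<omega> c y v w) (at y) u +
     frechet_derivative (\<lambda>y. form_in_chart B \<omega> c y w u) (at y) v +
     frechet_derivative (\<lambda>y. form_in_chart B \<omega> c y u v) (at y) w = 0)"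

definition Kaehler_manifold ::
  "('z::{t2_space,second_countable_topology}, 'f::fin_dim_complex) atlas \<Rightarrow> ('z \<Rightarrow> 'f \<Rightarrow> 'f \<Rightarrow> real) \<Rightarrow> bool" where
  "Kaehler_manifold B \<omega> \<longleftrightarrow> complex_atlas B \<and> smooth_2form B \<omega> \<and> closed_2form B \<omega> \<and>
     (\<forall>p v w. \<omega> p v (times_i w) = \<omega> p w (times_i v)) \<and>
     (\<forall>p v. v \<noteq> 0 \<longrightarrow> \<omega> p v (times_i v) > 0)"

definition holomorphic_action ::
  "'g::topological_space monoid \<Rightarrow> ('g, 'e::fin_dim_complex) atlas \<Rightarrow>
   ('z::topological_space, 'f::fin_dim_complex) atlas \<Rightarrow> ('g \<Rightarrow> 'z \<Rightarrow> 'z) \<Rightarrow> bool" where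
  "holomorphic_action L A B act \<longleftrightarrow> group_action L UNIV act \<and>
     holomorphic_map (prod_atlas A B) B (\<lambda>(g, z). act g z)"

definition invariant_2form ::
  "('z, 'f::real_normed_vector) atlas \<Rightarrow> ('g \<Rightarrow> 'z \<Rightarrow> 'z) \<Rightarrow> 'g set \<Rightarrow> ('z \<Rightarrow> 'f \<Rightarrow> 'f \<Rightarrow> real) \<Rightarrow> bool" where
  "invariant_2form B act U \<omega> \<longleftrightarrow> (\<forall>u\<in>U. \<forall>z v w.
     \<omega> (act u z) (tangent_map B B (act u) z v) (tangent_map B B (act u) z w) = \<omega> z v w)"

definition fundamental_field ::
  "'g::topological_space monoid \<Rightarrow> ('g, 'e::real_normed_vector) atlas \<Rightarrow>
   ('z, 'f::real_normed_vector) atlas \<Rightarrow> ('g \<Rightarrow> 'z \<Rightarrow> 'z) \<Rightarrow> 'e \<Rightarrow> 'z \<Rightarrow> 'f" where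
  "fundamental_field L A B act \<xi> z = velocity B (\<lambda>t. act (lie_exp L A (t *\<^sub>R \<xi>)) z)"

text \<open>
  \<open>\<mu> z\<close> represents a linear form on the Lie algebra of \<open>U\<close>; its values outside that
  subspace are irrelevant. Equivariance refers to the coadjoint action.
\<close>

definition momentum_map ::
  "'g::topological_space monoid \<Rightarrow> ('g, 'e::real_normed_vector) atlas \<Rightarrow> 'g set \<Rightarrow>
   ('z::topological_space, 'f::real_normed_vector) atlas \<Rightarrow> ('z \<Rightarrow> 'f \<Rightarrow> 'f \<Rightarrow> real) \<Rightarrow>
   ('g \<Rightarrow> 'z \<Rightarrow> 'z) \<Rightarrow> ('z \<Rightarrow> 'e \<Rightarrow> real) \<Rightarrow> bool" where
  "momentum_map L A U B \<omega> act \<mu> \<longleftrightarrow>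
     (\<forall>z. \<forall>\<xi>\<in>lie_algebra_of L A U. \<forall>\<eta>\<in>lie_algebra_of L A U. \<forall>a b.
        \<mu> z (a *\<^sub>R \<xi> + b *\<^sub>R \<eta>) = a * \<mu> z \<xi> + b * \<mu> z \<eta>) \<and>
     (\<forall>u\<in>U. \<forall>z. \<forall>\<xi>\<in>lie_algebra_of L A U. \<mu> (act u z) \<xi> = \<mu> z (Ad L A (inv\<^bsub>L\<^esub> u) \<xi>)) \<and>
     (\<forall>\<xi>\<in>lie_algebra_of L A U.
        smooth_on_open B vector_space_atlas UNIV (\<lambda>z. \<mu> z \<xi>) \<and>
        (\<forall>z v. tangent_map B vector_space_atlas (\<lambda>z. \<mu> z \<xi>) z v =
           \<omega> z (fundamental_field L A B act \<xi> z) v))"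

text \<open>For \<open>\<beta>\<close> in the noncompact part, the component of the momentum map along \<open>-i\<beta>\<close>, which lies in the Lie algebra of \<open>U\<close>.\<close>

definition momentum_p :: "('z \<Rightarrow> 'e::fin_dim_complex \<Rightarrow> real) \<Rightarrow> 'e \<Rightarrow> 'z \<Rightarrow> real" where
  "momentum_p \<mu> \<beta> z = \<mu> z (- times_i \<beta>)"

definition max_set :: "'z set \<Rightarrow> ('z \<Rightarrow> real) \<Rightarrow> 'z set" where
  "max_set S f = {p \<in> S. \<forall>z\<in>S. f z \<le> f p}"

definition closed_orbit ::
  "'g monoid \<Rightarrow> ('g \<Rightarrow> 'z::topological_space \<Rightarrow> 'z) \<Rightarrow> 'g set \<Rightarrow> 'z set \<Rightarrow> 'z set \<Rightarrow> bool" where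
  "closed_orbit L act H X S \<longleftrightarrow>
     S \<in> orbits (L\<lparr>carrier := H\<rparr>) X act \<and> closedin (top_of_set X) S"

definition unique_closed_orbit ::
  "'g monoid \<Rightarrow> ('g \<Rightarrow> 'z::topological_space \<Rightarrow> 'z) \<Rightarrow> 'g set \<Rightarrow> 'z set \<Rightarrow> 'z set \<Rightarrow> bool" where
  "unique_closed_orbit L act H X S \<longleftrightarrow>
     closed_orbit L act H X S \<and> (\<forall>S'. closed_orbit L act H X S' \<longrightarrow> S' = S)"

end

theory Submission
  imports Defs "HOL-Complex_Analysis.Complex_Analysis" "Jordan_Normal_Form.Determinant"
begin

text \<open>
  Under \<open>exp (t \<beta>)\<close> the function \<open>f \<beta> = momentum_p \<mu> \<beta>\<close> strictly increases off the fixed points. So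
  at a maximizer on \<open>X\<close> the element \<open>\<beta>\<close> and all its positive weight spaces stabilize the point, the
  orbit of the opposite parabolic subgroup is open and dense in \<open>X\<close>, and it follows that the set
  \<open>MX \<beta>\<close> of maximizers is a single orbit of the centralizer of \<open>\<beta>\<close> and meets every closed set that
  is invariant under \<open>exp \<beta>\<close> and the positive weight spaces in the Lie algebra of \<open>G\<close>. Maximizing the
  norm of the momentum map on \<open>MX \<beta>\<close>, first in the directions of \<open>p\<close> and then in those of \<open>i k\<close> that
  commute with \<open>\<beta>\<close>, yields a perturbation \<open>b'\<close> of \<open>\<beta>\<close> for which \<open>MX b' \<subseteq> MX \<beta>\<close> is an orbit of a
  compact group inside \<open>G_beta_plus\<close>; hence any point \<open>y\<close> of \<open>MX b'\<close> lies in every closed invariant set,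
  in particular in \<open>\<O>\<close>, and \<open>max_set \<O> (f \<beta>) = \<O> \<inter> MX \<beta>\<close>. Decomposing the Lie algebra of \<open>G\<close> into
  weight spaces of \<open>\<beta>\<close> shows that this set is near \<open>y\<close> an orbit of the identity component of
  \<open>K_beta\<close>, and since \<open>y\<close> is in the closure of every centralizer orbit in it, it is one globally.
\<close>

section \<open>Finite-dimensional complex vector spaces\<close>

text \<open>Density is proved in the complex group because on a real line the non-transversal
  parameters could separate the others. On a complex line they are zeros of an entire determinant,
  so they are countable and separate nothing. Statements about \<open>lie G\<close> reach the
  complex algebra because a weight space of an element of \<open>pp\<close> is the sum of its part
  in \<open>lie G\<close> and \<open>times_i\<close> times that part. The perturbation is forced:
  \<open>MX \<beta>\<close> is an orbit of a noncompact complex centralizer, so a closed invariant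
  set that meets it need not contain a prescribed point of it. At \<open>b'\<close>, the two
  maximizations put every noncompact direction of the centralizer into compact directions plus the
  isotropy of \<open>y\<close>. The exponential is given by a definite description and Lie algebras
  only through exponentials. One-parameter groups, sums in Lie algebras of closed subgroups and the
  splitting of \<open>lie G\<close> are therefore derived from estimates at the unit. Connected
  subgroups appear as products of exponentials (\<open>gen\<close>), and local statements on their
  orbits become global along a compact group.\<close>

lemma coordinate_bound:
  fixes B :: "'a::real_normed_vector set"
  assumes fin: "finite B" and ind: "independent B"
  obtains m where "m > 0" "\<And>r b. b \<in> B \<Longrightarrow> m * \<bar>r b\<bar> \<le> norm (\<Sum>b\<in>B. r b *\<^sub>R b)"
proof -
  \<comment> \<open>Coordinates vanish off \<open>B\<close>, so the cube is compact in the full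
    function space by Tychonoff. \<open>S\<close> below is the part where some coordinate on
    \<open>B\<close> has modulus 1; independence keeps the norm away from 0 there.\<close>
  define Q :: "('a \<Rightarrow> real) set" where "Q = PiE UNIV (\<lambda>b. if b \<in> B then {-1..1} else {0})"
  have "compactin (product_topology (\<lambda>i. euclidean) UNIV) Q"
    unfolding Q_def compactin_PiE by (auto simp: compactin_euclidean_iff)
  then have cQ: "compact Q"
    by (simp add: euclidean_product_topology)
  define S where "S = Q \<inter> (\<Union>b\<in>B. {r. \<bar>r b\<bar> = 1})"
  have "closed {r :: 'a \<Rightarrow> real. \<bar>r b\<bar> = 1}" for b
    by (intro closed_Collect_eq continuous_intros continuous_on_product_coordinates)
  then have "closed (\<Union>b\<in>B. {r :: 'a \<Rightarrow> real. \<bar>r b\<bar> = 1})"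
    using fin by (intro closed_UN) auto
  then have cS: "compact S"
    unfolding S_def using cQ by (rule compact_Int_closed[rotated])
  define F where "F r = norm (\<Sum>b\<in>B. r b *\<^sub>R b)" for r :: "'a \<Rightarrow> real"
  have cF: "continuous_on S F"
    unfolding F_def
    by (intro continuous_intros continuous_on_subset[OF continuous_on_product_coordinates]) auto
  have pos: "F r > 0" if r: "r \<in> S" for r
  proof -
    obtain b where b: "b \<in> B" "\<bar>r b\<bar> = 1" using r unfolding S_def by auto
    have "(\<Sum>b\<in>B. r b *\<^sub>R b) \<noteq> 0"
      using independentD[OF ind fin order_refl, of r b] b by auto
    then show ?thesis by (simp add: F_def)
  qed
  show ?thesis
  proof (cases "S = {}")
    case True
    have "B = {}"
    proof (rule ccontr)
      assume "B \<noteq> {}"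
      then obtain b where "b \<in> B" by blast
      then have "(\<lambda>c. if c = b then 1 else 0) \<in> S" by (auto simp: S_def Q_def)
      with True show False by simp
    qed
    then show ?thesis using that[of 1] by auto
  next
    case False
    then obtain r0 where r0: "r0 \<in> S" "\<And>r. r \<in> S \<Longrightarrow> F r0 \<le> F r"
      using continuous_attains_inf[OF cS False cF] by auto
    have "F r0 * \<bar>r b\<bar> \<le> F r" if b: "b \<in> B" for r b
    proof -
      define M where "M = Max ((\<lambda>b. \<bar>r b\<bar>) ` B)"
      have Mge: "\<bar>r c\<bar> \<le> M" if "c \<in> B" for c unfolding M_def using fin that by auto
      show ?thesis
      proof (cases "M = 0")
        case True
        then have "r b = 0" using Mge[OF b] by auto
        then show ?thesis by (simp add: F_def)
      next
        case False
        then have Mpos: "M > 0" using Mge[OF b] by auto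
        have "M \<in> (\<lambda>b. \<bar>r b\<bar>) ` B" unfolding M_def using fin b by (intro Max_in) auto
        then obtain c where c: "c \<in> B" "\<bar>r c\<bar> = M" by auto
        define r' where "r' = (\<lambda>b. if b \<in> B then r b / M else 0)"
        have "r' \<in> S"
        proof -
          have "-1 \<le> r x / M \<and> r x / M \<le> 1" if "x \<in> B" for x
            using Mge[OF that] Mpos by (auto simp: abs_le_iff field_simps)
          moreover have "\<bar>r c / M\<bar> = 1" using c Mpos by simp
          ultimately show ?thesis unfolding S_def Q_def r'_def using c(1) by auto
        qed
        then have "F r0 \<le> F r'" by (rule r0)
        also have "F r' = F r / M"
        proof -
          have "(\<Sum>b\<in>B. r' b *\<^sub>R b) = (1/M) *\<^sub>R (\<Sum>b\<in>B. r b *\<^sub>R b)"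
            unfolding scaleR_sum_right r'_def by (intro sum.cong) auto
          then show ?thesis using Mpos by (simp add: F_def)
        qed
        finally have "F r0 * M \<le> F r" using Mpos by (simp add: field_simps)
        moreover have "F r0 * \<bar>r b\<bar> \<le> F r0 * M"
          using Mge[OF b] pos[OF r0(1)] by (intro mult_left_mono) auto
        ultimately show ?thesis by simp
      qed
    qed
    then show ?thesis using that[OF pos[OF r0(1)]] by (auto simp: F_def)
  qed
qed

lemma fin_dim_basis:
  obtains B :: "'a::fin_dim_complex set" where "finite B" "independent B" "span B = UNIV"
proof -
  obtain C :: "'a set" where C: "finite C" "span C = UNIV"
    using finite_spanning_set[unfolded finite_spanning_set_iff] by blast
  obtain B where "B \<subseteq> C" "independent B" "C \<subseteq> span B"
    using maximal_independent_subset[of C] by blast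
  then show ?thesis
    using that[of B] C by (metis finite_subset span_mono span_span top.extremum_uniqueI)
qed

lemma linear_imp_bounded:
  fixes f :: "'a::fin_dim_complex \<Rightarrow> 'b::real_normed_vector"
  assumes "linear f" shows "bounded_linear f"
proof -
  obtain B :: "'a set" where B: "finite B" "independent B" "span B = UNIV" by (rule fin_dim_basis)
  obtain m where m: "m > 0" "\<And>r b. b \<in> B \<Longrightarrow> m * \<bar>r b\<bar> \<le> norm (\<Sum>b\<in>B. r b *\<^sub>R b)"
    using coordinate_bound[OF B(1,2)] by blast
  have "norm (f x) \<le> norm x * (\<Sum>b\<in>B. norm (f b) / m)" for x
  proof -
    obtain r where r: "x = (\<Sum>b\<in>B. r b *\<^sub>R b)"
      using UNIV_I[of x] unfolding B(3)[symmetric] span_finite[OF B(1)] by blast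
    have "f x = (\<Sum>b\<in>B. r b *\<^sub>R f b)"
      by (simp add: r linear_sum[OF assms] linear_cmul[OF assms])
    also have "norm \<dots> \<le> (\<Sum>b\<in>B. \<bar>r b\<bar> * norm (f b))"
      by (rule order_trans[OF norm_sum]) simp
    also have "\<dots> \<le> (\<Sum>b\<in>B. norm x / m * norm (f b))"
      using m r by (intro sum_mono mult_right_mono) (auto simp: field_simps)
    also have "\<dots> = norm x * (\<Sum>b\<in>B. norm (f b) / m)"
      by (simp add: sum_distrib_left)
    finally show ?thesis .
  qed
  then show ?thesis
    using assms by (intro bounded_linear_intro[where K="\<Sum>b\<in>B. norm (f b) / m"])
      (auto simp: linear_add linear_cmul)
qed

text \<open>The ball is a closed part of the continuous image of a compact cube of coordinates,
  whose size comes from \<open>coordinate_bound\<close>. This takes the place of Heine-Borel, since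
  the model spaces carry no Euclidean structure.\<close>

lemma compact_cball_fin_dim: "compact (cball (0::'a::fin_dim_complex) R)"
proof -
  obtain B :: "'a set" where B: "finite B" "independent B" "span B = UNIV" by (rule fin_dim_basis)
  obtain m where m: "m > 0" "\<And>r b. b \<in> B \<Longrightarrow> m * \<bar>r b\<bar> \<le> norm (\<Sum>b\<in>B. r b *\<^sub>R b)"
    using coordinate_bound[OF B(1,2)] by blast
  define Q :: "('a \<Rightarrow> real) set" where "Q = PiE UNIV (\<lambda>b. if b \<in> B then {-R/m..R/m} else {0})"
  have "compactin (product_topology (\<lambda>i. euclidean) UNIV) Q"
    unfolding Q_def compactin_PiE by (auto simp: compactin_euclidean_iff)
  then have cQ: "compact Q"
    by (simp add: euclidean_product_topology)
  define F where "F r = (\<Sum>b\<in>B. r b *\<^sub>R b)" for r :: "'a \<Rightarrow> real"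
  have cF: "continuous_on Q F"
    unfolding F_def
    by (intro continuous_intros continuous_on_subset[OF continuous_on_product_coordinates]) auto
  have "cball 0 R \<subseteq> F ` Q"
  proof
    fix x :: 'a assume x: "x \<in> cball 0 R"
    obtain r where r: "x = (\<Sum>b\<in>B. r b *\<^sub>R b)"
      using UNIV_I[of x] unfolding B(3)[symmetric] span_finite[OF B(1)] by blast
    define r' where "r' = (\<lambda>b. if b \<in> B then r b else 0)"
    have "x = F r'" unfolding F_def r r'_def by (intro sum.cong) auto
    moreover have "r' \<in> Q"
    proof -
      have "\<bar>r b\<bar> \<le> R / m" if "b \<in> B" for b
      proof -
        have "m * \<bar>r b\<bar> \<le> norm x" using m(2)[OF that] r by simp
        then show ?thesis using x m(1) by (simp add: field_simps)
      qed
      then show ?thesis by (auto simp: Q_def r'_def abs_le_iff minus_le_iff)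
    qed
    ultimately show "x \<in> F ` Q" by blast
  qed
  then have "cball 0 R = F ` Q \<inter> cball 0 R" by blast
  then show ?thesis
    using compact_continuous_image[OF cF cQ] by (metis closed_cball compact_Int_closed)
qed

lemma complete_UNIV_fin_dim: "complete (UNIV :: 'a::fin_dim_complex set)"
proof (rule completeI)
  fix f :: "nat \<Rightarrow> 'a" assume c: "Cauchy f"
  then have "Bseq f" by (rule Cauchy_Bseq)
  then obtain R where "\<And>n. norm (f n) \<le> R" by (auto simp: Bseq_def)
  then have "\<forall>n. f n \<in> cball 0 R" by simp
  then show "\<exists>l\<in>UNIV. f \<longlonglongrightarrow> l"
    using compact_imp_complete[OF compact_cball_fin_dim[of R]] c unfolding complete_def by blast
qed

text \<open>\<open>S\<close> is the kernel of a linear, hence continuous map: \<open>T\<close> kills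
  a basis of \<open>S\<close> and fixes the vectors completing it, so it moves each vector by an
  element of \<open>span B\<close> only.\<close>

lemma closed_subspace_fin_dim:
  fixes S :: "'a::fin_dim_complex set"
  assumes "subspace S" shows "closed S"
proof -
  obtain B where B: "B \<subseteq> S" "independent B" "S \<subseteq> span B"
    by (rule maximal_independent_subset[of S])
  obtain C where C: "B \<subseteq> C" "independent C" "UNIV \<subseteq> span C"
    by (rule maximal_independent_subset_extend[OF subset_UNIV B(2)])
  obtain D :: "'a set" where D: "finite D" "span D = UNIV"
    using finite_spanning_set[unfolded finite_spanning_set_iff] by blast
  have "finite C" using independent_span_bound[OF D(1) C(2)] D(2) by auto
  define T where "T = construct C (\<lambda>b. if b \<in> B then 0 else b)"
  have T: "linear T" "\<And>b. b \<in> C \<Longrightarrow> T b = (if b \<in> B then 0 else b)"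
    unfolding T_def by (rule linear_construct[OF C(2)]) (rule construct_basis[OF C(2)])
  have S: "S = {x. T x = 0}"
  proof (intro Set.set_eqI iffI)
    fix x assume "x \<in> S"
    then have "x \<in> span B" using B by blast
    then have "T x = 0"
      by (rule span_induct) (use T C(1) in \<open>auto simp: subspace_def linear_add linear_cmul linear_0\<close>)
    then show "x \<in> {x. T x = 0}" by simp
  next
    fix x assume x: "x \<in> {x. T x = 0}"
    have "x - T x \<in> span B" for x
    proof -
      have "x \<in> span C" using C by blast
      then show ?thesis
      proof (rule span_induct)
        show "subspace {x. x - T x \<in> span B}"
          using T(1) by (auto simp: subspace_def linear_add linear_cmul linear_0 span_zero
              add_diff_add span_add span_scale simp flip: scaleR_diff_right)
      qed (use T in \<open>auto intro: span_base span_zero\<close>)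
    qed
    from this[of x] x have "x \<in> span B" by simp
    then show "x \<in> S" using B(1) assms span_minimal by blast
  qed
  have "continuous_on UNIV T"
    using linear_imp_bounded[OF T(1)] by (simp add: linear_continuous_on)
  then have "closed {x. T x = 0}" by (intro closed_Collect_eq) auto
  then show ?thesis by (simp only: S)
qed

text \<open>The sum of the \<open>V i\<close> need not be direct: a decomposition is chosen for each
  vector of a basis and extended linearly. Overlaps may occur in use, where the stabilizer of a
  point is one of the summands.\<close>

lemma projections_exist:
  fixes V :: "nat \<Rightarrow> 'a::fin_dim_complex set"
  assumes sub: "\<And>i. i < n \<Longrightarrow> subspace (V i)"
    and sp: "\<And>x. \<exists>v. (\<forall>i<n. v i \<in> V i) \<and> x = (\<Sum>i<n. v i)"
  obtains P where "\<And>i. linear (P i)" "\<And>i x. i < n \<Longrightarrow> P i x \<in> V i" "\<And>x. (\<Sum>i<n. P i x) = x"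
proof -
  obtain B :: "'a set" where B: "finite B" "independent B" "span B = UNIV" by (rule fin_dim_basis)
  obtain v where v: "\<And>x i. i < n \<Longrightarrow> v x i \<in> V i" "\<And>x. x = (\<Sum>i<n. v x i)"
    using sp by metis
  define P where "P i = construct B (\<lambda>b. v b i)" for i
  have P: "linear (P i)" "\<And>b. b \<in> B \<Longrightarrow> P i b = v b i" for i
    unfolding P_def by (rule linear_construct[OF B(2)]) (rule construct_basis[OF B(2)])
  show ?thesis
  proof
    show "linear (P i)" for i by (rule P)
    show "P i x \<in> V i" if "i < n" for i x
    proof -
      have "x \<in> span B" using B by blast
      then show ?thesis
      proof (rule span_induct)
        show "subspace {x. P i x \<in> V i}" using sub[OF that] P(1)[of i]
          by (auto simp: subspace_def linear_add linear_cmul linear_0)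
      qed (use P v that in auto)
    qed
    show "(\<Sum>i<n. P i x) = x" for x
    proof -
      have "x \<in> span B" using B by blast
      then show ?thesis
      proof (rule span_induct)
        show "subspace {x. (\<Sum>i<n. P i x) = x}" using P(1)
          by (auto simp: subspace_def linear_add linear_cmul linear_0 sum.distrib simp flip: scaleR_sum_right)
      qed (use P v in auto)
    qed
  qed
qed

section \<open>Complex scalars, functionals and coordinates\<close>

definition sc :: "complex \<Rightarrow> 'a::fin_dim_complex \<Rightarrow> 'a" where
  "sc z x = Re z *\<^sub>R x + Im z *\<^sub>R times_i x"

lemma linear_times_i: "linear (times_i :: 'a::fin_dim_complex \<Rightarrow> 'a)"
  by (intro linearI times_i_add times_i_scaleR)

lemma times_i_simps:
  "times_i (0::'a::fin_dim_complex) = 0" "times_i (- x) = - times_i (x::'a)"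
  "times_i (x - y) = times_i (x::'a) - times_i y"
  "times_i (sum f S) = (\<Sum>i\<in>S. times_i (f i :: 'a))"
  by (simp_all add: linear_0[OF linear_times_i] linear_neg[OF linear_times_i]
    linear_diff[OF linear_times_i] linear_sum[OF linear_times_i])

lemmas times_i_all = times_i_simps times_i_add times_i_scaleR times_i_times_i

lemma sc_module: "vector_space (sc :: complex \<Rightarrow> 'a::fin_dim_complex \<Rightarrow> 'a)"
  by unfold_locales (auto simp: sc_def times_i_all algebra_simps)

interpretation sc: vector_space sc by (rule sc_module)

lemma sc_of_real [simp]: "sc (of_real r) x = r *\<^sub>R x" by (simp add: sc_def)
lemma sc_i [simp]: "sc \<i> x = times_i x" by (simp add: sc_def)

lemma linear_sc: "linear (sc z)"
  by (intro linearI) (auto simp: sc_def times_i_all algebra_simps)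

lemma sc_scaleR: "sc z (r *\<^sub>R x) = r *\<^sub>R sc z x"
  using linear_cmul[OF linear_sc] .

lemma linear_sc_left: "linear (\<lambda>z. sc z x)"
  by (intro linearI) (auto simp: sc_def algebra_simps)

lemma bounded_linear_sc_left: "bounded_linear (\<lambda>z. sc z x)"
  using linear_conv_bounded_linear linear_sc_left by blast

definition clin :: "('a::fin_dim_complex \<Rightarrow> 'b::fin_dim_complex) \<Rightarrow> bool" where
  "clin f \<longleftrightarrow> linear f \<and> (\<forall>v. f (times_i v) = times_i (f v))"

lemma clin_sc: "clin f \<Longrightarrow> f (sc z v) = sc z (f v)"
  by (simp add: clin_def sc_def linear_add linear_cmul)

lemma clin_compose: "clin f \<Longrightarrow> clin g \<Longrightarrow> clin (\<lambda>x. g (f x))"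
  by (auto simp: clin_def intro: linear_compose[unfolded o_def])

lemma times_i_bound: obtains C where "C \<ge> 1" "\<And>x::'a::fin_dim_complex. norm (times_i x) \<le> C * norm x"
proof -
  obtain K where K: "K > 0" "\<And>x::'a. norm (times_i x) \<le> norm x * K"
    using bounded_linear.pos_bounded[OF linear_imp_bounded[OF linear_times_i]] by blast
  show ?thesis
  proof
    show "1 \<le> max 1 K" by simp
    show "norm (times_i x) \<le> max 1 K * norm x" for x :: 'a
      using K(2)[of x] mult_right_mono[of K "max 1 K" "norm x"] by (simp add: mult.commute)
  qed
qed

lemma sc_bound: obtains C where "C \<ge> 1" "\<And>z (x::'a::fin_dim_complex). norm (sc z x) \<le> C * cmod z * norm x"
proof -
  obtain C where C: "C \<ge> 1" "\<And>x::'a. norm (times_i x) \<le> C * norm x" by (rule times_i_bound) blast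
  have "norm (sc z x) \<le> (1 + C) * cmod z * norm x" for z and x :: 'a
  proof -
    have "norm (sc z x) \<le> \<bar>Re z\<bar> * norm x + \<bar>Im z\<bar> * norm (times_i x)"
      unfolding sc_def by (rule order_trans[OF norm_triangle_ineq]) simp
    also have "\<dots> \<le> cmod z * norm x + cmod z * (C * norm x)"
      by (intro add_mono mult_mono abs_Re_le_cmod abs_Im_le_cmod C) auto
    finally show ?thesis by (simp add: algebra_simps)
  qed
  then show ?thesis using that[of "1 + C"] C by auto
qed

text \<open>The basis is extracted from the given set \<open>S\<close>. The determinant argument
  needs this: there \<open>S\<close> is a union of two subspaces, and each basis vector must belong
  to one of them. The basis is finite because a real spanning set also spans over the complex
  scalars.\<close>

lemma complex_coordinates:
  assumes "sc.span (S :: 'a::fin_dim_complex set) = UNIV"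
  obtains n :: nat and b l where "\<And>i. i < n \<Longrightarrow> b i \<in> S" "\<And>i. clin (l i :: 'a \<Rightarrow> complex)"
    "\<And>x. x = (\<Sum>i<n. sc (l i x) (b i))" "\<And>i j. i < n \<Longrightarrow> j < n \<Longrightarrow> l i (b j) = (if i = j then 1 else 0)"
proof -
  obtain B where B: "B \<subseteq> S" "sc.independent B" "S \<subseteq> sc.span B"
    by (rule sc.maximal_independent_subset[of S])
  have spB: "sc.span B = UNIV"
    using B assms by (metis sc.span_mono sc.span_span top.extremum_uniqueI)
  obtain D :: "'a set" where D: "finite D" "span D = UNIV"
    using finite_spanning_set[unfolded finite_spanning_set_iff] by blast
  have "span D \<subseteq> sc.span D"
  proof (rule span_minimal)
    show "D \<subseteq> sc.span D" by (rule sc.span_superset)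
    show "subspace (sc.span D)"
      unfolding subspace_def using sc.span_zero sc.span_add sc.span_scale[of _ D "of_real _"] by auto
  qed
  then have "finite B" using sc.independent_span_bound[OF D(1) B(2)] D(2) by auto
  then obtain b where b: "bij_betw b {..<card B} B"
    using ex_bij_betw_nat_finite lessThan_atLeast0 by metis
  define n where "n = card B"
  define l where "l i x = sc.representation B x (b i)" for i x
  have inj: "inj_on b {..<n}" and im: "b ` {..<n} = B" using b by (auto simp: bij_betw_def n_def)
  show ?thesis
  proof
    show "b i \<in> S" if "i < n" for i using im B(1) that by auto
    show "clin (l i)" for i
    proof -
      have "l i (x + y) = l i x + l i y" for x y
        using sc.representation_add[OF B(2), of y x] spB by (simp add: l_def)
      moreover have s: "l i (sc z x) = z * l i x" for z x
        using sc.representation_scale[OF B(2), of x z] spB by (simp add: l_def)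
      ultimately show ?thesis
        unfolding clin_def using s[of "of_real _"] s[of "\<i>"]
        by (auto intro!: linearI simp: times_i_complex_def scaleR_conv_of_real)
    qed
    show "x = (\<Sum>i<n. sc (l i x) (b i))" for x
    proof -
      have "x = (\<Sum>b\<in>B. sc (sc.representation B x b) b)"
        using sc.sum_representation_eq[OF B(2), of x B] spB \<open>finite B\<close> by simp
      also have "\<dots> = (\<Sum>i<n. sc (l i x) (b i))"
        unfolding l_def using sum.reindex[OF inj] by (simp flip: im)
      finally show ?thesis .
    qed
    show "l i (b j) = (if i = j then 1 else 0)" if "i < n" "j < n" for i j
      using sc.representation_basis[OF B(2), of "b j"] im that inj
      by (auto simp: l_def inj_on_def)
  qed
qed

text \<open>Finitely many complex functionals control the norm from both sides, with one constant;
  they reduce vector-valued estimates to complex functions of one variable.\<close>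

lemma functional_bound:
  obtains n :: nat and l :: "nat \<Rightarrow> 'a::fin_dim_complex \<Rightarrow> complex" and C
  where "\<And>i. clin (l i)" "C > 0"
    "\<And>i x. i < n \<Longrightarrow> cmod (l i x) \<le> C * norm x"
    "\<And>x t. (\<And>i. i < n \<Longrightarrow> cmod (l i x) \<le> t) \<Longrightarrow> 0 \<le> t \<Longrightarrow> norm x \<le> C * t"
proof -
  have sp: "sc.span (UNIV :: 'a set) = UNIV" by simp
  obtain n :: nat and b l where l: "\<And>i. clin (l i :: 'a \<Rightarrow> complex)" "\<And>x. x = (\<Sum>i<n. sc (l i x) (b i))"
    by (rule complex_coordinates[OF sp]) (rule that; assumption)
  obtain c where c: "c \<ge> 1" "\<And>z (x::'a). norm (sc z x) \<le> c * cmod z * norm x" by (rule sc_bound) blast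
  have "\<exists>K>0. \<forall>x. cmod (l i x) \<le> norm x * K" for i
    using bounded_linear.pos_bounded[OF linear_imp_bounded] l(1)[of i] unfolding clin_def by blast
  then obtain K where K: "\<And>i. K i > 0" "\<And>i x. cmod (l i x) \<le> norm x * K i" by metis
  define C where "C = 1 + (\<Sum>i<n. K i) + (\<Sum>i<n. c * norm (b i))"
  have Kn: "0 \<le> (\<Sum>i<n. K i)" using K(1) by (intro sum_nonneg) (auto intro: less_imp_le)
  have bn: "0 \<le> (\<Sum>i<n. c * norm (b i))" using c by (intro sum_nonneg) auto
  show ?thesis
  proof (rule that)
    show "C > 0" using Kn bn by (simp add: C_def)
    show "cmod (l i x) \<le> C * norm x" if "i < n" for i x
    proof -
      have "K i \<le> (\<Sum>i<n. K i)" using that K(1) by (intro member_le_sum) (auto intro: less_imp_le)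
      then have "K i \<le> C" using bn by (simp add: C_def)
      then have "norm x * K i \<le> norm x * C" by (intro mult_left_mono) auto
      then show ?thesis using K(2)[of i x] by (simp add: mult.commute)
    qed
    show "norm x \<le> C * t" if t: "\<And>i. i < n \<Longrightarrow> cmod (l i x) \<le> t" "0 \<le> t" for x t
    proof -
      have "norm x \<le> (\<Sum>i<n. norm (sc (l i x) (b i)))"
        using norm_sum[of "\<lambda>i. sc (l i x) (b i)" "{..<n}"] by (simp flip: l(2))
      also have "\<dots> \<le> (\<Sum>i<n. c * t * norm (b i))"
      proof (rule sum_mono)
        fix i assume "i \<in> {..<n}"
        then have "c * cmod (l i x) * norm (b i) \<le> c * t * norm (b i)"
          using t(1)[of i] c(1) by (intro mult_right_mono mult_left_mono) auto
        then show "norm (sc (l i x) (b i)) \<le> c * t * norm (b i)" using c(2) order_trans by blast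
      qed
      also have "\<dots> = (\<Sum>i<n. c * norm (b i)) * t" by (simp add: sum_distrib_left mult_ac)
      also have "\<dots> \<le> C * t" using Kn t(2) by (intro mult_right_mono) (auto simp: C_def)
      finally show ?thesis .
    qed
  qed (fact l)+
qed

section \<open>Local estimates for holomorphic maps\<close>

lemma sc_complex [simp]: "sc z w = z * (w :: complex)"
  by (simp add: sc_def times_i_complex_def complex_eq_iff)

text \<open>On the complex line through \<open>x\<close> in direction \<open>v\<close>, each
  functional of \<open>g\<close> is holomorphic in one variable, and Cauchy's inequality on the disc
  of radius \<open>s\<close> applies. \<open>C\<close> is fixed before \<open>g\<close> because the
  estimate is applied to a whole family of difference functions.\<close>

lemma cauchy_estimate:
  obtains C where "C > 0"
    "\<And>(g :: 'a::fin_dim_complex \<Rightarrow> 'b::fin_dim_complex) G x v s M.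
       \<lbrakk>\<And>z. cmod z \<le> s \<Longrightarrow> (g has_derivative G z) (at (x + sc z v)) \<and> clin (G z); s > 0;
        \<And>z. cmod z \<le> s \<Longrightarrow> norm (g (x + sc z v)) \<le> M\<rbrakk> \<Longrightarrow> norm (G 0 v) \<le> C * M / s"
proof -
  obtain n :: nat and l :: "nat \<Rightarrow> 'b \<Rightarrow> complex" and C where
    l: "\<And>i. clin (l i)" and C: "C > 0"
    "\<And>i x. i < n \<Longrightarrow> cmod (l i x) \<le> C * norm x"
    "\<And>x t. (\<And>i. i < n \<Longrightarrow> cmod (l i x) \<le> t) \<Longrightarrow> 0 \<le> t \<Longrightarrow> norm x \<le> C * t"
    by (rule functional_bound) blast
  show ?thesis
  proof (rule that[of "C * C"])
    show "C * C > 0" using C(1) by simp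
    fix g :: "'a \<Rightarrow> 'b" and G x v s M
    assume G: "\<And>z. cmod z \<le> s \<Longrightarrow> (g has_derivative G z) (at (x + sc z v)) \<and> clin (G z)"
      and s: "s > 0" and M: "\<And>z. cmod z \<le> s \<Longrightarrow> norm (g (x + sc z v)) \<le> M"
    have M0: "M \<ge> 0" using M[of 0] s norm_ge_zero order_trans by (metis less_imp_le norm_zero)
    have "cmod (l i (G 0 v)) \<le> C * M / s" if i: "i < n" for i
    proof -
      define F where "F z = l i (g (x + sc z v))" for z
      have bl: "bounded_linear (l i)" using l[of i] by (simp add: clin_def linear_imp_bounded)
      have F: "(F has_field_derivative l i (G z v)) (at z)" if z: "cmod z \<le> s" for z
      proof -
        have "((\<lambda>z. x + sc z v) has_derivative (\<lambda>h. sc h v)) (at z)"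
          by (auto intro!: derivative_eq_intros bounded_linear.has_derivative[OF bounded_linear_sc_left])
        from has_derivative_compose[OF this conjunct1[OF G[OF z]]]
        have "((\<lambda>z. g (x + sc z v)) has_derivative (\<lambda>h. G z (sc h v))) (at z)" .
        from bounded_linear.has_derivative[OF bl this]
        have "(F has_derivative (\<lambda>h. l i (G z (sc h v)))) (at z)" unfolding F_def .
        moreover have "l i (G z (sc h v)) = l i (G z v) * h" for h
          using G[OF z] l[of i] by (simp add: clin_sc mult.commute)
        ultimately show ?thesis by (simp add: has_field_derivative_def)
      qed
      have "cmod ((deriv ^^ 1) F 0) \<le> fact 1 * (C * M) / s ^ 1"
      proof (rule Cauchy_inequality)
        show "F holomorphic_on ball 0 s"
          by (rule holomorphic_onI, rule field_differentiable_at_within)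
            (use F in \<open>force simp: field_differentiable_def\<close>)
        show "continuous_on (cball 0 s) F"
          by (intro continuous_at_imp_continuous_on ballI DERIV_isCont[OF F]) auto
        show "cmod (F z) \<le> C * M" if "cmod (0 - z) = s" for z
        proof -
          have "cmod (F z) \<le> C * norm (g (x + sc z v))" unfolding F_def by (rule C(2)[OF i])
          also have "\<dots> \<le> C * M" using M[of z] that C(1) by simp
          finally show ?thesis .
        qed
      qed fact
      moreover have "deriv F 0 = l i (G 0 v)" using F[of 0] s by (intro DERIV_imp_deriv) auto
      ultimately show ?thesis by simp
    qed
    then have "norm (G 0 v) \<le> C * (C * M / s)" using C(1) M0 s by (intro C(3)) auto
    then show "norm (G 0 v) \<le> C * C * M / s" by simp
  qed
qed

text \<open>\<open>holo_on\<close> asks for complex differentiability only, without continuity of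
  the derivative. Cauchy's estimate bounds the derivatives, which makes \<open>f\<close> Lipschitz;
  applied to differences of translates it makes the derivative Lipschitz. The mean value inequality
  for \<open>f\<close> minus its derivative at 0 then gives the error term.\<close>

lemma holo_on_strict_derivative:
  fixes f :: "'a::fin_dim_complex \<Rightarrow> 'b::fin_dim_complex"
  assumes holo: "holo_on f S" and op: "open S" and S0: "0 \<in> S"
  obtains D r K where "clin D" "(f has_derivative D) (at 0)" "r > 0" "K \<ge> 0" "cball 0 r \<subseteq> S"
    "\<And>\<rho> x y. norm x \<le> \<rho> \<Longrightarrow> norm y \<le> \<rho> \<Longrightarrow> \<rho> \<le> r \<Longrightarrow> norm (f x - f y - D (x - y)) \<le> K * \<rho> * norm (x - y)"
proof -
  obtain C :: real where C: "C > 0" "\<And>(g :: 'a \<Rightarrow> 'b) G x v s M.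
       \<lbrakk>\<And>z. cmod z \<le> s \<Longrightarrow> (g has_derivative G z) (at (x + sc z v)) \<and> clin (G z); s > 0;
        \<And>z. cmod z \<le> s \<Longrightarrow> norm (g (x + sc z v)) \<le> M\<rbrakk> \<Longrightarrow> norm (G 0 v) \<le> C * M / s"
    by (rule cauchy_estimate) blast
  obtain c where c: "c \<ge> 1" "\<And>z (x::'a). norm (sc z x) \<le> c * cmod z * norm x" by (rule sc_bound) blast
  obtain D where D: "\<And>x. x \<in> S \<Longrightarrow> (f has_derivative D x) (at x)" "\<And>x. x \<in> S \<Longrightarrow> clin (D x)"
  proof -
    have "\<forall>x\<in>S. \<exists>D. (f has_derivative D) (at x) \<and> clin D"
      using holo unfolding holo_on_def clin_def by (blast dest: has_derivative_linear)
    then show ?thesis using that by metis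
  qed
  obtain R where R: "R > 0" "cball 0 (2 * R) \<subseteq> S"
  proof -
    obtain e where "e > 0" "cball 0 e \<subseteq> S" using op S0 open_contains_cball by blast
    then show ?thesis using that[of "e/2"] by simp
  qed
  have "continuous_on (cball 0 (2*R)) f"
    using R D(1) by (intro continuous_at_imp_continuous_on) (auto intro: has_derivative_continuous)
  then have "compact (f ` cball 0 (2*R))" by (rule compact_continuous_image[OF _ compact_cball_fin_dim])
  then obtain M where M: "M > 0" "\<And>x. norm x \<le> 2*R \<Longrightarrow> norm (f x) \<le> M"
    using compact_imp_bounded bounded_pos by (metis image_eqI mem_cball_0)
  have inS: "x \<in> S" if "norm x \<le> 2*R" for x using R that by auto
  define K1 where "K1 = C * M * c / R"
  have K1: "norm (D x v) \<le> K1 * norm v" if x: "norm x \<le> R" for x v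
  proof (cases "v = 0")
    case True
    then show ?thesis using D(2)[OF inS[of x]] x R by (simp add: clin_def linear_0)
  next
    case False
    \<comment> \<open>The radius for which \<open>x + sc z v\<close> keeps norm at most
      \<open>2 * R\<close>, where \<open>M\<close> bounds \<open>f\<close>.\<close>
    define s where "s = R / (c * norm v)"
    have s: "s > 0" using False R c by (simp add: s_def)
    have nz: "norm (x + sc z v) \<le> 2*R" if "cmod z \<le> s" for z
    proof -
      have "norm (sc z v) \<le> c * cmod z * norm v" by (rule c)
      also have "\<dots> \<le> c * s * norm v" using that c by (intro mult_right_mono mult_left_mono) auto
      also have "\<dots> = R" using False c by (simp add: s_def)
      finally show ?thesis using norm_triangle_ineq[of x "sc z v"] x by linarith
    qed
    have "norm (D (x + sc 0 v) v) \<le> C * M / s"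
      by (rule C(2)[where g=f and x=x and G="\<lambda>z. D (x + sc z v)"]) (use nz D inS M s in auto)
    then show ?thesis using False c by (simp add: s_def K1_def field_simps)
  qed
  have K1pos: "K1 \<ge> 0" using C M c R by (simp add: K1_def)
  have lip: "norm (f x - f y) \<le> K1 * norm (x - y)" if "norm x \<le> R" "norm y \<le> R" for x y
  proof (rule differentiable_bound[where S="cball 0 R" and f'=D])
    show "(f has_derivative D x) (at x within cball 0 R)" if "x \<in> cball 0 R" for x
      by (rule has_derivative_at_withinI, rule D(1), rule inS) (use that R in auto)
    show "onorm (D x) \<le> K1" if "x \<in> cball 0 R" for x
      using that K1 by (intro onorm_bound K1pos) auto
  qed (use that in auto)
  define K2 where "K2 = C * K1 * c / (R/2)"
  have K2pos: "K2 \<ge> 0" using C K1pos c R by (simp add: K2_def)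
  have K2: "norm (D x v - D y v) \<le> K2 * norm (x - y) * norm v" if x: "norm x \<le> R/2" "norm y \<le> R/2" for x y v
  proof (cases "v = 0")
    case True
    then show ?thesis using D(2)[OF inS[of x]] D(2)[OF inS[of y]] x R by (simp add: clin_def linear_0)
  next
    case False
    define s where "s = R/2 / (c * norm v)"
    have s: "s > 0" using False R c by (simp add: s_def)
    have nz: "norm (sc z v) \<le> R/2" if "cmod z \<le> s" for z
    proof -
      have "norm (sc z v) \<le> c * cmod z * norm v" by (rule c)
      also have "\<dots> \<le> c * s * norm v" using that c by (intro mult_right_mono mult_left_mono) auto
      also have "\<dots> = R/2" using False c by (simp add: s_def)
      finally show ?thesis .
    qed
    \<comment> \<open>The two translates differ by at most \<open>K1 * norm (x - y)\<close>, so
      Cauchy's estimate for \<open>g\<close> bounds the difference of the derivatives at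
      \<open>x\<close> and \<open>y\<close> by a multiple of \<open>norm (x - y)\<close>.\<close>
    define g where "g w = f (x + w) - f (y + w)" for w
    have nx: "norm (x + sc z v) \<le> R" "norm (y + sc z v) \<le> R" if "cmod z \<le> s" for z
      using nz[OF that] x norm_triangle_ineq[of x "sc z v"] norm_triangle_ineq[of y "sc z v"] by linarith+
    have "norm (D (x + sc 0 v) v - D (y + sc 0 v) v) \<le> C * (K1 * norm (x - y)) / s"
    proof (rule C(2)[where g=g and x=0 and G="\<lambda>z w. D (x + sc z v) w - D (y + sc z v) w"])
      fix z assume z: "cmod z \<le> s"
      have xS: "x + sc z v \<in> S" "y + sc z v \<in> S" using nx[OF z] R by (auto intro!: inS)
      have 1: "((\<lambda>w. f (a + w)) has_derivative (\<lambda>w. D (a + sc z v) w)) (at (0 + sc z v))"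
        if "a + sc z v \<in> S" for a
      proof -
        have "((\<lambda>w. a + w) has_derivative (\<lambda>w. w)) (at (0 + sc z v))" by (auto intro!: derivative_eq_intros)
        from has_derivative_compose[OF this, of f "D (a + sc z v)"] D(1)[OF that] show ?thesis by simp
      qed
      show "(g has_derivative (\<lambda>w. D (x + sc z v) w - D (y + sc z v) w)) (at (0 + sc z v)) \<and>
         clin (\<lambda>w. D (x + sc z v) w - D (y + sc z v) w)"
        unfolding g_def using has_derivative_diff[OF 1[OF xS(1)] 1[OF xS(2)]] D(2)[OF xS(1)] D(2)[OF xS(2)]
        by (auto simp: clin_def times_i_all linear_compose_sub)
      show "norm (g (0 + sc z v)) \<le> K1 * norm (x - y)"
        using lip[OF nx[OF z]] by (simp add: g_def)
    qed fact
    then show ?thesis using False c by (simp add: s_def K2_def field_simps)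
  qed
  show ?thesis
  proof
    show "clin (D 0)" "(f has_derivative D 0) (at 0)" using D S0 by auto
    show "R/2 > 0" "K2 \<ge> 0" using R K2pos by auto
    show "cball 0 (R/2) \<subseteq> S" using R by auto
    fix \<rho> and x y :: 'a assume xy: "norm x \<le> \<rho>" "norm y \<le> \<rho>" "\<rho> \<le> R/2"
    have lin0: "linear (D 0)" using D(2)[OF S0] by (simp add: clin_def)
    have "norm ((f x - D 0 x) - (f y - D 0 y)) \<le> (K2 * \<rho>) * norm (x - y)"
    proof (rule differentiable_bound[where S="cball 0 \<rho>" and f'="\<lambda>x v. D x v - D 0 v"])
      show "((\<lambda>x. f x - D 0 x) has_derivative (\<lambda>v. D x v - D 0 v)) (at x within cball 0 \<rho>)"
        if "x \<in> cball 0 \<rho>" for x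
      proof -
        have "x \<in> S" using that R xy(3) by (intro inS) auto
        then show ?thesis
          by (intro has_derivative_at_withinI[OF has_derivative_diff] D(1)
            bounded_linear.has_derivative[OF linear_imp_bounded[OF lin0]] has_derivative_ident)
      qed
      show "onorm (\<lambda>v. D x v - D 0 v) \<le> K2 * \<rho>" if "x \<in> cball 0 \<rho>" for x
      proof (rule onorm_bound)
        have r: "0 \<le> \<rho>" "norm x \<le> \<rho>" using that norm_ge_zero[of x] by auto (metis norm_ge_zero order_trans)
        then show "0 \<le> K2 * \<rho>" using K2pos by simp
        fix v
        have "norm (D x v - D 0 v) \<le> K2 * norm (x - 0) * norm v" using r xy(3) R by (intro K2) auto
        also have "\<dots> \<le> K2 * \<rho> * norm v" using r K2pos by (intro mult_right_mono mult_left_mono) auto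
        finally show "norm (D x v - D 0 v) \<le> K2 * \<rho> * norm v" .
      qed
    qed (use xy in auto)
    then show "norm (f x - f y - D 0 (x - y)) \<le> K2 * \<rho> * norm (x - y)"
      by (simp add: linear_diff[OF lin0] algebra_simps)
  qed
qed

text \<open>Strict differentiability at 0, for maps sending 0 to 0. It obeys the chain rule and
  suffices for the contraction argument of \<open>strict_diff_surj\<close>, so no derivative away
  from 0 has to be known.\<close>

definition strict_diff :: "('a::real_normed_vector \<Rightarrow> 'b::real_normed_vector) \<Rightarrow> ('a \<Rightarrow> 'b) \<Rightarrow> bool" where
  "strict_diff f D \<longleftrightarrow> f 0 = 0 \<and> bounded_linear D \<and>
     (\<forall>e>0. \<exists>\<rho>>0. \<forall>x y. norm x < \<rho> \<longrightarrow> norm y < \<rho> \<longrightarrow> norm (f x - f y - D (x - y)) \<le> e * norm (x - y))"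

lemma strict_diffE:
  assumes "strict_diff f D" "e > 0" obtains \<rho> where "\<rho> > 0"
    "\<And>x y. norm x < \<rho> \<Longrightarrow> norm y < \<rho> \<Longrightarrow> norm (f x - f y - D (x - y)) \<le> e * norm (x - y)"
  using assms unfolding strict_diff_def by blast

lemma strict_diff_lipschitz:
  fixes f :: "'a::real_normed_vector \<Rightarrow> 'b::real_normed_vector"
  assumes "strict_diff f D" obtains \<rho> K where "\<rho> > 0" "K > 0"
    "\<And>x y. norm x < \<rho> \<Longrightarrow> norm y < \<rho> \<Longrightarrow> norm (f x - f y) \<le> K * norm (x - y)"
proof -
  obtain \<rho> where \<rho>: "\<rho> > 0" "\<And>x y. norm x < \<rho> \<Longrightarrow> norm y < \<rho> \<Longrightarrow> norm (f x - f y - D (x - y)) \<le> 1 * norm (x - y)"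
    by (rule strict_diffE[OF assms, of 1]) auto
  obtain k where k: "k > 0" "\<And>x. norm (D x) \<le> norm x * k"
    using assms bounded_linear.pos_bounded unfolding strict_diff_def by metis
  show ?thesis
  proof (rule that[OF \<rho>(1), of "1 + k"])
    show "1 + k > 0" using k by simp
    fix x y :: 'a assume "norm x < \<rho>" "norm y < \<rho>"
    then have "norm (f x - f y - D (x - y)) \<le> norm (x - y)" using \<rho>(2)[of x y] by simp
    moreover have "norm (f x - f y) \<le> norm (f x - f y - D (x - y)) + norm (D (x - y))"
      using norm_triangle_ineq[of "f x - f y - D (x - y)" "D (x - y)"] by simp
    ultimately show "norm (f x - f y) \<le> (1 + k) * norm (x - y)" using k(2)[of "x - y"] by (simp add: algebra_simps)
  qed
qed

lemma strict_diff_compose: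
  fixes f :: "'a::real_normed_vector \<Rightarrow> 'b::real_normed_vector"
    and g :: "'b \<Rightarrow> 'c::real_normed_vector"
  assumes f: "strict_diff f D" and g: "strict_diff g E" shows "strict_diff (\<lambda>x. g (f x)) (\<lambda>x. E (D x))"
  unfolding strict_diff_def
proof (intro conjI allI impI)
  show "g (f 0) = 0" using f g by (simp add: strict_diff_def)
  show "bounded_linear (\<lambda>x. E (D x))" using f g by (auto simp: strict_diff_def intro: bounded_linear_compose)
  fix e :: real assume e: "e > 0"
  obtain \<rho> K where K: "\<rho> > 0" "K > 0" "\<And>x y. norm x < \<rho> \<Longrightarrow> norm y < \<rho> \<Longrightarrow> norm (f x - f y) \<le> K * norm (x - y)"
    using strict_diff_lipschitz[OF f] by blast
  obtain k where k: "k > 0" "\<And>x. norm (E x) \<le> norm x * k"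
    using g bounded_linear.pos_bounded unfolding strict_diff_def by metis
  obtain \<rho>1 where r1: "\<rho>1 > 0" "\<And>x y. norm x < \<rho>1 \<Longrightarrow> norm y < \<rho>1 \<Longrightarrow> norm (f x - f y - D (x - y)) \<le> (e/2/k) * norm (x - y)"
    by (rule strict_diffE[OF f, of "e/2/k"]) (use e k(1) in auto)
  obtain \<rho>2 where r2: "\<rho>2 > 0" "\<And>x y. norm x < \<rho>2 \<Longrightarrow> norm y < \<rho>2 \<Longrightarrow> norm (g x - g y - E (x - y)) \<le> (e/2/K) * norm (x - y)"
    by (rule strict_diffE[OF g, of "e/2/K"]) (use e K(2) in auto)
  show "\<exists>\<rho>>0. \<forall>x y. norm x < \<rho> \<longrightarrow> norm y < \<rho> \<longrightarrow> norm (g (f x) - g (f y) - E (D (x - y))) \<le> e * norm (x - y)"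
  proof (intro exI conjI allI impI)
    show "min (min \<rho> \<rho>1) (\<rho>2 / K) > 0" using K r1 r2 by simp
    fix x y :: 'a assume x: "norm x < min (min \<rho> \<rho>1) (\<rho>2 / K)" and y: "norm y < min (min \<rho> \<rho>1) (\<rho>2 / K)"
    have f0: "f 0 = 0" using f by (simp add: strict_diff_def)
    have small: "norm (f x) < \<rho>2" if "norm x < min (min \<rho> \<rho>1) (\<rho>2 / K)" for x
    proof -
      have "norm (f x) \<le> K * norm x" using K(3)[of x 0] that K(1) f0 by simp
      also have "\<dots> < \<rho>2" using that K(2) by (simp add: field_simps)
      finally show ?thesis .
    qed
    have lE: "linear E" using g by (simp add: strict_diff_def bounded_linear.linear)
    have *: "g (f x) - g (f y) - E (D (x - y)) = (g (f x) - g (f y) - E (f x - f y)) + E (f x - f y - D (x - y))"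
      by (simp add: linear_diff[OF lE])
    have "norm (g (f x) - g (f y) - E (D (x - y))) \<le> norm (g (f x) - g (f y) - E (f x - f y)) + norm (E (f x - f y - D (x - y)))"
      unfolding * by (rule norm_triangle_ineq)
    also have "\<dots> \<le> (e/2/K) * norm (f x - f y) + norm (f x - f y - D (x - y)) * k"
      by (intro add_mono r2(2) small x y k(2))
    also have "\<dots> \<le> (e/2/K) * (K * norm (x - y)) + (e/2/k * norm (x - y)) * k"
      using x y e k K by (intro add_mono mult_left_mono mult_right_mono K(3) r1(2)) auto
    also have "\<dots> = e * norm (x - y)" using K k by (simp add: field_simps)
    finally show "norm (g (f x) - g (f y) - E (D (x - y))) \<le> e * norm (x - y)" .
  qed
qed

lemma strict_diff_Pair:
  fixes f :: "'a::real_normed_vector \<Rightarrow> 'b::real_normed_vector"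
    and g :: "'a \<Rightarrow> 'c::real_normed_vector"
  assumes f: "strict_diff f D" and g: "strict_diff g E" shows "strict_diff (\<lambda>x. (f x, g x)) (\<lambda>x. (D x, E x))"
  unfolding strict_diff_def
proof (intro conjI allI impI)
  show "(f 0, g 0) = 0" using f g by (simp add: strict_diff_def zero_prod_def)
  show "bounded_linear (\<lambda>x. (D x, E x))" using f g by (auto simp: strict_diff_def intro: bounded_linear_Pair)
  fix e :: real assume e: "e > 0"
  then have e2: "e/2 > 0" by simp
  obtain \<rho>1 where r1: "\<rho>1 > 0" "\<And>x y. norm x < \<rho>1 \<Longrightarrow> norm y < \<rho>1 \<Longrightarrow> norm (f x - f y - D (x - y)) \<le> (e/2) * norm (x - y)"
    by (rule strict_diffE[OF f e2]) blast
  obtain \<rho>2 where r2: "\<rho>2 > 0" "\<And>x y. norm x < \<rho>2 \<Longrightarrow> norm y < \<rho>2 \<Longrightarrow> norm (g x - g y - E (x - y)) \<le> (e/2) * norm (x - y)"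
    by (rule strict_diffE[OF g e2]) blast
  show "\<exists>\<rho>>0. \<forall>x y. norm x < \<rho> \<longrightarrow> norm y < \<rho> \<longrightarrow> norm ((f x, g x) - (f y, g y) - (D (x - y), E (x - y))) \<le> e * norm (x - y)"
  proof (intro exI conjI allI impI)
    show "min \<rho>1 \<rho>2 > 0" using r1 r2 by simp
    fix x y :: 'a assume "norm x < min \<rho>1 \<rho>2" "norm y < min \<rho>1 \<rho>2"
    then have "norm (f x - f y - D (x - y)) + norm (g x - g y - E (x - y)) \<le> (e/2) * norm (x - y) + (e/2) * norm (x - y)"
      by (intro add_mono r1 r2) auto
    then show "norm ((f x, g x) - (f y, g y) - (D (x - y), E (x - y))) \<le> e * norm (x - y)"
      using norm_Pair_le[of "f x - f y - D (x - y)" "g x - g y - E (x - y)"] by simp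
  qed
qed

lemma strict_diff_bounded_linear: "bounded_linear D \<Longrightarrow> strict_diff D D"
  unfolding strict_diff_def by (auto simp: linear_simps intro: exI[of _ 1])

text \<open>A fixed point of \<open>T x = y - (F x - x)\<close> solves \<open>F x = y\<close>, and
  \<open>T\<close> contracts a small ball by the factor 1/2. Only this surjective half of the
  inverse function theorem is needed.\<close>

lemma strict_diff_surj:
  fixes F :: "'a::fin_dim_complex \<Rightarrow> 'a"
  assumes F: "strict_diff F (\<lambda>x. x)" and d: "\<delta> > 0"
  obtains \<delta>' where "\<delta>' > 0" "\<And>y. norm y < \<delta>' \<Longrightarrow> \<exists>x. norm x < \<delta> \<and> F x = y"
proof -
  obtain \<rho> where r: "\<rho> > 0" "\<And>x y. norm x < \<rho> \<Longrightarrow> norm y < \<rho> \<Longrightarrow> norm (F x - F y - (x - y)) \<le> (1/2) * norm (x - y)"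
    by (rule strict_diffE[OF F, of "1/2"]) auto
  have F0: "F 0 = 0" using F by (simp add: strict_diff_def)
  define s where "s = min \<rho> \<delta> / 2"
  have s: "s > 0" "s < \<rho>" "s < \<delta>" using r d by (auto simp: s_def)
  show ?thesis
  proof (rule that[of "s/2"])
    show "s/2 > 0" using s by simp
    fix y :: 'a assume y: "norm y < s/2"
    define T where "T x = y - (F x - x)" for x
    have "\<exists>!x. x \<in> cball 0 s \<and> T x = x"
    proof (rule Banach_fix[where c="1/2"])
      show "complete (cball (0::'a) s)" by (intro compact_imp_complete compact_cball_fin_dim)
      show "cball (0::'a) s \<noteq> {}" using s by auto
      show "T ` cball 0 s \<subseteq> cball 0 s"
      proof clarsimp
        fix x :: 'a assume x: "norm x \<le> s"
        have "norm (F x - x) \<le> (1/2) * norm x" using r(2)[of x 0] x s r(1) F0 by simp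
        then show "norm (T x) \<le> s" unfolding T_def using y x norm_triangle_ineq4[of y "F x - x"] by linarith
      qed
      fix x z :: 'a assume "x \<in> cball 0 s" "z \<in> cball 0 s"
      then have "norm (F x - F z - (x - z)) \<le> (1/2) * norm (x - z)" using s by (intro r) auto
      moreover have "T x - T z = - (F x - F z - (x - z))" by (simp add: T_def)
      ultimately show "dist (T x) (T z) \<le> 1/2 * dist x z" by (metis dist_norm norm_minus_cancel)
    qed auto
    then obtain x where "x \<in> cball 0 s" "T x = x" by blast
    then show "\<exists>x. norm x < \<delta> \<and> F x = y" using s by (intro exI[of _ x]) (auto simp: T_def)
  qed
qed

section \<open>Charts and derivatives on complex manifolds\<close>

lemma is_chartD:
  assumes "is_chart c"
  shows "open (fst c)" "open (snd c ` fst c)" "continuous_on (fst c) (snd c)"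
    "continuous_on (snd c ` fst c) (chart_inv c)"
    "p \<in> fst c \<Longrightarrow> chart_inv c (snd c p) = p" "inj_on (snd c) (fst c)"
    "y \<in> snd c ` fst c \<Longrightarrow> chart_inv c y \<in> fst c"
    "y \<in> snd c ` fst c \<Longrightarrow> snd c (chart_inv c y) = y"
proof -
  have h: "homeomorphism (fst c) (snd c ` fst c) (snd c) (chart_inv c)"
    using assms by (simp add: is_chart_def)
  show "open (fst c)" "open (snd c ` fst c)" using assms by (auto simp: is_chart_def)
  show "continuous_on (fst c) (snd c)" "continuous_on (snd c ` fst c) (chart_inv c)"
    using h by (auto simp: homeomorphism_def)
  show "p \<in> fst c \<Longrightarrow> chart_inv c (snd c p) = p" "inj_on (snd c) (fst c)"
    using h by (auto simp: homeomorphism_def intro: inj_on_inverseI)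
  show "y \<in> snd c ` fst c \<Longrightarrow> chart_inv c y \<in> fst c"
    "y \<in> snd c ` fst c \<Longrightarrow> snd c (chart_inv c y) = y"
    using h by (auto simp: homeomorphism_def)
qed

lemma complex_atlas_chart: "complex_atlas A \<Longrightarrow> c \<in> A \<Longrightarrow> is_chart c"
  by (simp add: complex_atlas_def)

lemma chart_at:
  assumes "complex_atlas A"
  shows "chart_at A p \<in> A" "p \<in> fst (chart_at A p)" "is_chart (chart_at A p)"
proof -
  have "\<exists>c. c \<in> A \<and> p \<in> fst c" using assms unfolding complex_atlas_def by blast
  then have "chart_at A p \<in> A \<and> p \<in> fst (chart_at A p)" unfolding chart_at_def by (rule someI_ex)
  then show "chart_at A p \<in> A" "p \<in> fst (chart_at A p)" "is_chart (chart_at A p)"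
    using complex_atlas_chart[OF assms] by blast+
qed

lemma open_chart_preimage:
  assumes c: "is_chart c" and f: "continuous_on (fst c) f" and W: "open W"
  shows "open {x \<in> snd c ` fst c. f (chart_inv c x) \<in> W}"
proof -
  have "continuous_on (snd c ` fst c) (\<lambda>x. f (chart_inv c x))"
    using is_chartD[OF c] by (intro continuous_on_compose2[OF f]) auto
  from continuous_open_preimage[OF this is_chartD(2)[OF c] W]
  show ?thesis by (simp add: vimage_def Int_def)
qed

text \<open>\<open>tangent_map\<close> is a \<open>frechet_derivative\<close> and carries no
  information where the map is not differentiable. The relation asserts differentiability too, in
  the same preferred charts.\<close>

definition has_mderiv where
  "has_mderiv A B f p T \<longleftrightarrow>
     ((\<lambda>x. snd (chart_at B (f p)) (f (chart_inv (chart_at A p) x))) has_derivative T) (at (snd (chart_at A p) p))"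

lemma tangent_map_eq: "has_mderiv A B f p T \<Longrightarrow> tangent_map A B f p = T"
  unfolding has_mderiv_def tangent_map_def o_def by (metis frechet_derivative_at)

lemma has_mderiv_compose:
  assumes A: "complex_atlas A" and B: "complex_atlas B"
    and f: "continuous_on UNIV f" "has_mderiv A B f p T" and g: "has_mderiv B C g (f p) S"
  shows "has_mderiv A C (\<lambda>x. g (f x)) p (\<lambda>v. S (T v))"
proof -
  let ?c = "chart_at A p" and ?d = "chart_at B (f p)" and ?e = "chart_at C (g (f p))"
  note c = chart_at[OF A, of p] is_chartD[OF chart_at(3)[OF A, of p]]
  note d = chart_at[OF B, of "f p"] is_chartD[OF chart_at(3)[OF B, of "f p"]]
  have 1: "((\<lambda>x. snd ?d (f (chart_inv ?c x))) has_derivative T) (at (snd ?c p))"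
    using f(2) by (simp add: has_mderiv_def)
  have 2: "((\<lambda>y. snd ?e (g (chart_inv ?d y))) has_derivative S) (at (snd ?d (f (chart_inv ?c (snd ?c p)))))"
    using g c by (simp add: has_mderiv_def)
  have 3: "((\<lambda>x. snd ?e (g (chart_inv ?d (snd ?d (f (chart_inv ?c x)))))) has_derivative (\<lambda>v. S (T v))) (at (snd ?c p))"
    by (rule has_derivative_compose[OF 1 2])
  show ?thesis
    unfolding has_mderiv_def
  proof (rule has_derivative_transform_within_open[OF 3])
    show "open {x \<in> snd ?c ` fst ?c. f (chart_inv ?c x) \<in> fst ?d}"
      using f(1) by (intro open_chart_preimage c d continuous_on_subset[OF f(1)]) auto
    show "snd ?c p \<in> {x \<in> snd ?c ` fst ?c. f (chart_inv ?c x) \<in> fst ?d}" using c d by auto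
  qed (use d in auto)
qed

text \<open>\<open>chart_inv\<close> of a product chart is an \<open>inv_into\<close>. Identifying
  it with the pair of inverses makes the holomorphy of group law and action usable in separately
  chosen charts.\<close>

lemma holo_on_joint:
  assumes A: "complex_atlas A" and B: "complex_atlas B"
    and F: "holomorphic_map (prod_atlas A B) C (\<lambda>(g, z). F g z)" and C: "complex_atlas C"
    and c: "c \<in> A" and d: "d \<in> B" and e: "e \<in> C"
  defines "S \<equiv> {w \<in> (snd c ` fst c) \<times> (snd d ` fst d). F (chart_inv c (fst w)) (chart_inv d (snd w)) \<in> fst e}"
  shows "holo_on (\<lambda>w. snd e (F (chart_inv c (fst w)) (chart_inv d (snd w)))) S" "open S"
proof -
  note cc = is_chartD[OF complex_atlas_chart[OF A c]]
  note dd = is_chartD[OF complex_atlas_chart[OF B d]]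
  have "continuous_on ((snd c ` fst c) \<times> (snd d ` fst d)) (\<lambda>w. chart_inv c (fst w))"
    by (rule continuous_on_compose2[OF cc(4) continuous_on_fst[OF continuous_on_id]]) auto
  moreover have "continuous_on ((snd c ` fst c) \<times> (snd d ` fst d)) (\<lambda>w. chart_inv d (snd w))"
    by (rule continuous_on_compose2[OF dd(4) continuous_on_snd[OF continuous_on_id]]) auto
  moreover have "continuous_on UNIV (\<lambda>(g, z). F g z)"
    using F unfolding holomorphic_map_def by blast
  ultimately have "continuous_on ((snd c ` fst c) \<times> (snd d ` fst d)) (\<lambda>w. (\<lambda>(g, z). F g z) (chart_inv c (fst w), chart_inv d (snd w)))"
    by (intro continuous_on_compose2[of UNIV "\<lambda>(g, z). F g z", OF _ continuous_on_Pair subset_UNIV])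
  from continuous_open_preimage[OF this open_Times[OF cc(2) dd(2)], of "fst e"]
  show op: "open S" using is_chartD[OF complex_atlas_chart[OF C e]] by (simp add: S_def vimage_def Int_def)
  define k where "k = (fst c \<times> fst d, map_prod (snd c) (snd d))"
  have k: "k \<in> prod_atlas A B" unfolding prod_atlas_def k_def using c d by blast
  have inj: "inj_on (snd k) (fst k)"
    using cc(6) dd(6) by (auto simp: k_def inj_on_def)
  have kinv: "chart_inv k w = (chart_inv c (fst w), chart_inv d (snd w))" if "w \<in> (snd c ` fst c) \<times> (snd d ` fst d)" for w
  proof -
    have "snd k (chart_inv c (fst w), chart_inv d (snd w)) = w" using that cc dd by (auto simp: k_def)
    moreover have "(chart_inv c (fst w), chart_inv d (snd w)) \<in> fst k" using that cc dd by (auto simp: k_def)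
    ultimately show ?thesis unfolding chart_inv_def[of k] using inv_into_f_f[OF inj] by metis
  qed
  have h: "holo_on (snd e \<circ> (\<lambda>(g, z). F g z) \<circ> chart_inv k) (snd k ` (fst k \<inter> (\<lambda>(g, z). F g z) -` fst e))"
    using F k e unfolding holomorphic_map_def by blast
  have sub: "S \<subseteq> snd k ` (fst k \<inter> (\<lambda>(g, z). F g z) -` fst e)"
  proof
    fix w assume w: "w \<in> S"
    then have "w = snd k (chart_inv c (fst w), chart_inv d (snd w))"
      "(chart_inv c (fst w), chart_inv d (snd w)) \<in> fst k \<inter> (\<lambda>(g, z). F g z) -` fst e"
      using cc dd by (auto simp: S_def k_def)
    then show "w \<in> snd k ` (fst k \<inter> (\<lambda>(g, z). F g z) -` fst e)" by blast
  qed
  show "holo_on (\<lambda>w. snd e (F (chart_inv c (fst w)) (chart_inv d (snd w)))) S"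
    unfolding holo_on_def
  proof
    fix w assume w: "w \<in> S"
    then obtain D where D: "((snd e \<circ> (\<lambda>(g, z). F g z) \<circ> chart_inv k) has_derivative D) (at w)"
      "\<forall>v. D (times_i v) = times_i (D v)" using h sub unfolding holo_on_def by blast
    have "((\<lambda>w. snd e (F (chart_inv c (fst w)) (chart_inv d (snd w)))) has_derivative D) (at w)"
      by (rule has_derivative_transform_within_open[OF D(1) op w]) (auto simp: S_def kinv)
    then show "\<exists>D. ((\<lambda>w. snd e (F (chart_inv c (fst w)) (chart_inv d (snd w)))) has_derivative D) (at w) \<and>
            (\<forall>v. D (times_i v) = times_i (D v))" using D(2) by blast
  qed
qed

lemma holomorphic_map_mderiv1:
  assumes "complex_atlas A" "complex_atlas B" "complex_atlas C"
    and F: "holomorphic_map (prod_atlas A B) C (\<lambda>(g, z). F g z)"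
  obtains T where "has_mderiv A C (\<lambda>g. F g z) g T" "clin T"
proof -
  let ?c = "chart_at A g" and ?d = "chart_at B z" and ?e = "chart_at C (F g z)"
  note c = chart_at[OF assms(1), of g] is_chartD[OF chart_at(3)[OF assms(1), of g]]
  note d = chart_at[OF assms(2), of z] is_chartD[OF chart_at(3)[OF assms(2), of z]]
  note e = chart_at[OF assms(3), of "F g z"]
  have "(snd ?c g, snd ?d z) \<in> {w \<in> (snd ?c ` fst ?c) \<times> (snd ?d ` fst ?d). F (chart_inv ?c (fst w)) (chart_inv ?d (snd w)) \<in> fst ?e}"
    using c d e by auto
  from holo_on_joint(1)[OF assms(1,2) F assms(3) c(1) d(1) e(1), unfolded holo_on_def, rule_format, OF this]
  obtain D where D: "((\<lambda>w. snd ?e (F (chart_inv ?c (fst w)) (chart_inv ?d (snd w)))) has_derivative D) (at (snd ?c g, snd ?d z))"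
    "\<And>v. D (times_i v) = times_i (D v)" by blast
  have "((\<lambda>x. (x, snd ?d z)) has_derivative (\<lambda>v. (v, 0))) (at (snd ?c g))"
    by (auto intro!: derivative_eq_intros)
  from has_derivative_compose[OF this D(1)]
  have h: "has_mderiv A C (\<lambda>g. F g z) g (\<lambda>v. D (v, 0))"
    unfolding has_mderiv_def using d by simp
  have "clin (\<lambda>v. D (v, 0))"
    unfolding clin_def using D(2)[of "(_, 0)"] has_derivative_linear[OF h[unfolded has_mderiv_def]]
    by (auto simp: times_i_prod_def times_i_simps)
  with h show ?thesis by (rule that)
qed

lemma holomorphic_map_mderiv2:
  assumes "complex_atlas A" "complex_atlas B" "complex_atlas C"
    and F: "holomorphic_map (prod_atlas A B) C (\<lambda>(g, z). F g z)"
  obtains T where "has_mderiv B C (\<lambda>z. F g z) z T" "clin T"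
proof -
  let ?c = "chart_at A g" and ?d = "chart_at B z" and ?e = "chart_at C (F g z)"
  note c = chart_at[OF assms(1), of g] is_chartD[OF chart_at(3)[OF assms(1), of g]]
  note d = chart_at[OF assms(2), of z] is_chartD[OF chart_at(3)[OF assms(2), of z]]
  note e = chart_at[OF assms(3), of "F g z"]
  have "(snd ?c g, snd ?d z) \<in> {w \<in> (snd ?c ` fst ?c) \<times> (snd ?d ` fst ?d). F (chart_inv ?c (fst w)) (chart_inv ?d (snd w)) \<in> fst ?e}"
    using c d e by auto
  from holo_on_joint(1)[OF assms(1,2) F assms(3) c(1) d(1) e(1), unfolded holo_on_def, rule_format, OF this]
  obtain D where D: "((\<lambda>w. snd ?e (F (chart_inv ?c (fst w)) (chart_inv ?d (snd w)))) has_derivative D) (at (snd ?c g, snd ?d z))"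
    "\<And>v. D (times_i v) = times_i (D v)" by blast
  have "((\<lambda>y. (snd ?c g, y)) has_derivative (\<lambda>v. (0, v))) (at (snd ?d z))"
    by (auto intro!: derivative_eq_intros)
  from has_derivative_compose[OF this D(1)]
  have h: "has_mderiv B C (\<lambda>z. F g z) z (\<lambda>v. D (0, v))"
    unfolding has_mderiv_def using c by simp
  have "clin (\<lambda>v. D (0, v))"
    unfolding clin_def using D(2)[of "(0, _)"] has_derivative_linear[OF h[unfolded has_mderiv_def]]
    by (auto simp: times_i_prod_def times_i_simps)
  with h show ?thesis by (rule that)
qed

definition has_cderiv where
  "has_cderiv B \<gamma> t v \<longleftrightarrow> ((\<lambda>s. snd (chart_at B (\<gamma> t)) (\<gamma> s)) has_vector_derivative v) (at t)"

lemma has_cderiv_compose: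
  fixes \<gamma> :: "real \<Rightarrow> 'm::topological_space"
  assumes B: "complex_atlas B" and \<gamma>: "continuous_on UNIV \<gamma>" "has_cderiv B \<gamma> t v" and g: "has_mderiv B C g (\<gamma> t) S"
  shows "has_cderiv C (\<lambda>s. g (\<gamma> s)) t (S v)"
proof -
  let ?d = "chart_at B (\<gamma> t)" and ?e = "chart_at C (g (\<gamma> t))"
  note d = chart_at[OF B, of "\<gamma> t"] is_chartD[OF chart_at(3)[OF B, of "\<gamma> t"]]
  have 1: "((\<lambda>s. snd ?d (\<gamma> s)) has_derivative (\<lambda>h. h *\<^sub>R v)) (at t)"
    using \<gamma>(2) by (simp add: has_cderiv_def has_vector_derivative_def)
  have 2: "((\<lambda>y. snd ?e (g (chart_inv ?d y))) has_derivative S) (at (snd ?d (\<gamma> t)))"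
    using g by (simp add: has_mderiv_def)
  from has_derivative_compose[OF 1 2] has_derivative_linear[OF 2]
  have 3: "((\<lambda>s. snd ?e (g (chart_inv ?d (snd ?d (\<gamma> s))))) has_derivative (\<lambda>h. h *\<^sub>R S v)) (at t)"
    by (simp add: linear_cmul)
  show ?thesis
    unfolding has_cderiv_def has_vector_derivative_def
  proof (rule has_derivative_transform_within_open[OF 3])
    show "open (\<gamma> -` fst ?d)" using \<gamma>(1) d by (simp add: open_vimage continuous_on_open_vimage)
  qed (use d in auto)
qed

text \<open>Velocities are measured in the preferred chart of each point, so coordinate changes
  first carry them into one fixed chart. There the curve is locally constant, and its level sets are
  open and closed in the real line.\<close>

lemma has_cderiv_zero_const:
  fixes \<gamma> :: "real \<Rightarrow> 'm::t2_space"
  assumes B: "complex_atlas B" and \<gamma>: "continuous_on UNIV \<gamma>" and z: "\<And>t. has_cderiv B \<gamma> t 0"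
  shows "\<gamma> s = \<gamma> t"
proof -
  have loc: "\<exists>U. open U \<and> t \<in> U \<and> (\<forall>s\<in>U. \<gamma> s = \<gamma> t)" for t
  proof -
    let ?d = "chart_at B (\<gamma> t)"
    note d = chart_at[OF B, of "\<gamma> t"] is_chartD[OF chart_at(3)[OF B, of "\<gamma> t"]]
    have op: "open (\<gamma> -` fst ?d)" using \<gamma> d by (simp add: open_vimage continuous_on_open_vimage)
    then obtain e where e: "e > 0" "ball t e \<subseteq> \<gamma> -` fst ?d" using d open_contains_ball by (metis vimageI2)
    have der: "((\<lambda>s. snd ?d (\<gamma> s)) has_vector_derivative 0) (at s)" if s: "s \<in> ball t e" for s
    proof -
      let ?c = "chart_at B (\<gamma> s)"
      note c = chart_at[OF B, of "\<gamma> s"] is_chartD[OF chart_at(3)[OF B, of "\<gamma> s"]]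
      have sd: "\<gamma> s \<in> fst ?d" using s e by auto
      then obtain D where D: "((snd ?d \<circ> chart_inv ?c) has_derivative D) (at (snd ?c (\<gamma> s)))"
        using B c d unfolding complex_atlas_def holo_on_def by blast
      have 1: "((\<lambda>r. snd ?c (\<gamma> r)) has_derivative (\<lambda>h. h *\<^sub>R 0)) (at s)"
        using z[of s] unfolding has_cderiv_def has_vector_derivative_def .
      from has_derivative_compose[OF 1 D] has_derivative_linear[OF D]
      have 3: "((\<lambda>r. snd ?d (chart_inv ?c (snd ?c (\<gamma> r)))) has_derivative (\<lambda>h. h *\<^sub>R 0)) (at s)"
        by (simp add: linear_0)
      show ?thesis unfolding has_vector_derivative_def
      proof (rule has_derivative_transform_within_open[OF 3])
        show "open (\<gamma> -` fst ?c)" using \<gamma> c by (simp add: open_vimage continuous_on_open_vimage)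
      qed (use c in auto)
    qed
    have c: "\<gamma> s = \<gamma> t" if s: "s \<in> ball t e" for s
    proof -
      have "snd ?d (\<gamma> s) = snd ?d (\<gamma> t)"
      proof (rule has_derivative_zero_unique_connected[of "ball t e"])
        show "((\<lambda>s. snd ?d (\<gamma> s)) has_derivative (\<lambda>x. 0)) (at r)" if "r \<in> ball t e" for r
          using der[OF that] by (simp add: has_vector_derivative_def)
      qed (use s e in auto)
      then show ?thesis using d s e inj_onD[OF d(9)] by auto
    qed
    show ?thesis
      by (rule exI[of _ "ball t e"], intro conjI ballI open_ball, simp add: e(1), erule c)
  qed
  have "open (\<gamma> -` {\<gamma> t})"
  proof (subst open_subopen, intro ballI)
    fix s assume s: "s \<in> \<gamma> -` {\<gamma> t}"
    obtain U where U: "open U" "s \<in> U" "\<forall>r\<in>U. \<gamma> r = \<gamma> s" using loc[of s] by blast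
    have "U \<subseteq> \<gamma> -` {\<gamma> t}"
    proof
      fix r assume "r \<in> U"
      then have "\<gamma> r = \<gamma> s" using U(3) by blast
      also have "\<gamma> s = \<gamma> t" using s by simp
      finally show "r \<in> \<gamma> -` {\<gamma> t}" by simp
    qed
    with U(1,2) show "\<exists>T. open T \<and> s \<in> T \<and> T \<subseteq> \<gamma> -` {\<gamma> t}" by blast
  qed
  moreover have "closed (\<gamma> -` {\<gamma> t})"
    using \<gamma> by (intro closed_vimage) (auto simp: continuous_on_eq_continuous_at)
  ultimately have "\<gamma> -` {\<gamma> t} \<in> {{}, UNIV}" using clopen[of "\<gamma> -` {\<gamma> t}"] by simp
  moreover have "t \<in> \<gamma> -` {\<gamma> t}" by simp
  ultimately have "s \<in> \<gamma> -` {\<gamma> t}" by blast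
  then show ?thesis by simp
qed

section \<open>Complex Lie groups and their exponential map\<close>

locale complex_Lie =
  fixes L :: "'g::{t2_space,second_countable_topology} monoid" (structure)
    and A :: "('g, 'e::fin_dim_complex) atlas"
  assumes Lie: "complex_Lie_group L A"

sublocale complex_Lie \<subseteq> group L
  using Lie by (simp add: complex_Lie_group_def)

context complex_Lie
begin

lemma carrier_UNIV [simp]: "carrier L = UNIV" and atlas: "complex_atlas A"
  and holo_mult: "holomorphic_map (prod_atlas A A) A (\<lambda>(g, h). g \<otimes> h)"
  and holo_inv: "holomorphic_map A A (\<lambda>g. inv g)"
  using Lie by (simp_all add: complex_Lie_group_def)

lemma tendsto_mult_group:
  assumes "(f \<longlongrightarrow> a) F" "(g \<longlongrightarrow> b) F" shows "((\<lambda>x. f x \<otimes> g x) \<longlongrightarrow> a \<otimes> b) F"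
proof -
  have "isCont (\<lambda>(g, h). g \<otimes> h) (a, b)"
    using holo_mult unfolding holomorphic_map_def by (simp add: continuous_on_eq_continuous_at)
  from isCont_tendsto_compose[OF this tendsto_Pair[OF assms]] show ?thesis by simp
qed

lemma tendsto_inv_group: "(f \<longlongrightarrow> a) F \<Longrightarrow> ((\<lambda>x. inv (f x)) \<longlongrightarrow> inv a) F"
  using holo_inv isCont_tendsto_compose[of a "\<lambda>g. inv g" f F]
  unfolding holomorphic_map_def by (simp add: continuous_on_eq_continuous_at)

lemma continuous_on_mult_group:
  "continuous_on S f \<Longrightarrow> continuous_on S g \<Longrightarrow> continuous_on S (\<lambda>x. f x \<otimes> g x)"
  unfolding continuous_on_def by (auto intro: tendsto_mult_group)

lemma tendsto_pow_group: "(f \<longlongrightarrow> a) F \<Longrightarrow> ((\<lambda>x. f x [^] (n::nat)) \<longlongrightarrow> a [^] n) F"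
  by (induction n) (auto intro: tendsto_mult_group)

section \<open>The multiplication in a chart centred at the unit\<close>

abbreviation c0 where "c0 \<equiv> chart_at A \<one>"

definition \<phi> where "\<phi> g = snd c0 g - snd c0 \<one>"
definition \<psi> where "\<psi> x = chart_inv c0 (x + snd c0 \<one>)"
definition dom where "dom = fst c0"
definition rng where "rng = {x. x + snd c0 \<one> \<in> snd c0 ` fst c0}"

lemmas c0 = chart_at[OF atlas, of \<one>] is_chartD[OF chart_at(3)[OF atlas, of \<one>]]

lemma open_dom: "open dom" and one_dom: "\<one> \<in> dom" and open_rng: "open rng"
  and psi_dom: "x \<in> rng \<Longrightarrow> \<psi> x \<in> dom" and phi_rng: "g \<in> dom \<Longrightarrow> \<phi> g \<in> rng"
  and phi_psi: "x \<in> rng \<Longrightarrow> \<phi> (\<psi> x) = x" and psi_phi: "g \<in> dom \<Longrightarrow> \<psi> (\<phi> g) = g"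
  and phi_one: "\<phi> \<one> = 0" and psi_zero: "\<psi> 0 = \<one>" and zero_rng: "0 \<in> rng"
proof -
  have "rng = (\<lambda>x. x + snd c0 \<one>) -` (snd c0 ` fst c0)" by (auto simp: rng_def)
  then show "open rng" using c0 by (simp add: open_vimage continuous_on_add)
qed (use c0 in \<open>auto simp: dom_def rng_def \<phi>_def \<psi>_def\<close>)

lemma continuous_on_phi: "continuous_on dom \<phi>"
  unfolding dom_def \<phi>_def using c0 by (intro continuous_intros) auto

lemma continuous_on_psi: "continuous_on rng \<psi>"
  unfolding rng_def \<psi>_def
  by (rule continuous_on_compose2[OF c0(7)]) (auto intro!: continuous_intros)

lemma tendsto_phi: "(f \<longlongrightarrow> a) F \<Longrightarrow> a \<in> dom \<Longrightarrow> ((\<lambda>x. \<phi> (f x)) \<longlongrightarrow> \<phi> a) F"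
  using continuous_on_phi open_dom isCont_tendsto_compose by (metis continuous_on_eq_continuous_at)

lemma tendsto_psi: "(f \<longlongrightarrow> a) F \<Longrightarrow> a \<in> rng \<Longrightarrow> ((\<lambda>x. \<psi> (f x)) \<longlongrightarrow> \<psi> a) F"
  using continuous_on_psi open_rng isCont_tendsto_compose by (metis continuous_on_eq_continuous_at)

definition m where "m x y = \<phi> (\<psi> x \<otimes> \<psi> y)"

lemma m_holo:
  defines "S \<equiv> {w. fst w \<in> rng \<and> snd w \<in> rng \<and> \<psi> (fst w) \<otimes> \<psi> (snd w) \<in> dom}"
  shows "holo_on (\<lambda>w. m (fst w) (snd w)) S" "open S"
proof -
  let ?a = "snd c0 \<one>"
  define T where "T = {w \<in> (snd c0 ` fst c0) \<times> (snd c0 ` fst c0). chart_inv c0 (fst w) \<otimes> chart_inv c0 (snd w) \<in> fst c0}"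
  define f where "f w = snd c0 (chart_inv c0 (fst w) \<otimes> chart_inv c0 (snd w))" for w
  note h = holo_on_joint[OF atlas atlas holo_mult atlas c0(1) c0(1) c0(1), folded T_def, folded f_def]
  have S: "S = (\<lambda>w. w + (?a, ?a)) -` T"
    by (auto simp: S_def T_def rng_def \<psi>_def dom_def)
  show "open S" unfolding S by (rule open_vimage[OF h(2)]) (intro continuous_intros)
  have fm: "(\<lambda>w. m (fst w) (snd w)) = (\<lambda>w. f (w + (?a, ?a)) - ?a)" by (simp add: f_def m_def \<phi>_def \<psi>_def)
  show "holo_on (\<lambda>w. m (fst w) (snd w)) S"
    unfolding holo_on_def
  proof
    fix w assume "w \<in> S"
    then obtain D where D: "(f has_derivative D) (at (w + (?a,?a)))" "\<forall>v. D (times_i v) = times_i (D v)"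
      using h(1) unfolding holo_on_def S by auto
    have "((\<lambda>w. w + (?a,?a)) has_derivative (\<lambda>v. v)) (at w)" by (auto intro!: derivative_eq_intros)
    from has_derivative_diff[OF has_derivative_compose[OF this D(1)] has_derivative_const[of ?a]]
    show "\<exists>D. ((\<lambda>w. m (fst w) (snd w)) has_derivative D) (at w) \<and> (\<forall>v. D (times_i v) = times_i (D v))"
      unfolding fm using D(2) by auto
  qed
qed

text \<open>Since \<open>m x 0 = x\<close> and \<open>m 0 y = y\<close>, the derivative of the
  multiplication at the origin is addition. The normalization \<open>8 * K * r \<le> 1\<close> keeps
  later error terms small against the linear ones.\<close>

lemma local_mult:
  obtains r K where "r > 0" "K \<ge> 0" "8 * K * r \<le> 1" "cball 0 r \<subseteq> rng"
    "\<And>x y. norm x \<le> r \<Longrightarrow> norm y \<le> r \<Longrightarrow> \<psi> x \<otimes> \<psi> y \<in> dom"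
    "\<And>\<rho> x y x' y'. \<lbrakk>norm x \<le> \<rho>; norm y \<le> \<rho>; norm x' \<le> \<rho>; norm y' \<le> \<rho>; \<rho> \<le> r\<rbrakk> \<Longrightarrow>
       norm (m x y - m x' y' - (x - x') - (y - y')) \<le> K * \<rho> * (norm (x - x') + norm (y - y'))"
proof -
  define S' where "S' = {w. fst w \<in> rng \<and> snd w \<in> rng \<and> \<psi> (fst w) \<otimes> \<psi> (snd w) \<in> dom}"
  define f' where "f' w = m (fst w) (snd w)" for w
  have f'm: "f' (x, y) = m x y" for x y by (simp add: f'_def)
  have opS': "open S'" unfolding S'_def by (rule m_holo)
  have 0: "0 \<in> S'" by (simp add: S'_def zero_rng psi_zero one_dom)
  have "holo_on f' S'" using m_holo(1) by (simp add: S'_def f'_def[abs_def])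
  then obtain D r K where D: "clin D" "(f' has_derivative D) (at 0)" "r > 0" "K \<ge> 0" "cball 0 r \<subseteq> S'"
    "\<And>\<rho> x y. norm x \<le> \<rho> \<Longrightarrow> norm y \<le> \<rho> \<Longrightarrow> \<rho> \<le> r \<Longrightarrow> norm (f' x - f' y - D (x - y)) \<le> K * \<rho> * norm (x - y)"
    using opS' 0 by (rule holo_on_strict_derivative) blast
  have rngS: "x \<in> rng \<and> y \<in> rng \<and> \<psi> x \<otimes> \<psi> y \<in> dom" if "(x, y) \<in> S'" for x y
    using that by (auto simp: S'_def)
  have ev: "open {x. (x, 0) \<in> S'}" "open {x. (0, x) \<in> S'}"
  proof -
    have "continuous_on UNIV (\<lambda>x::'e. (x, 0::'e))" "continuous_on UNIV (\<lambda>x::'e. (0::'e, x))"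
      by (intro continuous_intros)+
    from this[THEN open_vimage[OF opS']] show "open {x. (x, 0) \<in> S'}" "open {x. (0, x) \<in> S'}"
      by (simp_all add: vimage_def)
  qed
  have D1: "D (v, 0) = v" for v
  proof -
    have "((\<lambda>x. (x, 0)) has_derivative (\<lambda>v. (v, 0))) (at (0::'e))" by (auto intro!: derivative_eq_intros)
    from has_derivative_compose[OF this, of f' D] D(2)
    have 1: "((\<lambda>x. f' (x, 0)) has_derivative (\<lambda>v. D (v, 0))) (at 0)" by (simp add: zero_prod_def)
    have "((\<lambda>x. x) has_derivative (\<lambda>v. D (v, 0))) (at 0)"
      by (rule has_derivative_transform_within_open[OF 1 ev(1)])
        (use 0 rngS in \<open>auto simp: zero_prod_def f'm m_def psi_zero phi_psi\<close>)
    from has_derivative_unique[OF this has_derivative_ident] show ?thesis by metis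
  qed
  have D2: "D (0, v) = v" for v
  proof -
    have "((\<lambda>x. (0, x)) has_derivative (\<lambda>v. (0, v))) (at (0::'e))" by (auto intro!: derivative_eq_intros)
    from has_derivative_compose[OF this, of f' D] D(2)
    have 1: "((\<lambda>x. f' (0, x)) has_derivative (\<lambda>v. D (0, v))) (at 0)" by (simp add: zero_prod_def)
    have "((\<lambda>x. x) has_derivative (\<lambda>v. D (0, v))) (at 0)"
      by (rule has_derivative_transform_within_open[OF 1 ev(2)])
        (use 0 rngS in \<open>auto simp: zero_prod_def f'm m_def psi_zero phi_psi\<close>)
    from has_derivative_unique[OF this has_derivative_ident] show ?thesis by metis
  qed
  have DD: "D (v, w) = v + w" for v w
    using linear_add[of D "(v, 0)" "(0, w)"] D(1) D1 D2 by (simp add: clin_def)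
  \<comment> \<open>The half pays for the norm of a pair, at most \<open>2 * \<rho>\<close>. The
    second entry yields \<open>8 * (2 * K) * s \<le> 1\<close> for the new constant
    \<open>2 * K\<close>.\<close>
  define s where "s = min (r/2) (1 / (16 * K + 1))"
  have s: "s > 0" "2 * s \<le> r" using D(3,4) by (auto simp: s_def)
  have nP: "norm (x, y) \<le> 2 * \<rho>" if "norm x \<le> \<rho>" "norm y \<le> \<rho>" for x y :: 'e and \<rho>
    using norm_Pair_le[of x y] that by linarith
  have inS': "(x, y) \<in> S'" if "norm x \<le> s" "norm y \<le> s" for x y
    using nP[OF that] s D(5) by (auto simp: subset_iff)
  show ?thesis
  proof (rule that[of s "2 * K"])
    show "s > 0" "2 * K \<ge> 0" using s D by auto
    have "s \<le> 1 / (16 * K + 1)" by (simp add: s_def)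
    then have "16 * K * s + s \<le> 1" using D(4) by (simp add: field_simps)
    then show "8 * (2 * K) * s \<le> 1" using s(1) by simp
    show "cball 0 s \<subseteq> rng" using inS'[of _ 0] rngS[of _ 0] s by auto
    show "\<psi> x \<otimes> \<psi> y \<in> dom" if "norm x \<le> s" "norm y \<le> s" for x y using inS'[OF that] rngS by blast
    fix \<rho> and x y x' y' :: 'e
    assume n: "norm x \<le> \<rho>" "norm y \<le> \<rho>" "norm x' \<le> \<rho>" "norm y' \<le> \<rho>" "\<rho> \<le> s"
    have "\<rho> \<ge> 0" using n(1) norm_ge_zero order_trans by blast
    have "norm (f' (x, y) - f' (x', y') - D ((x, y) - (x', y'))) \<le> K * (2*\<rho>) * norm ((x, y) - (x', y'))"
      using n s by (intro D(6) nP) auto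
    also have "\<dots> \<le> K * (2*\<rho>) * (norm (x - x') + norm (y - y'))"
      using D(4) \<open>\<rho> \<ge> 0\<close> norm_Pair_le[of "x - x'" "y - y'"] by (intro mult_left_mono) auto
    finally show "norm (m x y - m x' y' - (x - x') - (y - y')) \<le> 2 * K * \<rho> * (norm (x - x') + norm (y - y'))"
      by (simp add: f'm DD algebra_simps)
  qed
qed

end

text \<open>
  The exponential map is constructed in the chart as the limit of the maps
  \<open>x \<mapsto> (x/2^n)^(2^n)\<close>; no differential equation is solved.
\<close>

locale local_Lie = complex_Lie L A
  for L :: "'g::{t2_space,second_countable_topology} monoid" (structure)
    and A :: "('g, 'e::fin_dim_complex) atlas" +
  fixes r K :: real
  assumes r: "r > 0" and K: "K \<ge> 0" and Kr: "8 * K * r \<le> 1" and rng: "cball 0 r \<subseteq> rng"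
    and dom: "\<And>x y. norm x \<le> r \<Longrightarrow> norm y \<le> r \<Longrightarrow> \<psi> x \<otimes> \<psi> y \<in> dom"
    and est: "\<And>\<rho> x y x' y'. \<lbrakk>norm x \<le> \<rho>; norm y \<le> \<rho>; norm x' \<le> \<rho>; norm y' \<le> \<rho>; \<rho> \<le> r\<rbrakk> \<Longrightarrow>
       norm (m x y - m x' y' - (x - x') - (y - y')) \<le> K * \<rho> * (norm (x - x') + norm (y - y'))"
begin

lemma rngI: "norm x \<le> r \<Longrightarrow> x \<in> rng" using rng by auto

lemma psi_m: "norm x \<le> r \<Longrightarrow> norm y \<le> r \<Longrightarrow> \<psi> (m x y) = \<psi> x \<otimes> \<psi> y"
  by (simp add: m_def psi_phi dom)

lemma m00: "m 0 0 = 0" by (simp add: m_def psi_zero phi_one)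

text \<open>Halving before squaring keeps the recursion inside the chart and lets one estimate
  reproduce itself at every level.\<close>

primrec En :: "nat \<Rightarrow> 'e \<Rightarrow> 'e" where
  "En 0 x = x"
| "En (Suc n) x = m (En n ((1/2) *\<^sub>R x)) (En n ((1/2) *\<^sub>R x))"

lemma En_zero: "En n 0 = 0" by (induction n) (auto simp: m00)

lemma Krho: "\<rho> \<le> r/2 \<Longrightarrow> 4 * K * \<rho> \<le> 1/4"
proof -
  assume "\<rho> \<le> r/2"
  then have "4 * K * \<rho> \<le> 4 * K * (r/2)" using K by (intro mult_left_mono) auto
  then show ?thesis using Kr by simp
qed

lemma lip_of_est:
  assumes "norm (u - v - (x - y)) \<le> c * norm (x - y)" "c \<le> 1" shows "norm (u - v) \<le> 2 * norm (x - y :: 'e)"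
proof -
  have "norm (u - v) \<le> norm (u - v - (x - y)) + norm (x - y)"
    using norm_triangle_ineq[of "u - v - (x - y)" "x - y"] by simp
  moreover have "c * norm (x - y) \<le> 1 * norm (x - y)" using assms(2) by (intro mult_right_mono) auto
  ultimately show ?thesis using assms(1) by simp
qed

text \<open>The inductive error is taken at radius \<open>\<rho>/2\<close> and for halved arguments;
  after the doubling by the square it amounts to \<open>2 * K * \<rho>\<close>. The multiplication
  adds the same, which gives \<open>4 * K * \<rho>\<close> again.\<close>

lemma En_est:
  "norm x \<le> \<rho> \<Longrightarrow> norm y \<le> \<rho> \<Longrightarrow> \<rho> \<le> r/2 \<Longrightarrow> norm (En n x - En n y - (x - y)) \<le> 4 * K * \<rho> * norm (x - y)"
proof (induction n arbitrary: x y \<rho>)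
  case 0
  have "\<rho> \<ge> 0" using 0(1) norm_ge_zero order_trans by blast
  then show ?case using K by simp
next
  case (Suc n)
  have \<rho>0: "\<rho> \<ge> 0" using Suc.prems(1) norm_ge_zero order_trans by blast
  let ?x = "(1/2) *\<^sub>R x" and ?y = "(1/2) *\<^sub>R y"
  have IH: "norm (En n a - En n b - (a - b)) \<le> 4 * K * (\<rho>/2) * norm (a - b)"
    if "norm a \<le> \<rho>/2" "norm b \<le> \<rho>/2" for a b
    using that Suc.prems(3) \<rho>0 by (intro Suc.IH) auto
  have k1: "4 * K * (\<rho>/2) \<le> 1" using Krho[OF Suc.prems(3)] by simp
  have sm: "norm (En n a) \<le> \<rho>" if "norm a \<le> \<rho>/2" for a
    using lip_of_est[OF IH[OF that, of 0] k1] \<rho>0 that by (simp add: En_zero)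
  let ?u = "En n ?x" and ?v = "En n ?y"
  have hx: "norm ?x \<le> \<rho>/2" "norm ?y \<le> \<rho>/2" using Suc.prems by auto
  have uv: "norm (?u - ?v) \<le> norm (x - y)"
    using lip_of_est[OF IH[OF hx] k1] by (simp flip: scaleR_diff_right)
  have 1: "norm (m ?u ?u - m ?v ?v - (?u - ?v) - (?u - ?v)) \<le> K * \<rho> * (norm (?u - ?v) + norm (?u - ?v))"
    using sm[OF hx(1)] sm[OF hx(2)] Suc.prems(3) r by (intro est) auto
  have "K * \<rho> * (norm (?u - ?v) + norm (?u - ?v)) \<le> K * \<rho> * (2 * norm (x - y))"
    using uv K \<rho>0 by (intro mult_left_mono) auto
  with 1 have 2: "norm (m ?u ?u - m ?v ?v - (?u - ?v) - (?u - ?v)) \<le> 2 * K * \<rho> * norm (x - y)" by simp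
  have 3: "norm (2 *\<^sub>R (?u - ?v - (?x - ?y))) \<le> 2 * K * \<rho> * norm (x - y)"
    using IH[OF hx] by (simp flip: scaleR_diff_right)
  have eq: "En (Suc n) x - En (Suc n) y - (x - y) = (m ?u ?u - m ?v ?v - (?u - ?v) - (?u - ?v)) + 2 *\<^sub>R (?u - ?v - (?x - ?y))"
    by (simp add: algebra_simps scaleR_2)
  show ?case unfolding eq by (rule order_trans[OF norm_triangle_le[OF add_mono[OF 2 3]]]) simp
qed

lemma En_small: "norm x \<le> \<rho> \<Longrightarrow> \<rho> \<le> r/2 \<Longrightarrow> norm (En n x) \<le> 2 * \<rho>"
proof -
  assume x: "norm x \<le> \<rho>" "\<rho> \<le> r/2"
  have "\<rho> \<ge> 0" using x(1) norm_ge_zero order_trans by blast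
  then have "norm (En n x - En n 0 - (x - 0)) \<le> 4 * K * \<rho> * norm (x - 0)" using x by (intro En_est) auto
  from lip_of_est[OF this] Krho[OF x(2)] x show ?thesis by (simp add: En_zero)
qed

lemma En_lip: "norm x \<le> r/2 \<Longrightarrow> norm y \<le> r/2 \<Longrightarrow> norm (En n x - En n y) \<le> 2 * norm (x - y)"
  using lip_of_est[OF En_est[of x "r/2" y n]] Krho[of "r/2"] by simp

text \<open>Halving \<open>x\<close> divides \<open>K * (norm x)^2\<close> by 4, while squaring in
  the chart expands differences by at most 3. This gives the ratio 3/4 and geometric
  convergence.\<close>

lemma En_step: "norm x \<le> r/2 \<Longrightarrow> norm (En (Suc n) x - En n x) \<le> (3/4)^n * (K * (norm x)^2)"
proof (induction n arbitrary: x)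
  case 0
  let ?x = "(1/2) *\<^sub>R x"
  have 1: "norm (m ?x ?x - m 0 0 - (?x - 0) - (?x - 0)) \<le> K * norm x * (norm (?x - 0) + norm (?x - 0))"
    using 0 r by (intro est) auto
  have "?x + ?x = x" by (simp flip: scaleR_left.add)
  then have eq: "m ?x ?x - m 0 0 - (?x - 0) - (?x - 0) = En (Suc 0) x - En 0 x"
    by (simp add: m00 diff_diff_eq)
  from 1[unfolded eq] show ?case by (simp add: power2_eq_square)
next
  case (Suc n)
  let ?x = "(1/2) *\<^sub>R x"
  let ?u = "En (Suc n) ?x" and ?v = "En n ?x"
  have xr: "norm x \<le> r" using Suc.prems r by linarith
  have sm: "norm (En k ?x) \<le> norm x" for k using En_small[of ?x "norm ?x" k] xr by simp
  have 1: "norm (m ?u ?u - m ?v ?v - (?u - ?v) - (?u - ?v)) \<le> K * norm x * (norm (?u - ?v) + norm (?u - ?v))"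
    by (intro est sm) (use Suc.prems r in auto)
  have "K * norm x \<le> 1/2" using Krho[OF Suc.prems] by simp
  then have "K * norm x * (norm (?u - ?v) + norm (?u - ?v)) \<le> 1/2 * (norm (?u - ?v) + norm (?u - ?v))"
    by (intro mult_right_mono) auto
  then have 2: "norm (m ?u ?u - m ?v ?v) \<le> 3 * norm (?u - ?v)"
  proof -
    have "m ?u ?u - m ?v ?v = (m ?u ?u - m ?v ?v - (?u - ?v) - (?u - ?v)) + ((?u - ?v) + (?u - ?v))" by simp
    then have "norm (m ?u ?u - m ?v ?v) \<le> norm (m ?u ?u - m ?v ?v - (?u - ?v) - (?u - ?v)) + norm ((?u - ?v) + (?u - ?v))"
      using norm_triangle_ineq by metis
    moreover have "norm ((?u - ?v) + (?u - ?v)) \<le> norm (?u - ?v) + norm (?u - ?v)" by (rule norm_triangle_ineq)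
    ultimately show ?thesis using 1 \<open>K * norm x * (norm (?u - ?v) + norm (?u - ?v)) \<le> 1/2 * (norm (?u - ?v) + norm (?u - ?v))\<close>
      by argo
  qed
  have "norm (?u - ?v) \<le> (3/4)^n * (K * (norm ?x)^2)" by (rule Suc.IH) (use xr in auto)
  also have "\<dots> = (3/4)^n * (K * (norm x)^2) / 4" by (simp add: power2_eq_square)
  finally have "3 * norm (?u - ?v) \<le> 3/4 * ((3/4)^n * (K * (norm x)^2))" by linarith
  then have "norm (m ?u ?u - m ?v ?v) \<le> (3/4)^(Suc n) * (K * (norm x)^2)"
    using 2 by (simp only: power_Suc mult.assoc)
  then show ?case by (simp only: En.simps)
qed

lemma En_Cauchy_est: "norm x \<le> r/2 \<Longrightarrow> norm (En (n + k) x - En n x) \<le> 4 * (3/4)^n * (K * (norm x)^2)"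
proof -
  assume x: "norm x \<le> r/2"
  have "norm (En (n + k) x - En n x) \<le> 4 * ((3/4)^n - (3/4)^(n+k)) * (K * (norm x)^2)"
  proof (induction k)
    case (Suc k)
    have "norm (En (n + Suc k) x - En n x) \<le> norm (En (Suc (n + k)) x - En (n + k) x) + norm (En (n + k) x - En n x)"
      using norm_triangle_ineq[of "En (Suc (n + k)) x - En (n + k) x" "En (n + k) x - En n x"] by simp
    also have "\<dots> \<le> (3/4)^(n+k) * (K * (norm x)^2) + 4 * ((3/4)^n - (3/4)^(n+k)) * (K * (norm x)^2)"
      by (intro add_mono En_step x Suc)
    also have "\<dots> = 4 * ((3/4)^n - (3/4)^(n+Suc k)) * (K * (norm x)^2)" by (simp add: algebra_simps)
    finally show ?case .
  qed simp
  also have "\<dots> \<le> 4 * (3/4)^n * (K * (norm x)^2)" using K by (intro mult_right_mono) auto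
  finally show ?thesis .
qed

definition E where "E x = lim (\<lambda>n. En n x)"

lemma En_tendsto: assumes x: "norm x \<le> r/2" shows "(\<lambda>n. En n x) \<longlonglongrightarrow> E x"
proof -
  have "Cauchy (\<lambda>n. En n x)"
  proof (rule metric_CauchyI)
    fix e :: real assume e: "e > 0"
    have "(\<lambda>n. 4 * (3/4)^n * (K * (norm x)^2)) \<longlonglongrightarrow> 4 * 0 * (K * (norm x)^2)"
      by (intro tendsto_intros) auto
    then have "eventually (\<lambda>n. 4 * (3/4)^n * (K * (norm x)^2) < e/2) sequentially"
      using e by (intro order_tendstoD(2)) auto
    then obtain N where N: "4 * (3/4)^N * (K * (norm x)^2) < e/2" by (auto simp: eventually_sequentially)
    have *: "norm (En n x - En N x) < e/2" if "n \<ge> N" for n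
      using En_Cauchy_est[OF x, of N "n - N"] N that by simp
    show "\<exists>M. \<forall>m\<ge>M. \<forall>n\<ge>M. dist (En m x) (En n x) < e"
    proof (intro exI allI impI)
      fix m n assume "m \<ge> N" "n \<ge> N"
      then show "dist (En m x) (En n x) < e"
        using norm_triangle_ineq4[of "En m x - En N x" "En n x - En N x"] *[of m] *[of n] by (simp add: dist_norm)
    qed
  qed
  then have "convergent (\<lambda>n. En n x)" using complete_UNIV_fin_dim unfolding complete_def convergent_def by blast
  then show ?thesis unfolding E_def by (simp add: convergent_LIMSEQ_iff)
qed

lemma E_est: "norm x \<le> \<rho> \<Longrightarrow> norm y \<le> \<rho> \<Longrightarrow> \<rho> \<le> r/2 \<Longrightarrow> norm (E x - E y - (x - y)) \<le> 4 * K * \<rho> * norm (x - y)"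
  by (rule tendsto_upperbound[where F=sequentially, OF tendsto_norm[OF tendsto_diff[OF tendsto_diff[OF En_tendsto En_tendsto] tendsto_const]]])
    (auto intro!: always_eventually En_est)

lemma E_zero: "E 0 = 0" by (simp add: E_def En_zero)

lemma E_quad: "norm x \<le> r/2 \<Longrightarrow> norm (E x - x) \<le> 4 * K * (norm x)^2"
  using E_est[of x "norm x" 0] by (simp add: E_zero power2_eq_square)

lemma E_small: "norm x \<le> r/2 \<Longrightarrow> norm (E x) \<le> 2 * norm x"
  using lip_of_est[OF E_est[of x "norm x" 0]] Krho[of "norm x"] by (simp add: E_zero)

lemma E_lip: "norm x \<le> r/2 \<Longrightarrow> norm y \<le> r/2 \<Longrightarrow> norm (E x - E y) \<le> 2 * norm (x - y)"
  using lip_of_est[OF E_est[of x "r/2" y]] Krho[of "r/2"] by simp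

lemma E_tendsto: assumes "(f \<longlongrightarrow> a) F" "norm a < r/2" shows "((\<lambda>x. E (f x)) \<longlongrightarrow> E a) F"
proof -
  have "isCont E a"
  proof -
    have "continuous_on (cball 0 (r/2)) E"
      by (rule lipschitz_on_continuous_on[of 2]) (auto simp: lipschitz_on_def dist_norm intro!: E_lip)
    then have "continuous_on (ball 0 (r/2)) E" by (rule continuous_on_subset) auto
    then show ?thesis using assms(2) by (simp add: continuous_on_eq_continuous_at)
  qed
  from isCont_tendsto_compose[OF this assms(1)] show ?thesis .
qed

lemma psi_En: "norm x \<le> r/2 \<Longrightarrow> \<psi> (En n x) = \<psi> ((1/2^n) *\<^sub>R x) [^] ((2::nat)^n)"
proof (induction n arbitrary: x)
  case (Suc n)
  let ?x = "(1/2) *\<^sub>R x"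
  have "norm x \<le> r" using Suc.prems r by linarith
  then have n: "norm ?x \<le> r/2" by simp
  have "norm (En n ?x) \<le> r" using En_small[of ?x "r/2" n] n by simp
  then have "\<psi> (En (Suc n) x) = \<psi> (En n ?x) \<otimes> \<psi> (En n ?x)" by (simp add: psi_m)
  also have "\<dots> = \<psi> ((1/2^n) *\<^sub>R ?x) [^] ((2::nat)^n + 2^n)" by (simp add: Suc.IH[OF n] nat_pow_mult)
  also have "(2::nat)^n + 2^n = 2^(Suc n)" by simp
  also have "(1/2^n) *\<^sub>R ?x = (1/2^(Suc n)) *\<^sub>R x" by simp
  finally show ?case .
qed simp

text \<open>Sequences of group elements with \<open>g n\<close> close to the point \<open>v/2^n\<close> of the chart.\<close>

definition TG where
  "TG g v \<longleftrightarrow> (\<forall>\<^sub>F n in sequentially. g n \<in> dom) \<and> (\<lambda>n. (2^n) *\<^sub>R \<phi> (g n)) \<longlonglongrightarrow> v"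

lemma TG_zero: assumes "TG g v" shows "(\<lambda>n. \<phi> (g n)) \<longlonglongrightarrow> 0"
proof -
  have "(\<lambda>n. (1/2)^n *\<^sub>R ((2^n) *\<^sub>R \<phi> (g n))) \<longlonglongrightarrow> 0 *\<^sub>R v"
    using assms unfolding TG_def by (intro tendsto_scaleR LIMSEQ_power_zero) auto
  moreover have "(1/2)^n *\<^sub>R ((2^n) *\<^sub>R \<phi> (g n)) = \<phi> (g n)" for n by (simp flip: power_mult_distrib)
  ultimately show ?thesis by simp
qed

lemma eventually_small: assumes "(f \<longlongrightarrow> (0::'e)) F" "d > 0" shows "\<forall>\<^sub>F n in F. norm (f n) \<le> d"
  using tendstoD[OF assms] by (auto simp: dist_norm elim: eventually_mono)

lemma tendsto_le_zero:
  fixes f :: "nat \<Rightarrow> 'e" and g :: "nat \<Rightarrow> real"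
  assumes "\<forall>\<^sub>F n in sequentially. norm (f n) \<le> g n" "g \<longlonglongrightarrow> 0"
  shows "f \<longlonglongrightarrow> 0"
  using assms by (rule Lim_null_comparison)

text \<open>The error of the multiplication is \<open>K * \<rho> n\<close>, tending to 0, times
  norms that stay bounded after scaling by \<open>2^n\<close>; so tangents add.\<close>

lemma TG_mult:
  assumes g: "TG g v" and h: "TG h w" shows "TG (\<lambda>n. g n \<otimes> h n) (v + w)"
proof -
  let ?a = "\<lambda>n. \<phi> (g n)" and ?b = "\<lambda>n. \<phi> (h n)"
  have ev: "\<forall>\<^sub>F n in sequentially. g n \<in> dom \<and> h n \<in> dom \<and> norm (?a n) \<le> r \<and> norm (?b n) \<le> r"
    using g h eventually_small[OF TG_zero[OF g] r] eventually_small[OF TG_zero[OF h] r]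
    unfolding TG_def by (simp add: eventually_conj_iff)
  have 1: "\<forall>\<^sub>F n in sequentially. g n \<otimes> h n \<in> dom"
    using ev by eventually_elim (metis dom psi_phi)
  define \<rho> where "\<rho> n = max (norm (?a n)) (norm (?b n))" for n
  have \<rho>: "\<rho> \<longlonglongrightarrow> 0"
    unfolding \<rho>_def using tendsto_max[OF tendsto_norm[OF TG_zero[OF g]] tendsto_norm[OF TG_zero[OF h]]] by simp
  have "(\<lambda>n. (2^n) *\<^sub>R (\<phi> (g n \<otimes> h n) - ?a n - ?b n)) \<longlonglongrightarrow> 0"
  proof (rule tendsto_le_zero)
    have "(\<lambda>n. K * \<rho> n * (norm (2^n *\<^sub>R ?a n) + norm (2^n *\<^sub>R ?b n))) \<longlonglongrightarrow> K * 0 * (norm v + norm w)"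
      using g h unfolding TG_def by (intro tendsto_mult tendsto_add tendsto_norm tendsto_const \<rho>) auto
    then show "(\<lambda>n. K * \<rho> n * (norm (2^n *\<^sub>R ?a n) + norm (2^n *\<^sub>R ?b n))) \<longlonglongrightarrow> 0"
      by simp
    show "\<forall>\<^sub>F n in sequentially. norm (2 ^ n *\<^sub>R (\<phi> (g n \<otimes> h n) - ?a n - ?b n))
       \<le> K * \<rho> n * (norm (2^n *\<^sub>R ?a n) + norm (2^n *\<^sub>R ?b n))"
      using ev
    proof eventually_elim
      case (elim n)
      have "m (?a n) (?b n) = \<phi> (g n \<otimes> h n)" using elim by (simp add: m_def psi_phi)
      moreover have "norm (m (?a n) (?b n) - m 0 0 - (?a n - 0) - (?b n - 0)) \<le> K * \<rho> n * (norm (?a n - 0) + norm (?b n - 0))"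
        using elim r by (intro est) (auto simp: \<rho>_def le_max_iff_disj)
      ultimately have "2^n * norm (\<phi> (g n \<otimes> h n) - ?a n - ?b n) \<le> 2^n * (K * \<rho> n * (norm (?a n) + norm (?b n)))"
        by (simp add: m00)
      then show ?case by (simp add: distrib_left mult_ac)
    qed
  qed
  from tendsto_add[OF this tendsto_add[of _ v _ _ w]] g h
  have "(\<lambda>n. (2^n) *\<^sub>R (\<phi> (g n \<otimes> h n) - ?a n - ?b n) + (2^n *\<^sub>R ?a n + 2^n *\<^sub>R ?b n)) \<longlonglongrightarrow> 0 + (v + w)"
    unfolding TG_def by auto
  then have "(\<lambda>n. (2^n) *\<^sub>R \<phi> (g n \<otimes> h n)) \<longlonglongrightarrow> v + w" by (simp add: algebra_simps)
  with 1 show ?thesis by (simp add: TG_def)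
qed

lemma TG_tendsto_one: assumes "TG g v" shows "g \<longlonglongrightarrow> \<one>"
proof (rule Lim_transform_eventually)
  show "(\<lambda>n. \<psi> (\<phi> (g n))) \<longlonglongrightarrow> \<one>" using tendsto_psi[OF TG_zero[OF assms] zero_rng] psi_zero by simp
  show "\<forall>\<^sub>F n in sequentially. \<psi> (\<phi> (g n)) = g n"
    using assms unfolding TG_def by (auto elim: eventually_mono simp: psi_phi)
qed

lemma TG_inv: assumes g: "TG g v" shows "TG (\<lambda>n. inv (g n)) (- v)"
proof -
  let ?a = "\<lambda>n. \<phi> (g n)" and ?b = "\<lambda>n. \<phi> (inv (g n))"
  have i1: "(\<lambda>n. inv (g n)) \<longlonglongrightarrow> \<one>" using tendsto_inv_group[OF TG_tendsto_one[OF g]] by simp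
  have ed: "\<forall>\<^sub>F n in sequentially. inv (g n) \<in> dom" using topological_tendstoD[OF i1 open_dom one_dom] .
  have b0: "?b \<longlonglongrightarrow> 0" using tendsto_phi[OF i1 one_dom] by (simp add: phi_one)
  have ev: "\<forall>\<^sub>F n in sequentially. g n \<in> dom \<and> inv (g n) \<in> dom \<and> norm (?a n) \<le> r \<and> norm (?b n) \<le> r"
    using g ed eventually_small[OF TG_zero[OF g] r] eventually_small[OF b0 r]
    unfolding TG_def by (simp add: eventually_conj_iff)
  define \<rho> where "\<rho> n = max (norm (?a n)) (norm (?b n))" for n
  have \<rho>: "\<rho> \<longlonglongrightarrow> 0"
    unfolding \<rho>_def using tendsto_max[OF tendsto_norm[OF TG_zero[OF g]] tendsto_norm[OF b0]] by simp
  have "(\<lambda>n. (2^n) *\<^sub>R (?a n + ?b n)) \<longlonglongrightarrow> 0"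
  proof (rule tendsto_le_zero)
    have "(\<lambda>n. K * \<rho> n * (4 * norm (2^n *\<^sub>R ?a n))) \<longlonglongrightarrow> K * 0 * (4 * norm v)"
      using g unfolding TG_def by (intro tendsto_mult tendsto_add tendsto_norm tendsto_const \<rho>) auto
    then show "(\<lambda>n. K * \<rho> n * (4 * norm (2^n *\<^sub>R ?a n))) \<longlonglongrightarrow> 0"
      by simp
    show "\<forall>\<^sub>F n in sequentially. norm (2 ^ n *\<^sub>R (?a n + ?b n)) \<le> K * \<rho> n * (4 * norm (2^n *\<^sub>R ?a n))"
      using ev
    proof eventually_elim
      case (elim n)
      have m0: "m (?a n) (?b n) = 0" using elim by (simp add: m_def psi_phi phi_one)
      have "norm (m (?a n) (?b n) - m 0 0 - (?a n - 0) - (?b n - 0)) \<le> K * \<rho> n * (norm (?a n - 0) + norm (?b n - 0))"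
        using elim r by (intro est) (auto simp: \<rho>_def le_max_iff_disj)
      then have 1: "norm (?a n + ?b n) \<le> K * \<rho> n * (norm (?a n) + norm (?b n))"
        using norm_minus_cancel[of "?a n + ?b n"] by (simp add: m0 m00)
      have \<rho>0: "\<rho> n \<ge> 0" "\<rho> n \<le> r" using elim by (auto simp: \<rho>_def le_max_iff_disj)
      \<comment> \<open>With \<open>K * r \<le> 1/8\<close> the term in \<open>norm (?b n)\<close>
        on the right can be absorbed, so the unknown coordinate of the inverse is bounded by that of
        \<open>g n\<close>.\<close>
      have "K * \<rho> n \<le> K * r" using \<rho>0 K by (intro mult_left_mono)
      then have "K * \<rho> n \<le> 1/8" using Kr by simp
      then have "K * \<rho> n * (norm (?a n) + norm (?b n)) \<le> 1/8 * (norm (?a n) + norm (?b n))" by (intro mult_right_mono) auto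
      from order_trans[OF 1 this] have "norm (?a n + ?b n) \<le> 1/8 * norm (?a n) + 1/8 * norm (?b n)" by simp
      moreover have "norm (?b n) \<le> norm (?a n + ?b n) + norm (?a n)"
        using norm_triangle_ineq4[of "?a n + ?b n" "?a n"] by simp
      ultimately have "norm (?a n) + norm (?b n) \<le> 4 * norm (?a n)" using norm_ge_zero[of "?a n"] by linarith
      then have "K * \<rho> n * (norm (?a n) + norm (?b n)) \<le> K * \<rho> n * (4 * norm (?a n))" using K \<rho>0 by (intro mult_left_mono) auto
      with 1 have "2^n * norm (?a n + ?b n) \<le> 2^n * (K * \<rho> n * (4 * norm (?a n)))" by simp
      then show ?case by (simp add: mult_ac)
    qed
  qed
  from tendsto_diff[OF this, of "\<lambda>n. 2^n *\<^sub>R ?a n" v] g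
  have "(\<lambda>n. (2^n) *\<^sub>R ?b n) \<longlonglongrightarrow> - v" unfolding TG_def by (simp add: algebra_simps)
  with ed show ?thesis by (simp add: TG_def)
qed

lemma TG_one: "TG (\<lambda>n. \<one>) 0" by (simp add: TG_def one_dom phi_one)

lemma TG_pow: assumes "TG g v" shows "TG (\<lambda>n. g n [^] (k::nat)) (real k *\<^sub>R v)"
proof (induction k)
  case 0 then show ?case by (simp add: TG_one)
next
  case (Suc k)
  from TG_mult[OF Suc assms] show ?case by (simp add: algebra_simps)
qed

definition X where "X x = \<psi> (E x)"

lemma X_dom: "norm x \<le> r/2 \<Longrightarrow> X x \<in> dom" and phi_X: "norm x \<le> r/2 \<Longrightarrow> \<phi> (X x) = E x"
  using E_small[of x] by (auto simp: X_def intro!: psi_dom phi_psi rngI)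

lemma X_tendsto: "(f \<longlongrightarrow> a) F \<Longrightarrow> norm a < r/2 \<Longrightarrow> ((\<lambda>x. X (f x)) \<longlongrightarrow> X a) F"
  unfolding X_def using E_small[of a] by (intro tendsto_psi E_tendsto rngI) auto

text \<open>\<open>En_lip\<close> is uniform in \<open>n\<close>, so
  \<open>2^n *\<^sub>R \<phi> (g n)\<close> may be replaced by its limit \<open>v\<close> under
  \<open>En n\<close>. Thus only the tangent of the sequence matters; powers, inverses and
  uniqueness of the exponential all rest on this.\<close>

lemma TG_limit: assumes g: "TG g v" and v: "norm v < r/2" shows "(\<lambda>n. g n [^] ((2::nat)^n)) \<longlonglongrightarrow> X v"
proof -
  define y where "y = (\<lambda>n. (2^n) *\<^sub>R \<phi> (g n))"
  have y: "y \<longlonglongrightarrow> v" using g by (simp add: TG_def y_def)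
  have small: "\<forall>\<^sub>F n in sequentially. norm (y n) < r/2" by (rule order_tendstoD(2)[OF tendsto_norm[OF y] v])
  have "(\<lambda>n. En n (y n) - En n v) \<longlonglongrightarrow> 0"
  proof (rule tendsto_le_zero)
    show "\<forall>\<^sub>F n in sequentially. norm (En n (y n) - En n v) \<le> 2 * norm (y n - v)"
      using small by eventually_elim (use v in \<open>auto intro!: En_lip\<close>)
    show "(\<lambda>n. 2 * norm (y n - v)) \<longlonglongrightarrow> 0" using y by (auto intro!: tendsto_eq_intros)
  qed
  from tendsto_add[OF this En_tendsto[of v]] v have "(\<lambda>n. En n (y n)) \<longlonglongrightarrow> E v" by simp
  then have "(\<lambda>n. \<psi> (En n (y n))) \<longlonglongrightarrow> X v"
    unfolding X_def using E_small[of v] v by (intro tendsto_psi rngI) auto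
  moreover have "\<forall>\<^sub>F n in sequentially. \<psi> (En n (y n)) = g n [^] ((2::nat)^n)"
    using small conjunct1[OF g[unfolded TG_def]]
    by eventually_elim (simp add: psi_En less_imp_le y_def psi_phi)
  ultimately show ?thesis by (rule Lim_transform_eventually)
qed

lemma TG_psi: "TG (\<lambda>n. \<psi> ((1/2^n) *\<^sub>R x)) x"
proof -
  have "(\<lambda>n. (1/2)^n *\<^sub>R x) \<longlonglongrightarrow> 0 *\<^sub>R x" by (intro tendsto_scaleR LIMSEQ_power_zero) auto
  then have 0: "(\<lambda>n. (1/2^n) *\<^sub>R x) \<longlonglongrightarrow> 0" by (simp add: power_one_over)
  have ev: "\<forall>\<^sub>F n in sequentially. (1/2^n) *\<^sub>R x \<in> rng" using topological_tendstoD[OF 0 open_rng zero_rng] .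
  then have "\<forall>\<^sub>F n in sequentially. x = (2^n) *\<^sub>R \<phi> (\<psi> ((1/2^n) *\<^sub>R x))"
    by eventually_elim (simp add: phi_psi)
  then have "(\<lambda>n. (2^n) *\<^sub>R \<phi> (\<psi> ((1/2^n) *\<^sub>R x))) \<longlonglongrightarrow> x"
    by (rule Lim_transform_eventually[OF tendsto_const])
  then show ?thesis unfolding TG_def using ev by (auto elim: eventually_mono intro: psi_dom)
qed

lemma X_pow: assumes "norm (real k *\<^sub>R x) < r/2" "norm x < r/2" shows "X (real k *\<^sub>R x) = X x [^] k"
proof -
  have "(\<lambda>n. (\<psi> ((1/2^n) *\<^sub>R x) [^] k) [^] ((2::nat)^n)) \<longlonglongrightarrow> X (real k *\<^sub>R x)"
    by (rule TG_limit[OF TG_pow[OF TG_psi] assms(1)])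
  moreover have "(\<lambda>n. (\<psi> ((1/2^n) *\<^sub>R x) [^] ((2::nat)^n)) [^] k) \<longlonglongrightarrow> X x [^] k"
    by (rule tendsto_pow_group[OF TG_limit[OF TG_psi assms(2)]])
  ultimately show ?thesis by (simp add: nat_pow_pow mult.commute LIMSEQ_unique)
qed

lemma X_minus: assumes "norm x < r/2" shows "X (- x) = inv (X x)"
proof -
  have "(\<lambda>n. inv (\<psi> ((1/2^n) *\<^sub>R x)) [^] ((2::nat)^n)) \<longlonglongrightarrow> X (- x)"
    by (rule TG_limit[OF TG_inv[OF TG_psi]]) (use assms in simp)
  moreover have "(\<lambda>n. inv (\<psi> ((1/2^n) *\<^sub>R x) [^] ((2::nat)^n))) \<longlonglongrightarrow> inv (X x)"
    by (rule tendsto_inv_group[OF TG_limit[OF TG_psi assms]])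
  ultimately show ?thesis by (simp add: nat_pow_inv LIMSEQ_unique)
qed

text \<open>For commensurable \<open>s\<close> and \<open>t\<close> both sides are powers of one
  element by \<open>X_pow\<close>. The fractions \<open>p n s / real (Suc n)\<close> approach
  \<open>s\<close> from below, which keeps all arguments inside the radius.\<close>

lemma X_add_pos:
  assumes st: "s \<ge> 0" "t \<ge> 0" and n: "norm ((s + t) *\<^sub>R x) < r/2"
  shows "X ((s + t) *\<^sub>R x) = X (s *\<^sub>R x) \<otimes> X (t *\<^sub>R x)"
proof -
  define p where "p n s = real (nat \<lfloor>s * real (Suc n)\<rfloor>)" for n s
  have p_le: "p n s \<le> s * real (Suc n)" if "s \<ge> 0" for n s
    unfolding p_def using that by simp
  have p_lim: "(\<lambda>n. p n s / real (Suc n)) \<longlonglongrightarrow> s" if "s \<ge> 0" for s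
  proof (rule tendsto_sandwich)
    show "\<forall>\<^sub>F n in sequentially. p n s / real (Suc n) \<le> s"
      using p_le[OF that] by (auto simp: divide_le_eq intro!: always_eventually)
    show "\<forall>\<^sub>F n in sequentially. s - 1 / real (Suc n) \<le> p n s / real (Suc n)"
    proof (intro always_eventually allI)
      fix n
      have "s * real (Suc n) - 1 \<le> p n s" unfolding p_def using that by linarith
      from divide_right_mono[OF this, of "real (Suc n)"]
      show "s - 1 / real (Suc n) \<le> p n s / real (Suc n)" by (simp add: diff_divide_distrib del: of_nat_Suc)
    qed
    show "(\<lambda>n. s - 1 / real (Suc n)) \<longlonglongrightarrow> s"
      using tendsto_diff[OF tendsto_const LIMSEQ_inverse_real_of_nat, of s] by (simp add: inverse_eq_divide)
  qed simp
  have lim: "(\<lambda>n. X ((p n s / real (Suc n)) *\<^sub>R x)) \<longlonglongrightarrow> X (s *\<^sub>R x)" if "s \<ge> 0" "norm (s *\<^sub>R x) < r/2" for s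
    by (intro X_tendsto that tendsto_scaleR p_lim tendsto_const)
  have ns: "norm (s *\<^sub>R x) < r/2" "norm (t *\<^sub>R x) < r/2"
    using n st mult_right_mono[of s "s+t" "norm x"] mult_right_mono[of t "s+t" "norm x"] by auto
  have "\<forall>\<^sub>F n in sequentially. norm ((1 / real (Suc n)) *\<^sub>R x) < r/2"
  proof -
    have "(\<lambda>n. (inverse (real (Suc n))) *\<^sub>R x) \<longlonglongrightarrow> 0 *\<^sub>R x" by (intro tendsto_scaleR LIMSEQ_inverse_real_of_nat tendsto_const)
    from order_tendstoD(2)[OF tendsto_norm[OF this], of "r/2"] show ?thesis using r
      by (simp add: inverse_eq_divide del: of_nat_Suc norm_scaleR)
  qed
  then have ev: "\<forall>\<^sub>F n in sequentially. X (((p n s + p n t) / real (Suc n)) *\<^sub>R x) = X ((p n s / real (Suc n)) *\<^sub>R x) \<otimes> X ((p n t / real (Suc n)) *\<^sub>R x)"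
  proof eventually_elim
    case (elim n)
    let ?x = "(1 / real (Suc n)) *\<^sub>R x"
    have pw: "X (real k *\<^sub>R ?x) = X ?x [^] k" if "real k \<le> (s + t) * real (Suc n)" for k
    proof (rule X_pow[OF _ elim])
      have "norm (real k *\<^sub>R ?x) = real k / real (Suc n) * norm x" by simp
      also have "\<dots> \<le> (s + t) * norm x"
        using that by (intro mult_right_mono) (auto simp: divide_le_eq)
      also have "\<dots> = norm ((s + t) *\<^sub>R x)" using st by simp
      finally show "norm (real k *\<^sub>R ?x) < r/2" using n by linarith
    qed
    have le: "p n s \<le> (s + t) * real (Suc n)" "p n t \<le> (s + t) * real (Suc n)" "p n s + p n t \<le> (s + t) * real (Suc n)"
    proof -
      have "0 \<le> s * real (Suc n)" "0 \<le> t * real (Suc n)" using st by auto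
      then show "p n s \<le> (s + t) * real (Suc n)" "p n t \<le> (s + t) * real (Suc n)" "p n s + p n t \<le> (s + t) * real (Suc n)"
        using p_le[OF st(1), of n] p_le[OF st(2), of n] by (simp_all only: distrib_right)
    qed
    define a b where "a = nat \<lfloor>s * real (Suc n)\<rfloor>" and "b = nat \<lfloor>t * real (Suc n)\<rfloor>"
    have ab: "p n s = real a" "p n t = real b" by (simp_all add: p_def a_def b_def)
    have "X (real (a + b) *\<^sub>R ?x) = X (real a *\<^sub>R ?x) \<otimes> X (real b *\<^sub>R ?x)"
      using le unfolding ab by (subst (1 2 3) pw) (simp_all add: nat_pow_mult)
    then show ?case by (simp add: ab)
  qed
  have "(\<lambda>n. X (((p n s + p n t) / real (Suc n)) *\<^sub>R x)) \<longlonglongrightarrow> X ((s + t) *\<^sub>R x)"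
    unfolding add_divide_distrib by (intro X_tendsto n tendsto_scaleR tendsto_add p_lim st tendsto_const)
  moreover have "(\<lambda>n. X (((p n s + p n t) / real (Suc n)) *\<^sub>R x)) \<longlonglongrightarrow> X (s *\<^sub>R x) \<otimes> X (t *\<^sub>R x)"
    by (rule Lim_transform_eventually[OF tendsto_mult_group[OF lim lim] eventually_mono[OF ev]]) (use st ns in auto)
  ultimately show ?thesis by (rule LIMSEQ_unique)
qed

end

section \<open>The global exponential and uniqueness of one-parameter groups\<close>

context local_Lie
begin

lemma X_add:
  assumes n: "(\<bar>s\<bar> + \<bar>t\<bar>) * norm x < r/2"
  shows "X ((s + t) *\<^sub>R x) = X (s *\<^sub>R x) \<otimes> X (t *\<^sub>R x)"
proof -
  have main: "X ((s + t) *\<^sub>R x) = X (s *\<^sub>R x) \<otimes> X (t *\<^sub>R x)"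
    if n: "(\<bar>s\<bar> + \<bar>t\<bar>) * norm x < r/2" and s: "s \<ge> 0" for s t x
  proof (cases "t \<ge> 0")
    case True
    then show ?thesis using n s by (intro X_add_pos) auto
  next
    case False
    have sm: "norm (u *\<^sub>R x) < r/2" if "\<bar>u\<bar> \<le> \<bar>s\<bar> + \<bar>t\<bar>" for u
      using le_less_trans[OF mult_right_mono[OF that norm_ge_zero] n] by simp
    have inv: "X (- u *\<^sub>R x) = inv (X (u *\<^sub>R x))" if "\<bar>u\<bar> \<le> \<bar>s\<bar> + \<bar>t\<bar>" for u
      using X_minus[OF sm[OF that]] by simp
    show ?thesis
    proof (cases "s + t \<ge> 0")
      case True
      have "X ((s + t + - t) *\<^sub>R x) = X ((s + t) *\<^sub>R x) \<otimes> X (- t *\<^sub>R x)"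
        using False True s by (intro X_add_pos sm) auto
      also have "X (- t *\<^sub>R x) = inv (X (t *\<^sub>R x))" using s False by (intro inv) auto
      finally show ?thesis by (simp add: m_assoc)
    next
      case False2: False
      have "X ((- (s + t) + s) *\<^sub>R x) = X (- (s + t) *\<^sub>R x) \<otimes> X (s *\<^sub>R x)"
        using False False2 s by (intro X_add_pos sm) auto
      also have "X (- (s + t) *\<^sub>R x) = inv (X ((s + t) *\<^sub>R x))" using s False False2 by (intro inv) auto
      also have "X ((- (s + t) + s) *\<^sub>R x) = inv (X (t *\<^sub>R x))" using inv[of t] s by simp
      finally have "inv (X (t *\<^sub>R x)) = inv (X ((s + t) *\<^sub>R x)) \<otimes> X (s *\<^sub>R x)" .
      then have "X ((s + t) *\<^sub>R x) \<otimes> inv (X (t *\<^sub>R x)) = X (s *\<^sub>R x)" by (simp flip: m_assoc)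
      then have "X (s *\<^sub>R x) \<otimes> X (t *\<^sub>R x) = X ((s + t) *\<^sub>R x) \<otimes> (inv (X (t *\<^sub>R x)) \<otimes> X (t *\<^sub>R x))"
        by (metis m_assoc UNIV_I carrier_UNIV)
      then show ?thesis by simp
    qed
  qed
  show ?thesis
  proof (cases "s \<ge> 0")
    case True then show ?thesis using main n by blast
  next
    case False
    have e: "(-s + -t) *\<^sub>R (-x) = (s + t) *\<^sub>R x" "(-s) *\<^sub>R (-x) = s *\<^sub>R x" "(-t) *\<^sub>R (-x) = t *\<^sub>R x"
      by (simp_all add: algebra_simps)
    show ?thesis using main[of "-s" "-t" "-x"] n False unfolding e by simp
  qed
qed

text \<open>\<open>N\<close> only has to bring \<open>\<xi>\<close> divided by \<open>N\<close> into
  the radius of \<open>X\<close>. By \<open>ge_eq\<close> all admissible \<open>N\<close> agree,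
  through the common refinement \<open>N * M\<close>.\<close>

definition ge where
  "ge \<xi> = (let N = Suc (nat \<lceil>2 * norm \<xi> / r\<rceil>) in X ((1 / real N) *\<^sub>R \<xi>) [^] N)"

lemma ge_eq: assumes N: "N > 0" "norm \<xi> < real N * (r/2)" shows "ge \<xi> = X ((1 / real N) *\<^sub>R \<xi>) [^] N"
proof -
  have refine: "X ((1 / real N) *\<^sub>R \<xi>) [^] N = X ((1 / real (N * M)) *\<^sub>R \<xi>) [^] (N * M)"
    if N: "N > 0" "norm \<xi> < real N * (r/2)" and M: "M > 0" for N M :: nat
  proof -
    have 1: "norm ((1 / real N) *\<^sub>R \<xi>) < r/2" using N by (simp add: field_simps)
    have "norm \<xi> < real N * (r/2)" by (rule N)
    also have "\<dots> \<le> real N * (r/2) * real M" using M N r by simp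
    finally have 2: "norm ((1 / real (N * M)) *\<^sub>R \<xi>) < r/2" using N M by (simp add: field_simps)
    have e: "real M *\<^sub>R (1 / real (N * M)) *\<^sub>R \<xi> = (1 / real N) *\<^sub>R \<xi>" using N M by simp
    have "X ((1 / real N) *\<^sub>R \<xi>) = X ((1 / real (N * M)) *\<^sub>R \<xi>) [^] M"
      using X_pow[of M "(1 / real (N * M)) *\<^sub>R \<xi>"] 1 2 unfolding e by simp
    then show ?thesis by (simp add: nat_pow_pow mult.commute)
  qed
  define M where "M = Suc (nat \<lceil>2 * norm \<xi> / r\<rceil>)"
  have "2 * norm \<xi> / r < real M" unfolding M_def by linarith
  then have M: "norm \<xi> < real M * (r/2)" using r by (simp add: field_simps)
  have M0: "M > 0" by (simp add: M_def)
  show ?thesis using refine[OF N M0] refine[OF M0 M N(1)]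
    unfolding ge_def Let_def M_def[symmetric] by (simp add: mult.commute)
qed

lemma large_N: obtains N :: nat where "N > 0" "c < real N * (r/2)"
proof -
  obtain N :: nat where "c / (r/2) < real N" using reals_Archimedean2 by blast
  then have "c < real (Suc N) * (r/2)" using r by (simp add: field_simps)
  then show ?thesis using that[of "Suc N"] by simp
qed

lemma ge_small: "norm \<xi> < r/2 \<Longrightarrow> ge \<xi> = X \<xi>"
  using ge_eq[of 1 \<xi>] by simp

lemma ge_add: "ge ((s + t) *\<^sub>R \<xi>) = ge (s *\<^sub>R \<xi>) \<otimes> ge (t *\<^sub>R \<xi>)"
proof -
  obtain N :: nat where N: "N > 0" "(\<bar>s\<bar> + \<bar>t\<bar>) * norm \<xi> < real N * (r/2)" by (rule large_N)
  let ?x = "(1 / real N) *\<^sub>R \<xi>"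
  have g: "ge (u *\<^sub>R \<xi>) = X (u *\<^sub>R ?x) [^] N" if "\<bar>u\<bar> \<le> \<bar>s\<bar> + \<bar>t\<bar>" for u
    using ge_eq[OF N(1), of "u *\<^sub>R \<xi>"] le_less_trans[OF mult_right_mono[OF that norm_ge_zero] N(2)] by simp
  have n: "(\<bar>s\<bar> + \<bar>t\<bar>) * norm ?x < r/2" using N by (simp add: field_simps)
  have ad: "X ((s + t) *\<^sub>R ?x) = X (s *\<^sub>R ?x) \<otimes> X (t *\<^sub>R ?x)" by (rule X_add[OF n])
  \<comment> \<open>The two orders of addition show that the factors commute, as the
    \<open>N\<close>-th power of a product requires.\<close>
  have "X ((t + s) *\<^sub>R ?x) = X (t *\<^sub>R ?x) \<otimes> X (s *\<^sub>R ?x)" by (rule X_add) (use n in \<open>simp add: add.commute\<close>)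
  with ad have "X (s *\<^sub>R ?x) \<otimes> X (t *\<^sub>R ?x) = X (t *\<^sub>R ?x) \<otimes> X (s *\<^sub>R ?x)" by (simp add: add.commute)
  then have "(X (s *\<^sub>R ?x) \<otimes> X (t *\<^sub>R ?x)) [^] N = X (s *\<^sub>R ?x) [^] N \<otimes> X (t *\<^sub>R ?x) [^] N"
    by (intro pow_mult_distrib) auto
  then show ?thesis using g[of "s + t", unfolded ad, OF abs_triangle_ineq] g[of s] g[of t] by simp
qed

lemma ge_tendsto: assumes f: "(f \<longlongrightarrow> a) F" shows "((\<lambda>x. ge (f x)) \<longlongrightarrow> ge a) F"
proof -
  obtain N :: nat where N: "N > 0" "norm a < real N * (r/2)" by (rule large_N)
  have ev: "\<forall>\<^sub>F x in F. norm (f x) < real N * (r/2)" by (rule order_tendstoD(2)[OF tendsto_norm[OF f] N(2)])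
  have "((\<lambda>x. X ((1 / real N) *\<^sub>R f x) [^] N) \<longlongrightarrow> X ((1 / real N) *\<^sub>R a) [^] N) F"
    by (intro tendsto_pow_group X_tendsto tendsto_scaleR tendsto_const f) (use N in \<open>simp add: field_simps\<close>)
  then show ?thesis unfolding ge_eq[OF N]
    by (rule Lim_transform_eventually) (use ev in \<open>auto elim!: eventually_mono simp: ge_eq[OF N(1)]\<close>)
qed

lemma ge_one_param: "one_param_subgroup L A \<xi> (\<lambda>t. ge (t *\<^sub>R \<xi>))"
  unfolding one_param_subgroup_def
proof (intro conjI allI)
  show "continuous_on UNIV (\<lambda>t. ge (t *\<^sub>R \<xi>))"
    unfolding continuous_on_def by (auto intro!: ge_tendsto tendsto_intros)
  show "ge ((s + t) *\<^sub>R \<xi>) = ge (s *\<^sub>R \<xi>) \<otimes> ge (t *\<^sub>R \<xi>)" for s t by (rule ge_add)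
  have "((\<lambda>t. E (t *\<^sub>R \<xi>)) has_derivative (\<lambda>t. t *\<^sub>R \<xi>)) (at 0)"
    unfolding has_derivative_at
  proof (intro conjI)
    show "bounded_linear (\<lambda>t. t *\<^sub>R \<xi>)" by (rule bounded_linear_scaleR_left)
    have "((\<lambda>t. norm (t *\<^sub>R \<xi>)) \<longlongrightarrow> norm (0 *\<^sub>R \<xi>)) (at 0)" by (intro tendsto_intros)
    from order_tendstoD(2)[OF this, of "r/2"] r
    have ev: "\<forall>\<^sub>F t in at 0. norm (t *\<^sub>R \<xi>) < r/2" by simp
    show "(\<lambda>h. norm (E ((0 + h) *\<^sub>R \<xi>) - E (0 *\<^sub>R \<xi>) - h *\<^sub>R \<xi>) / norm h) \<midarrow>0\<rightarrow> 0"
    proof (rule Lim_null_comparison)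
      show "\<forall>\<^sub>F h in at 0. norm (norm (E ((0 + h) *\<^sub>R \<xi>) - E (0 *\<^sub>R \<xi>) - h *\<^sub>R \<xi>) / norm h) \<le> 4 * K * \<bar>h\<bar> * (norm \<xi>)^2"
        using ev
      proof eventually_elim
        case (elim h)
        then have "norm (E (h *\<^sub>R \<xi>) - h *\<^sub>R \<xi>) \<le> 4 * K * (norm (h *\<^sub>R \<xi>))^2" by (intro E_quad) auto
        also have "\<dots> = (4 * K * \<bar>h\<bar> * (norm \<xi>)^2) * \<bar>h\<bar>" by (simp add: power2_eq_square)
        finally show ?case
          by (cases "h = 0") (simp_all add: E_zero pos_divide_le_eq K)
      qed
      have "((\<lambda>h. 4 * K * \<bar>h\<bar> * (norm \<xi>)^2) \<longlongrightarrow> 4 * K * \<bar>0\<bar> * (norm \<xi>)^2) (at 0)" by (intro tendsto_intros)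
      then show "((\<lambda>h. 4 * K * \<bar>h\<bar> * (norm \<xi>)^2) \<longlongrightarrow> 0) (at 0)" by simp
    qed
  qed
  then have "((\<lambda>t. E (t *\<^sub>R \<xi>) + snd c0 \<one>) has_derivative (\<lambda>t. t *\<^sub>R \<xi>)) (at 0)"
    by (auto intro!: derivative_eq_intros)
  then show "((snd c0 \<circ> (\<lambda>t. ge (t *\<^sub>R \<xi>))) has_vector_derivative \<xi>) (at 0)"
    unfolding has_vector_derivative_def
  proof (rule has_derivative_transform_within_open)
    have "continuous_on UNIV (\<lambda>t. norm (t *\<^sub>R \<xi>))" by (intro continuous_intros)
    then have "open ((\<lambda>t. norm (t *\<^sub>R \<xi>)) -` {..<r/2})" by (intro open_vimage) auto
    then show "open {t. norm (t *\<^sub>R \<xi>) < r/2}" by (simp add: vimage_def del: norm_scaleR)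
    fix t assume "t \<in> {t. norm (t *\<^sub>R \<xi>) < r/2}"
    then have "norm (t *\<^sub>R \<xi>) < r/2" by blast
    then show "E (t *\<^sub>R \<xi>) + snd c0 \<one> = (snd c0 \<circ> (\<lambda>t. ge (t *\<^sub>R \<xi>))) t"
      using phi_X[of "t *\<^sub>R \<xi>"] ge_small[of "t *\<^sub>R \<xi>"] by (simp add: \<phi>_def diff_eq_eq)
  qed (use r in auto)
qed

lemma one_param_pow:
  assumes \<gamma>: "\<And>s t. \<gamma> (s + t) = \<gamma> s \<otimes> \<gamma> (t::real)"
  shows "\<gamma> (real n * t) = \<gamma> t [^] n"
proof (induction n)
  case 0
  have "\<gamma> 0 \<otimes> \<gamma> 0 = \<gamma> 0 \<otimes> \<one>" using \<gamma>[of 0 0] by simp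
  then show ?case by simp
next
  case (Suc n)
  then show ?case using \<gamma>[of "real n * t" t] by (simp add: algebra_simps)
qed

text \<open>For small \<open>t\<close> the sequence \<open>\<gamma> (t / 2^n)\<close> has tangent
  \<open>t *\<^sub>R \<xi>\<close>, while its \<open>2^n\<close>-th powers are constantly
  \<open>\<gamma> t\<close>; \<open>TG_limit\<close> identifies that constant. Only the derivative
  at 0 enters.\<close>

lemma one_param_unique:
  assumes "one_param_subgroup L A \<xi> \<gamma>" shows "\<gamma> t = ge (t *\<^sub>R \<xi>)"
proof -
  have cont: "continuous_on UNIV \<gamma>" and hom: "\<And>s t. \<gamma> (s + t) = \<gamma> s \<otimes> \<gamma> t"
    and der: "((\<lambda>t. snd c0 (\<gamma> t)) has_vector_derivative \<xi>) (at 0)"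
    using assms by (auto simp: one_param_subgroup_def o_def)
  note pow = one_param_pow[of \<gamma>, OF hom]
  have \<gamma>0: "\<gamma> 0 = \<one>" using pow[of 0 0] by simp
  have sm: "\<gamma> t = X (t *\<^sub>R \<xi>)" if t: "norm (t *\<^sub>R \<xi>) < r/2" for t
  proof (cases "t = 0")
    case True then show ?thesis by (simp add: \<gamma>0 X_def E_zero psi_zero)
  next
    case False
    have h0: "(\<lambda>n. t / 2^n) \<longlonglongrightarrow> 0"
      using tendsto_mult[OF tendsto_const LIMSEQ_power_zero[of "1/2::real"], of t] by (simp add: power_divide)
    have "TG (\<lambda>n. \<gamma> (t / 2^n)) (t *\<^sub>R \<xi>)"
      unfolding TG_def
    proof
      have "(\<lambda>n. \<gamma> (t / 2^n)) \<longlonglongrightarrow> \<gamma> 0"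
        using cont h0 by (intro isCont_tendsto_compose[of _ \<gamma>]) (auto simp: continuous_on_eq_continuous_at)
      then show "\<forall>\<^sub>F n in sequentially. \<gamma> (t / 2 ^ n) \<in> local.dom"
        using topological_tendstoD[OF _ open_dom] one_dom \<gamma>0 by metis
      have "((\<lambda>h. (snd c0 (\<gamma> h) - snd c0 (\<gamma> 0)) /\<^sub>R h) \<longlongrightarrow> \<xi>) (at 0)"
      proof (rule LIM_zero_cancel, rule tendsto_norm_zero_cancel, rule Lim_transform_eventually)
        show "((\<lambda>h. norm (snd c0 (\<gamma> (0 + h)) - snd c0 (\<gamma> 0) - h *\<^sub>R \<xi>) / norm h) \<longlongrightarrow> 0) (at 0)"
          using der unfolding has_vector_derivative_def has_derivative_at by blast
        have "norm (f - h *\<^sub>R \<xi>) / norm h = norm (f /\<^sub>R h - \<xi>)" if "h \<noteq> 0" for h and f :: 'e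
        proof -
          have "f /\<^sub>R h - \<xi> = (f - h *\<^sub>R \<xi>) /\<^sub>R h" using that by (simp add: scaleR_diff_right)
          then show ?thesis by (simp add: divide_inverse mult.commute)
        qed
        then show "\<forall>\<^sub>F h in at 0. norm (snd c0 (\<gamma> (0 + h)) - snd c0 (\<gamma> 0) - h *\<^sub>R \<xi>) / norm h =
            norm ((snd c0 (\<gamma> h) - snd c0 (\<gamma> 0)) /\<^sub>R h - \<xi>)"
          by (auto simp: eventually_at_filter)
      qed
      from filterlim_compose[OF this, of "\<lambda>n. t / 2^n" sequentially]
      have "(\<lambda>n. (snd c0 (\<gamma> (t/2^n)) - snd c0 (\<gamma> 0)) /\<^sub>R (t/2^n)) \<longlonglongrightarrow> \<xi>"
        using h0 False by (auto simp: filterlim_at)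
      from tendsto_scaleR[OF tendsto_const this, of t]
      show "(\<lambda>n. 2 ^ n *\<^sub>R \<phi> (\<gamma> (t / 2 ^ n))) \<longlonglongrightarrow> t *\<^sub>R \<xi>"
        using False by (simp add: \<gamma>0 \<phi>_def)
    qed
    from TG_limit[OF this t] have "(\<lambda>n. \<gamma> (t / 2^n) [^] ((2::nat)^n)) \<longlonglongrightarrow> X (t *\<^sub>R \<xi>)" .
    moreover have "\<gamma> (t / 2^n) [^] ((2::nat)^n) = \<gamma> t" for n using pow[of "2^n" "t/2^n"] by simp
    ultimately show ?thesis by (simp add: LIMSEQ_const_iff)
  qed
  obtain N :: nat where N: "N > 0" "norm (t *\<^sub>R \<xi>) < real N * (r/2)" by (rule large_N)
  have "\<gamma> t = \<gamma> (t / real N) [^] N" using pow[of N "t / real N"] N by simp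
  also have "\<gamma> (t / real N) = X ((t / real N) *\<^sub>R \<xi>)" using N by (intro sm) (simp add: field_simps)
  finally show ?thesis using ge_eq[OF N] by simp
qed

lemma lie_exp_ge: "lie_exp L A \<xi> = ge \<xi>"
proof -
  have "(THE \<gamma>. one_param_subgroup L A \<xi> \<gamma>) = (\<lambda>t. ge (t *\<^sub>R \<xi>))"
    by (intro the_equality ge_one_param ext one_param_unique)
  then show ?thesis by (simp add: lie_exp_def)
qed

end

context complex_Lie
begin

abbreviation ex where "ex \<equiv> lie_exp L A"

text \<open>The facts that survive the construction: the radius and the constants of
  \<open>local_Lie\<close> are hidden, and from here on the exponential is used only through these
  properties.\<close>

lemma ex_add: "ex ((s + t) *\<^sub>R \<xi>) = ex (s *\<^sub>R \<xi>) \<otimes> ex (t *\<^sub>R \<xi>)"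
  and ex_tendsto: "(f \<longlongrightarrow> a) F \<Longrightarrow> ((\<lambda>x. ex (f x)) \<longlongrightarrow> ex a) F"
  and ex_one_param: "one_param_subgroup L A \<xi> (\<lambda>t. ex (t *\<^sub>R \<xi>))"
  and ex_unique: "one_param_subgroup L A \<xi> \<gamma> \<Longrightarrow> \<gamma> t = ex (t *\<^sub>R \<xi>)"
  and ex_local: "\<exists>r K. r > 0 \<and> K \<ge> 0 \<and> (\<forall>x. norm x \<le> r \<longrightarrow> ex x \<in> dom) \<and>
    (\<forall>\<rho> x y. norm x \<le> \<rho> \<longrightarrow> norm y \<le> \<rho> \<longrightarrow> \<rho> \<le> r \<longrightarrow> norm (\<phi> (ex x) - \<phi> (ex y) - (x - y)) \<le> K * \<rho> * norm (x - y))"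
  and mult_local: "strict_diff (\<lambda>(x, y). m x y) (\<lambda>(x, y). x + y)"
  and mult_local_dom: "\<exists>r>0. cball 0 r \<subseteq> rng \<and> (\<forall>x y. norm x \<le> r \<longrightarrow> norm y \<le> r \<longrightarrow> \<psi> x \<otimes> \<psi> y \<in> dom)"
proof -
  obtain r K where rK: "r > 0" "K \<ge> 0" "8 * K * r \<le> 1" "cball 0 r \<subseteq> rng"
    "\<And>x y. norm x \<le> r \<Longrightarrow> norm y \<le> r \<Longrightarrow> \<psi> x \<otimes> \<psi> y \<in> dom"
    "\<And>\<rho> x y x' y'. \<lbrakk>norm x \<le> \<rho>; norm y \<le> \<rho>; norm x' \<le> \<rho>; norm y' \<le> \<rho>; \<rho> \<le> r\<rbrakk> \<Longrightarrow>
       norm (m x y - m x' y' - (x - x') - (y - y')) \<le> K * \<rho> * (norm (x - x') + norm (y - y'))"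
    by (rule local_mult) blast
  interpret loc: local_Lie L A r K
    using rK by unfold_locales auto
  note [simp] = loc.lie_exp_ge
  show "ex ((s + t) *\<^sub>R \<xi>) = ex (s *\<^sub>R \<xi>) \<otimes> ex (t *\<^sub>R \<xi>)" by (simp add: loc.ge_add)
  show "(f \<longlongrightarrow> a) F \<Longrightarrow> ((\<lambda>x. ex (f x)) \<longlongrightarrow> ex a) F" by (simp add: loc.ge_tendsto)
  show "one_param_subgroup L A \<xi> (\<lambda>t. ex (t *\<^sub>R \<xi>))" using loc.ge_one_param by simp
  show "one_param_subgroup L A \<xi> \<gamma> \<Longrightarrow> \<gamma> t = ex (t *\<^sub>R \<xi>)" by (simp add: loc.one_param_unique)
  show "\<exists>r K. r > 0 \<and> K \<ge> 0 \<and> (\<forall>x. norm x \<le> r \<longrightarrow> ex x \<in> dom) \<and>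
    (\<forall>\<rho> x y. norm x \<le> \<rho> \<longrightarrow> norm y \<le> \<rho> \<longrightarrow> \<rho> \<le> r \<longrightarrow> norm (\<phi> (ex x) - \<phi> (ex y) - (x - y)) \<le> K * \<rho> * norm (x - y))"
  proof (intro exI conjI allI impI)
    have sm: "norm x < r/2" if "norm x \<le> r/3" for x :: 'e using that rK(1) by linarith
    show "r/3 > 0" "4 * K \<ge> 0" using rK by auto
    show "ex x \<in> dom" if "norm x \<le> r/3" for x
      using loc.X_dom[of x] loc.ge_small[of x] sm[OF that] by simp
    fix \<rho> and x y :: 'e assume *: "norm x \<le> \<rho>" "norm y \<le> \<rho>" "\<rho> \<le> r/3"
    have "norm x < r/2" "norm y < r/2" using * rK(1) by linarith+
    then show "norm (\<phi> (ex x) - \<phi> (ex y) - (x - y)) \<le> 4 * K * \<rho> * norm (x - y)"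
      using loc.E_est[of x \<rho> y] * rK(1) by (simp add: loc.ge_small loc.phi_X)
  qed
  show "\<exists>r>0. cball 0 r \<subseteq> rng \<and> (\<forall>x y. norm x \<le> r \<longrightarrow> norm y \<le> r \<longrightarrow> \<psi> x \<otimes> \<psi> y \<in> dom)"
    using rK by blast
  show "strict_diff (\<lambda>(x, y). m x y) (\<lambda>(x, y). x + y)"
    unfolding strict_diff_def
  proof (intro conjI allI impI)
    show "(case 0 of (x, y) \<Rightarrow> m x y) = 0" by (simp add: zero_prod_def loc.m00)
    show "bounded_linear (\<lambda>(x, y). x + y :: 'e)"
      using bounded_linear_add[OF bounded_linear_fst bounded_linear_snd] by (simp add: case_prod_beta')
    fix e :: real assume e: "e > 0"
    define \<rho> where "\<rho> = min r (e / (2 * K + 1))"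
    have \<rho>: "\<rho> > 0" "\<rho> \<le> r" using rK e by (auto simp: \<rho>_def)
    have "\<rho> \<le> e / (2 * K + 1)" by (simp add: \<rho>_def)
    then have "\<rho> * (2 * K + 1) \<le> e" using rK(2) by (simp add: le_divide_eq)
    then have Kr: "2 * (K * \<rho>) \<le> e" using \<rho> by (simp add: algebra_simps)
    have "norm (m x y - m x' y' - ((x - x') + (y - y'))) \<le> e * norm (x - x', y - y')"
      if "norm (x, y) < \<rho>" "norm (x', y') < \<rho>" for x y x' y'
    proof -
      have le: "norm x \<le> norm (x, y)" "norm y \<le> norm (x, y)" for x y :: 'e
        by (simp_all add: norm_Pair real_le_rsqrt)
      have "norm (m x y - m x' y' - (x - x') - (y - y')) \<le> K * \<rho> * (norm (x - x') + norm (y - y'))"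
        using that le(1)[of x y] le(2)[of y x] le(1)[of x' y'] le(2)[of y' x'] \<rho> by (intro rK(6)) linarith+
      also have "\<dots> \<le> K * \<rho> * (norm (x - x', y - y') + norm (x - x', y - y'))"
        using rK(2) \<rho> by (intro mult_left_mono add_mono le) auto
      also have "\<dots> = 2 * (K * \<rho>) * norm (x - x', y - y')" by simp
      also have "\<dots> \<le> e * norm (x - x', y - y')" using Kr by (intro mult_right_mono) auto
      finally show ?thesis by (simp add: diff_diff_eq add.assoc)
    qed
    then show "\<exists>\<rho>>0. \<forall>x y. norm x < \<rho> \<longrightarrow> norm y < \<rho> \<longrightarrow>
         norm ((case x of (x, y) \<Rightarrow> m x y) - (case y of (x, y) \<Rightarrow> m x y) - (case x - y of (x, y) \<Rightarrow> x + y)) \<le> e * norm (x - y)"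
      using \<rho>(1) by (intro exI[of _ \<rho>]) auto
  qed
qed

end

section \<open>The adjoint representation\<close>

lemma strict_diff_has_derivative:
  assumes "strict_diff f D" shows "(f has_derivative D) (at 0)"
  unfolding has_derivative_at
proof
  show "bounded_linear D" using assms by (simp add: strict_diff_def)
  show "(\<lambda>h. norm (f (0 + h) - f 0 - D h) / norm h) \<midarrow>0\<rightarrow> 0"
  proof (rule tendstoI)
    fix e :: real assume e: "e > 0"
    obtain \<rho> where \<rho>: "\<rho> > 0" "\<And>x y. norm x < \<rho> \<Longrightarrow> norm y < \<rho> \<Longrightarrow> norm (f x - f y - D (x - y)) \<le> (e/2) * norm (x - y)"
      by (rule strict_diffE[OF assms, of "e/2"]) (use e in auto)
    have *: "dist (norm (f (0 + h) - f 0 - D h) / norm h) 0 < e" if h: "h \<noteq> 0" "norm h < \<rho>" for h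
    proof -
      have "norm (f h - f 0 - D (h - 0)) \<le> (e/2) * norm (h - 0)" using h \<rho>(1) by (intro \<rho>(2)) auto
      also have "\<dots> < e * norm h" using e h by simp
      finally show ?thesis using h by (simp add: dist_norm pos_divide_less_eq)
    qed
    have "\<forall>\<^sub>F h in at 0. h \<noteq> (0 :: 'a) \<and> norm h < \<rho>"
      using \<rho>(1) unfolding eventually_at by (intro exI[of _ \<rho>]) (auto simp: dist_norm)
    then show "\<forall>\<^sub>F h in at 0. dist (norm (f (0 + h) - f 0 - D h) / norm h) 0 < e"
      by eventually_elim (rule *; blast)
  qed
qed

lemma strict_diff_small:
  fixes f :: "'a::real_normed_vector \<Rightarrow> 'b::real_normed_vector"
  assumes "strict_diff f D" "d > 0" obtains \<rho> where "\<rho> > 0" "\<And>x. norm x < \<rho> \<Longrightarrow> norm (f x) < d"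
proof -
  obtain \<rho> K where K: "\<rho> > 0" "K > 0" "\<And>x y. norm x < \<rho> \<Longrightarrow> norm y < \<rho> \<Longrightarrow> norm (f x - f y) \<le> K * norm (x - y)"
    using strict_diff_lipschitz[OF assms(1)] by blast
  show ?thesis
  proof (rule that[of "min \<rho> (d/K)"])
    show "min \<rho> (d/K) > 0" using K assms by simp
    fix x :: 'a assume x: "norm x < min \<rho> (d/K)"
    have "norm (f x) \<le> K * norm x" using K(3)[of x 0] x K(1) assms(1) by (simp add: strict_diff_def)
    also have "\<dots> < d" using x K(2) by (simp add: field_simps)
    finally show "norm (f x) < d" .
  qed
qed

context complex_Lie
begin

lemma cancel_group [simp]: "inv g \<otimes> (g \<otimes> h) = h" "g \<otimes> (inv g \<otimes> h) = h"
  by (simp_all flip: m_assoc)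

lemma ex_zero [simp]: "ex 0 = \<one>"
proof -
  have "ex 0 \<otimes> ex 0 = ex 0 \<otimes> \<one>" using ex_add[of 0 0 0] by simp
  then show ?thesis by simp
qed

lemma ex_minus: "ex (- \<xi>) = inv (ex \<xi>)"
proof -
  have "ex (- \<xi>) \<otimes> ex \<xi> = \<one>" using ex_add[of "-1" 1 \<xi>] by simp
  then show ?thesis by (metis inv_equality UNIV_I carrier_UNIV)
qed

lemma ex_inv_cancel [simp]: "ex \<xi> \<otimes> ex (- \<xi>) = \<one>" "ex (- \<xi>) \<otimes> ex \<xi> = \<one>"
  by (simp_all add: ex_minus)

lemma ex_pow: "ex (real n *\<^sub>R \<xi>) = ex \<xi> [^] n"
proof (induction n)
  case (Suc n)
  have "ex (real (Suc n) *\<^sub>R \<xi>) = ex ((real n + 1) *\<^sub>R \<xi>)" by (simp add: add.commute)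
  then show ?case using Suc by (simp add: ex_add)
qed simp

lemma continuous_on_ex: "continuous_on S f \<Longrightarrow> continuous_on S (\<lambda>x. ex (f x))"
  unfolding continuous_on_def by (auto intro: ex_tendsto)

lemma ex_strict_diff: "strict_diff (\<lambda>x. \<phi> (ex x)) (\<lambda>x. x)"
proof -
  obtain r K where rK: "r > 0" "K \<ge> 0"
    "\<And>\<rho> x y. norm x \<le> \<rho> \<Longrightarrow> norm y \<le> \<rho> \<Longrightarrow> \<rho> \<le> r \<Longrightarrow> norm (\<phi> (ex x) - \<phi> (ex y) - (x - y)) \<le> K * \<rho> * norm (x - y)"
    using ex_local by blast
  show ?thesis unfolding strict_diff_def
  proof (intro conjI allI impI)
    show "\<phi> (ex 0) = 0" by (simp add: phi_one)
    fix e :: real assume e: "e > 0"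
    define \<rho> where "\<rho> = min r (e / (K + 1))"
    have \<rho>: "\<rho> > 0" "\<rho> \<le> r" using rK e by (auto simp: \<rho>_def)
    have "\<rho> \<le> e / (K + 1)" by (simp add: \<rho>_def)
    then have "\<rho> * (K + 1) \<le> e" using rK(2) by (simp add: le_divide_eq)
    then have Kr: "K * \<rho> \<le> e" using \<rho> by (simp add: algebra_simps)
    have "norm (\<phi> (ex x) - \<phi> (ex y) - (x - y)) \<le> e * norm (x - y)" if "norm x < \<rho>" "norm y < \<rho>" for x y
      using order_trans[OF rK(3)[of x \<rho> y] mult_right_mono[OF Kr norm_ge_zero]] that \<rho> by auto
    then show "\<exists>\<rho>>0. \<forall>x y. norm x < \<rho> \<longrightarrow> norm y < \<rho> \<longrightarrow> norm (\<phi> (ex x) - \<phi> (ex y) - (x - y)) \<le> e * norm (x - y)"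
      using \<rho>(1) by blast
  qed (rule bounded_linear_ident)
qed

lemma strict_diff_m:
  assumes "strict_diff f D" "strict_diff g E" shows "strict_diff (\<lambda>x. m (f x) (g x)) (\<lambda>x. D x + E x)"
  using strict_diff_compose[OF strict_diff_Pair[OF assms] mult_local] by simp

lemma ex_dom_local: obtains r where "r > 0" "\<And>x. norm x \<le> r \<Longrightarrow> ex x \<in> dom"
  using ex_local by blast

text \<open>The product of the exponentials of the four components has as strict derivative the sum
  of the projections, which is the identity; so it covers a neighbourhood of the unit. The sum may
  be redundant, and fewer factors are obtained by inserting \<open>{0}\<close>.\<close>

lemma local_product:
  assumes sub: "subspace V0" "subspace V1" "subspace V2" "subspace V3"
    and sp: "\<And>x. \<exists>a\<in>V0. \<exists>b\<in>V1. \<exists>c\<in>V2. \<exists>d\<in>V3. x = a + b + (c + d)" and d: "\<delta> > 0"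
  obtains N where "open N" "\<one> \<in> N"
    "\<And>g. g \<in> N \<Longrightarrow> \<exists>a\<in>V0. \<exists>b\<in>V1. \<exists>c\<in>V2. \<exists>d\<in>V3. norm a < \<delta> \<and> norm b < \<delta> \<and> norm c < \<delta> \<and> norm d < \<delta> \<and>
       g = ex a \<otimes> ex b \<otimes> (ex c \<otimes> ex d)"
proof -
  define V where "V i = (if i = 0 then V0 else if i = 1 then V1 else if i = 2 then V2 else V3)" for i :: nat
  have s4: "(\<Sum>i<4. f i) = f 0 + f 1 + (f 2 + f 3)" for f :: "nat \<Rightarrow> 'e"
    by (simp add: eval_nat_numeral add.assoc)
  obtain P where P: "\<And>i. linear (P i)" "\<And>i x. i < 4 \<Longrightarrow> P i x \<in> V i" "\<And>x. (\<Sum>i<4. P i x) = x"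
  proof (rule projections_exist[of 4 V])
    show "subspace (V i)" for i using sub by (simp add: V_def)
    show "\<exists>v. (\<forall>i<4. v i \<in> V i) \<and> x = (\<Sum>i<4. v i)" for x
    proof -
      obtain a b c d where "a \<in> V0" "b \<in> V1" "c \<in> V2" "d \<in> V3" "x = a + b + (c + d)" using sp by blast
      then show ?thesis unfolding s4
        by (intro exI[of _ "\<lambda>i. if i = 0 then a else if i = 1 then b else if i = 2 then c else d"]) (auto simp: V_def)
    qed
  qed blast
  have bl: "bounded_linear (P i)" for i by (rule linear_imp_bounded[OF P(1)])
  define e where "e i x = \<phi> (ex (P i x))" for i x
  have e: "strict_diff (e i) (P i)" for i
    unfolding e_def using strict_diff_compose[OF strict_diff_bounded_linear[OF bl] ex_strict_diff] by simp
  have e01: "strict_diff (\<lambda>x. m (e 0 x) (e 1 x)) (\<lambda>x. P 0 x + P 1 x)" by (rule strict_diff_m[OF e e])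
  have e23: "strict_diff (\<lambda>x. m (e 2 x) (e 3 x)) (\<lambda>x. P 2 x + P 3 x)" by (rule strict_diff_m[OF e e])
  define F where "F x = m (m (e 0 x) (e 1 x)) (m (e 2 x) (e 3 x))" for x
  have F: "strict_diff F (\<lambda>x. x)" unfolding F_def using strict_diff_m[OF e01 e23] P(3) by (simp add: s4)
  obtain s where s: "s > 0" "\<And>x. norm x \<le> s \<Longrightarrow> ex x \<in> dom" by (rule ex_dom_local) blast
  obtain r where r: "r > 0" "cball 0 r \<subseteq> rng" "\<And>x y. norm x \<le> r \<Longrightarrow> norm y \<le> r \<Longrightarrow> \<psi> x \<otimes> \<psi> y \<in> dom"
    using mult_local_dom by blast
  have ee: "\<exists>\<rho>>0. \<forall>x. norm x < \<rho> \<longrightarrow> norm (e i x) < r \<and> norm (P i x) < min \<delta> s" for i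
  proof -
    obtain \<rho>1 where 1: "\<rho>1 > 0" "\<And>x. norm x < \<rho>1 \<Longrightarrow> norm (e i x) < r" using strict_diff_small[OF e r(1)] by blast
    obtain \<rho>2 where 2: "\<rho>2 > 0" "\<And>x. norm x < \<rho>2 \<Longrightarrow> norm (P i x) < min \<delta> s"
      using strict_diff_small[OF strict_diff_bounded_linear[OF bl], of "min \<delta> s"] d s(1) by (metis min_less_iff_conj)
    show ?thesis using 1 2 by (intro exI[of _ "min \<rho>1 \<rho>2"]) auto
  qed
  then obtain R where R: "\<And>i. R i > 0" "\<And>i x. norm x < R i \<Longrightarrow> norm (e i x) < r \<and> norm (P i x) < min \<delta> s" by metis
  obtain \<rho>1 where \<rho>1: "\<rho>1 > 0" "\<And>x. norm x < \<rho>1 \<Longrightarrow> norm (m (e 0 x) (e 1 x)) < r" using strict_diff_small[OF e01 r(1)] by blast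
  obtain \<rho>2 where \<rho>2: "\<rho>2 > 0" "\<And>x. norm x < \<rho>2 \<Longrightarrow> norm (m (e 2 x) (e 3 x)) < r" using strict_diff_small[OF e23 r(1)] by blast
  define \<rho> where "\<rho> = min (min \<rho>1 \<rho>2) (min (min (R 0) (R 1)) (min (R 2) (R 3)))"
  have "\<rho> > 0" using \<rho>1 \<rho>2 R(1) by (simp add: \<rho>_def)
  then obtain \<delta>' where \<delta>': "\<delta>' > 0" "\<And>y. norm y < \<delta>' \<Longrightarrow> \<exists>x. norm x < \<rho> \<and> F x = y"
    using strict_diff_surj[OF F] by blast
  show ?thesis
  proof (rule that[of "dom \<inter> \<phi> -` ball 0 \<delta>'"])
    show "open (dom \<inter> \<phi> -` ball 0 \<delta>')"
      using continuous_open_preimage[OF continuous_on_phi open_dom, of "ball 0 \<delta>'"] by simp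
    show "\<one> \<in> dom \<inter> \<phi> -` ball 0 \<delta>'" using \<delta>'(1) by (simp add: one_dom phi_one)
    fix g assume g: "g \<in> dom \<inter> \<phi> -` ball 0 \<delta>'"
    then obtain x where x: "norm x < \<rho>" "F x = \<phi> g" using \<delta>'(2)[of "\<phi> g"] by auto
    have i: "norm (e i x) \<le> r" "norm (P i x) < \<delta>" "norm (P i x) \<le> s" if "i \<in> {0,1,2,3}" for i
      using R(2)[of x i] x(1) that unfolding \<rho>_def by auto
    have pe: "\<psi> (e i x) = ex (P i x)" if "i \<in> {0,1,2,3}" for i
      using i[OF that] s(2) by (simp add: e_def psi_phi)
    have pm: "\<psi> (m a b) = \<psi> a \<otimes> \<psi> b" if "norm a \<le> r" "norm b \<le> r" for a b
      using that r(3) by (simp add: m_def psi_phi)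
    have "g = \<psi> (F x)" using g x(2) by (simp add: psi_phi)
    also have "\<dots> = \<psi> (m (e 0 x) (e 1 x)) \<otimes> \<psi> (m (e 2 x) (e 3 x))"
      unfolding F_def using \<rho>1(2)[of x] \<rho>2(2)[of x] x(1) by (intro pm) (auto simp: \<rho>_def)
    also have "\<dots> = ex (P 0 x) \<otimes> ex (P 1 x) \<otimes> (ex (P 2 x) \<otimes> ex (P 3 x))"
      using i by (simp add: pm pe)
    finally have g': "g = ex (P 0 x) \<otimes> ex (P 1 x) \<otimes> (ex (P 2 x) \<otimes> ex (P 3 x))" .
    have "P 0 x \<in> V0" "P 1 x \<in> V1" "P 2 x \<in> V2" "P 3 x \<in> V3"
      using P(2)[of 0 x] P(2)[of 1 x] P(2)[of 2 x] P(2)[of 3 x] by (simp_all add: V_def)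
    then show "\<exists>a\<in>V0. \<exists>b\<in>V1. \<exists>c\<in>V2. \<exists>d\<in>V3. norm a < \<delta> \<and> norm b < \<delta> \<and> norm c < \<delta> \<and> norm d < \<delta> \<and>
       g = ex a \<otimes> ex b \<otimes> (ex c \<otimes> ex d)"
      by (intro bexI[of _ "P 0 x"] bexI[of _ "P 1 x"] bexI[of _ "P 2 x"] bexI[of _ "P 3 x"] conjI g' i(2)) simp_all
  qed
qed

lemma ex_has_derivative: "((\<lambda>t. \<phi> (ex (t *\<^sub>R \<xi>))) has_derivative (\<lambda>t. t *\<^sub>R \<xi>)) (at 0)"
  using strict_diff_has_derivative[OF strict_diff_compose[OF strict_diff_bounded_linear[OF bounded_linear_scaleR_left[of \<xi>]] ex_strict_diff]] .

lemma ex_eq_imp_eq: assumes "\<And>t::real. ex (t *\<^sub>R \<xi>) = ex (t *\<^sub>R \<eta>)" shows "\<xi> = \<eta>"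
proof -
  have "(\<lambda>t::real. t *\<^sub>R \<xi>) = (\<lambda>t. t *\<^sub>R \<eta>)"
    using ex_has_derivative[of \<xi>] ex_has_derivative[of \<eta>] unfolding assms by (rule has_derivative_unique)
  from fun_cong[OF this, of 1] show ?thesis by simp
qed

lemma one_paramI:
  assumes "continuous_on UNIV \<gamma>" "\<And>s t. \<gamma> (s + t) = \<gamma> s \<otimes> \<gamma> t"
    and d: "((\<lambda>t. \<phi> (\<gamma> t)) has_derivative (\<lambda>t. t *\<^sub>R \<xi>)) (at 0)"
  shows "\<gamma> t = ex (t *\<^sub>R \<xi>)"
proof (rule ex_unique)
  have "((\<lambda>t. \<phi> (\<gamma> t) + snd c0 \<one>) has_derivative (\<lambda>t. t *\<^sub>R \<xi>)) (at 0)"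
    using d by (auto intro!: derivative_eq_intros)
  then show "one_param_subgroup L A \<xi> \<gamma>"
    unfolding one_param_subgroup_def has_vector_derivative_def using assms(1,2) by (simp add: \<phi>_def o_def)
qed

text \<open>Conjugation is a left translation followed by a right translation, and both are partial
  maps of the holomorphic multiplication. This gives existence and complex linearity of the
  differential together.\<close>

lemma conj_mderiv: "has_mderiv A A (\<lambda>h. g \<otimes> h \<otimes> inv g) \<one> (Ad L A g)" and clin_Ad: "clin (Ad L A g)"
proof -
  obtain T where T: "has_mderiv A A (\<lambda>h. g \<otimes> h) \<one> T" "clin T"
    by (rule holomorphic_map_mderiv2[OF atlas atlas atlas holo_mult])
  obtain S where S: "has_mderiv A A (\<lambda>h. h \<otimes> inv g) (g \<otimes> \<one>) S" "clin S"
    by (rule holomorphic_map_mderiv1[OF atlas atlas atlas holo_mult])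
  have "continuous_on UNIV (\<lambda>h. g \<otimes> h)" by (intro continuous_on_mult_group continuous_intros)
  from has_mderiv_compose[OF atlas atlas this T(1) S(1)]
  have m: "has_mderiv A A (\<lambda>h. g \<otimes> h \<otimes> inv g) \<one> (\<lambda>v. S (T v))" .
  have eq: "Ad L A g = (\<lambda>v. S (T v))" unfolding Ad_def by (rule tangent_map_eq[OF m])
  show "has_mderiv A A (\<lambda>h. g \<otimes> h \<otimes> inv g) \<one> (Ad L A g)" unfolding eq by (rule m)
  show "clin (Ad L A g)" unfolding eq by (rule clin_compose[OF T(2) S(2)])
qed

abbreviation AD where "AD \<equiv> Ad L A"

lemma linear_AD: "linear (AD g)" using clin_Ad[of g] by (simp add: clin_def)
lemma AD_times_i: "AD g (times_i v) = times_i (AD g v)" using clin_Ad[of g] by (simp add: clin_def)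
lemma AD_sc: "AD g (sc z v) = sc z (AD g v)" by (rule clin_sc[OF clin_Ad])
lemma AD_scaleR: "AD g (t *\<^sub>R v) = t *\<^sub>R AD g v" by (rule linear_cmul[OF linear_AD])
lemma AD_add: "AD g (v + w) = AD g v + AD g w" by (rule linear_add[OF linear_AD])
lemma AD_zero [simp]: "AD g 0 = 0" by (rule linear_0[OF linear_AD])

lemma conj_ex_cderiv: "has_cderiv A (\<lambda>t. ex (t *\<^sub>R \<xi>)) 0 \<xi>"
  using ex_one_param[of \<xi>] by (simp add: has_cderiv_def one_param_subgroup_def o_def)

text \<open>A conjugated one-parameter group is again one, with velocity transformed by
  \<open>AD g\<close>; uniqueness does the rest.\<close>

lemma ex_conj_scale: "g \<otimes> ex (t *\<^sub>R \<xi>) \<otimes> inv g = ex (t *\<^sub>R AD g \<xi>)"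
proof (rule ex_unique)
  have m: "has_mderiv A A (\<lambda>h. g \<otimes> h \<otimes> inv g) (ex (0 *\<^sub>R \<xi>)) (AD g)" using conj_mderiv by simp
  have ct: "continuous_on UNIV (\<lambda>t. ex (t *\<^sub>R \<xi>))" by (intro continuous_on_ex continuous_intros)
  from has_cderiv_compose[OF atlas ct conj_ex_cderiv m]
  have "has_cderiv A (\<lambda>t. g \<otimes> ex (t *\<^sub>R \<xi>) \<otimes> inv g) 0 (AD g \<xi>)" .
  moreover have "g \<otimes> ex ((s + t) *\<^sub>R \<xi>) \<otimes> inv g = (g \<otimes> ex (s *\<^sub>R \<xi>) \<otimes> inv g) \<otimes> (g \<otimes> ex (t *\<^sub>R \<xi>) \<otimes> inv g)" for s t
    by (simp add: ex_add m_assoc)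
  ultimately show "one_param_subgroup L A (AD g \<xi>) (\<lambda>t. g \<otimes> ex (t *\<^sub>R \<xi>) \<otimes> inv g)"
    unfolding one_param_subgroup_def has_cderiv_def
    by (auto simp: o_def intro!: continuous_on_mult_group ct continuous_intros)
qed

lemma ex_conj: "g \<otimes> ex \<xi> \<otimes> inv g = ex (AD g \<xi>)"
  using ex_conj_scale[of g 1] by simp

lemma ex_conj': "g \<otimes> ex \<xi> = ex (AD g \<xi>) \<otimes> g"
  unfolding ex_conj[symmetric] by (simp add: m_assoc)

lemma AD_mult: "AD (g \<otimes> h) \<xi> = AD g (AD h \<xi>)"
proof (rule ex_eq_imp_eq)
  fix t :: real
  have "ex (t *\<^sub>R AD (g \<otimes> h) \<xi>) = (g \<otimes> h) \<otimes> ex (t *\<^sub>R \<xi>) \<otimes> inv (g \<otimes> h)" by (simp add: ex_conj_scale)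
  also have "\<dots> = g \<otimes> (h \<otimes> ex (t *\<^sub>R \<xi>) \<otimes> inv h) \<otimes> inv g" by (simp add: m_assoc inv_mult_group)
  also have "\<dots> = ex (t *\<^sub>R AD g (AD h \<xi>))" by (simp add: ex_conj_scale)
  finally show "ex (t *\<^sub>R AD (g \<otimes> h) \<xi>) = ex (t *\<^sub>R AD g (AD h \<xi>))" .
qed

lemma AD_one [simp]: "AD \<one> \<xi> = \<xi>"
  by (rule ex_eq_imp_eq) (simp flip: ex_conj_scale)

lemma AD_inv_cancel [simp]: "AD g (AD (inv g) \<xi>) = \<xi>" "AD (inv g) (AD g \<xi>) = \<xi>"
  by (simp_all flip: AD_mult)

lemma AD_fix_iff: "AD g \<xi> = \<xi> \<longleftrightarrow> (\<forall>t::real. g \<otimes> ex (t *\<^sub>R \<xi>) = ex (t *\<^sub>R \<xi>) \<otimes> g)"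
proof
  assume "AD g \<xi> = \<xi>"
  then show "\<forall>t::real. g \<otimes> ex (t *\<^sub>R \<xi>) = ex (t *\<^sub>R \<xi>) \<otimes> g" by (simp add: ex_conj' AD_scaleR)
next
  assume *: "\<forall>t::real. g \<otimes> ex (t *\<^sub>R \<xi>) = ex (t *\<^sub>R \<xi>) \<otimes> g"
  show "AD g \<xi> = \<xi>"
  proof (rule ex_eq_imp_eq)
    show "ex (t *\<^sub>R AD g \<xi>) = ex (t *\<^sub>R \<xi>)" for t using * by (simp add: m_assoc flip: ex_conj_scale)
  qed
qed

lemma ex_comm_self: "ex (s *\<^sub>R \<xi>) \<otimes> ex (t *\<^sub>R \<xi>) = ex (t *\<^sub>R \<xi>) \<otimes> ex (s *\<^sub>R \<xi>)"
  by (simp add: add.commute flip: ex_add)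

lemma AD_ex_self [simp]: "AD (ex (s *\<^sub>R \<xi>)) \<xi> = \<xi>"
  unfolding AD_fix_iff by (simp add: ex_comm_self)

text \<open>The product of two commuting one-parameter groups is a one-parameter group. Its velocity
  is the sum because the multiplication is addition to first order.\<close>

lemma ex_add_commute:
  assumes "\<And>t. AD (ex (t *\<^sub>R \<beta>)) \<xi> = \<xi>"
  shows "ex (\<beta> + \<xi>) = ex \<beta> \<otimes> ex \<xi>"
proof -
  have c: "ex (s *\<^sub>R \<beta>) \<otimes> ex (t *\<^sub>R \<xi>) = ex (t *\<^sub>R \<xi>) \<otimes> ex (s *\<^sub>R \<beta>)" for s t
    using assms unfolding AD_fix_iff by blast
  define \<gamma> where "\<gamma> t = ex (t *\<^sub>R \<beta>) \<otimes> ex (t *\<^sub>R \<xi>)" for t :: real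
  have "\<gamma> 1 = ex (1 *\<^sub>R (\<beta> + \<xi>))"
  proof (rule one_paramI)
    show ct: "continuous_on UNIV \<gamma>" unfolding \<gamma>_def
      by (intro continuous_on_mult_group continuous_on_ex continuous_intros)
    show "\<gamma> (s + t) = \<gamma> s \<otimes> \<gamma> t" for s t
    proof -
      have "\<gamma> (s + t) = ex (s *\<^sub>R \<beta>) \<otimes> (ex (t *\<^sub>R \<beta>) \<otimes> ex (s *\<^sub>R \<xi>)) \<otimes> ex (t *\<^sub>R \<xi>)"
        by (simp add: \<gamma>_def ex_add m_assoc)
      also have "\<dots> = \<gamma> s \<otimes> \<gamma> t" unfolding c by (simp add: \<gamma>_def m_assoc)
      finally show ?thesis .
    qed
    let ?e = "\<lambda>\<xi> t::real. \<phi> (ex (t *\<^sub>R \<xi>))"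
    have s: "strict_diff (?e \<xi>) (\<lambda>t. t *\<^sub>R \<xi>)" for \<xi>
      by (rule strict_diff_compose[OF strict_diff_bounded_linear[OF bounded_linear_scaleR_left[of \<xi>]] ex_strict_diff])
    have 1: "((\<lambda>t. m (?e \<beta> t) (?e \<xi> t)) has_derivative (\<lambda>t. t *\<^sub>R (\<beta> + \<xi>))) (at 0)"
      using strict_diff_has_derivative[OF strict_diff_m[OF s s]] by (simp add: scaleR_add_right)
    define S where "S = {t. ex (t *\<^sub>R \<beta>) \<in> dom} \<inter> {t. ex (t *\<^sub>R \<xi>) \<in> dom}"
    have op: "open {t::real. ex (t *\<^sub>R \<xi>) \<in> dom}" for \<xi>
    proof -
      have "continuous_on UNIV (\<lambda>t::real. ex (t *\<^sub>R \<xi>))" by (intro continuous_on_ex continuous_intros)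
      from open_vimage[OF open_dom this] show ?thesis by (simp add: vimage_def)
    qed
    show "((\<lambda>t. \<phi> (\<gamma> t)) has_derivative (\<lambda>t. t *\<^sub>R (\<beta> + \<xi>))) (at 0)"
      by (rule has_derivative_transform_within_open[OF 1, of S])
        (auto simp: S_def op one_dom m_def psi_phi \<gamma>_def intro!: open_Int)
  qed
  then show ?thesis by (simp add: \<gamma>_def)
qed

text \<open>\<open>\<xi>\<close> and \<open>times_i \<xi>\<close> commute because
  \<open>AD g\<close> is complex linear: what fixes \<open>times_i \<xi>\<close> fixes
  \<open>\<xi>\<close>. This makes the exponential a homomorphism on the complex line through
  \<open>\<xi>\<close>.\<close>

lemma AD_ex_sc_self [simp]: "AD (ex (sc z \<xi>)) (sc w \<xi>) = sc w \<xi>"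
proof -
  have 1: "AD (ex (s *\<^sub>R \<xi>)) (sc w \<xi>) = sc w \<xi>" for s by (simp add: AD_sc)
  have 2: "AD (ex (s *\<^sub>R times_i \<xi>)) (sc w \<xi>) = sc w \<xi>" for s
  proof -
    have "AD (ex (s *\<^sub>R times_i \<xi>)) (times_i \<xi>) = times_i \<xi>" by (rule AD_ex_self)
    then have "times_i (AD (ex (s *\<^sub>R times_i \<xi>)) (times_i \<xi>)) = times_i (times_i \<xi>)" by simp
    then have "AD (ex (s *\<^sub>R times_i \<xi>)) \<xi> = \<xi>" by (simp add: times_i_all AD_times_i)
    then show ?thesis by (simp add: AD_sc)
  qed
  have "ex (sc z \<xi>) = ex (Re z *\<^sub>R \<xi>) \<otimes> ex (Im z *\<^sub>R times_i \<xi>)"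
    unfolding sc_def by (rule ex_add_commute) (use 1[of _] in \<open>simp add: AD_scaleR AD_times_i\<close>)
  then show ?thesis by (simp add: AD_mult 1 2)
qed

lemma ex_sc_add: "ex (sc (z + w) \<xi>) = ex (sc z \<xi>) \<otimes> ex (sc w \<xi>)"
proof -
  have "AD (ex (t *\<^sub>R sc z \<xi>)) (sc w \<xi>) = sc w \<xi>" for t
    using AD_ex_sc_self[of "of_real t * z" \<xi> w] by (simp flip: sc_of_real)
  from ex_add_commute[OF this] show ?thesis by (simp add: sc.scale_left_distrib)
qed

lemma conj_nbhd:
  assumes Q: "compact Q" and N: "open N" "\<one> \<in> N"
  obtains \<delta> where "\<delta> > 0" "\<And>k \<xi>. k \<in> Q \<Longrightarrow> norm \<xi> < \<delta> \<Longrightarrow> k \<otimes> ex \<xi> \<otimes> inv k \<in> N"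
proof (rule ccontr)
  assume neg: "\<not> thesis"
  have "\<exists>k \<xi>. k \<in> Q \<and> norm \<xi> < 1 / real (Suc n) \<and> k \<otimes> ex \<xi> \<otimes> inv k \<notin> N" for n
    using neg that[of "1 / real (Suc n)"] by fastforce
  then obtain k \<xi> where k: "\<And>n. k n \<in> Q" "\<And>n::nat. norm (\<xi> n) < 1 / real (Suc n)" "\<And>n. k n \<otimes> ex (\<xi> n) \<otimes> inv (k n) \<notin> N"
    by metis
  obtain l q where l: "l \<in> Q" "strict_mono (q :: nat \<Rightarrow> nat)" "(k \<circ> q) \<longlonglongrightarrow> l"
    using Q k(1) unfolding compact_eq_seq_compact_metric seq_compact_def
    by (metis Q compact_imp_seq_compact seq_compact_def)
  have "\<xi> \<longlonglongrightarrow> 0"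
  proof (rule Lim_null_comparison)
    show "\<forall>\<^sub>F n in sequentially. norm (\<xi> n) \<le> 1 / real (Suc n)" using k(2) by (auto intro!: always_eventually less_imp_le)
    show "(\<lambda>n. 1 / real (Suc n)) \<longlonglongrightarrow> 0" using LIMSEQ_inverse_real_of_nat by (simp add: inverse_eq_divide)
  qed
  then have "(\<xi> \<circ> q) \<longlonglongrightarrow> 0" using l(2) by (rule LIMSEQ_subseq_LIMSEQ)
  then have "(\<lambda>n. (k \<circ> q) n \<otimes> ex ((\<xi> \<circ> q) n) \<otimes> inv ((k \<circ> q) n)) \<longlonglongrightarrow> l \<otimes> ex 0 \<otimes> inv l"
    by (intro tendsto_mult_group tendsto_inv_group l(3) ex_tendsto)
  then have "\<forall>\<^sub>F n in sequentially. (k \<circ> q) n \<otimes> ex ((\<xi> \<circ> q) n) \<otimes> inv ((k \<circ> q) n) \<in> N"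
    using N by (intro topological_tendstoD) auto
  then show False using k(3) by (auto simp: eventually_sequentially)
qed

lemma ex_inj_local: obtains r where "r > 0" "inj_on ex (cball 0 r)"
proof -
  obtain \<rho> where \<rho>: "\<rho> > 0" "\<And>x y. norm x < \<rho> \<Longrightarrow> norm y < \<rho> \<Longrightarrow> norm (\<phi> (ex x) - \<phi> (ex y) - (x - y)) \<le> (1/2) * norm (x - y)"
    by (rule strict_diffE[OF ex_strict_diff, of "1/2"]) auto
  have "inj_on ex (cball 0 (\<rho>/2))"
  proof (rule inj_onI)
    fix x y assume xy: "x \<in> cball 0 (\<rho>/2)" "y \<in> cball 0 (\<rho>/2)" "ex x = ex y"
    have "norm (\<phi> (ex x) - \<phi> (ex y) - (x - y)) \<le> (1/2) * norm (x - y)" using xy(1,2) \<rho>(1) by (intro \<rho>(2)) auto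
    then have "norm (x - y) \<le> (1/2) * norm (x - y)" using xy(3) by (simp add: norm_minus_commute)
    then show "x = y" by simp
  qed
  then show ?thesis using that[of "\<rho>/2"] \<rho>(1) by simp
qed

lemma ex_ball_nbhd: assumes "r > 0" obtains N where "open N" "\<one> \<in> N" "\<And>g. g \<in> N \<Longrightarrow> \<exists>x. norm x < r \<and> g = ex x"
proof -
  obtain N where o: "open N" "\<one> \<in> N" and N: "\<And>g. g \<in> N \<Longrightarrow> \<exists>a\<in>UNIV. \<exists>b\<in>{0}. \<exists>c\<in>{0}. \<exists>d\<in>{0}. norm a < r \<and> norm b < r \<and> norm c < r \<and> norm d < r \<and>
       g = ex a \<otimes> ex b \<otimes> (ex c \<otimes> ex d)"
    by (rule local_product[of UNIV "{0}" "{0}" "{0}" r]) (use assms in \<open>auto simp: subspace_def\<close>)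
  show ?thesis by (rule that[OF o]) (use N in auto)
qed

text \<open>\<open>conj_nbhd\<close> makes conjugates of small exponentials small. If
  \<open>AD k \<xi>\<close> were large, shrinking \<open>\<xi>\<close> would bring its norm to
  exactly \<open>s\<close>, while its exponential is also that of a shorter vector, against local
  injectivity.\<close>

lemma AD_small:
  assumes Q: "compact Q" and R: "R > 0"
  obtains \<delta> where "\<delta> > 0" "\<And>k \<xi>. k \<in> Q \<Longrightarrow> norm \<xi> < \<delta> \<Longrightarrow> norm (AD k \<xi>) < R"
proof -
  obtain r where r: "r > 0" "inj_on ex (cball 0 r)" by (rule ex_inj_local)
  define s where "s = min R r / 2"
  have s: "s > 0" "s < R" "2 * s \<le> r" using r R by (auto simp: s_def)
  obtain N where N: "open N" "\<one> \<in> N" "\<And>g. g \<in> N \<Longrightarrow> \<exists>x. norm x < s \<and> g = ex x" by (rule ex_ball_nbhd[OF s(1)]) blast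
  obtain \<delta> where \<delta>: "\<delta> > 0" "\<And>k \<xi>. k \<in> Q \<Longrightarrow> norm \<xi> < \<delta> \<Longrightarrow> k \<otimes> ex \<xi> \<otimes> inv k \<in> N"
    by (rule conj_nbhd[OF Q N(1,2)]) blast
  show ?thesis
  proof (rule that[OF \<delta>(1)])
    fix k and \<xi> :: 'e assume k: "k \<in> Q" "norm \<xi> < \<delta>"
    let ?\<eta> = "AD k \<xi>"
    have "norm ?\<eta> < s"
    proof (rule ccontr)
      assume c: "\<not> norm ?\<eta> < s"
      then have n0: "norm ?\<eta> > 0" using s(1) by linarith
      define t where "t = s / norm ?\<eta>"
      have t: "0 < t" "t \<le> 1" "norm (t *\<^sub>R ?\<eta>) = s" using c n0 s(1) by (auto simp: t_def)
      have "norm (t *\<^sub>R \<xi>) < \<delta>" using mult_right_mono[OF t(2) norm_ge_zero[of \<xi>]] t(1) k(2) by simp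
      then have "k \<otimes> ex (t *\<^sub>R \<xi>) \<otimes> inv k \<in> N" using \<delta>(2) k(1) by blast
      then obtain x where x: "norm x < s" "ex (t *\<^sub>R ?\<eta>) = ex x" using N(3) unfolding ex_conj_scale by blast
      have "t *\<^sub>R ?\<eta> = x" using x(1) t(3) s by (intro inj_onD[OF r(2) x(2)]) auto
      then show False using x(1) t(3) by simp
    qed
    then show "norm (AD k \<xi>) < R" using s(2) by linarith
  qed
qed

lemma AD_bounded:
  assumes Q: "compact Q" obtains M where "M > 0" "\<And>k \<xi>. k \<in> Q \<Longrightarrow> norm (AD k \<xi>) \<le> M * norm \<xi>"
proof -
  obtain \<delta> where \<delta>: "\<delta> > 0" "\<And>k \<xi>. k \<in> Q \<Longrightarrow> norm \<xi> < \<delta> \<Longrightarrow> norm (AD k \<xi>) < 1"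
    by (rule AD_small[OF Q, of 1]) auto
  show ?thesis
  proof (rule that[of "2/\<delta>"])
    show "2/\<delta> > 0" using \<delta>(1) by simp
    fix k \<xi> assume k: "k \<in> Q"
    show "norm (AD k \<xi>) \<le> 2/\<delta> * norm \<xi>"
    proof (cases "\<xi> = 0")
      case False
      define t where "t = \<delta> / (2 * norm \<xi>)"
      have t: "t > 0" using False \<delta>(1) by (simp add: t_def)
      have "norm (t *\<^sub>R \<xi>) < \<delta>" using False \<delta>(1) by (simp add: t_def)
      from \<delta>(2)[OF k this] have "t * norm (AD k \<xi>) < 1" using t by (simp add: AD_scaleR)
      then show ?thesis using False \<delta>(1) by (simp add: t_def field_simps)
    qed simp
  qed
qed

end

context complex_Lie
begin

lemma clin_sc_left: "clin (\<lambda>h. sc h (x::'b::fin_dim_complex))"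
  unfolding clin_def using linear_sc_left by (auto simp: times_i_complex_def simp flip: sc_i sc.scale_scale)

lemma ex_sc_has_derivative: "((\<lambda>h. \<phi> (ex (sc h \<xi>))) has_derivative (\<lambda>h. sc h \<xi>)) (at 0)"
  using strict_diff_has_derivative[OF strict_diff_compose[OF strict_diff_bounded_linear[OF bounded_linear_sc_left[of \<xi>]] ex_strict_diff]] .

lemma open_ex_dom: 
  assumes "continuous_on UNIV f" shows "open {h. f h \<in> dom}"
  using open_vimage[OF open_dom assms] by (simp add: vimage_def)

text \<open>Only the parameter 0 is treated; in \<open>AD_entire_functional\<close> the homomorphism
  \<open>ex_sc_add\<close> moves the statement to every parameter.\<close>

lemma conj_curve_holo:
  assumes Y: "Y \<in> dom"
  obtains T where "((\<lambda>h. \<phi> (ex (sc h \<xi>) \<otimes> Y \<otimes> ex (sc (- h) \<xi>))) has_derivative T) (at 0)" "clin T"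
proof -
  let ?y = "\<phi> Y"
  define e where "e h = \<phi> (ex (sc h \<xi>))" for h
  have e0: "e 0 = 0" by (simp add: e_def phi_one)
  have e: "(e has_derivative (\<lambda>h. sc h \<xi>)) (at 0)" unfolding e_def by (rule ex_sc_has_derivative)
  have e': "((\<lambda>h. e (- h)) has_derivative (\<lambda>h. sc (- h) \<xi>)) (at 0)"
  proof -
    have "((\<lambda>h::complex. - h) has_derivative (\<lambda>h. - h)) (at 0)" by (auto intro!: derivative_eq_intros)
    from has_derivative_compose[OF this, of e "\<lambda>h. sc h \<xi>"] e show ?thesis by simp
  qed
  have "(0, ?y) \<in> {w. fst w \<in> rng \<and> snd w \<in> rng \<and> \<psi> (fst w) \<otimes> \<psi> (snd w) \<in> dom}"
    using Y by (simp add: zero_rng phi_rng psi_zero psi_phi)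
  then obtain D1 where D1: "((\<lambda>w. m (fst w) (snd w)) has_derivative D1) (at (0, ?y))" "\<And>v. D1 (times_i v) = times_i (D1 v)"
    using m_holo(1) unfolding holo_on_def by blast
  have m0: "m 0 ?y = ?y" using Y by (simp add: m_def psi_zero psi_phi)
  have "(?y, 0) \<in> {w. fst w \<in> rng \<and> snd w \<in> rng \<and> \<psi> (fst w) \<otimes> \<psi> (snd w) \<in> dom}"
    using Y by (simp add: zero_rng phi_rng psi_zero psi_phi)
  then obtain D2 where D2: "((\<lambda>w. m (fst w) (snd w)) has_derivative D2) (at (?y, 0))" "\<And>v. D2 (times_i v) = times_i (D2 v)"
    using m_holo(1) unfolding holo_on_def by blast
  have "((\<lambda>h. (e h, ?y)) has_derivative (\<lambda>h. (sc h \<xi>, 0))) (at 0)" by (intro has_derivative_Pair e has_derivative_const)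
  from has_derivative_compose[OF this, of "\<lambda>w. m (fst w) (snd w)" D1] D1(1)
  have a: "((\<lambda>h. m (e h) ?y) has_derivative (\<lambda>h. D1 (sc h \<xi>, 0))) (at 0)" by (simp add: e0)
  have "((\<lambda>h. (m (e h) ?y, e (- h))) has_derivative (\<lambda>h. (D1 (sc h \<xi>, 0), sc (- h) \<xi>))) (at 0)"
    by (intro has_derivative_Pair a e')
  from has_derivative_compose[OF this, of "\<lambda>w. m (fst w) (snd w)" D2] D2(1)
  have b: "((\<lambda>h. m (m (e h) ?y) (e (- h))) has_derivative (\<lambda>h. D2 (D1 (sc h \<xi>, 0), sc (- h) \<xi>))) (at 0)"
    by (simp add: e0 m0)
  have ct: "continuous_on UNIV (\<lambda>h. ex (sc h \<xi>))" "continuous_on UNIV (\<lambda>h. ex (sc (-h) \<xi>))"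
    by (auto intro!: continuous_on_ex bounded_linear.continuous_on[OF bounded_linear_sc_left] continuous_intros)
  define S where "S = {h. ex (sc h \<xi>) \<in> dom} \<inter> {h. ex (sc (-h) \<xi>) \<in> dom} \<inter> {h. ex (sc h \<xi>) \<otimes> Y \<in> dom}"
  have S: "open S" unfolding S_def
    by (intro open_Int open_ex_dom ct continuous_on_mult_group continuous_intros)
  have c: "((\<lambda>h. \<phi> (ex (sc h \<xi>) \<otimes> Y \<otimes> ex (sc (- h) \<xi>))) has_derivative (\<lambda>h. D2 (D1 (sc h \<xi>, 0), sc (- h) \<xi>))) (at 0)"
    by (rule has_derivative_transform_within_open[OF b S])
      (use Y in \<open>auto simp: S_def e_def m_def psi_phi one_dom\<close>)
  moreover have "clin (\<lambda>h. D2 (D1 (sc h \<xi>, 0), sc (- h) \<xi>))"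
    unfolding clin_def
  proof (intro conjI allI)
    show "linear (\<lambda>h. D2 (D1 (sc h \<xi>, 0), sc (- h) \<xi>))" by (rule has_derivative_linear[OF c])
    fix v :: complex
    have 1: "sc (times_i v) \<xi> = times_i (sc v \<xi>)" using clin_sc_left unfolding clin_def by blast
    then show "D2 (D1 (sc (times_i v) \<xi>, 0), sc (- times_i v) \<xi>) = times_i (D2 (D1 (sc v \<xi>, 0), sc (- v) \<xi>))"
      using D1(2)[of "(sc v \<xi>, 0)"] D2(2)[of "(D1 (sc v \<xi>, 0), sc (-v) \<xi>)"]
      by (simp add: times_i_prod_def times_i_simps)
  qed
  ultimately show ?thesis by (rule that)
qed

text \<open>\<open>AD\<close> is itself a derivative, so differentiating it directly in
  \<open>\<zeta>\<close> would call for second derivatives. Instead it is the locally uniform limit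
  of the rescaled coordinates \<open>F n \<zeta>\<close> of conjugates, which are holomorphic in
  \<open>\<zeta>\<close>, and Weierstrass' theorem applies.\<close>

lemma AD_entire_functional:
  assumes l: "clin (l :: 'e \<Rightarrow> complex)"
  shows "(\<lambda>\<zeta>. l (AD (ex (sc \<zeta> \<xi>)) w)) holomorphic_on UNIV"
proof -
  have "(\<lambda>\<zeta>. l (AD (ex (sc \<zeta> \<xi>)) w)) holomorphic_on ball 0 R" if R: "R > 0" for R
  proof -
    have ct: "continuous_on UNIV (\<lambda>h. ex (sc h \<xi>))"
      by (intro continuous_on_ex bounded_linear.continuous_on[OF bounded_linear_sc_left] continuous_intros)
    define Q where "Q = (\<lambda>\<zeta>. ex (sc \<zeta> \<xi>)) ` cball 0 R"
    have Q: "compact Q" unfolding Q_def by (intro compact_continuous_image continuous_on_subset[OF ct]) auto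
    obtain M where M: "M > 0" "\<And>k \<xi>. k \<in> Q \<Longrightarrow> norm (AD k \<xi>) \<le> M * norm \<xi>" using AD_bounded[OF Q] by blast
    obtain r K where rK: "r > 0" "K \<ge> 0" "\<And>x. norm x \<le> r \<Longrightarrow> ex x \<in> dom"
      "\<And>\<rho> x y. norm x \<le> \<rho> \<Longrightarrow> norm y \<le> \<rho> \<Longrightarrow> \<rho> \<le> r \<Longrightarrow> norm (\<phi> (ex x) - \<phi> (ex y) - (x - y)) \<le> K * \<rho> * norm (x - y)"
      using ex_local by blast
    have quad: "norm (\<phi> (ex x) - x) \<le> K * (norm x)^2" if "norm x \<le> r" for x
      using rK(4)[of x "norm x" 0] that by (simp add: phi_one power2_eq_square)
    \<comment> \<open>The offset keeps \<open>AD k (b n *\<^sub>R w)\<close> within the radius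
      \<open>r\<close> for every \<open>n\<close>, so its exponential stays in the chart
      domain.\<close>
    obtain N0 :: nat where N0: "M * norm w / r < real N0" using reals_Archimedean2 by blast
    define b where "b n = 1 / real (n + Suc N0)" for n
    have b0: "b n > 0" for n by (simp add: b_def)
    have bs: "norm (AD k (b n *\<^sub>R w)) \<le> r" if "k \<in> Q" for k n
    proof -
      have "norm (AD k (b n *\<^sub>R w)) = b n * norm (AD k w)" using b0[of n] by (simp add: AD_scaleR)
      also have "\<dots> \<le> b n * (M * norm w)" using M(2)[OF that] b0[of n] by simp
      also have "\<dots> \<le> r"
      proof -
        have "M * norm w \<le> r * real N0" using N0 rK(1) by (simp add: field_simps)
        also have "\<dots> \<le> r * real (n + Suc N0)" using rK(1) by simp
        finally show ?thesis by (simp add: b_def field_simps)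
      qed
      finally show ?thesis .
    qed
    define F where "F n \<zeta> = \<phi> (ex (AD (ex (sc \<zeta> \<xi>)) (b n *\<^sub>R w)))" for n \<zeta>
    have bl: "bounded_linear l" using l by (simp add: clin_def linear_imp_bounded)
    obtain C where C: "C > 0" "\<And>x. cmod (l x) \<le> norm x * C" using bounded_linear.pos_bounded[OF bl] by blast
    have hol: "(\<lambda>\<zeta>. l (F n \<zeta>) / of_real (b n)) holomorphic_on ball 0 R" for n
    proof (intro holomorphic_intros)
      show "(\<lambda>\<zeta>. l (F n \<zeta>)) holomorphic_on ball 0 R"
      proof (rule holomorphic_onI, rule field_differentiable_at_within)
        fix \<zeta> :: complex assume z: "\<zeta> \<in> ball 0 R"
        define Y where "Y = ex (AD (ex (sc \<zeta> \<xi>)) (b n *\<^sub>R w))"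
        have "ex (sc \<zeta> \<xi>) \<in> Q" using z by (auto simp: Q_def)
        then have "Y \<in> dom" unfolding Y_def by (intro rK(3) bs)
        then obtain T where T: "((\<lambda>h. \<phi> (ex (sc h \<xi>) \<otimes> Y \<otimes> ex (sc (- h) \<xi>))) has_derivative T) (at 0)" "clin T"
          by (rule conj_curve_holo)
        have eq: "\<phi> (ex (sc (h - \<zeta>) \<xi>) \<otimes> Y \<otimes> ex (sc (- (h - \<zeta>)) \<xi>)) = F n h" for h
        proof -
          have "ex (sc (h - \<zeta>) \<xi>) \<otimes> Y \<otimes> ex (sc (- (h - \<zeta>)) \<xi>) = ex (AD (ex (sc (h - \<zeta>) \<xi>)) (AD (ex (sc \<zeta> \<xi>)) (b n *\<^sub>R w)))"
            unfolding Y_def by (simp only: ex_minus sc.scale_minus_left flip: ex_conj)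
          also have "AD (ex (sc (h - \<zeta>) \<xi>)) (AD (ex (sc \<zeta> \<xi>)) (b n *\<^sub>R w)) = AD (ex (sc (h - \<zeta> + \<zeta>) \<xi>)) (b n *\<^sub>R w)"
            unfolding ex_sc_add AD_mult ..
          finally show ?thesis by (simp add: F_def)
        qed
        have "((\<lambda>h. h - \<zeta>) has_derivative (\<lambda>h. h)) (at \<zeta>)" by (auto intro!: derivative_eq_intros)
        from has_derivative_compose[OF this, of "\<lambda>h. \<phi> (ex (sc h \<xi>) \<otimes> Y \<otimes> ex (sc (- h) \<xi>))" T] T(1)
        have "(F n has_derivative T) (at \<zeta>)" by (simp only: eq diff_self)
        from bounded_linear.has_derivative[OF bl this]
        have "((\<lambda>\<zeta>. l (F n \<zeta>)) has_derivative (\<lambda>h. l (T h))) (at \<zeta>)" .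
        moreover have "(\<lambda>h. l (T h)) = (*) (l (T 1))"
        proof
          show "l (T h) = l (T 1) * h" for h
            using clin_sc[OF clin_compose[OF T(2) l], of h 1] by (simp add: mult.commute)
        qed
        ultimately have "((\<lambda>\<zeta>. l (F n \<zeta>)) has_field_derivative l (T 1)) (at \<zeta>)"
          unfolding has_field_derivative_def by (rule back_subst)
        then show "(\<lambda>\<zeta>. l (F n \<zeta>)) field_differentiable at \<zeta>" by (auto simp: field_differentiable_def)
      qed
    qed (use b0[of n] in auto)
    have ul: "uniform_limit (ball 0 R) (\<lambda>n \<zeta>. l (F n \<zeta>) / of_real (b n)) (\<lambda>\<zeta>. l (AD (ex (sc \<zeta> \<xi>)) w)) sequentially"
    proof (rule uniform_limitI)
      fix e :: real assume e: "e > 0"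
      have est: "dist (l (F n \<zeta>) / of_real (b n)) (l (AD (ex (sc \<zeta> \<xi>)) w)) \<le> (K * (M * norm w)^2 * C) * b n"
        if z: "\<zeta> \<in> ball 0 R" for n \<zeta>
      proof -
        let ?k = "ex (sc \<zeta> \<xi>)"
        have k: "?k \<in> Q" using z by (auto simp: Q_def)
        have "l (F n \<zeta>) / of_real (b n) - l (AD ?k w) = l (F n \<zeta> - AD ?k (b n *\<^sub>R w)) / of_real (b n)"
          using b0[of n] bl by (simp add: linear_simps AD_scaleR field_simps scaleR_conv_of_real)
        then have "dist (l (F n \<zeta>) / of_real (b n)) (l (AD ?k w)) = cmod (l (F n \<zeta> - AD ?k (b n *\<^sub>R w))) / b n"
          using b0[of n] by (simp add: dist_norm norm_divide)
        also have "\<dots> \<le> (norm (F n \<zeta> - AD ?k (b n *\<^sub>R w)) * C) / b n"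
          using C(2) b0[of n] by (intro divide_right_mono) auto
        also have "\<dots> \<le> (K * (norm (AD ?k (b n *\<^sub>R w)))^2 * C) / b n"
          unfolding F_def using quad[OF bs[OF k]] C(1) b0[of n] by (intro divide_right_mono mult_right_mono) auto
        also have "\<dots> \<le> (K * (b n * (M * norm w))^2 * C) / b n"
        proof -
          have "norm (AD ?k (b n *\<^sub>R w)) \<le> b n * (M * norm w)" using M(2)[OF k, of w] b0[of n] by (simp add: AD_scaleR)
          then show ?thesis using C(1) b0[of n] rK(2)
            by (intro divide_right_mono mult_right_mono mult_left_mono power_mono) auto
        qed
        also have "\<dots> = (K * (M * norm w)^2 * C) * b n" using b0[of n] by (simp add: power2_eq_square)
        finally show ?thesis .
      qed
      have "b \<longlonglongrightarrow> 0"
        using LIMSEQ_ignore_initial_segment[OF LIMSEQ_inverse_real_of_nat, of N0] unfolding b_def[abs_def]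
        by (simp add: inverse_eq_divide add_ac)
      then have "(\<lambda>n. (K * (M * norm w)^2 * C) * b n) \<longlonglongrightarrow> (K * (M * norm w)^2 * C) * 0" by (intro tendsto_intros)
      then have "\<forall>\<^sub>F n in sequentially. (K * (M * norm w)^2 * C) * b n < e" using e by (intro order_tendstoD(2)) auto
      then show "\<forall>\<^sub>F n in sequentially. \<forall>\<zeta>\<in>ball 0 R. dist (l (F n \<zeta>) / of_real (b n)) (l (AD (ex (sc \<zeta> \<xi>)) w)) < e"
        by eventually_elim (use est le_less_trans in blast)
    qed
    show ?thesis
    proof (rule holomorphic_uniform_sequence[OF _ hol])
      fix x :: complex assume "x \<in> ball 0 R"
      then obtain d where "d > 0" "cball x d \<subseteq> ball 0 R" using open_contains_cball open_ball by blast
      then show "\<exists>d>0. cball x d \<subseteq> ball 0 R \<and> uniform_limit (cball x d) (\<lambda>n \<zeta>. l (F n \<zeta>) / of_real (b n)) (\<lambda>\<zeta>. l (AD (ex (sc \<zeta> \<xi>)) w)) sequentially"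
        using uniform_limit_on_subset[OF ul] by blast
    qed simp
  qed
  then have h: "(\<lambda>\<zeta>. l (AD (ex (sc \<zeta> \<xi>)) w)) holomorphic_on ball 0 (cmod z + 1)" for z :: complex
    by (simp add: add_nonneg_pos)
  show ?thesis
  proof (rule holomorphic_onI, simp)
    fix z :: complex
    show "(\<lambda>\<zeta>. l (AD (ex (sc \<zeta> \<xi>)) w)) field_differentiable at z"
      by (rule holomorphic_on_imp_differentiable_at[OF h[of z]]) auto
  qed
qed

text \<open>The Lie bracket with \<open>\<xi>\<close>. It is taken as a derivative in a complex
  parameter because this yields \<open>ad_times_i_left\<close>, complex linearity in the first
  argument.\<close>

definition ad where "ad \<xi> w = frechet_derivative (\<lambda>\<zeta>. AD (ex (sc \<zeta> \<xi>)) w) (at 0) (1::complex)"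

lemma AD_sc_has_derivative:
  "((\<lambda>\<zeta>. AD (ex (sc \<zeta> \<xi>)) w) has_derivative (\<lambda>h. sc h (ad \<xi> w))) (at (0::complex))"
proof -
  have sp: "sc.span (UNIV :: 'e set) = UNIV" by simp
  obtain n :: nat and b l where b: "\<And>i. clin (l i :: 'e \<Rightarrow> complex)" "\<And>x. x = (\<Sum>i<n. sc (l i x) (b i))"
    by (rule complex_coordinates[OF sp]) (rule that; assumption)
  define f where "f i \<zeta> = l i (AD (ex (sc \<zeta> \<xi>)) w)" for i \<zeta>
  have "\<exists>d. (f i has_field_derivative d) (at 0)" for i
    using AD_entire_functional[OF b(1)[of i], of \<xi> w] unfolding f_def holomorphic_on_def field_differentiable_def by simp
  then obtain d where d: "\<And>i. (f i has_field_derivative d i) (at 0)" by metis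
  define a where "a = (\<Sum>i<n. sc (d i) (b i))"
  have "((\<lambda>\<zeta>. \<Sum>i<n. sc (f i \<zeta>) (b i)) has_derivative (\<lambda>h. \<Sum>i<n. sc (d i * h) (b i))) (at 0)"
    by (intro has_derivative_sum bounded_linear.has_derivative[OF bounded_linear_sc_left] d[unfolded has_field_derivative_def])
  moreover have "(\<Sum>i<n. sc (f i \<zeta>) (b i)) = AD (ex (sc \<zeta> \<xi>)) w" for \<zeta> unfolding f_def by (rule b(2)[symmetric])
  moreover have "(\<Sum>i<n. sc (d i * h) (b i)) = sc h a" for h
    unfolding a_def by (simp add: sc.scale_sum_right mult.commute)
  ultimately have D: "((\<lambda>\<zeta>. AD (ex (sc \<zeta> \<xi>)) w) has_derivative (\<lambda>h. sc h a)) (at 0)" by simp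
  from frechet_derivative_at[OF this] have "ad \<xi> w = a" unfolding ad_def by (metis sc.scale_one)
  with D show ?thesis by simp
qed

lemma ad_has_vector_derivative:
  "((\<lambda>t. AD (ex (t *\<^sub>R \<xi>)) w) has_vector_derivative AD (ex (t *\<^sub>R \<xi>)) (ad \<xi> w)) (at t)"
proof -
  have 0: "((\<lambda>s::real. complex_of_real (s - t)) has_derivative (\<lambda>h. complex_of_real h)) (at t)"
    by (auto intro!: derivative_eq_intros)
  have "((\<lambda>\<zeta>. AD (ex (sc \<zeta> \<xi>)) w) has_derivative (\<lambda>h. sc h (ad \<xi> w))) (at (of_real (t - t)))"
    using AD_sc_has_derivative by simp
  from has_derivative_compose[OF 0 this]
  have "((\<lambda>s. AD (ex ((s - t) *\<^sub>R \<xi>)) w) has_derivative (\<lambda>h. h *\<^sub>R ad \<xi> w)) (at t)"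
    by (simp only: sc_of_real)
  from bounded_linear.has_derivative[OF linear_imp_bounded[OF linear_AD] this, of "ex (t *\<^sub>R \<xi>)"]
  have "((\<lambda>s. AD (ex (t *\<^sub>R \<xi>)) (AD (ex ((s - t) *\<^sub>R \<xi>)) w)) has_derivative (\<lambda>h. h *\<^sub>R AD (ex (t *\<^sub>R \<xi>)) (ad \<xi> w))) (at t)"
    by (simp add: AD_scaleR)
  moreover have "AD (ex (t *\<^sub>R \<xi>)) (AD (ex ((s - t) *\<^sub>R \<xi>)) w) = AD (ex (s *\<^sub>R \<xi>)) w" for s
    by (simp flip: AD_mult ex_add)
  ultimately show ?thesis by (simp add: has_vector_derivative_def)
qed

lemma ad_eqI:
  assumes "((\<lambda>t::real. AD (ex (t *\<^sub>R \<xi>)) w) has_vector_derivative a) (at 0)" shows "ad \<xi> w = a"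
  using vector_derivative_unique_at[OF ad_has_vector_derivative[of \<xi> w 0] assms] by simp

lemma ad_times_i_left: "ad (times_i \<xi>) w = times_i (ad \<xi> w)"
proof (rule ad_eqI)
  have 0: "((\<lambda>t. \<i> * complex_of_real t) has_derivative (\<lambda>h. \<i> * of_real h)) (at 0)"
    by (auto intro!: derivative_eq_intros)
  have "((\<lambda>\<zeta>. AD (ex (sc \<zeta> \<xi>)) w) has_derivative (\<lambda>h. sc h (ad \<xi> w))) (at (\<i> * of_real 0))"
    using AD_sc_has_derivative by simp
  from has_derivative_compose[OF 0 this]
  have "((\<lambda>t. AD (ex (sc (\<i> * of_real t) \<xi>)) w) has_derivative (\<lambda>h. sc (\<i> * of_real h) (ad \<xi> w))) (at 0)" .
  moreover have "sc (\<i> * of_real t) x = t *\<^sub>R times_i x" for t and x :: 'e by (simp add: sc_def)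
  ultimately show "((\<lambda>t. AD (ex (t *\<^sub>R times_i \<xi>)) w) has_vector_derivative times_i (ad \<xi> w)) (at 0)"
    by (simp add: has_vector_derivative_def)
qed

lemma clin_ad: "clin (ad \<xi>)"
proof -
  note d = ad_has_vector_derivative[of \<xi> _ 0, simplified]
  have "ad \<xi> (v + w) = ad \<xi> v + ad \<xi> w" for v w
    by (rule ad_eqI) (simp only: AD_add, intro has_vector_derivative_add d)
  moreover have "ad \<xi> (c *\<^sub>R v) = c *\<^sub>R ad \<xi> v" for c v
    by (rule ad_eqI) (simp only: AD_scaleR, intro bounded_linear.has_vector_derivative[OF bounded_linear_scaleR_right] d)
  moreover have "ad \<xi> (times_i v) = times_i (ad \<xi> v)" for v
    by (rule ad_eqI) (simp only: AD_times_i, intro bounded_linear.has_vector_derivative[OF linear_imp_bounded[OF linear_times_i]] d)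
  ultimately show ?thesis by (auto simp: clin_def intro: linearI)
qed

lemma linear_ad: "linear (ad \<xi>)" using clin_ad by (simp add: clin_def)
lemma ad_times_i: "ad \<xi> (times_i v) = times_i (ad \<xi> v)" using clin_ad by (simp add: clin_def)

text \<open>The difference quotients stay in \<open>S\<close>, and \<open>S\<close> is
  closed.\<close>

lemma ad_subspace:
  assumes S: "subspace S" and inv: "\<And>t::real. AD (ex (t *\<^sub>R \<xi>)) ` S \<subseteq> S" and v: "v \<in> S"
  shows "ad \<xi> v \<in> S"
proof -
  have d: "((\<lambda>t. AD (ex (t *\<^sub>R \<xi>)) v) has_vector_derivative ad \<xi> v) (at 0)" using ad_has_vector_derivative[of \<xi> v 0] by simp
  have "((\<lambda>h. norm (AD (ex ((0 + h) *\<^sub>R \<xi>)) v - AD (ex (0 *\<^sub>R \<xi>)) v - h *\<^sub>R ad \<xi> v) / norm h) \<longlongrightarrow> 0) (at 0)"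
    using d unfolding has_vector_derivative_def has_derivative_at by blast
  then have lim0: "((\<lambda>h. (AD (ex (h *\<^sub>R \<xi>)) v - v - h *\<^sub>R ad \<xi> v) /\<^sub>R h) \<longlongrightarrow> 0) (at 0)"
    by (intro tendsto_norm_zero_cancel[of "\<lambda>h. (AD (ex (h *\<^sub>R \<xi>)) v - v - h *\<^sub>R ad \<xi> v) /\<^sub>R h"]) (simp add: divide_inverse mult.commute)
  have lim: "((\<lambda>h. (AD (ex (h *\<^sub>R \<xi>)) v - v) /\<^sub>R h) \<longlongrightarrow> ad \<xi> v) (at 0)"
  proof (rule LIM_zero_cancel, rule Lim_transform_eventually[OF lim0])
    show "\<forall>\<^sub>F h in at 0. (AD (ex (h *\<^sub>R \<xi>)) v - v - h *\<^sub>R ad \<xi> v) /\<^sub>R h = (AD (ex (h *\<^sub>R \<xi>)) v - v) /\<^sub>R h - ad \<xi> v"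
      by (auto simp: eventually_at_filter scaleR_diff_right)
  qed
  show ?thesis
  proof (rule Lim_in_closed_set[OF closed_subspace_fin_dim[OF S] _ _ lim])
    show "\<forall>\<^sub>F h in at 0. (AD (ex (h *\<^sub>R \<xi>)) v - v) /\<^sub>R h \<in> S"
      using inv v S by (intro always_eventually allI) (auto intro!: subspace_scale subspace_diff)
  qed simp
qed

end

section \<open>Diagonalization of generators of bounded groups\<close>

lemma bounded_bilinear_sc: "bounded_bilinear (sc :: complex \<Rightarrow> 'a::fin_dim_complex \<Rightarrow> 'a)"
proof -
  obtain C where C: "C \<ge> 1" "\<And>z (x::'a). norm (sc z x) \<le> C * cmod z * norm x" by (rule sc_bound) blast
  show ?thesis
    by unfold_locales
      (auto simp: sc_def times_i_all algebra_simps intro!: exI[of _ C] order_trans[OF C(2)[unfolded sc_def]])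
qed

text \<open>Applying \<open>A\<close> minus \<open>y\<close> removes the component of eigenvalue
  \<open>y\<close> and rescales the others by nonzero factors; induction over the
  eigenvalues.\<close>

lemma eigen_components_in_subspace:
  fixes A :: "'a::real_vector \<Rightarrow> 'a"
  assumes A: "linear A" and S: "subspace S" "A ` S \<subseteq> S"
    and "finite \<Lambda>" "\<And>x. x \<in> \<Lambda> \<Longrightarrow> A (u x) = x *\<^sub>R u x" "(\<Sum>x\<in>\<Lambda>. u x) \<in> S"
  shows "x \<in> \<Lambda> \<Longrightarrow> u x \<in> S"
  using assms(4-6)
proof (induction \<Lambda> arbitrary: u x rule: finite_induct)
  case empty
  then show ?case by simp
next
  case (insert y F)
  let ?v = "\<Sum>x\<in>insert y F. u x"
  have "A ?v - y *\<^sub>R ?v \<in> S" using S insert.prems(3) by (auto intro!: subspace_diff subspace_scale)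
  moreover have "A ?v - y *\<^sub>R ?v = (\<Sum>x\<in>F. (x - y) *\<^sub>R u x)"
    using insert.hyps insert.prems(2)
    by (simp add: linear_add[OF A] linear_sum[OF A] scaleR_sum_right scaleR_add_right sum_subtractf scaleR_diff_left)
  ultimately have *: "(\<Sum>x\<in>F. (x - y) *\<^sub>R u x) \<in> S" by simp
  have F: "u x \<in> S" if "x \<in> F" for x
  proof -
    have "(x - y) *\<^sub>R u x \<in> S"
      by (rule insert.IH[OF that _ *]) (use insert.prems(2) in \<open>simp add: linear_cmul[OF A] mult.commute\<close>)
    then have "(1 / (x - y)) *\<^sub>R (x - y) *\<^sub>R u x \<in> S" by (rule subspace_scale[OF S(1)])
    then show ?thesis using that insert.hyps by (cases "x = y") auto
  qed
  have "?v - (\<Sum>x\<in>F. u x) \<in> S" by (intro subspace_diff[OF S(1) insert.prems(3)] subspace_sum[OF S(1)] F)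
  then have "u y \<in> S" using insert.hyps by simp
  then show ?case using F insert.prems(1) by auto
qed

text \<open>The model is \<open>ad \<beta>\<close> with the group
  \<open>AD (ex (s *\<^sub>R times_i \<beta>))\<close>, bounded when \<open>\<beta>\<close> is
  hyperbolic. Boundedness forces \<open>A\<close> to be diagonalizable with real eigenvalues and
  replaces an invariant inner product.\<close>

locale bounded_group =
  fixes A :: "'a::fin_dim_complex \<Rightarrow> 'a" and R :: "real \<Rightarrow> 'a \<Rightarrow> 'a" and M :: real
  assumes A: "clin A" and R: "clin (R s)" and R0: "R 0 v = v"
    and der: "((\<lambda>s. R s v) has_vector_derivative R s (times_i (A v))) (at s)"
    and bd: "norm (R s v) \<le> M * norm v"
begin

lemma const_of_zero_der:
  fixes f :: "real \<Rightarrow> 'a"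
  assumes "\<And>s. (f has_vector_derivative 0) (at s)" shows "f s = f 0"
  using has_derivative_zero_unique_connected[of UNIV f s 0] assms by (auto simp: has_vector_derivative_def)

lemma twisted_der:
  "((\<lambda>s. sc (exp (- (\<i> * of_real s * z))) (R s v)) has_vector_derivative
     sc (exp (- (\<i> * of_real s * z))) (R s (times_i (A v - sc z v)))) (at s)"
proof -
  have e: "((\<lambda>s. exp (- (\<i> * of_real s * z))) has_vector_derivative (- (\<i> * z)) * exp (- (\<i> * of_real s * z))) (at s)"
  proof -
    have "((\<lambda>w. exp (- (\<i> * w * z))) has_field_derivative (- (\<i> * z)) * exp (- (\<i> * of_real s * z))) (at (of_real s))"
      by (auto intro!: derivative_eq_intros)
    from has_vector_derivative_real_field[OF this] show ?thesis .
  qed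
  have lin: "linear (R s)" using R[of s] by (simp add: clin_def)
  from bounded_bilinear.has_vector_derivative[OF bounded_bilinear_sc e der]
  have d: "((\<lambda>s. sc (exp (- (\<i> * of_real s * z))) (R s v)) has_vector_derivative
     sc (exp (- (\<i> * of_real s * z))) (R s (times_i (A v))) + sc ((- (\<i> * z)) * exp (- (\<i> * of_real s * z))) (R s v)) (at s)" .
  have "sc ((- (\<i> * z)) * exp (- (\<i> * of_real s * z))) (R s v) = sc (exp (- (\<i> * of_real s * z))) (- R s (times_i (sc z v)))"
  proof -
    have "R s (times_i (sc z v)) = sc (\<i> * z) (R s v)" using clin_sc[OF R, of s "\<i> * z" v] by (simp flip: sc_i)
    then show ?thesis by (simp add: mult.commute mult.left_commute sc.scale_minus_left flip: sc.scale_minus_right)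
  qed
  moreover have "R s (times_i (A v - sc z v)) = R s (times_i (A v)) + (- R s (times_i (sc z v)))"
    by (simp add: times_i_all linear_diff[OF lin])
  ultimately show ?thesis using d by (simp add: sc.scale_right_distrib sc.scale_right_diff_distrib)
qed

text \<open>On an eigenvector the twisted curve is constant, so \<open>R s\<close> multiplies
  \<open>w\<close> by exp(isz). For nonreal \<open>z\<close> this is unbounded in
  \<open>s\<close>.\<close>

lemma real_eigenvalue:
  assumes w: "A w = sc z w" "w \<noteq> 0" shows "Im z = 0"
proof (rule ccontr)
  assume z: "Im z \<noteq> 0"
  obtain C where C: "C \<ge> 1" "\<And>z (x::'a). norm (sc z x) \<le> C * cmod z * norm x" by (rule sc_bound) blast
  have "sc (exp (- (\<i> * of_real s * z))) (R s w) = w" for s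
    using const_of_zero_der[of "\<lambda>s. sc (exp (- (\<i> * of_real s * z))) (R s w)" s] twisted_der[of z w]
    by (simp add: w times_i_simps linear_0 R[unfolded clin_def] R0)
  then have 1: "norm w \<le> C * cmod (exp (- (\<i> * of_real s * z))) * norm (R s w)" for s using C(2) by metis
  have 2: "norm w \<le> C * exp (s * Im z) * (M * norm w)" for s
  proof -
    have "C * cmod (exp (- (\<i> * of_real s * z))) * norm (R s w) \<le> C * cmod (exp (- (\<i> * of_real s * z))) * (M * norm w)"
      using C(1) by (intro mult_left_mono bd) auto
    moreover have "cmod (exp (- (\<i> * of_real s * z))) = exp (s * Im z)" by simp
    ultimately show ?thesis using 1[of s] by simp
  qed
  have 3: "1 \<le> C * M * exp t" for t
  proof -
    have "1 * norm w \<le> (C * M * exp t) * norm w" using 2[of "t / Im z"] z by (simp add: mult_ac)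
    then show ?thesis using w(2) by (metis mult_le_cancel_right norm_ge_zero norm_le_zero_iff not_le)
  qed
  define c where "c = C * M"
  have c: "c > 0" using 3[of 0] by (simp add: c_def)
  have "1 \<le> c * exp (- ln (2 * c))" unfolding c_def by (rule 3)
  then show False using c by (simp add: exp_minus)
qed

text \<open>On a generalized eigenvector of height two the twisted curve grows linearly in
  \<open>s\<close>, which a bounded group excludes.\<close>

lemma no_jordan_block:
  assumes w: "A (A v - sc z v) = sc z (A v - sc z v)" shows "A v = sc z v"
proof (rule ccontr)
  define w1 where "w1 = A v - sc z v"
  assume "A v \<noteq> sc z v"
  then have w0: "w1 \<noteq> 0" by (simp add: w1_def)
  have z: "Im z = 0" using real_eigenvalue[of w1 z] w w0 by (simp add: w1_def)
  obtain C where C: "C \<ge> 1" "\<And>z (x::'a). norm (sc z x) \<le> C * cmod z * norm x" by (rule sc_bound) blast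
  let ?e = "\<lambda>s. exp (- (\<i> * complex_of_real s * z))"
  have iw: "A (times_i w1) = sc z (times_i w1)"
    using w A clin_sc[OF A] unfolding w1_def[symmetric] by (simp add: clin_def sc_def times_i_all)
  have i: "sc (?e s) (R s (times_i w1)) = times_i w1" for s
    using const_of_zero_der[of "\<lambda>s. sc (?e s) (R s (times_i w1))" s] twisted_der[of z "times_i w1"]
    by (simp add: iw times_i_simps linear_0 R[unfolded clin_def] R0)
  define f where "f s = sc (?e s) (R s v) - s *\<^sub>R times_i w1" for s
  have "(f has_vector_derivative 0) (at s)" for s
  proof -
    have "((\<lambda>s. s *\<^sub>R times_i w1) has_vector_derivative times_i w1) (at s)"
      by (auto intro!: derivative_eq_intros)
    from has_vector_derivative_diff[OF twisted_der[of z v s] this] i[of s]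
    show ?thesis by (simp add: f_def[abs_def] w1_def)
  qed
  from const_of_zero_der[OF this] have f: "sc (?e s) (R s v) = v + s *\<^sub>R times_i w1" for s
    by (simp add: f_def R0 diff_eq_eq)
  have bnd: "norm (v + s *\<^sub>R times_i w1) \<le> C * (M * norm v)" for s
  proof -
    have "norm (v + s *\<^sub>R times_i w1) \<le> C * cmod (?e s) * norm (R s v)" using C(2)[of "?e s" "R s v"] f by simp
    also have "cmod (?e s) = 1" using z by simp
    also have "C * 1 * norm (R s v) \<le> C * (M * norm v)" using bd[of s v] C(1) by simp
    finally show ?thesis .
  qed
  have iw0: "times_i w1 \<noteq> 0" using w0 by (metis times_i_times_i times_i_simps(1) neg_equal_0_iff_equal)
  define s where "s = (C * (M * norm v) + norm v + 1) / norm (times_i w1)"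
  have "0 \<le> C * (M * norm v)" using bnd[of 0] norm_ge_zero order_trans by blast
  then have s: "s * norm (times_i w1) = C * (M * norm v) + norm v + 1" "s \<ge> 0" using iw0 by (auto simp: s_def)
  have "norm (s *\<^sub>R times_i w1) \<le> norm (v + s *\<^sub>R times_i w1) + norm v"
    using norm_triangle_ineq4[of "v + s *\<^sub>R times_i w1" v] by simp
  then show False using bnd[of s] s by simp
qed

definition diag where
  "diag \<Lambda> v \<longleftrightarrow> finite \<Lambda> \<and> (\<exists>u. (\<forall>x\<in>\<Lambda>. A (u x) = x *\<^sub>R u x) \<and> v = (\<Sum>x\<in>\<Lambda>. u x))"

lemma linA: "linear A" using A by (simp add: clin_def)

lemma diag_mono: "diag \<Lambda> v \<Longrightarrow> \<Lambda> \<subseteq> \<Lambda>' \<Longrightarrow> finite \<Lambda>' \<Longrightarrow> diag \<Lambda>' v"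
proof -
  assume d: "diag \<Lambda> v" "\<Lambda> \<subseteq> \<Lambda>'" "finite \<Lambda>'"
  then obtain u where u: "\<forall>x\<in>\<Lambda>. A (u x) = x *\<^sub>R u x" "v = (\<Sum>x\<in>\<Lambda>. u x)" by (auto simp: diag_def)
  have "v = (\<Sum>x\<in>\<Lambda>'. if x \<in> \<Lambda> then u x else 0)"
    unfolding u(2) using d by (simp add: sum.If_cases Int_absorb1)
  then show ?thesis using u d unfolding diag_def
    by (intro conjI exI[of _ "\<lambda>x. if x \<in> \<Lambda> then u x else 0"]) (auto simp: linear_0[OF linA])
qed

lemma diag_add: "diag \<Lambda> v \<Longrightarrow> diag \<Lambda> w \<Longrightarrow> diag \<Lambda> (v + w)"
  unfolding diag_def
proof (elim conjE exE, intro conjI)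
  fix u u' assume "\<forall>x\<in>\<Lambda>. A (u x) = x *\<^sub>R u x" "v = sum u \<Lambda>" "\<forall>x\<in>\<Lambda>. A (u' x) = x *\<^sub>R u' x" "w = sum u' \<Lambda>"
  then show "\<exists>u. (\<forall>x\<in>\<Lambda>. A (u x) = x *\<^sub>R u x) \<and> v + w = sum u \<Lambda>"
    by (intro exI[of _ "\<lambda>x. u x + u' x"]) (auto simp: sum.distrib linear_add[OF linA] scaleR_add_right)
qed

lemma diag_scale: "diag \<Lambda> v \<Longrightarrow> diag \<Lambda> (c *\<^sub>R v)"
  unfolding diag_def
proof (elim conjE exE, intro conjI)
  fix u assume "\<forall>x\<in>\<Lambda>. A (u x) = x *\<^sub>R u x" "v = sum u \<Lambda>"
  then show "\<exists>u. (\<forall>x\<in>\<Lambda>. A (u x) = x *\<^sub>R u x) \<and> c *\<^sub>R v = sum u \<Lambda>"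
    by (intro exI[of _ "\<lambda>x. c *\<^sub>R u x"]) (auto simp: scaleR_sum_right linear_cmul[OF linA])
qed

text \<open>Components of \<open>A v - sc z v\<close> with eigenvalue other than \<open>z\<close>
  are divided out of \<open>v\<close>. What remains is annihilated by the square of \<open>A\<close>
  minus \<open>z\<close>, and \<open>no_jordan_block\<close> makes it an eigenvector.\<close>

lemma diag_step:
  assumes d: "diag \<Lambda> (A v - sc z v)" shows "\<exists>\<Lambda>. diag \<Lambda> v"
proof -
  obtain u where u: "\<And>x. x \<in> \<Lambda> \<Longrightarrow> A (u x) = x *\<^sub>R u x" "A v - sc z v = (\<Sum>x\<in>\<Lambda>. u x)" and fin: "finite \<Lambda>"
    using d by (auto simp: diag_def)
  define \<Lambda>' where "\<Lambda>' = {x\<in>\<Lambda>. of_real x \<noteq> z}"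
  define u' where "u' x = sc (1 / (of_real x - z)) (u x)" for x
  have u': "A (u' x) = x *\<^sub>R u' x" if "x \<in> \<Lambda>" for x
    unfolding u'_def by (simp add: clin_sc[OF A] u(1)[OF that] sc_scaleR)
  have fin': "finite \<Lambda>'" using fin by (simp add: \<Lambda>'_def)
  have au: "A (u' x) - sc z (u' x) = u x" if "x \<in> \<Lambda>'" for x
  proof -
    have "A (u' x) - sc z (u' x) = sc (of_real x - z) (u' x)"
      using u'[of x] that by (simp add: \<Lambda>'_def sc.scale_left_diff_distrib)
    then show ?thesis using that by (simp add: u'_def \<Lambda>'_def)
  qed
  define v' where "v' = v - (\<Sum>x\<in>\<Lambda>'. u' x)"
  have "A v' - sc z v' = (\<Sum>x\<in>\<Lambda>. u x) - (\<Sum>x\<in>\<Lambda>'. u x)"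
  proof -
    have "A v' - sc z v' = (A v - sc z v) - (\<Sum>x\<in>\<Lambda>'. A (u' x) - sc z (u' x))"
      by (simp add: v'_def linear_diff[OF linA] linear_sum[OF linA] sc.scale_right_diff_distrib sc.scale_sum_right sum_subtractf)
    then show ?thesis using u(2) au by simp
  qed
  also have "\<dots> = (\<Sum>x\<in>\<Lambda> - \<Lambda>'. u x)" using fin by (simp add: \<Lambda>'_def sum_diff)
  finally have e: "A v' - sc z v' = (\<Sum>x\<in>\<Lambda> - \<Lambda>'. u x)" .
  have "A (\<Sum>x\<in>\<Lambda> - \<Lambda>'. u x) = sc z (\<Sum>x\<in>\<Lambda> - \<Lambda>'. u x)"
    unfolding linear_sum[OF linA] sc.scale_sum_right by (intro sum.cong) (auto simp: u(1) \<Lambda>'_def)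
  then have ev: "A v' = sc z v'" unfolding e[symmetric] by (rule no_jordan_block)
  have dv: "diag \<Lambda>' (\<Sum>x\<in>\<Lambda>'. u' x)"
    unfolding diag_def using fin' u' by (auto simp: \<Lambda>'_def intro!: exI[of _ u'])
  have v: "v = v' + (\<Sum>x\<in>\<Lambda>'. u' x)" by (simp add: v'_def)
  have "diag {Re z} v'"
  proof (cases "v' = 0")
    case True then show ?thesis by (auto simp: diag_def linear_0[OF linA] intro!: exI[of _ "\<lambda>x. 0"])
  next
    case False
    have "z = of_real (Re z)" using real_eigenvalue[OF ev False] by (simp add: complex_eq_iff)
    then have "A v' = Re z *\<^sub>R v'" using ev by (metis sc_of_real)
    then show ?thesis by (auto simp: diag_def intro!: exI[of _ "\<lambda>x. v'"])
  qed
  then have "diag (insert (Re z) \<Lambda>') v'" using fin' by (rule_tac diag_mono) auto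
  moreover have "diag (insert (Re z) \<Lambda>') (\<Sum>x\<in>\<Lambda>'. u' x)" using fin' by (intro diag_mono[OF dv]) auto
  ultimately show ?thesis unfolding v by (blast intro: diag_add)
qed

definition pe where "pe p v = (\<Sum>i\<le>degree p. sc (coeff p i) ((A ^^ i) v))"

lemma pe_bound: "degree p \<le> N \<Longrightarrow> pe p v = (\<Sum>i\<le>N. sc (coeff p i) ((A ^^ i) v))"
  unfolding pe_def by (rule sum.mono_neutral_left) (auto simp: coeff_eq_0 not_le)

lemma pe_root: "pe ([:-z, 1:] * p) v = pe p (A v - sc z v)"
proof -
  let ?N = "Suc (degree p)"
  have lp: "linear (A ^^ i)" for i 
  proof (induction i)
    case 0
    show ?case by (intro linearI) auto
  next
    case (Suc i)
    then show ?case using linear_compose[OF Suc linA] by (simp add: o_def)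
  qed
  have sp: "(A ^^ i) (sc z x) = sc z ((A ^^ i) x)" for i x by (induction i) (auto simp: clin_sc[OF A])
  have dg: "degree ([:-z, 1:] * p) \<le> ?N" using degree_mult_le[of "[:-z, 1:]" p] by simp
  have "pe ([:-z, 1:] * p) v = (\<Sum>i\<le>?N. sc (coeff (pCons 0 p) i) ((A ^^ i) v) - sc (coeff p i) (sc z ((A ^^ i) v)))"
    unfolding pe_bound[OF dg] by (intro sum.cong) (auto simp: sc.scale_left_diff_distrib mult.commute)
  also have "\<dots> = (\<Sum>i\<le>?N. sc (coeff (pCons 0 p) i) ((A ^^ i) v)) - (\<Sum>i\<le>?N. sc (coeff p i) (sc z ((A ^^ i) v)))"
    by (rule sum_subtractf)
  also have "(\<Sum>i\<le>?N. sc (coeff (pCons 0 p) i) ((A ^^ i) v)) = (\<Sum>i\<le>degree p. sc (coeff p i) ((A ^^ Suc i) v))"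
    by (subst sum.atMost_Suc_shift) simp
  also have "(\<Sum>i\<le>?N. sc (coeff p i) (sc z ((A ^^ i) v))) = (\<Sum>i\<le>degree p. sc (coeff p i) (sc z ((A ^^ i) v)))"
    by (simp add: coeff_eq_0)
  finally show ?thesis
    unfolding pe_def by (simp add: linear_diff[OF lp] sp sc.scale_right_diff_distrib sum_subtractf funpow_swap1)
qed

text \<open>Roots are split off one at a time by the fundamental theorem of algebra, and
  \<open>diag_step\<close> undoes each linear factor.\<close>

lemma diag_of_pe: "p \<noteq> 0 \<Longrightarrow> pe p v = 0 \<Longrightarrow> \<exists>\<Lambda>. diag \<Lambda> v"
proof (induction "degree p" arbitrary: p v)
  case 0
  then obtain c where "p = [:c:]" by (metis degree_eq_zeroE)
  then have "v = 0" using 0 by (simp add: pe_def)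
  then show ?case by (intro exI[of _ "{}"]) (simp add: diag_def)
next
  case (Suc n)
  have "degree p \<in> {1..degree p}" "coeff p (degree p) \<noteq> 0" using Suc(2) Suc.prems(1) by auto
  then obtain z where "(\<Sum>i\<le>degree p. coeff p i * z ^ i) = 0"
    using fundamental_theorem_of_algebra[of "coeff p" "degree p"] by blast
  then have "poly p z = 0" by (simp add: poly_altdef)
  then obtain q where q: "p = [:-z, 1:] * q" by (metis poly_eq_0_iff_dvd dvdE)
  have q0: "q \<noteq> 0" using q Suc.prems(1) by auto
  have "degree p = Suc (degree q)" unfolding q using q0 by (subst degree_mult_eq) auto
  then have "n = degree q" using Suc(2) by simp
  from Suc.hyps(1)[OF this q0] Suc.prems(2) obtain \<Lambda> where "diag \<Lambda> (A v - sc z v)" unfolding q pe_root by blast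
  then show ?case by (rule diag_step)
qed

lemma ex_diag: "\<exists>\<Lambda>. diag \<Lambda> v"
proof -
  obtain B :: "'a set" where B: "finite B" "independent B" "span B = UNIV" by (rule fin_dim_basis)
  \<comment> \<open>One more iterate than the dimension forces a relation. Coinciding iterates are a
    separate case because \<open>dependent\<close> speaks of sets, not of families.\<close>
  define f where "f i = (A ^^ i) v" for i :: nat
  have "\<exists>a. (\<exists>i\<le>card B. a i \<noteq> 0) \<and> (\<Sum>i\<le>card B. a i *\<^sub>R f i) = 0"
  proof (cases "inj_on f {..card B}")
    case True
    have "card (f ` {..card B}) = Suc (card B)" using card_image[OF True] by simp
    then have "dependent (f ` {..card B})" using independent_span_bound[OF B(1), of "f ` {..card B}"] B(3) by auto
    then obtain c where c: "\<exists>x\<in>f ` {..card B}. c x \<noteq> 0" "(\<Sum>x\<in>f ` {..card B}. c x *\<^sub>R x) = 0"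
      by (auto simp: dependent_finite)
    then show ?thesis using sum.reindex[OF True, of "\<lambda>x. c x *\<^sub>R x"]
      by (intro exI[of _ "\<lambda>i. c (f i)"]) auto
  next
    case False
    then obtain i j where ij: "i \<le> card B" "j \<le> card B" "i \<noteq> j" "f i = f j" by (auto simp: inj_on_def)
    have "(\<Sum>k\<le>card B. (if k = i then 1 else if k = j then -1 else 0) *\<^sub>R f k) = (\<Sum>k\<in>{i,j}. (if k = i then 1 else if k = j then -1 else 0) *\<^sub>R f k)"
      using ij by (intro sum.mono_neutral_right) auto
    also have "\<dots> = 0" using ij by simp
    finally show ?thesis using ij by (intro exI[of _ "\<lambda>k. if k = i then 1 else if k = j then -1 else 0"]) auto
  qed
  then obtain a where a: "\<exists>i\<le>card B. a i \<noteq> 0" "(\<Sum>i\<le>card B. a i *\<^sub>R f i) = 0" by blast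
  define p where "p = (\<Sum>i\<le>card B. monom (complex_of_real (a i)) i)"
  have cp: "coeff p i = (if i \<le> card B then of_real (a i) else 0)" for i
    unfolding p_def by (simp add: coeff_sum if_distrib cong: if_cong)
  have "degree p \<le> card B" by (rule degree_le) (simp add: cp)
  then have "pe p v = 0" using a(2) by (simp add: pe_bound cp f_def)
  moreover have "p \<noteq> 0" using a(1) cp by (metis coeff_0 of_real_eq_0_iff)
  ultimately show ?thesis using diag_of_pe by blast
qed

lemma ex_diag_uniform: "\<exists>\<Lambda>. \<forall>v. diag \<Lambda> v"
proof -
  obtain B :: "'a set" where B: "finite B" "independent B" "span B = UNIV" by (rule fin_dim_basis)
  obtain L where L: "\<And>v. diag (L v) v" using ex_diag by metis
  have fin: "finite (\<Union>b\<in>B. L b)" using L B(1) by (auto simp: diag_def)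
  have "diag (\<Union>b\<in>B. L b) v" for v
  proof -
    have "v \<in> span B" using B by simp
    then show ?thesis
    proof (rule span_induct)
      show "subspace {v. diag (\<Union>b\<in>B. L b) v}"
      proof (intro subspaceI CollectI)
        show "diag (\<Union>b\<in>B. L b) 0" unfolding diag_def using fin
          by (intro conjI exI[of _ "\<lambda>x. 0"]) (auto simp: linear_0[OF linA])
      qed (auto intro: diag_add diag_scale)
      show "diag (\<Union>b\<in>B. L b) b" if "b \<in> B" for b using fin that by (intro diag_mono[OF L]) auto
    qed
  qed
  then show ?thesis by blast
qed

text \<open>Linearity and commutation come from uniqueness of the components, invariance from
  \<open>eigen_components_in_subspace\<close>. \<open>P x\<close> is 0 off \<open>\<Lambda>\<close>,
  so that it can be used for every real \<open>x\<close>.\<close>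

theorem spectral:
  obtains \<Lambda> P where "finite \<Lambda>" "\<And>x. linear (P x)" "\<And>v. v = (\<Sum>x\<in>\<Lambda>. P x v)"
    "\<And>x v. A (P x v) = x *\<^sub>R P x v" "\<And>x v S. subspace S \<Longrightarrow> A ` S \<subseteq> S \<Longrightarrow> v \<in> S \<Longrightarrow> P x v \<in> S"
    "\<And>x v T. linear T \<Longrightarrow> (\<And>v. A (T v) = T (A v)) \<Longrightarrow> P x (T v) = T (P x v)"
    "\<And>x v. A v = x *\<^sub>R v \<Longrightarrow> P x v = v" "\<And>x y v. A v = x *\<^sub>R v \<Longrightarrow> x \<noteq> y \<Longrightarrow> P y v = 0"
    "\<And>x v. x \<notin> \<Lambda> \<Longrightarrow> P x v = 0"
proof -
  obtain \<Lambda> where \<Lambda>: "\<And>v. diag \<Lambda> v" using ex_diag_uniform by blast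
  have fin: "finite \<Lambda>" using \<Lambda> by (auto simp: diag_def)
  obtain u where u: "\<And>v x. x \<in> \<Lambda> \<Longrightarrow> A (u v x) = x *\<^sub>R u v x" "\<And>v. v = (\<Sum>x\<in>\<Lambda>. u v x)"
    using \<Lambda> unfolding diag_def by metis
  define P where "P x v = (if x \<in> \<Lambda> then u v x else 0)" for x v
  have P: "A (P x v) = x *\<^sub>R P x v" for x v using u(1) by (simp add: P_def linear_0[OF linA])
  have Ps: "v = (\<Sum>x\<in>\<Lambda>. P x v)" for v using u(2)[of v] by (simp add: P_def)
  have s0: "subspace {0 :: 'a}" "A ` {0} \<subseteq> {0}" by (auto simp: subspace_def linear_0[OF linA])
  have uniq: "P x v = w x" if "\<And>x. x \<in> \<Lambda> \<Longrightarrow> A (w x) = x *\<^sub>R w x" "v = (\<Sum>x\<in>\<Lambda>. w x)" "x \<in> \<Lambda>" for v w x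
  proof -
    have "P x v - w x \<in> {0}"
    proof (rule eigen_components_in_subspace[OF linA s0 fin _ _ that(3)])
      show "A (P y v - w y) = y *\<^sub>R (P y v - w y)" if "y \<in> \<Lambda>" for y
        using P that \<open>\<And>x. x \<in> \<Lambda> \<Longrightarrow> A (w x) = x *\<^sub>R w x\<close> by (simp add: linear_diff[OF linA] scaleR_diff_right)
      show "(\<Sum>x\<in>\<Lambda>. P x v - w x) \<in> {0}" using Ps[of v] that(2) by (simp add: sum_subtractf)
    qed
    then show ?thesis by simp
  qed
  have add: "P x (v + w) = P x v + P x w" for x v w
  proof (cases "x \<in> \<Lambda>")
    case True
    show ?thesis
    proof (rule uniq[OF _ _ True])
      show "v + w = (\<Sum>x\<in>\<Lambda>. P x v + P x w)" using Ps[of v] Ps[of w] by (simp add: sum.distrib)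
    qed (simp add: P linear_add[OF linA] scaleR_add_right)
  qed (simp add: P_def)
  have comm: "P x (T v) = T (P x v)" if T: "linear T" "\<And>v. A (T v) = T (A v)" for x v T
  proof (cases "x \<in> \<Lambda>")
    case True
    show ?thesis
    proof (rule uniq[OF _ _ True])
      show "T v = (\<Sum>x\<in>\<Lambda>. T (P x v))" using Ps[of v] linear_sum[OF T(1)] by metis
    qed (simp add: T(2) P linear_cmul[OF T(1)])
  qed (simp add: P_def linear_0[OF T(1)])
  have scale: "P x (c *\<^sub>R v) = c *\<^sub>R P x v" for x c v
    by (rule comm) (auto simp: linear_cmul[OF linA] intro!: linearI scaleR_add_right)
  show ?thesis
  proof (rule that[of \<Lambda> P])
    show "linear (P x)" for x by (intro linearI add scale)
    show "P x v \<in> S" if S: "subspace S" "A ` S \<subseteq> S" "v \<in> S" for x v S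
    proof (cases "x \<in> \<Lambda>")
      case True
      show ?thesis by (rule eigen_components_in_subspace[OF linA S(1,2) fin P _ True]) (use Ps[of v] S(3) in simp)
    qed (use S in \<open>simp add: P_def subspace_0\<close>)
    have eig: "P y v = (if x = y then v else 0)" if "A v = x *\<^sub>R v" for x y v
    proof -
      \<comment> \<open>A nonzero eigenvector with a new eigenvalue, entered with a minus sign,
        would give a vanishing sum of eigencomponents that are not all 0.\<close>
      have xin: "x \<in> \<Lambda> \<or> v = 0"
      proof (rule ccontr)
        assume n: "\<not> (x \<in> \<Lambda> \<or> v = 0)"
        have "(\<lambda>y. if y = x then - v else P y v) x \<in> {0}"
        proof (rule eigen_components_in_subspace[OF linA s0, where \<Lambda>="insert x \<Lambda>" and x=x and u="\<lambda>y. if y = x then - v else P y v"])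
          have "(\<Sum>y\<in>\<Lambda>. if y = x then - v else P y v) = (\<Sum>y\<in>\<Lambda>. P y v)" using n by (intro sum.cong) auto
          then show "(\<Sum>y\<in>insert x \<Lambda>. if y = x then - v else P y v) \<in> {0}" using n fin Ps[of v] by simp
        qed (use fin that P in \<open>auto simp: linear_neg[OF linA]\<close>)
        then show False using n by simp
      qed
      show ?thesis
      proof (cases "y \<in> \<Lambda>")
        case True
        show ?thesis
        proof (cases "v = 0")
          case True
          then show ?thesis using scale[of y 0 0] by simp
        next
          case False
          show ?thesis
            by (rule uniq[OF _ _ \<open>y \<in> \<Lambda>\<close>, where w="\<lambda>y. if x = y then v else 0"])
              (use that xin False fin in \<open>auto simp: linear_0[OF linA] sum.delta\<close>)
        qed
      qed (use xin in \<open>auto simp: P_def\<close>)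
    qed
    show "P x v = v" if "A v = x *\<^sub>R v" for x v using eig[OF that, of x] by simp
    show "P y v = 0" if "A v = x *\<^sub>R v" "x \<noteq> y" for x y v using eig[OF that(1), of y] that(2) by simp
    show "P x v = 0" if "x \<notin> \<Lambda>" for x v using that by (simp add: P_def)
  qed (fact fin Ps P comm)+
qed

end

section \<open>A determinant argument\<close>

text \<open>In a complex basis taken from \<open>V \<union> q\<close>, the members in
  \<open>V\<close> are replaced by their images under \<open>T \<zeta>\<close>. The resulting matrix
  is the identity at 0, its determinant is entire, and where the determinant does not vanish the
  adjugate solves for the coefficients.\<close>

lemma entire_family_transversal:
  fixes T :: "complex \<Rightarrow> 'a::fin_dim_complex \<Rightarrow> 'a"
  assumes clin: "\<And>\<zeta>. clin (T \<zeta>)" and T0: "\<And>v. T 0 v = v"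
    and hol: "\<And>(l :: 'a \<Rightarrow> complex) w. clin l \<Longrightarrow> (\<lambda>\<zeta>. l (T \<zeta> w)) holomorphic_on UNIV"
    and V: "subspace V" "\<And>v. v \<in> V \<Longrightarrow> times_i v \<in> V" and q: "subspace q" "\<And>v. v \<in> q \<Longrightarrow> times_i v \<in> q"
    and sp: "\<And>x. \<exists>a\<in>V. \<exists>b\<in>q. x = a + b"
  obtains h :: "complex \<Rightarrow> complex" where "h holomorphic_on UNIV" "h 0 \<noteq> 0"
    "\<And>\<zeta> x. h \<zeta> \<noteq> 0 \<Longrightarrow> \<exists>a\<in>V. \<exists>b\<in>q. x = T \<zeta> a + b"
proof -
  have "sc.span (V \<union> q) = UNIV"
  proof (intro Set.set_eqI iffI UNIV_I)
    fix x
    obtain a b where "a \<in> V" "b \<in> q" "x = a + b" using sp by blast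
    then show "x \<in> sc.span (V \<union> q)" by (auto intro: sc.span_add sc.span_base)
  qed
  then obtain n :: nat and b l where b: "\<And>i. i < n \<Longrightarrow> b i \<in> V \<union> q" and l: "\<And>i. clin (l i :: 'a \<Rightarrow> complex)"
    and x: "\<And>x. x = (\<Sum>i<n. sc (l i x) (b i))" and lb: "\<And>i j. i < n \<Longrightarrow> j < n \<Longrightarrow> l i (b j) = (if i = j then 1 else 0)"
    by (rule complex_coordinates) (rule that; assumption)
  have scV: "sc z v \<in> V" if "v \<in> V" for z v
    unfolding sc_def using V that by (auto intro: subspace_add subspace_scale)
  have scq: "sc z v \<in> q" if "v \<in> q" for z v
    unfolding sc_def using q that by (auto intro: subspace_add subspace_scale)
  define u where "u i \<zeta> = (if b i \<in> V then T \<zeta> (b i) else b i)" for i \<zeta>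
  define Mt where "Mt \<zeta> = mat n n (\<lambda>(j, i). l j (u i \<zeta>))" for \<zeta>
  have Mc: "Mt \<zeta> \<in> carrier_mat n n" for \<zeta> by (simp add: Mt_def)
  have ll: "linear (l j)" for j using l[of j] by (simp add: clin_def)
  show ?thesis
  proof (rule that[of "\<lambda>\<zeta>. det (Mt \<zeta>)"])
    have "(\<lambda>\<zeta>. l j (u i \<zeta>)) holomorphic_on UNIV" for i j
      using hol[OF l[of j], of "b i"] by (cases "b i \<in> V") (auto simp: u_def)
    then have "(\<lambda>\<zeta>. \<Sum>p\<in>{p. p permutes {0..<n}}. signof p * (\<Prod>i = 0..<n. l i (u (p i) \<zeta>))) holomorphic_on UNIV"
      by (intro holomorphic_intros) auto
    moreover have "det (Mt \<zeta>) = (\<Sum>p\<in>{p. p permutes {0..<n}}. signof p * (\<Prod>i = 0..<n. l i (u (p i) \<zeta>)))" for \<zeta>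
      unfolding det_def'[OF Mc]
      by (intro sum.cong arg_cong2[where f="(*)"] prod.cong) (auto simp: Mt_def permutes_in_image)
    ultimately show "(\<lambda>\<zeta>. det (Mt \<zeta>)) holomorphic_on UNIV" by simp
    have "Mt 0 = 1\<^sub>m n"
      by (rule eq_matI) (auto simp: Mt_def u_def T0 lb)
    then show "det (Mt 0) \<noteq> 0" by simp
    fix \<zeta> x assume d: "det (Mt \<zeta>) \<noteq> 0"
    define Aj where "Aj = adj_mat (Mt \<zeta>)"
    have Aj: "Aj \<in> carrier_mat n n" "Mt \<zeta> * Aj = det (Mt \<zeta>) \<cdot>\<^sub>m 1\<^sub>m n" using adj_mat[OF Mc] by (simp_all add: Aj_def)
    have prod: "(\<Sum>i<n. l j (u i \<zeta>) * Aj $$ (i, k)) = (if j = k then det (Mt \<zeta>) else 0)" if "j < n" "k < n" for j k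
    proof -
      have "(Mt \<zeta> * Aj) $$ (j, k) = (\<Sum>i<n. l j (u i \<zeta>) * Aj $$ (i, k))"
        using that Aj(1) by (simp add: Mt_def scalar_prod_def lessThan_atLeast0)
      then show ?thesis unfolding Aj(2) using that by auto
    qed
    define c where "c i = (\<Sum>k<n. Aj $$ (i, k) * l k x) / det (Mt \<zeta>)" for i
    have lc: "l j (\<Sum>i<n. sc (c i) (u i \<zeta>)) = l j x" if j: "j < n" for j
    proof -
      have "l j (\<Sum>i<n. sc (c i) (u i \<zeta>)) = (\<Sum>i<n. c i * l j (u i \<zeta>))"
        by (simp add: linear_sum[OF ll] clin_sc[OF l])
      also have "\<dots> = (\<Sum>i<n. \<Sum>k<n. l j (u i \<zeta>) * Aj $$ (i, k) * l k x) / det (Mt \<zeta>)"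
        by (simp add: c_def sum_distrib_left sum_distrib_right sum_divide_distrib mult_ac)
      also have "(\<Sum>i<n. \<Sum>k<n. l j (u i \<zeta>) * Aj $$ (i, k) * l k x) = (\<Sum>k<n. (\<Sum>i<n. l j (u i \<zeta>) * Aj $$ (i, k)) * l k x)"
        by (subst sum.swap) (simp add: sum_distrib_right)
      also have "\<dots> = (\<Sum>k<n. (if j = k then det (Mt \<zeta>) else 0) * l k x)"
        using prod[OF j] by (intro sum.cong) auto
      also have "\<dots> = (\<Sum>k<n. if j = k then det (Mt \<zeta>) * l k x else 0)" by (intro sum.cong) auto
      also have "\<dots> = det (Mt \<zeta>) * l j x" using j by simp
      finally show ?thesis using d by simp
    qed
    have "x = (\<Sum>i<n. sc (l i x) (b i))" by (rule x)
    also have "\<dots> = (\<Sum>i<n. sc (l i (\<Sum>i<n. sc (c i) (u i \<zeta>))) (b i))" using lc by simp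
    also have "\<dots> = (\<Sum>i<n. sc (c i) (u i \<zeta>))" by (rule x[symmetric])
    also have "\<dots> = (\<Sum>i<n. (if b i \<in> V then T \<zeta> (sc (c i) (b i)) else 0) + (if b i \<in> V then 0 else sc (c i) (b i)))"
      by (intro sum.cong) (auto simp: u_def clin_sc[OF clin])
    also have "\<dots> = (\<Sum>i<n. T \<zeta> (if b i \<in> V then sc (c i) (b i) else 0)) + (\<Sum>i<n. if b i \<in> V then 0 else sc (c i) (b i))"
      unfolding sum.distrib
      by (intro arg_cong2[where f="(+)"] sum.cong) (use clin[of \<zeta>] in \<open>auto simp: clin_def linear_0\<close>)
    also have "(\<Sum>i<n. T \<zeta> (if b i \<in> V then sc (c i) (b i) else 0)) = T \<zeta> (\<Sum>i<n. if b i \<in> V then sc (c i) (b i) else 0)"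
      using clin[of \<zeta>] by (simp add: clin_def linear_sum)
    finally have xx: "x = T \<zeta> (\<Sum>i<n. if b i \<in> V then sc (c i) (b i) else 0) + (\<Sum>i<n. if b i \<in> V then 0 else sc (c i) (b i))" .
    have "(\<Sum>i<n. if b i \<in> V then sc (c i) (b i) else 0) \<in> V"
      by (intro subspace_sum V) (auto intro: scV subspace_0[OF V(1)])
    moreover have "(\<Sum>i<n. if b i \<in> V then 0 else sc (c i) (b i)) \<in> q"
      by (intro subspace_sum q) (use b in \<open>auto intro: scq subspace_0[OF q(1)]\<close>)
    ultimately show "\<exists>a\<in>V. \<exists>b\<in>q. x = T \<zeta> a + b" using xx by blast
  qed
qed

text \<open>The zeros are countable, so their complement in the plane is path connected and, balls
  being uncountable, dense.\<close>

lemma entire_nonzero_set: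
  assumes h: "h holomorphic_on UNIV" "h 0 \<noteq> (0::complex)"
  shows "connected {\<zeta>. h \<zeta> \<noteq> 0}" "open {\<zeta>. h \<zeta> \<noteq> 0}" "z \<in> closure {\<zeta>. h \<zeta> \<noteq> 0}"
proof -
  have ct: "countable {\<zeta>. h \<zeta> = 0}"
  proof (cases "h constant_on UNIV")
    case True
    then obtain c where "\<And>\<zeta>. h \<zeta> = c" by (auto simp: constant_on_def)
    then have "{\<zeta>. h \<zeta> = 0} = {}" using h(2) by simp
    then show ?thesis by simp
  next
    case False
    have "fsigma (UNIV :: complex set)" using fsigma.intros[of "\<lambda>_. UNIV :: complex set"] by simp
    from holomorphic_countable_zeros[OF h(1) open_UNIV connected_UNIV this False]
    show ?thesis by simp
  qed
  have e: "{\<zeta>. h \<zeta> \<noteq> 0} = - {\<zeta>. h \<zeta> = 0}" by auto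
  show "connected {\<zeta>. h \<zeta> \<noteq> 0}" unfolding e
    by (rule path_connected_imp_connected[OF path_connected_complement_countable[OF _ ct]]) simp
  have "continuous_on UNIV h" using h(1) by (rule holomorphic_on_imp_continuous_on)
  then show "open {\<zeta>. h \<zeta> \<noteq> 0}" by (intro open_Collect_neq) auto
  show "z \<in> closure {\<zeta>. h \<zeta> \<noteq> 0}"
  proof (rule ccontr)
    assume z: "z \<notin> closure {\<zeta>. h \<zeta> \<noteq> 0}"
    define U where "U = - closure {\<zeta>. h \<zeta> \<noteq> 0}"
    have U: "open U" "z \<in> U" using z by (simp_all add: U_def open_Compl)
    have "U \<subseteq> {\<zeta>. h \<zeta> = 0}" using closure_subset[of "{\<zeta>. h \<zeta> \<noteq> 0}"] by (auto simp: U_def)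
    then have "countable U" using ct countable_subset by blast
    moreover have "uncountable U" 
    proof -
      obtain e where e: "e > 0" "ball z e \<subseteq> U" using U open_contains_ball by blast
      have "uncountable (ball z e)" using e(1) by (rule uncountable_ball)
      then show ?thesis using countable_subset[OF e(2)] by blast
    qed
    ultimately show False by blast
  qed
qed

section \<open>Holomorphic actions of complex Lie groups\<close>

locale Lie_action = complex_Lie L A
  for L :: "'g::{t2_space,second_countable_topology} monoid" (structure)
    and A :: "('g, 'e::fin_dim_complex) atlas" +
  fixes B :: "('z::{t2_space,second_countable_topology}, 'f::fin_dim_complex) atlas"
    and act :: "'g \<Rightarrow> 'z \<Rightarrow> 'z"
  assumes atlasB: "complex_atlas B" and hact: "holomorphic_action L A B act"
begin

lemma act_mult: "act (g \<otimes> h) z = act g (act h z)" and act_one [simp]: "act \<one> z = z"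
proof -
  interpret ga: group_action L UNIV act using hact by (simp add: holomorphic_action_def)
  show "act (g \<otimes> h) z = act g (act h z)" by (rule ga.composition_rule) auto
  show "act \<one> z = z" using fun_cong[OF ga.id_eq_one, of z] by simp
qed

lemma act_inv_cancel [simp]: "act (inv g) (act g z) = z" "act g (act (inv g) z) = z"
  by (simp_all flip: act_mult)

lemma act_ex_cancel [simp]: "act (ex (- \<xi>)) (act (ex \<xi>) z) = z" "act (ex \<xi>) (act (ex (- \<xi>)) z) = z"
  by (simp_all flip: act_mult)

lemma holo_act: "holomorphic_map (prod_atlas A B) B (\<lambda>(g, z). act g z)"
  using hact by (simp add: holomorphic_action_def)

lemma tendsto_act:
  assumes "(f \<longlongrightarrow> g) F" "(k \<longlongrightarrow> z) F" shows "((\<lambda>x. act (f x) (k x)) \<longlongrightarrow> act g z) F"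
proof -
  have "isCont (\<lambda>(g, z). act g z) (g, z)"
    using holo_act unfolding holomorphic_map_def by (simp add: continuous_on_eq_continuous_at)
  from isCont_tendsto_compose[OF this tendsto_Pair[OF assms]] show ?thesis by simp
qed

lemma continuous_on_act: "continuous_on S f \<Longrightarrow> continuous_on S k \<Longrightarrow> continuous_on S (\<lambda>x. act (f x) (k x))"
  unfolding continuous_on_def by (auto intro: tendsto_act)

definition rho where "rho z = tangent_map A B (\<lambda>g. act g z) \<one>"

lemma rho_mderiv: "has_mderiv A B (\<lambda>g. act g z) \<one> (rho z)" and clin_rho: "clin (rho z)"
proof -
  obtain T where T: "has_mderiv A B (\<lambda>g. act g z) \<one> T" "clin T"
    by (rule holomorphic_map_mderiv1[OF atlas atlasB atlasB holo_act])
  have eq: "rho z = T" unfolding rho_def by (rule tangent_map_eq[OF T(1)])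
  show "has_mderiv A B (\<lambda>g. act g z) \<one> (rho z)" "clin (rho z)" unfolding eq by (rule T)+
qed

lemma linear_rho: "linear (rho z)" using clin_rho[of z] by (simp add: clin_def)
lemma rho_times_i: "rho z (times_i v) = times_i (rho z v)" using clin_rho[of z] by (simp add: clin_def)

lemma continuous_on_curve: "continuous_on UNIV (\<lambda>t::real. act (ex (t *\<^sub>R \<xi>)) z)"
  by (intro continuous_on_act continuous_on_ex continuous_intros)

lemma rho_cderiv: "has_cderiv B (\<lambda>t. act (ex (t *\<^sub>R \<xi>)) z) 0 (rho z \<xi>)"
proof -
  have m: "has_mderiv A B (\<lambda>g. act g z) (ex (0 *\<^sub>R \<xi>)) (rho z)" using rho_mderiv by simp
  have ct: "continuous_on UNIV (\<lambda>t. ex (t *\<^sub>R \<xi>))" by (intro continuous_on_ex continuous_intros)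
  show ?thesis by (rule has_cderiv_compose[OF atlas ct conj_ex_cderiv m])
qed

lemma fundamental_field_rho: "fundamental_field L A B act \<xi> z = rho z \<xi>"
  using rho_cderiv[of \<xi> z] unfolding fundamental_field_def velocity_def has_cderiv_def o_def
  by (rule vector_derivative_at)

lemma has_cderiv_shift: "has_cderiv B \<gamma> 0 v \<Longrightarrow> has_cderiv B (\<lambda>s. \<gamma> (s - t)) t v"
proof -
  assume "has_cderiv B \<gamma> 0 v"
  then have 1: "((\<lambda>s. snd (chart_at B (\<gamma> 0)) (\<gamma> s)) has_derivative (\<lambda>h. h *\<^sub>R v)) (at (t - t))"
    by (simp add: has_cderiv_def has_vector_derivative_def)
  have "((\<lambda>s. s - t) has_derivative (\<lambda>h. h)) (at t)" by (auto intro!: derivative_eq_intros)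
  from has_derivative_compose[OF this 1] show ?thesis
    by (simp add: has_cderiv_def has_vector_derivative_def)
qed

text \<open>The velocity of the orbit curve at time \<open>t\<close> is the image of its velocity at
  0 under the differential of \<open>act (ex (t *\<^sub>R \<xi>))\<close>. If the one at 0 vanishes,
  so do all of them, and the curve is constant.\<close>

lemma rho_zero_iff: "rho z \<xi> = 0 \<longleftrightarrow> (\<forall>t::real. act (ex (t *\<^sub>R \<xi>)) z = z)"
proof
  assume 0: "rho z \<xi> = 0"
  have "has_cderiv B (\<lambda>s. act (ex (s *\<^sub>R \<xi>)) z) t 0" for t
  proof -
    obtain T where T: "has_mderiv B B (act (ex (t *\<^sub>R \<xi>))) (act (ex ((t - t) *\<^sub>R \<xi>)) z) T" "clin T"
      by (rule holomorphic_map_mderiv2[OF atlas atlasB atlasB holo_act])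
    have "continuous_on UNIV (\<lambda>s. act (ex ((s - t) *\<^sub>R \<xi>)) z)"
      by (intro continuous_on_act continuous_on_ex continuous_intros)
    from has_cderiv_compose[OF atlasB this has_cderiv_shift[OF rho_cderiv] T(1)]
    have "has_cderiv B (\<lambda>s. act (ex (t *\<^sub>R \<xi>)) (act (ex ((s - t) *\<^sub>R \<xi>)) z)) t (T 0)" by (simp add: 0)
    moreover have "act (ex (t *\<^sub>R \<xi>)) (act (ex ((s - t) *\<^sub>R \<xi>)) z) = act (ex (s *\<^sub>R \<xi>)) z" for s
      by (simp flip: act_mult ex_add)
    ultimately show ?thesis using T(2) by (simp add: clin_def linear_0)
  qed
  from has_cderiv_zero_const[OF atlasB continuous_on_curve this, of _ 0]
  show "\<forall>t::real. act (ex (t *\<^sub>R \<xi>)) z = z" by simp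
next
  assume c: "\<forall>t::real. act (ex (t *\<^sub>R \<xi>)) z = z"
  have "((\<lambda>t. snd (chart_at B z) z) has_vector_derivative rho z \<xi>) (at 0)"
    using rho_cderiv[of \<xi> z] c by (simp add: has_cderiv_def)
  from vector_derivative_unique_at[OF this has_vector_derivative_const] show "rho z \<xi> = 0" .
qed

definition stab where "stab z = {\<xi>. rho z \<xi> = 0}"

lemma subspace_stab: "subspace (stab z)"
  unfolding stab_def using linear_rho[of z] by (auto simp: subspace_def linear_add linear_cmul linear_0)

lemma stab_times_i: "v \<in> stab z \<Longrightarrow> times_i v \<in> stab z"
  by (simp add: stab_def rho_times_i times_i_simps)

lemma stab_iff: "\<xi> \<in> stab z \<longleftrightarrow> (\<forall>t::real. act (ex (t *\<^sub>R \<xi>)) z = z)"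
  by (simp add: stab_def rho_zero_iff)

lemma act_stab: "\<xi> \<in> stab z \<Longrightarrow> act (ex \<xi>) z = z"
  using stab_iff[of \<xi> z] by (metis scaleR_one)

lemma stab_act: "\<xi> \<in> stab z \<Longrightarrow> AD g \<xi> \<in> stab (act g z)"
proof -
  assume x: "\<xi> \<in> stab z"
  have "act (ex (t *\<^sub>R AD g \<xi>)) (act g z) = act g z" for t :: real
  proof -
    have "act (ex (t *\<^sub>R AD g \<xi>)) (act g z) = act (ex (AD g (t *\<^sub>R \<xi>)) \<otimes> g) z" by (simp add: act_mult AD_scaleR)
    also have "\<dots> = act g (act (ex (t *\<^sub>R \<xi>)) z)" by (simp add: act_mult flip: ex_conj')
    finally show ?thesis using x by (simp add: stab_iff)
  qed
  then show ?thesis by (simp add: stab_iff)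
qed

end

section \<open>Eigenspaces of the adjoint action and generated subgroups\<close>

context complex_Lie
begin

definition eig where "eig \<beta> x = {v. ad \<beta> v = x *\<^sub>R v}"

lemma AD_eig: "v \<in> eig \<beta> x \<Longrightarrow> AD (ex (t *\<^sub>R \<beta>)) v = exp (t * x) *\<^sub>R v"
proof -
  assume v: "v \<in> eig \<beta> x"
  define f where "f t = exp (- (t * x)) *\<^sub>R AD (ex (t *\<^sub>R \<beta>)) v" for t
  have "(f has_vector_derivative 0) (at t)" for t
  proof -
    have "((\<lambda>t. exp (- (t * x))) has_real_derivative - x * exp (- (t * x))) (at t)"
      by (auto intro!: derivative_eq_intros)
    from has_vector_derivative_scaleR[OF this ad_has_vector_derivative[of \<beta> v t]] v
    show ?thesis by (simp add: f_def[abs_def] eig_def AD_scaleR mult.commute)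
  qed
  then have "f t = f 0"
    using has_derivative_zero_unique_connected[of UNIV f t 0] by (auto simp: has_vector_derivative_def)
  then have "exp (t * x) *\<^sub>R f t = exp (t * x) *\<^sub>R v" by (simp add: f_def)
  then show ?thesis by (simp add: f_def exp_minus)
qed

lemma eigI:
  assumes "\<And>t. AD (ex (t *\<^sub>R \<beta>)) v = exp (t * x) *\<^sub>R v" shows "v \<in> eig \<beta> x"
proof -
  have "((\<lambda>t. exp (t * x) *\<^sub>R v) has_vector_derivative x *\<^sub>R v) (at 0)"
    by (auto intro!: derivative_eq_intros)
  then show ?thesis unfolding eig_def by (intro CollectI ad_eqI) (simp add: assms)
qed

lemma eig0_iff: "v \<in> eig \<beta> 0 \<longleftrightarrow> (\<forall>t. AD (ex (t *\<^sub>R \<beta>)) v = v)"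
  using AD_eig[of v \<beta> 0] eigI[of \<beta> v 0] by auto

lemma eig0_commute: "v \<in> eig \<beta> 0 \<Longrightarrow> ex (t *\<^sub>R \<beta>) \<otimes> ex v = ex v \<otimes> ex (t *\<^sub>R \<beta>)"
  using ex_conj'[of "ex (t *\<^sub>R \<beta>)" v] by (simp add: eig0_iff)

lemma eig0_sym: "v \<in> eig \<beta> 0 \<Longrightarrow> \<beta> \<in> eig v 0"
proof -
  assume v: "v \<in> eig \<beta> 0"
  have "ex (s *\<^sub>R v) \<otimes> ex (t *\<^sub>R \<beta>) = ex (t *\<^sub>R \<beta>) \<otimes> ex (s *\<^sub>R v)" for s t
    using v unfolding eig0_iff by (simp add: ex_conj'[of "ex (t *\<^sub>R \<beta>)"] AD_scaleR)
  then show ?thesis unfolding eig0_iff AD_fix_iff by blast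
qed

lemma self_eig0: "\<beta> \<in> eig \<beta> 0" by (simp add: eig0_iff)

lemma subspace_eig: "subspace (eig \<beta> x)"
  unfolding eig_def subspace_def
  by (auto simp: linear_add[OF linear_ad] linear_cmul[OF linear_ad] linear_0[OF linear_ad] algebra_simps)

lemma eig_times_i: "v \<in> eig \<beta> x \<Longrightarrow> times_i v \<in> eig \<beta> x"
  by (simp add: eig_def ad_times_i times_i_scaleR)

text \<open>What the spectral theorem needs of membership in \<open>iu\<close>: the group generated
  by \<open>times_i \<beta>\<close> stays in a compact set, on which \<open>AD\<close> is
  bounded.\<close>

definition hyperbolic where "hyperbolic \<beta> \<longleftrightarrow> (\<exists>Q. compact Q \<and> (\<forall>s. ex (s *\<^sub>R times_i \<beta>) \<in> Q))"

lemma spectral_hyperbolic: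
  assumes "hyperbolic \<beta>"
  obtains \<Lambda> P where "finite \<Lambda>" "\<And>x. linear (P x)" "\<And>v. v = (\<Sum>x\<in>\<Lambda>. P x v)"
    "\<And>x v. P x v \<in> eig \<beta> x" "\<And>x v S. subspace S \<Longrightarrow> ad \<beta> ` S \<subseteq> S \<Longrightarrow> v \<in> S \<Longrightarrow> P x v \<in> S"
    "\<And>x v T. linear T \<Longrightarrow> (\<And>v. ad \<beta> (T v) = T (ad \<beta> v)) \<Longrightarrow> P x (T v) = T (P x v)"
    "\<And>x v. v \<in> eig \<beta> x \<Longrightarrow> P x v = v" "\<And>x y v. v \<in> eig \<beta> x \<Longrightarrow> x \<noteq> y \<Longrightarrow> P y v = 0"
    "\<And>x v. x \<notin> \<Lambda> \<Longrightarrow> P x v = 0"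
proof -
  obtain Q where Q: "compact Q" "\<And>s. ex (s *\<^sub>R times_i \<beta>) \<in> Q" using assms by (auto simp: hyperbolic_def)
  obtain M where M: "\<And>k \<xi>. k \<in> Q \<Longrightarrow> norm (AD k \<xi>) \<le> M * norm \<xi>" using AD_bounded[OF Q(1)] by blast
  interpret bg: bounded_group "ad \<beta>" "\<lambda>s. AD (ex (s *\<^sub>R times_i \<beta>))" M
  proof
    show "((\<lambda>s. AD (ex (s *\<^sub>R times_i \<beta>)) v) has_vector_derivative AD (ex (s *\<^sub>R times_i \<beta>)) (times_i (ad \<beta> v))) (at s)" for s v
      using ad_has_vector_derivative[of "times_i \<beta>" v s] by (simp add: ad_times_i_left)
  qed (auto intro: clin_ad clin_Ad M Q)
  show ?thesis
    by (rule bg.spectral) (rule that; (assumption | simp add: eig_def)?; blast?)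
qed

text \<open>The sum of the weight spaces with weights in \<open>I\<close>, taken inside
  \<open>S\<close>. For \<open>S = UNIV\<close>, the choices \<open>{..0}\<close> and
  \<open>{0..}\<close> give the algebras of two opposite parabolic subgroups.\<close>

definition Eg where "Eg S \<beta> I = span (\<Union>x\<in>I. eig \<beta> x \<inter> S)"

lemma subspace_Eg: "subspace (Eg S \<beta> I)" by (simp add: Eg_def)

lemma Eg_subset: "subspace S \<Longrightarrow> Eg S \<beta> I \<subseteq> S"
  unfolding Eg_def by (rule span_minimal) auto

lemma eig_in_Eg: "v \<in> eig \<beta> x \<Longrightarrow> v \<in> S \<Longrightarrow> x \<in> I \<Longrightarrow> v \<in> Eg S \<beta> I"
  unfolding Eg_def by (rule span_base) blast

lemma Eg_zero: "subspace S \<Longrightarrow> Eg S \<beta> {0} = eig \<beta> 0 \<inter> S"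
  unfolding Eg_def using subspace_eig[of \<beta> 0] by (simp add: span_eq_iff subspace_inter)

lemma Eg_times_i: "v \<in> Eg UNIV \<beta> I \<Longrightarrow> times_i v \<in> Eg UNIV \<beta> I"
  unfolding Eg_def
proof (induction rule: span_induct)
  case base
  show ?case using subspace_span by (auto simp: subspace_def times_i_all)
next
  case (step v)
  then show ?case by (auto intro!: span_base eig_times_i)
qed

lemma Eg_Un: "v \<in> Eg S \<beta> (I \<union> J) \<Longrightarrow> \<exists>a\<in>Eg S \<beta> I. \<exists>b\<in>Eg S \<beta> J. v = a + b"
  unfolding Eg_def UN_Un span_Un by blast

lemma Eg_UNIV:
  assumes h: "hyperbolic \<beta>" and S: "subspace S" "ad \<beta> ` S \<subseteq> S" shows "Eg S \<beta> UNIV = S"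
proof
  show "Eg S \<beta> UNIV \<subseteq> S" by (rule Eg_subset[OF S(1)])
  show "S \<subseteq> Eg S \<beta> UNIV"
  proof
    fix v assume v: "v \<in> S"
    show "v \<in> Eg S \<beta> UNIV"
    proof (rule spectral_hyperbolic[OF h])
      fix \<Lambda> P
      assume P: "\<And>v. v = (\<Sum>x\<in>\<Lambda>. P x v)" "\<And>x v. P x v \<in> eig \<beta> x"
        "\<And>x v S. subspace S \<Longrightarrow> ad \<beta> ` S \<subseteq> S \<Longrightarrow> v \<in> S \<Longrightarrow> P x v \<in> S"
      have "(\<Sum>x\<in>\<Lambda>. P x v) \<in> Eg S \<beta> UNIV"
        by (intro subspace_sum[OF subspace_Eg] eig_in_Eg[OF P(2)] P(3) S v) auto
      then show ?thesis by (simp flip: P(1))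
    qed
  qed
qed

text \<open>The filter is left open because both flows occur: weights \<open>\<le> 0\<close> have
  limits as \<open>t\<close> tends to infinity, weights \<open>\<ge> 0\<close> as it tends to minus
  infinity. The limit is the component of weight 0.\<close>

lemma Eg_limit:
  assumes S: "subspace S" and v: "v \<in> Eg S \<beta> I"
    and F: "\<And>x. x \<in> I \<Longrightarrow> ((\<lambda>t. exp (t * x)) \<longlongrightarrow> (if x = 0 then 1 else 0)) F"
  obtains w where "w \<in> eig \<beta> 0" "w \<in> S" "((\<lambda>t. AD (ex (t *\<^sub>R \<beta>)) v) \<longlongrightarrow> w) F" "0 \<notin> I \<Longrightarrow> w = 0"
proof -
  have "\<exists>w. w \<in> eig \<beta> 0 \<and> w \<in> S \<and> ((\<lambda>t. AD (ex (t *\<^sub>R \<beta>)) v) \<longlongrightarrow> w) F \<and> (0 \<notin> I \<longrightarrow> w = 0)"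
    using v unfolding Eg_def
  proof (induction rule: span_induct)
    case base
    show ?case
    proof (intro subspaceI CollectI)
      show "\<exists>w. w \<in> eig \<beta> 0 \<and> w \<in> S \<and> ((\<lambda>t. AD (ex (t *\<^sub>R \<beta>)) 0) \<longlongrightarrow> w) F \<and> (0 \<notin> I \<longrightarrow> w = 0)"
        using subspace_0[OF S] subspace_0[OF subspace_eig] by (intro exI[of _ 0]) simp
    next
      fix a b
      assume "a \<in> {a. \<exists>w. w \<in> eig \<beta> 0 \<and> w \<in> S \<and> ((\<lambda>t. AD (ex (t *\<^sub>R \<beta>)) a) \<longlongrightarrow> w) F \<and> (0 \<notin> I \<longrightarrow> w = 0)}"
        "b \<in> {a. \<exists>w. w \<in> eig \<beta> 0 \<and> w \<in> S \<and> ((\<lambda>t. AD (ex (t *\<^sub>R \<beta>)) a) \<longlongrightarrow> w) F \<and> (0 \<notin> I \<longrightarrow> w = 0)}"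
      then obtain w w' where "w \<in> eig \<beta> 0" "w \<in> S" "((\<lambda>t. AD (ex (t *\<^sub>R \<beta>)) a) \<longlongrightarrow> w) F" "0 \<notin> I \<longrightarrow> w = 0"
        "w' \<in> eig \<beta> 0" "w' \<in> S" "((\<lambda>t. AD (ex (t *\<^sub>R \<beta>)) b) \<longlongrightarrow> w') F" "0 \<notin> I \<longrightarrow> w' = 0" by blast
      then show "\<exists>w. w \<in> eig \<beta> 0 \<and> w \<in> S \<and> ((\<lambda>t. AD (ex (t *\<^sub>R \<beta>)) (a + b)) \<longlongrightarrow> w) F \<and> (0 \<notin> I \<longrightarrow> w = 0)"
        by (intro exI[of _ "w + w'"]) (auto simp: AD_add intro: tendsto_add subspace_add[OF S] subspace_add[OF subspace_eig])
    next
      fix c a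
      assume "a \<in> {a. \<exists>w. w \<in> eig \<beta> 0 \<and> w \<in> S \<and> ((\<lambda>t. AD (ex (t *\<^sub>R \<beta>)) a) \<longlongrightarrow> w) F \<and> (0 \<notin> I \<longrightarrow> w = 0)}"
      then obtain w where "w \<in> eig \<beta> 0" "w \<in> S" "((\<lambda>t. AD (ex (t *\<^sub>R \<beta>)) a) \<longlongrightarrow> w) F" "0 \<notin> I \<longrightarrow> w = 0" by blast
      then show "\<exists>w. w \<in> eig \<beta> 0 \<and> w \<in> S \<and> ((\<lambda>t. AD (ex (t *\<^sub>R \<beta>)) (c *\<^sub>R a)) \<longlongrightarrow> w) F \<and> (0 \<notin> I \<longrightarrow> w = 0)"
        by (intro exI[of _ "c *\<^sub>R w"]) (auto simp: AD_scaleR intro: tendsto_scaleR subspace_scale[OF S] subspace_scale[OF subspace_eig])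
    qed
  next
    case (step v)
    then obtain x where x: "x \<in> I" "v \<in> eig \<beta> x" "v \<in> S" by blast
    have "((\<lambda>t. exp (t * x) *\<^sub>R v) \<longlongrightarrow> (if x = 0 then 1 else 0) *\<^sub>R v) F" by (intro tendsto_scaleR F x tendsto_const)
    then have "((\<lambda>t. AD (ex (t *\<^sub>R \<beta>)) v) \<longlongrightarrow> (if x = 0 then v else 0)) F"
      by (auto simp: AD_eig[OF x(2)] split: if_splits)
    then show ?case using x subspace_0[OF S] subspace_0[OF subspace_eig, of \<beta> 0]
      by (intro exI[of _ "if x = 0 then v else 0"]) auto
  qed
  then show ?thesis using that by blast
qed

lemma exp_scale_tendsto:
  "x \<le> 0 \<Longrightarrow> ((\<lambda>t. exp (t * x)) \<longlongrightarrow> (if x = 0 then 1 else 0)) (at_top :: real filter)"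
  "0 \<le> x \<Longrightarrow> ((\<lambda>t. exp (t * x)) \<longlongrightarrow> (if x = 0 then 1 else 0)) (at_bot :: real filter)"
proof -
  show "((\<lambda>t. exp (t * x)) \<longlongrightarrow> (if x = 0 then 1 else 0)) at_top" if "x \<le> 0" for x :: real
  proof (cases "x = 0")
    case False
    then have "filterlim (\<lambda>t::real. t * x) at_bot at_top"
      using that by (intro filterlim_tendsto_neg_mult_at_bot[where f="\<lambda>_. x" and c=x, unfolded mult.commute[of x]])
        (auto simp: filterlim_ident)
    from filterlim_compose[OF exp_at_bot this] False show ?thesis by simp
  qed simp
  from this[of "-x"] show "((\<lambda>t. exp (t * x)) \<longlongrightarrow> (if x = 0 then 1 else 0)) at_bot" if "0 \<le> x"
    using that by (simp add: at_bot_mirror filterlim_filtermap)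
qed

text \<open>Stands in for the connected subgroup with Lie algebra \<open>S\<close>. Being purely
  algebraic, it permits induction over the exponential factors.\<close>

inductive_set gen :: "'e set \<Rightarrow> 'g set" for S where
  one: "\<one> \<in> gen S"
| step: "v \<in> S \<Longrightarrow> g \<in> gen S \<Longrightarrow> ex v \<otimes> g \<in> gen S"

lemma gen_ex: "v \<in> S \<Longrightarrow> ex v \<in> gen S"
  using gen.step[OF _ gen.one] by fastforce

lemma gen_mult: "g \<in> gen S \<Longrightarrow> h \<in> gen S \<Longrightarrow> g \<otimes> h \<in> gen S"
  by (induction rule: gen.induct) (auto simp: m_assoc intro: gen.step)

lemma gen_inv: assumes S: "subspace S" and g: "g \<in> gen S" shows "inv g \<in> gen S"
  using g
proof (induction rule: gen.induct)
  case (step v g)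
  then have "ex (- v) \<in> gen S" by (auto intro: gen_ex subspace_neg[OF S])
  then show ?case using step by (auto simp: inv_mult_group ex_minus intro: gen_mult)
qed (auto intro: gen.one)

lemma gen_mono: "S \<subseteq> T \<Longrightarrow> gen S \<subseteq> gen T"
proof
  fix g assume S: "S \<subseteq> T" and "g \<in> gen S"
  from this(2) show "g \<in> gen T" by (induction rule: gen.induct) (use S in \<open>auto intro: gen.intros\<close>)
qed

lemma ex_small_imp_gen:
  assumes H: "\<And>g h. g \<in> H \<Longrightarrow> h \<in> H \<Longrightarrow> g \<otimes> h \<in> H" "\<one> \<in> H"
    and S: "subspace S" and d: "\<delta> > 0" "\<And>v. v \<in> S \<Longrightarrow> norm v < \<delta> \<Longrightarrow> ex v \<in> H"
  shows "gen S \<subseteq> H"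
proof
  have ex: "ex v \<in> H" if "v \<in> S" for v
  proof -
    obtain n :: nat where n: "norm v / \<delta> < real n" using reals_Archimedean2 by blast
    have n0: "n > 0" using n d(1) by (metis divide_nonneg_pos gr0I norm_ge_zero not_less of_nat_0)
    have "norm ((1 / real n) *\<^sub>R v) < \<delta>" using n n0 d(1) by (simp add: field_simps)
    then have h: "ex ((1 / real n) *\<^sub>R v) \<in> H" using that by (intro d(2) subspace_scale[OF S])
    have "g [^] k \<in> H" if "g \<in> H" for g and k :: nat by (induction k) (auto intro: H that)
    from this[OF h, of n] show ?thesis using n0 ex_pow[of n "(1 / real n) *\<^sub>R v"] by simp
  qed
  fix g assume "g \<in> gen S"
  then show "g \<in> H" by (induction rule: gen.induct) (auto intro: H ex)
qed

text \<open>A subgroup containing a neighbourhood of the unit is open, and so is the union of its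
  other cosets.\<close>

lemma gen_UNIV: assumes "connected (UNIV :: 'g set)" shows "gen UNIV = UNIV"
proof -
  obtain N where N: "open N" "\<one> \<in> N" "\<And>g. g \<in> N \<Longrightarrow> \<exists>x. norm x < 1 \<and> g = ex x" by (rule ex_ball_nbhd[of 1]) auto
  have Ng: "N \<subseteq> gen UNIV" using N(3) by (auto intro: gen_ex)
  have cont: "continuous_on UNIV (\<lambda>h. h \<otimes> inv g)" for g by (intro continuous_on_mult_group continuous_intros)
  have nb: "open ((\<lambda>h. h \<otimes> inv g) -` N)" "g \<in> (\<lambda>h. h \<otimes> inv g) -` N" for g
    using open_vimage[OF N(1) cont] N(2) by auto
  have "open (gen UNIV)"
  proof (subst open_subopen, intro ballI)
    fix g assume g: "g \<in> gen UNIV"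
    have "(\<lambda>h. h \<otimes> inv g) -` N \<subseteq> gen UNIV"
    proof
      fix h assume "h \<in> (\<lambda>h. h \<otimes> inv g) -` N"
      then have "(h \<otimes> inv g) \<otimes> g \<in> gen UNIV" using Ng g by (intro gen_mult[of "h \<otimes> inv g"]) auto
      then show "h \<in> gen UNIV" by (simp add: m_assoc)
    qed
    with nb show "\<exists>T. open T \<and> g \<in> T \<and> T \<subseteq> gen UNIV" by blast
  qed
  moreover have "open (- gen UNIV)"
  proof (subst open_subopen, intro ballI)
    fix g assume g: "g \<in> - gen UNIV"
    have "(\<lambda>h. h \<otimes> inv g) -` N \<subseteq> - gen UNIV"
    proof
      fix h assume h: "h \<in> (\<lambda>h. h \<otimes> inv g) -` N"
      show "h \<in> - gen UNIV"
      proof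
        assume hg: "h \<in> gen UNIV"
        have "h \<otimes> inv g \<in> gen UNIV" using h Ng by auto
        then have "inv (h \<otimes> inv g) \<otimes> h \<in> gen UNIV" using hg by (intro gen_mult[OF gen_inv]) auto
        then show False using g by (simp add: inv_mult_group m_assoc)
      qed
    qed
    with nb show "\<exists>T. open T \<and> g \<in> T \<and> T \<subseteq> - gen UNIV" by blast
  qed
  then have "closed (gen UNIV)" by (simp add: closed_def)
  ultimately show ?thesis
    using assms gen.one[of UNIV] unfolding connected_clopen by (metis closed_closedin empty_iff open_openin subtopology_UNIV)
qed

end

section \<open>Orbits of opposite parabolic subgroups\<close>

context Lie_action
begin

text \<open>The tangent directions of the orbit at \<open>z\<close> are already exhausted by
  \<open>V\<close>. By \<open>transv_nbhd\<close>, elements near the unit then move \<open>z\<close>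
  as exponentials of \<open>V\<close> do.\<close>

definition transv where "transv V z \<longleftrightarrow> (\<forall>x. \<exists>a\<in>V. \<exists>b\<in>stab z. x = a + b)"

lemma transv_nbhd:
  assumes V: "subspace V" and z: "transv V z"
  obtains N where "open N" "\<one> \<in> N" "\<And>g. g \<in> N \<Longrightarrow> \<exists>a\<in>V. act g z = act (ex a) z"
proof -
  obtain N where o: "open N" "\<one> \<in> N" and
    N: "\<And>g. g \<in> N \<Longrightarrow> \<exists>a\<in>V. \<exists>b\<in>stab z. \<exists>c\<in>{0}. \<exists>d\<in>{0}. norm a < 1 \<and> norm b < 1 \<and> norm c < 1 \<and> norm d < 1 \<and>
       g = ex a \<otimes> ex b \<otimes> (ex c \<otimes> ex d)"
  proof (rule local_product[of V "stab z" "{0}" "{0}" 1])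
    show "\<exists>a\<in>V. \<exists>b\<in>stab z. \<exists>c\<in>{0}. \<exists>d\<in>{0}. x = a + b + (c + d)" for x
      using z unfolding transv_def by (metis add_0_right singletonI)
  qed (auto simp: V subspace_stab)
  show ?thesis
  proof (rule that[OF o])
    fix g assume g: "g \<in> N"
    obtain a b where "a \<in> V" "b \<in> stab z" "g = ex a \<otimes> ex b" using N[OF g] by auto
    then show "\<exists>a\<in>V. act g z = act (ex a) z" by (auto simp: act_mult act_stab)
  qed
qed

text \<open>Transversality at a moved point is carried back to \<open>z\<close> by \<open>AD\<close>
  and then holds wherever an entire function does not vanish. That set is connected, and lying on
  the same \<open>gen V\<close>-orbit is locally constant there; so every good parameter is reached
  from 0.\<close>

lemma transv_line:
  assumes V: "subspace V" "\<And>v. v \<in> V \<Longrightarrow> times_i v \<in> V" and z: "transv V z"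
  obtains h where "h holomorphic_on UNIV" "h 0 \<noteq> (0::complex)"
    "\<And>\<zeta>. h \<zeta> \<noteq> 0 \<Longrightarrow> \<exists>\<pi>\<in>gen V. act (ex (sc \<zeta> \<xi>)) z = act \<pi> z"
proof -
  let ?g = "\<lambda>\<zeta>. ex (sc \<zeta> \<xi>)"
  have inv: "inv (?g \<zeta>) = ?g (- \<zeta>)" for \<zeta> by (simp flip: ex_minus)
  obtain h where h: "h holomorphic_on UNIV" "h 0 \<noteq> (0::complex)"
    "\<And>\<zeta> x. h \<zeta> \<noteq> 0 \<Longrightarrow> \<exists>a\<in>V. \<exists>b\<in>stab z. x = AD (?g (- \<zeta>)) a + b"
  proof (rule entire_family_transversal[of "\<lambda>\<zeta>. AD (?g (- \<zeta>))" V "stab z"])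
    show "(\<lambda>\<zeta>. l (AD (?g (- \<zeta>)) w)) holomorphic_on UNIV" if "clin l" for l :: "'e \<Rightarrow> complex" and w
    proof -
      have "(\<lambda>\<zeta>::complex. - \<zeta>) holomorphic_on UNIV" by (intro holomorphic_on_minus holomorphic_on_ident)
      from holomorphic_on_compose_gen[OF this AD_entire_functional[OF that, of \<xi> w]]
      show ?thesis by (simp add: o_def)
    qed
    show "\<exists>a\<in>V. \<exists>b\<in>stab z. x = a + b" for x using z by (simp add: transv_def)
  qed (auto simp: V subspace_stab stab_times_i clin_Ad)
  have tr: "transv V (act (?g \<zeta>) z)" if hz: "h \<zeta> \<noteq> 0" for \<zeta>
    unfolding transv_def
  proof
    fix x
    obtain a b where ab: "a \<in> V" "b \<in> stab z" "AD (inv (?g \<zeta>)) x = AD (inv (?g \<zeta>)) a + b"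
      using h(3)[OF hz, of "AD (inv (?g \<zeta>)) x"] unfolding inv by blast
    have "x = AD (?g \<zeta>) (AD (inv (?g \<zeta>)) x)" by simp
    also have "\<dots> = a + AD (?g \<zeta>) b" unfolding ab(3) by (simp add: AD_add)
    finally show "\<exists>a\<in>V. \<exists>b\<in>stab (act (?g \<zeta>) z). x = a + b" using ab stab_act by blast
  qed
  define R where "R \<zeta> \<zeta>' \<longleftrightarrow> (\<exists>\<pi>\<in>gen V. act (?g \<zeta>') z = act \<pi> (act (?g \<zeta>) z))" for \<zeta> \<zeta>'
  have "R 0 \<zeta>" if \<zeta>: "h \<zeta> \<noteq> 0" for \<zeta>
  proof (rule connected_equivalence_relation[of "{\<zeta>. h \<zeta> \<noteq> 0}"])
    show "connected {\<zeta>. h \<zeta> \<noteq> 0}" by (rule entire_nonzero_set[OF h(1,2)])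
    show "R y x" if xy: "R x y" for x y
    proof -
      obtain \<pi> where "\<pi> \<in> gen V" "act (?g y) z = act \<pi> (act (?g x) z)" using xy by (auto simp: R_def)
      then show ?thesis unfolding R_def by (intro bexI[of _ "inv \<pi>"]) (auto simp: gen_inv V)
    qed
    show "R x w" if xy: "R x y" "R y w" for x y w
    proof -
      obtain \<pi> \<pi>' where "\<pi> \<in> gen V" "act (?g y) z = act \<pi> (act (?g x) z)" "\<pi>' \<in> gen V" "act (?g w) z = act \<pi>' (act (?g y) z)"
        using xy by (auto simp: R_def)
      then show ?thesis unfolding R_def by (intro bexI[of _ "\<pi>' \<otimes> \<pi>"]) (auto simp: gen_mult act_mult)
    qed
    fix a assume a: "a \<in> {\<zeta>. h \<zeta> \<noteq> 0}"
    then obtain N where N: "open N" "\<one> \<in> N" "\<And>g. g \<in> N \<Longrightarrow> \<exists>v\<in>V. act g (act (?g a) z) = act (ex v) (act (?g a) z)"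
      using transv_nbhd[OF V(1) tr[of a]] by blast
    have ct: "continuous_on UNIV (\<lambda>\<zeta>. ex (sc (\<zeta> - a) \<xi>))"
      by (intro continuous_on_ex bounded_linear.continuous_on[OF bounded_linear_sc_left] continuous_intros)
    define T where "T = (\<lambda>\<zeta>. ex (sc (\<zeta> - a) \<xi>)) -` N"
    have "open T" unfolding T_def by (rule open_vimage[OF N(1) ct])
    moreover have "a \<in> T" using N(2) by (simp add: T_def)
    moreover have "R a x" if xT: "x \<in> T" for x
    proof -
      have "?g x = ex (sc (x - a) \<xi>) \<otimes> ?g a" by (simp flip: ex_sc_add)
      moreover obtain v where "v \<in> V" "act (ex (sc (x - a) \<xi>)) (act (?g a) z) = act (ex v) (act (?g a) z)"
        using N(3) xT unfolding T_def by blast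
      ultimately show ?thesis unfolding R_def by (intro bexI[of _ "ex v"] gen_ex) (simp_all add: act_mult)
    qed
    ultimately show "\<exists>T. openin (top_of_set {\<zeta>. h \<zeta> \<noteq> 0}) T \<and> a \<in> T \<and> (\<forall>x\<in>T. R a x)"
      using a by (intro exI[of _ "T \<inter> {\<zeta>. h \<zeta> \<noteq> 0}"]) (auto simp: openin_open)
  qed (use h \<zeta> in auto)
  then show ?thesis using that[OF h(1,2)] by (simp add: R_def)
qed

text \<open>Every group element is a product of exponentials, and one further factor does not leave
  the closure. The element \<open>\<pi>\<close> of \<open>gen V\<close> is moved past that factor by
  conjugation, so the complex line starts at \<open>y\<close>, and the parameter 1 is a limit of
  good ones.\<close>

lemma transv_orbit_dense:
  assumes conn: "connected (UNIV :: 'g set)" and V: "subspace V" "\<And>v. v \<in> V \<Longrightarrow> times_i v \<in> V" and y: "transv V y"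
  shows "closure {g. \<exists>\<pi>\<in>gen V. act g y = act \<pi> y} = UNIV"
proof -
  define S where "S = {g. \<exists>\<pi>\<in>gen V. act g y = act \<pi> y}"
  have step0: "ex \<xi> \<otimes> g \<in> closure S" if g: "g \<in> S" for \<xi> g
  proof -
    obtain \<pi> where \<pi>: "\<pi> \<in> gen V" "act g y = act \<pi> y" using g by (auto simp: S_def)
    define \<xi>' where "\<xi>' = AD (inv \<pi>) \<xi>"
    obtain h where h: "h holomorphic_on UNIV" "h 0 \<noteq> (0::complex)"
      "\<And>\<zeta>. h \<zeta> \<noteq> 0 \<Longrightarrow> \<exists>\<pi>\<in>gen V. act (ex (sc \<zeta> \<xi>')) y = act \<pi> y"
      by (rule transv_line[OF V y, of \<xi>']) auto
    have inS: "ex (sc \<zeta> \<xi>) \<otimes> g \<in> S" if \<zeta>: "h \<zeta> \<noteq> 0" for \<zeta>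
    proof -
      obtain \<pi>' where \<pi>': "\<pi>' \<in> gen V" "act (ex (sc \<zeta> \<xi>')) y = act \<pi>' y" using h(3)[OF \<zeta>] by blast
      have "ex (sc \<zeta> \<xi>) \<otimes> \<pi> = \<pi> \<otimes> ex (sc \<zeta> \<xi>')" unfolding \<xi>'_def by (simp add: ex_conj'[of \<pi>] flip: AD_sc)
      then have "act (ex (sc \<zeta> \<xi>) \<otimes> g) y = act \<pi> (act \<pi>' y)" using \<pi>(2) \<pi>'(2) by (metis act_mult)
      then show ?thesis unfolding S_def using \<pi>(1) \<pi>'(1) by (auto simp flip: act_mult intro: gen_mult)
    qed
    have "(1::complex) \<in> closure {\<zeta>. h \<zeta> \<noteq> 0}" by (rule entire_nonzero_set[OF h(1,2)])
    then obtain s where s: "\<And>n. h (s n) \<noteq> 0" "s \<longlonglongrightarrow> 1" unfolding closure_sequential by blast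
    have "(\<lambda>n. sc (s n) \<xi>) \<longlonglongrightarrow> sc 1 \<xi>" by (rule bounded_linear.tendsto[OF bounded_linear_sc_left s(2)])
    then have "(\<lambda>n. ex (sc (s n) \<xi>) \<otimes> g) \<longlonglongrightarrow> ex (sc 1 \<xi>) \<otimes> g" by (intro tendsto_mult_group ex_tendsto tendsto_const)
    then show ?thesis using inS[OF s(1)] unfolding closure_sequential by (intro exI[of _ "\<lambda>n. ex (sc (s n) \<xi>) \<otimes> g"]) simp
  qed
  have step: "ex \<xi> \<otimes> g \<in> closure S" if g: "g \<in> closure S" for \<xi> g
  proof -
    have "continuous_on (closure S) (\<lambda>g. ex \<xi> \<otimes> g)" by (intro continuous_on_mult_group continuous_intros)
    from image_closure_subset[OF this, of "closure S"] step0 g show ?thesis by auto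
  qed
  have "\<one> \<in> S" unfolding S_def by (intro CollectI bexI[of _ \<one>] gen.one) simp
  then have oneS: "\<one> \<in> closure S" by (rule subsetD[OF closure_subset])
  have "g \<in> closure S" if "g \<in> gen UNIV" for g
    using that by (induction rule: gen.induct) (auto intro: step oneS)
  then show ?thesis using gen_UNIV[OF conn] by (auto simp: S_def)
qed

text \<open>
  Two points of one orbit at which the parabolic algebra of non-positive weights is transversal
  to the stabilizer lie on the same orbit of the parabolic group, since these orbits are open and
  dense; the contraction \<open>exp (t \<beta>)\<close> then moves them into one orbit of the centralizer.
\<close>

lemma same_centralizer_orbit:
  assumes conn: "connected (UNIV :: 'g set)"
    and y: "transv (Eg UNIV \<beta> {..0}) y" and c: "transv (Eg UNIV \<beta> {..0}) c" and cy: "c = act g0 y"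
    and fy: "\<beta> \<in> stab y" and fc: "\<beta> \<in> stab c"
  shows "\<exists>\<gamma>\<in>gen (eig \<beta> 0). c = act \<gamma> y"
proof -
  let ?V = "Eg UNIV \<beta> {..0}"
  have V: "subspace ?V" "\<And>v. v \<in> ?V \<Longrightarrow> times_i v \<in> ?V" by (auto intro: subspace_Eg Eg_times_i)
  obtain N where N: "open N" "\<one> \<in> N" "\<And>g. g \<in> N \<Longrightarrow> \<exists>a\<in>?V. act g c = act (ex a) c"
    using transv_nbhd[OF V(1) c] by blast
  have cont: "continuous_on UNIV (\<lambda>h. h \<otimes> inv g0)" by (intro continuous_on_mult_group continuous_intros)
  define N' where "N' = (\<lambda>h. h \<otimes> inv g0) -` N"
  have oN: "open N'" unfolding N'_def by (rule open_vimage[OF N(1) cont])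
  have gN: "g0 \<in> N'" using N(2) by (simp add: N'_def)
  define D where "D = {g. \<exists>\<pi>\<in>gen ?V. act g y = act \<pi> y}"
  \<comment> \<open>Density is used at \<open>y\<close> and openness at \<open>c\<close>: the
    elements near \<open>g0\<close> that move \<open>y\<close> along the local orbit of
    \<open>c\<close> form an open set, which meets \<open>D\<close>.\<close>
  have "closure D = UNIV" unfolding D_def by (rule transv_orbit_dense[OF conn V y])
  then have "N' \<inter> closure D \<noteq> {}" using gN by auto
  then have "N' \<inter> D \<noteq> {}" using open_Int_closure_eq_empty[OF oN] by blast
  then obtain h where h: "h \<in> N'" "\<exists>\<pi>\<in>gen ?V. act h y = act \<pi> y" by (auto simp: D_def)
  then obtain \<pi> where \<pi>: "\<pi> \<in> gen ?V" "act h y = act \<pi> y" by blast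
  obtain a where a: "a \<in> ?V" "act (h \<otimes> inv g0) c = act (ex a) c" using h(1) N(3) by (auto simp: N'_def)
  have "act (h \<otimes> inv g0) c = act h y" by (simp add: cy act_mult)
  then have "c = act (ex (- a) \<otimes> \<pi>) y" using a(2) \<pi>(2) by (metis act_ex_cancel(1) act_mult)
  moreover have "ex (- a) \<otimes> \<pi> \<in> gen ?V" using a(1) \<pi>(1) V(1) by (intro gen.step subspace_neg)
  ultimately obtain \<pi> where \<pi>: "\<pi> \<in> gen ?V" "c = act \<pi> y" by blast
  \<comment> \<open>Factor by factor: conjugation by \<open>ex (t *\<^sub>R \<beta>)\<close> turns
    each factor into the exponential of a vector that converges to its component of weight
    0.\<close>
  have lim: "\<exists>\<gamma>\<in>gen (eig \<beta> 0). ((\<lambda>t. ex (t *\<^sub>R \<beta>) \<otimes> \<pi> \<otimes> inv (ex (t *\<^sub>R \<beta>))) \<longlongrightarrow> \<gamma>) at_top"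
    using \<pi>(1)
  proof (induction rule: gen.induct)
    case one
    then show ?case by (intro bexI[of _ \<one>]) (auto intro: gen.one)
  next
    case (step v g)
    then obtain \<gamma> where \<gamma>: "\<gamma> \<in> gen (eig \<beta> 0)" "((\<lambda>t. ex (t *\<^sub>R \<beta>) \<otimes> g \<otimes> inv (ex (t *\<^sub>R \<beta>))) \<longlongrightarrow> \<gamma>) at_top" by blast
    obtain w where w: "w \<in> eig \<beta> 0" "((\<lambda>t. AD (ex (t *\<^sub>R \<beta>)) v) \<longlongrightarrow> w) at_top"
      by (rule Eg_limit[OF subspace_UNIV step(1), of at_top]) (use exp_scale_tendsto(1) in auto)
    have "((\<lambda>t. ex (AD (ex (t *\<^sub>R \<beta>)) v) \<otimes> (ex (t *\<^sub>R \<beta>) \<otimes> g \<otimes> inv (ex (t *\<^sub>R \<beta>)))) \<longlongrightarrow> ex w \<otimes> \<gamma>) at_top"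
      by (intro tendsto_mult_group ex_tendsto w \<gamma>)
    moreover have "ex (AD (ex (t *\<^sub>R \<beta>)) v) \<otimes> (ex (t *\<^sub>R \<beta>) \<otimes> g \<otimes> inv (ex (t *\<^sub>R \<beta>))) = ex (t *\<^sub>R \<beta>) \<otimes> (ex v \<otimes> g) \<otimes> inv (ex (t *\<^sub>R \<beta>))" for t
      by (simp add: m_assoc flip: ex_conj)
    ultimately show ?case using w(1) \<gamma>(1) by (intro bexI[of _ "ex w \<otimes> \<gamma>"] gen.step) auto
  qed
  then obtain \<gamma> where \<gamma>: "\<gamma> \<in> gen (eig \<beta> 0)" "((\<lambda>t. ex (t *\<^sub>R \<beta>) \<otimes> \<pi> \<otimes> inv (ex (t *\<^sub>R \<beta>))) \<longlongrightarrow> \<gamma>) at_top" by blast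
  have "((\<lambda>t. act (ex (t *\<^sub>R \<beta>) \<otimes> \<pi> \<otimes> inv (ex (t *\<^sub>R \<beta>))) y) \<longlongrightarrow> act \<gamma> y) at_top"
    by (intro tendsto_act \<gamma> tendsto_const)
  moreover have "act (ex (t *\<^sub>R \<beta>) \<otimes> \<pi> \<otimes> inv (ex (t *\<^sub>R \<beta>))) y = c" for t
  proof -
    have "act (inv (ex (t *\<^sub>R \<beta>))) y = y" using fy[unfolded stab_iff, rule_format, of "-t"] by (simp add: ex_minus)
    then show ?thesis using fc by (simp add: act_mult stab_iff flip: \<pi>(2))
  qed
  ultimately have "((\<lambda>t::real. c) \<longlongrightarrow> act \<gamma> y) at_top" by simp
  then have "c = act \<gamma> y" by (simp add: tendsto_const_iff)
  with \<gamma>(1) show ?thesis by blast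
qed

end

section \<open>Closed subgroups\<close>

lemma complement_exists:
  fixes h :: "'a::real_vector set"
  assumes "subspace h"
  obtains W where "subspace W" "W \<inter> h = {0}" "\<And>x. \<exists>a\<in>W. \<exists>b\<in>h. x = a + b"
proof -
  obtain B where B: "B \<subseteq> h" "independent B" "h \<subseteq> span B"
    by (rule maximal_independent_subset[of h])
  obtain C where C: "B \<subseteq> C" "independent C" "UNIV \<subseteq> span C"
    by (rule maximal_independent_subset_extend[OF subset_UNIV B(2)])
  have hB: "h = span B" using B assms by (simp add: span_minimal subset_antisym)
  define T where "T = construct C (\<lambda>b. if b \<in> B then 0 else b)"
  have T: "linear T" "\<And>b. b \<in> C \<Longrightarrow> T b = (if b \<in> B then 0 else b)"
    unfolding T_def by (rule linear_construct[OF C(2)]) (rule construct_basis[OF C(2)])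
  have sub: "subspace {x. T x = 0}" "subspace {x. T x = x}"
    using T(1) by (auto simp: subspace_def linear_add linear_cmul linear_0)
  have "B \<subseteq> {x. T x = 0}" "C - B \<subseteq> {x. T x = x}" using T(2) C(1) by auto
  note sm = span_minimal[OF this(1) sub(1)] span_minimal[OF this(2) sub(2)]
  have T0: "T x = 0" if "x \<in> h" for x using sm(1) that hB by auto
  have T1: "T x = x" if "x \<in> span (C - B)" for x using sm(2) that by auto
  show ?thesis
  proof (rule that[of "span (C - B)"])
    show "span (C - B) \<inter> h = {0}"
    proof (intro equalityI subsetI)
      fix x assume "x \<in> span (C - B) \<inter> h"
      then show "x \<in> {0}" using T0[of x] T1[of x] by simp
    qed (use subspace_0[OF assms] in \<open>simp add: span_zero\<close>)
    fix x
    have "x \<in> span ((C - B) \<union> B)" using C by (auto simp: Un_absorb2)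
    then show "\<exists>a\<in>span (C - B). \<exists>b\<in>h. x = a + b" unfolding span_Un hB by blast
  qed simp
qed

context complex_Lie
begin

lemma subgroup_mult: "subgroup H L \<Longrightarrow> g \<in> H \<Longrightarrow> h \<in> H \<Longrightarrow> g \<otimes> h \<in> H"
  and subgroup_inv: "subgroup H L \<Longrightarrow> g \<in> H \<Longrightarrow> inv g \<in> H"
  and subgroup_one: "subgroup H L \<Longrightarrow> \<one> \<in> H"
  by (auto intro: subgroup.m_closed subgroup.m_inv_closed subgroup.one_closed)

abbreviation lie where "lie \<equiv> lie_algebra_of L A"

lemma lie_iff: "\<xi> \<in> lie H \<longleftrightarrow> (\<forall>t::real. ex (t *\<^sub>R \<xi>) \<in> H)"
  by (simp add: lie_algebra_of_def)

lemma ex_lie: "\<xi> \<in> lie H \<Longrightarrow> ex \<xi> \<in> H"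
  using lie_iff[of \<xi> H] by (metis scaleR_one)

lemma lie_scale: "\<xi> \<in> lie H \<Longrightarrow> c *\<^sub>R \<xi> \<in> lie H"
  by (simp add: lie_iff)

lemma AD_lie: "subgroup H L \<Longrightarrow> g \<in> H \<Longrightarrow> \<xi> \<in> lie H \<Longrightarrow> AD g \<xi> \<in> lie H"
  unfolding lie_iff by (auto simp flip: ex_conj_scale intro!: subgroup_mult subgroup_inv)

text \<open>Cartan's argument: with \<open>k n\<close> the integer part of
  \<open>t / norm (w n)\<close>, the powers \<open>ex (w n) [^] k n\<close> lie in \<open>H\<close>
  and converge to \<open>ex (t *\<^sub>R u)\<close>.\<close>

lemma lie_of_directions:
  assumes H: "closed H" "subgroup H L" and w: "\<And>n. ex (w n) \<in> H" "\<And>n. w n \<noteq> 0" "w \<longlonglongrightarrow> 0"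
    and u: "(\<lambda>n. w n /\<^sub>R norm (w n)) \<longlonglongrightarrow> u"
  shows "u \<in> lie H"
proof -
  have pos: "ex (t *\<^sub>R u) \<in> H" if t: "t \<ge> 0" for t :: real
  proof -
    define k where "k n = nat \<lfloor>t / norm (w n)\<rfloor>" for n
    have kn: "\<bar>real (k n) * norm (w n) - t\<bar> \<le> norm (w n)" for n
    proof -
      have p: "norm (w n) > 0" using w(2) by simp
      have "t / norm (w n) \<ge> 0" using t by simp
      then have "real (k n) \<le> t / norm (w n)" "t / norm (w n) \<le> real (k n) + 1" unfolding k_def by linarith+
      then have "real (k n) * norm (w n) \<le> t" "t \<le> (real (k n) + 1) * norm (w n)"
        using p by (simp_all add: pos_le_divide_eq pos_divide_le_eq)
      then show ?thesis by (simp add: algebra_simps abs_le_iff)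
    qed
    have "(\<lambda>n. real (k n) * norm (w n) - t) \<longlonglongrightarrow> 0"
    proof (rule Lim_null_comparison)
      show "\<forall>\<^sub>F n in sequentially. norm (real (k n) * norm (w n) - t) \<le> norm (w n)" using kn by simp
      show "(\<lambda>n. norm (w n)) \<longlonglongrightarrow> 0" using w(3) tendsto_norm_zero by blast
    qed
    then have "(\<lambda>n. real (k n) * norm (w n)) \<longlonglongrightarrow> t" by (rule LIM_zero_cancel)
    from tendsto_scaleR[OF this u]
    have l: "(\<lambda>n. (real (k n) * norm (w n)) *\<^sub>R (w n /\<^sub>R norm (w n))) \<longlonglongrightarrow> t *\<^sub>R u" .
    have e: "(real (k n) * norm (w n)) *\<^sub>R (w n /\<^sub>R norm (w n)) = real (k n) *\<^sub>R w n" for n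
      using w(2)[of n] by (simp add: mult.assoc)
    from l have "(\<lambda>n. real (k n) *\<^sub>R w n) \<longlonglongrightarrow> t *\<^sub>R u" unfolding e .
    then have lim: "(\<lambda>n. ex (real (k n) *\<^sub>R w n)) \<longlonglongrightarrow> ex (t *\<^sub>R u)" by (rule ex_tendsto)
    have inH: "ex (real (k n) *\<^sub>R w n) \<in> H" for n
    proof -
      have "g [^] j \<in> H" if "g \<in> H" for g and j :: nat
        by (induction j) (auto intro: subgroup_mult[OF H(2)] subgroup_one[OF H(2)] that)
      then show ?thesis using w(1) by (simp add: ex_pow)
    qed
    show ?thesis by (rule closed_sequentially[OF H(1) inH lim])
  qed
  have "ex (t *\<^sub>R u) \<in> H" for t :: real
  proof (cases "t \<ge> 0")
    case False
    then have "inv (ex ((- t) *\<^sub>R u)) \<in> H" by (intro subgroup_inv[OF H(2)] pos) auto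
    then show ?thesis by (simp flip: ex_minus)
  qed (rule pos)
  then show ?thesis by (simp add: lie_iff)
qed

text \<open>\<open>lie_algebra_of\<close> is described by exponentials, so closure under sums is not
  formal. The logarithms \<open>w n\<close> of
  \<open>ex (t n *\<^sub>R a) \<otimes> ex (t n *\<^sub>R b)\<close>, divided by \<open>t n\<close>,
  tend to \<open>a + b\<close>, and \<open>lie_of_directions\<close> applies to their
  directions.\<close>

lemma lie_add:
  assumes H: "closed H" "subgroup H L" and ab: "a \<in> lie H" "b \<in> lie H" shows "a + b \<in> lie H"
proof (cases "a + b = 0")
  case True
  then show ?thesis by (simp add: lie_iff subgroup_one[OF H(2)])
next
  case False
  define s where "s = a + b"
  have s: "s \<noteq> 0" using False by (simp add: s_def)
  have se: "strict_diff (\<lambda>t::real. \<phi> (ex (t *\<^sub>R x))) (\<lambda>t. t *\<^sub>R x)" for x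
    by (rule strict_diff_compose[OF strict_diff_bounded_linear[OF bounded_linear_scaleR_left[of x]] ex_strict_diff])
  define F where "F t = m (\<phi> (ex (t *\<^sub>R a))) (\<phi> (ex (t *\<^sub>R b)))" for t :: real
  have F: "strict_diff F (\<lambda>t. t *\<^sub>R s)" unfolding F_def s_def using strict_diff_m[OF se se] by (simp add: scaleR_add_right)
  obtain r1 where r1: "r1 > 0" "\<And>x y. norm x < r1 \<Longrightarrow> norm y < r1 \<Longrightarrow> norm (\<phi> (ex x) - \<phi> (ex y) - (x - y)) \<le> (1/2) * norm (x - y)"
    by (rule strict_diffE[OF ex_strict_diff, of "1/2"]) auto
  obtain N where N: "open N" "\<one> \<in> N" "\<And>g. g \<in> N \<Longrightarrow> \<exists>x. norm x < r1 \<and> g = ex x" by (rule ex_ball_nbhd[OF r1(1)]) blast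
  define t where "t n = 1 / real (Suc n)" for n
  have t0: "t \<longlonglongrightarrow> 0" unfolding t_def using LIMSEQ_inverse_real_of_nat by (simp add: inverse_eq_divide)
  have tp: "t n > 0" for n by (simp add: t_def)
  define g where "g n = ex (t n *\<^sub>R a) \<otimes> ex (t n *\<^sub>R b)" for n
  have ta: "(\<lambda>n. ex (t n *\<^sub>R x)) \<longlonglongrightarrow> \<one>" for x
    using ex_tendsto[OF tendsto_scaleR[OF t0 tendsto_const, of x]] by simp
  have g1: "g \<longlonglongrightarrow> \<one>" unfolding g_def using tendsto_mult_group[OF ta[of a] ta[of b]] by simp
  have gH: "g n \<in> H" for n unfolding g_def using ab by (auto intro!: subgroup_mult[OF H(2)] simp: lie_iff)
  have evF: "\<forall>\<^sub>F n in sequentially. \<phi> (g n) = F (t n)"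
  proof -
    have "\<forall>\<^sub>F n in sequentially. ex (t n *\<^sub>R a) \<in> dom \<and> ex (t n *\<^sub>R b) \<in> dom"
      by (intro eventually_conj topological_tendstoD[OF ta open_dom one_dom])
    then show ?thesis by eventually_elim (simp add: F_def m_def psi_phi g_def)
  qed
  define w where "w n = (SOME w. norm w < r1 \<and> g n = ex w)" for n
  have evw: "\<forall>\<^sub>F n in sequentially. norm (w n) < r1 \<and> g n = ex (w n)"
    using topological_tendstoD[OF g1 N(1,2)]
  proof eventually_elim
    case (elim n)
    from someI_ex[OF N(3)[OF elim]] show ?case unfolding w_def .
  qed
  have lim: "(\<lambda>n. w n /\<^sub>R t n) \<longlonglongrightarrow> s"
  proof (rule tendstoI)
    fix e :: real assume e: "e > 0"
    \<comment> \<open>The part \<open>2 * (1 + norm s)\<close> comes from bounding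
      \<open>w n\<close> by \<open>t n\<close>, one unit from the error of \<open>F\<close>, and the
      last unit makes the final inequality strict.\<close>
    define e' where "e' = min 1 (e / (2 * (1 + norm s) + 2))"
    have pos: "2 * (1 + norm s) + 2 > 0" by (simp add: add_pos_nonneg add_nonneg_pos)
    have e': "e' > 0" "e' \<le> 1" using e pos by (auto simp: e'_def)
    obtain \<rho>1 where \<rho>1: "\<rho>1 > 0" "\<And>x y. norm x < \<rho>1 \<Longrightarrow> norm y < \<rho>1 \<Longrightarrow> norm (F x - F y - (x - y) *\<^sub>R s) \<le> e' * norm (x - y)"
      by (rule strict_diffE[OF F e'(1)]) blast
    obtain \<rho>2 where \<rho>2: "\<rho>2 > 0" "\<And>x y. norm x < \<rho>2 \<Longrightarrow> norm y < \<rho>2 \<Longrightarrow> norm (\<phi> (ex x) - \<phi> (ex y) - (x - y)) \<le> e' * norm (x - y)"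
      by (rule strict_diffE[OF ex_strict_diff e'(1)]) blast
    have "\<forall>\<^sub>F n in sequentially. t n < min \<rho>1 (\<rho>2 / (2 * (1 + norm s)))"
      using \<rho>1(1) \<rho>2(1) by (intro order_tendstoD(2)[OF t0]) (auto simp: add_pos_nonneg)
    with evF evw show "\<forall>\<^sub>F n in sequentially. dist (w n /\<^sub>R t n) s < e"
    proof eventually_elim
      case (elim n)
      have F0: "F 0 = 0" using F by (simp add: strict_diff_def)
      have 1: "norm (F (t n) - t n *\<^sub>R s) \<le> e' * t n" using \<rho>1(2)[of "t n" 0] elim \<rho>1(1) tp[of n] by (simp add: F0)
      have et: "e' * t n \<le> 1 * t n" using e' tp[of n] by (intro mult_right_mono) auto
      have 2: "norm (F (t n)) \<le> (1 + norm s) * t n"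
      proof -
        have "norm (F (t n)) \<le> norm (F (t n) - t n *\<^sub>R s) + t n * norm s"
          using norm_triangle_ineq[of "F (t n) - t n *\<^sub>R s" "t n *\<^sub>R s"] tp[of n] by simp
        moreover have "norm (F (t n) - t n *\<^sub>R s) \<le> t n" using 1 et by linarith
        moreover have "(1 + norm s) * t n = t n + t n * norm s" by (simp add: algebra_simps)
        ultimately show ?thesis by linarith
      qed
      have wF: "\<phi> (ex (w n)) = F (t n)" using elim by simp
      have 3: "norm (F (t n) - w n) \<le> 1/2 * norm (w n)" using r1(2)[of "w n" 0] elim r1(1) wF by (simp add: phi_one)
      have 4: "norm (w n) \<le> 2 * norm (F (t n))"
        using norm_triangle_ineq4[of "F (t n)" "F (t n) - w n"] 3 by simp
      have 5: "norm (w n) \<le> 2 * (1 + norm s) * t n" using 2 4 by linarith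
      have "t n * (2 * (1 + norm s)) < \<rho>2" using elim by (simp add: less_divide_eq add_pos_nonneg split: if_splits)
      then have "norm (w n) < \<rho>2" using 5 by (simp add: mult.commute)
      then have 6: "norm (F (t n) - w n) \<le> e' * norm (w n)" using \<rho>2(2)[of "w n" 0] \<rho>2(1) wF by (simp add: phi_one)
      have "norm (w n - t n *\<^sub>R s) \<le> norm (F (t n) - w n) + norm (F (t n) - t n *\<^sub>R s)"
        using norm_triangle_ineq4[of "F (t n) - t n *\<^sub>R s" "F (t n) - w n"] by simp
      also have "\<dots> \<le> e' * (2 * (1 + norm s) * t n) + e' * t n"
        using 1 6 mult_left_mono[OF 5, of e'] e' by linarith
      also have "\<dots> = (e' * (2 * (1 + norm s) + 1)) * t n" by (simp add: algebra_simps)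
      also have "\<dots> < e * t n"
      proof (rule mult_strict_right_mono[OF _ tp])
        have "e' \<le> e / (2 * (1 + norm s) + 2)" by (simp add: e'_def)
        then have "e' * (2 * (1 + norm s) + 2) \<le> e" using pos by (simp add: pos_le_divide_eq)
        then show "e' * (2 * (1 + norm s) + 1) < e" using e'(1) by (simp add: algebra_simps)
      qed
      finally have 7: "norm (w n - t n *\<^sub>R s) < e * t n" .
      have "w n /\<^sub>R t n - s = (w n - t n *\<^sub>R s) /\<^sub>R t n" using tp[of n] by (simp add: scaleR_diff_right)
      then have "dist (w n /\<^sub>R t n) s = norm (w n - t n *\<^sub>R s) / t n"
        using tp[of n] by (simp add: dist_norm divide_inverse mult.commute)
      then show ?case using 7 tp[of n] by (simp add: pos_divide_less_eq)
    qed
  qed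
  have "\<forall>\<^sub>F n in sequentially. w n /\<^sub>R t n \<noteq> 0" by (rule tendsto_imp_eventually_ne[OF lim s])
  with evw have "\<forall>\<^sub>F n in sequentially. w n \<noteq> 0 \<and> g n = ex (w n)" by eventually_elim auto
  then obtain M where M: "\<And>n. n \<ge> M \<Longrightarrow> w n \<noteq> 0 \<and> g n = ex (w n)" by (auto simp: eventually_sequentially)
  have "s /\<^sub>R norm s \<in> lie H"
  proof (rule lie_of_directions[OF H, of "\<lambda>n. w (n + M)"])
    show "ex (w (n + M)) \<in> H" for n using M[of "n + M"] gH[of "n + M"] by simp
    show "w (n + M) \<noteq> 0" for n using M[of "n + M"] by simp
    have "(\<lambda>n. t n *\<^sub>R (w n /\<^sub>R t n)) \<longlonglongrightarrow> 0 *\<^sub>R s" by (intro tendsto_scaleR t0 lim)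
    moreover have "t n *\<^sub>R (w n /\<^sub>R t n) = w n" for n using tp[of n] by simp
    ultimately have "w \<longlonglongrightarrow> 0" by simp
    then show "(\<lambda>n. w (n + M)) \<longlonglongrightarrow> 0" by (rule LIMSEQ_ignore_initial_segment)
    have "(\<lambda>n. (w n /\<^sub>R t n) /\<^sub>R norm (w n /\<^sub>R t n)) \<longlonglongrightarrow> s /\<^sub>R norm s"
      using s by (intro tendsto_scaleR tendsto_inverse tendsto_norm lim) auto
    moreover have "(w n /\<^sub>R t n) /\<^sub>R norm (w n /\<^sub>R t n) = w n /\<^sub>R norm (w n)" for n using tp[of n] by simp
    ultimately have "(\<lambda>n. w n /\<^sub>R norm (w n)) \<longlonglongrightarrow> s /\<^sub>R norm s" by (simp only:)
    then show "(\<lambda>n. w (n + M) /\<^sub>R norm (w (n + M))) \<longlonglongrightarrow> s /\<^sub>R norm s" by (rule LIMSEQ_ignore_initial_segment)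
  qed
  from lie_scale[OF this, of "norm s"] show ?thesis using s by (simp add: s_def)
qed

lemma subspace_lie: "closed H \<Longrightarrow> subgroup H L \<Longrightarrow> subspace (lie H)"
  by (intro subspaceI lie_add lie_scale) (auto simp: lie_iff subgroup_one)

text \<open>Otherwise nonzero \<open>w n\<close> in \<open>W\<close> tend to 0 with exponentials in
  \<open>H\<close>. By compactness of the ball their directions accumulate at a unit vector of
  \<open>W\<close>, which \<open>lie_of_directions\<close> puts into \<open>lie H\<close>.\<close>

lemma closed_subgroup_transversal:
  assumes H: "closed H" "subgroup H L" and W: "subspace W" "W \<inter> lie H \<subseteq> {0}"
  obtains \<delta> where "\<delta> > 0" "\<And>w. w \<in> W \<Longrightarrow> norm w < \<delta> \<Longrightarrow> ex w \<in> H \<Longrightarrow> w = 0"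
proof (rule ccontr)
  assume neg: "\<not> thesis"
  have "\<exists>w. w \<in> W \<and> norm w < 1 / real (Suc n) \<and> ex w \<in> H \<and> w \<noteq> 0" for n
    using neg that[of "1 / real (Suc n)"] by fastforce
  then obtain w where w: "\<And>n. w n \<in> W" "\<And>n::nat. norm (w n) < 1 / real (Suc n)" "\<And>n. ex (w n) \<in> H" "\<And>n. w n \<noteq> 0" by metis
  define u where "u n = w n /\<^sub>R norm (w n)" for n
  have nu: "norm (u n) = 1" "u n \<in> W" for n using w by (auto simp: u_def intro: subspace_scale[OF W(1)])
  have "seq_compact (cball (0::'e) 1)" by (rule compact_imp_seq_compact[OF compact_cball_fin_dim])
  then obtain l q where l: "strict_mono (q :: nat \<Rightarrow> nat)" "(u \<circ> q) \<longlonglongrightarrow> l"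
    using nu(1) unfolding seq_compact_def by (metis mem_cball_0 order_refl)
  have w0: "w \<longlonglongrightarrow> 0"
  proof (rule Lim_null_comparison)
    show "\<forall>\<^sub>F n in sequentially. norm (w n) \<le> 1 / real (Suc n)" using w(2) by (auto intro!: always_eventually less_imp_le)
    show "(\<lambda>n. 1 / real (Suc n)) \<longlonglongrightarrow> 0" using LIMSEQ_inverse_real_of_nat by (simp add: inverse_eq_divide)
  qed
  have "l \<in> lie H"
  proof (rule lie_of_directions[OF H, of "w \<circ> q"])
    show "(w \<circ> q) \<longlonglongrightarrow> 0" using w0 l(1) by (rule LIMSEQ_subseq_LIMSEQ)
    show "(\<lambda>n. (w \<circ> q) n /\<^sub>R norm ((w \<circ> q) n)) \<longlonglongrightarrow> l" using l(2) by (simp add: u_def o_def)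
  qed (use w in auto)
  moreover have "l \<in> W"
    using closed_sequentially[OF closed_subspace_fin_dim[OF W(1)], of "u \<circ> q"] nu(2) l(2) by auto
  moreover have "norm l = 1"
    using LIMSEQ_unique[OF tendsto_norm[OF l(2)], of 1] nu(1) by (simp add: o_def)
  ultimately show False using W(2) by auto
qed

text \<open>\<open>local_product\<close> with a complement \<open>W\<close> of \<open>lie H\<close>
  as an extra factor. For an element of \<open>H\<close> the exponential of the
  \<open>W\<close>-part lies in \<open>H\<close> as well, and is trivial by transversality.\<close>

lemma closed_subgroup_product:
  assumes H: "closed H" "subgroup H L" "subspace (lie H)"
    and V: "subspace V1" "subspace V2" "subspace V3" "V1 \<subseteq> lie H" "V2 \<subseteq> lie H" "V3 \<subseteq> lie H"
    and sp: "\<And>x. x \<in> lie H \<Longrightarrow> \<exists>a\<in>V1. \<exists>b\<in>V2. \<exists>c\<in>V3. x = a + (b + c)" and d: "\<delta> > 0"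
  obtains N where "open N" "\<one> \<in> N"
    "\<And>g. g \<in> N \<Longrightarrow> g \<in> H \<Longrightarrow> \<exists>a\<in>V1. \<exists>b\<in>V2. \<exists>c\<in>V3. norm a < \<delta> \<and> norm b < \<delta> \<and> norm c < \<delta> \<and> g = ex a \<otimes> (ex b \<otimes> ex c)"
proof -
  obtain W where W: "subspace W" "W \<inter> lie H = {0}" "\<And>x. \<exists>a\<in>W. \<exists>b\<in>lie H. x = a + b"
    using complement_exists[OF H(3)] by blast
  have W': "W \<inter> lie H \<subseteq> {0}" using W(2) by simp
  obtain \<delta>' where \<delta>': "\<delta>' > 0" "\<And>w. w \<in> W \<Longrightarrow> norm w < \<delta>' \<Longrightarrow> ex w \<in> H \<Longrightarrow> w = 0"
    using closed_subgroup_transversal[OF H(1,2) W(1) W'] by blast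
  have m: "min \<delta> \<delta>' > 0" using d \<delta>'(1) by simp
  obtain N where o: "open N" "\<one> \<in> N" and N:
    "\<And>g. g \<in> N \<Longrightarrow> \<exists>w\<in>W. \<exists>a\<in>V1. \<exists>b\<in>V2. \<exists>c\<in>V3. norm w < min \<delta> \<delta>' \<and> norm a < min \<delta> \<delta>' \<and> norm b < min \<delta> \<delta>' \<and> norm c < min \<delta> \<delta>' \<and>
       g = ex w \<otimes> ex a \<otimes> (ex b \<otimes> ex c)"
  proof (rule local_product[OF W(1) V(1-3) _ m])
    fix x
    obtain w y where "w \<in> W" "y \<in> lie H" "x = w + y" using W(3) by blast
    moreover obtain a b c where "a \<in> V1" "b \<in> V2" "c \<in> V3" "y = a + (b + c)" using sp calculation(2) by blast
    ultimately show "\<exists>a\<in>W. \<exists>b\<in>V1. \<exists>c\<in>V2. \<exists>d\<in>V3. x = a + b + (c + d)"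
      by (intro bexI[of _ w] bexI[of _ a] bexI[of _ b] bexI[of _ c]) (simp_all add: add.assoc)
  qed blast
  show ?thesis
  proof (rule that[OF o])
    fix g assume g: "g \<in> N" "g \<in> H"
    obtain w a b c where *: "w \<in> W" "a \<in> V1" "b \<in> V2" "c \<in> V3" "norm w < \<delta>'" "norm a < \<delta>" "norm b < \<delta>" "norm c < \<delta>"
      "g = ex w \<otimes> ex a \<otimes> (ex b \<otimes> ex c)" using N[OF g(1)] by auto
    have abc: "ex a \<otimes> (ex b \<otimes> ex c) \<in> H" using * V by (auto intro!: subgroup_mult[OF H(2)] ex_lie)
    have "ex w = g \<otimes> inv (ex a \<otimes> (ex b \<otimes> ex c))" unfolding *(9) by (simp add: m_assoc inv_mult_group)
    then have "ex w \<in> H" using g(2) abc by (auto intro: subgroup_mult[OF H(2)] subgroup_inv[OF H(2)])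
    then have "w = 0" using \<delta>'(2) * by blast
    then show "\<exists>a\<in>V1. \<exists>b\<in>V2. \<exists>c\<in>V3. norm a < \<delta> \<and> norm b < \<delta> \<and> norm c < \<delta> \<and> g = ex a \<otimes> (ex b \<otimes> ex c)"
      using * by (intro bexI[of _ a] bexI[of _ b] bexI[of _ c]) auto
  qed
qed

text \<open>Along a one-parameter group in \<open>H\<close>, compare the chart expressions to first order.\<close>

lemma lie_subset_sum:
  assumes kp: "subspace (k + p)" "subspace k" "subspace p"
    and near: "\<And>\<delta>. \<delta> > 0 \<Longrightarrow> \<exists>N. open N \<and> \<one> \<in> N \<and> (\<forall>g\<in>H \<inter> N. \<exists>a\<in>k. \<exists>b\<in>p. norm a < \<delta> \<and> norm b < \<delta> \<and> g = ex a \<otimes> ex b)"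
    and ind: "k \<inter> p = {0}" and x: "\<xi> \<in> lie H"
  shows "\<exists>a\<in>k. \<exists>b\<in>p. \<xi> = a + b"
proof -
  obtain W where W: "subspace W" "W \<inter> (k + p) = {0}" "\<And>x. \<exists>a\<in>W. \<exists>b\<in>k + p. x = a + b"
    using complement_exists[OF kp(1)] by blast
  define V where "V i = (if i = 0 then k else if i = 1 then p else W)" for i :: nat
  have s3: "(\<Sum>i<3. f i) = f 0 + f 1 + f 2" for f :: "nat \<Rightarrow> 'e"
    by (simp add: eval_nat_numeral)
  obtain P where P: "\<And>i. linear (P i)" "\<And>i x. i < 3 \<Longrightarrow> P i x \<in> V i" "\<And>x. (\<Sum>i<3. P i x) = x"
  proof (rule projections_exist[of 3 V])
    show "subspace (V i)" for i using kp W by (simp add: V_def)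
    show "\<exists>v. (\<forall>i<3. v i \<in> V i) \<and> x = (\<Sum>i<3. v i)" for x
    proof -
      obtain w y where wy: "w \<in> W" "y \<in> k + p" "x = w + y" using W(3) by blast
      then obtain a b where "a \<in> k" "b \<in> p" "y = a + b" by (auto simp: set_plus_def)
      then show ?thesis unfolding s3 using wy
        by (intro exI[of _ "\<lambda>i. if i = 0 then a else if i = 1 then b else w"]) (auto simp: V_def)
    qed
  qed blast
  have P0: "P 0 x \<in> k" and P1: "P 1 x \<in> p" and P2: "P 2 x \<in> W" and Psum: "P 0 x + P 1 x + P 2 x = x" for x
    using P(2)[of 0 x] P(2)[of 1 x] P(2)[of 2 x] P(3)[of x] by (auto simp: V_def s3)
  \<comment> \<open>\<open>projections_exist\<close> does not know that \<open>k\<close> and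
    \<open>p\<close> are independent; independence makes its projections the true components on
    \<open>k + p\<close>.\<close>
  have Pkp: "P 0 (a + b) = a" "P 1 (a + b) = b" if "a \<in> k" "b \<in> p" for a b
  proof -
    have "P 2 (a + b) = (a - P 0 (a + b)) + (b - P 1 (a + b))" using Psum[of "a + b"] by (simp add: algebra_simps)
    moreover have "\<dots> \<in> k + p" using that P0 P1 by (intro set_plus_intro subspace_diff kp) auto
    ultimately have "P 2 (a + b) = 0" using P2[of "a + b"] W(2) by auto
    then have e: "a - P 0 (a + b) = P 1 (a + b) - b" using Psum[of "a + b"] by (simp add: algebra_simps)
    have "a - P 0 (a + b) \<in> k" "P 1 (a + b) - b \<in> p" using that P0 P1 by (auto intro: subspace_diff kp)
    then have "a - P 0 (a + b) = 0" using e ind by (metis IntI singletonD)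
    then show "P 0 (a + b) = a" "P 1 (a + b) = b" using e by auto
  qed
  have bl: "bounded_linear (P i)" for i by (rule linear_imp_bounded[OF P(1)])
  have s: "strict_diff (\<lambda>x. \<phi> (ex (P i x))) (P i)" for i
    using strict_diff_compose[OF strict_diff_bounded_linear[OF bl] ex_strict_diff] by simp
  define F where "F x = m (\<phi> (ex (P 0 x))) (\<phi> (ex (P 1 x)))" for x
  have F: "strict_diff F (\<lambda>x. P 0 x + P 1 x)" unfolding F_def by (rule strict_diff_m[OF s s])
  have "norm (P 2 \<xi>) = 0"
  proof (rule ccontr)
    assume "norm (P 2 \<xi>) \<noteq> 0"
    then have c: "norm (P 2 \<xi>) > 0" by simp
    obtain M where M: "M > 0" "\<And>x. norm (P 2 x) \<le> norm x * M" using bounded_linear.pos_bounded[OF bl] by blast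
    have xi: "norm \<xi> > 0" using c linear_0[OF P(1)] by (metis norm_zero zero_less_norm_iff)
    have ex: "strict_diff (\<lambda>t. \<phi> (ex (t *\<^sub>R \<xi>))) (\<lambda>t. t *\<^sub>R \<xi>)"
      by (rule strict_diff_compose[OF strict_diff_bounded_linear[OF bounded_linear_scaleR_left[of \<xi>]] ex_strict_diff])
    \<comment> \<open>Chosen so that the errors bound \<open>norm (P 2 \<xi>)\<close> by half of
      itself. The factor \<open>1 + 4 * norm \<xi>\<close> sums the two errors once
      \<open>a + b\<close> has been bounded by \<open>4 * t * norm \<xi>\<close>.\<close>
    define e where "e = min (1/2) (norm (P 2 \<xi>) / (M * (1 + 4 * norm \<xi>) * 2))"
    have "norm (P 2 \<xi>) / (M * (1 + 4 * norm \<xi>) * 2) > 0"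
      using c M(1) by (intro divide_pos_pos mult_pos_pos add_pos_nonneg) auto
    then have e1: "e > 0" by (simp add: e_def)
    have "e \<le> 1/2" unfolding e_def by (rule min.cobounded1)
    note e = e1 this
    obtain \<rho>1 where r1: "\<rho>1 > 0" "\<And>s t. norm s < \<rho>1 \<Longrightarrow> norm t < \<rho>1 \<Longrightarrow> norm (\<phi> (ex (s *\<^sub>R \<xi>)) - \<phi> (ex (t *\<^sub>R \<xi>)) - (s - t) *\<^sub>R \<xi>) \<le> min e (norm \<xi>) * norm (s - t)"
      by (rule strict_diffE[OF ex, of "min e (norm \<xi>)"]) (use e xi in auto)
    obtain \<rho>2 where r2: "\<rho>2 > 0" "\<And>x y. norm x < \<rho>2 \<Longrightarrow> norm y < \<rho>2 \<Longrightarrow> norm (F x - F y - (P 0 (x - y) + P 1 (x - y))) \<le> e * norm (x - y)"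
      by (rule strict_diffE[OF F e(1)]) blast
    obtain rd where rd: "rd > 0" "\<And>x. norm x \<le> rd \<Longrightarrow> ex x \<in> dom" by (rule ex_dom_local) blast
    define \<delta> where "\<delta> = min (\<rho>2/2) rd"
    have \<delta>: "\<delta> > 0" using r2 rd by (simp add: \<delta>_def)
    obtain N where N: "open N" "\<one> \<in> N" "\<And>g. g \<in> H \<inter> N \<Longrightarrow> \<exists>a\<in>k. \<exists>b\<in>p. norm a < \<delta> \<and> norm b < \<delta> \<and> g = ex a \<otimes> ex b"
      using near[OF \<delta>] by blast
    have "((\<lambda>t::real. ex (t *\<^sub>R \<xi>)) \<longlongrightarrow> ex (0 *\<^sub>R \<xi>)) (at_right 0)" by (intro ex_tendsto tendsto_intros)
    then have "\<forall>\<^sub>F t in at_right (0::real). ex (t *\<^sub>R \<xi>) \<in> N" using N by (intro topological_tendstoD) auto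
    moreover have "\<forall>\<^sub>F t in at_right (0::real). t < \<rho>1 \<and> 0 < t" using r1(1) unfolding eventually_at_right_field by blast
    ultimately obtain t :: real where t: "ex (t *\<^sub>R \<xi>) \<in> N" "0 < t" "t < \<rho>1"
      by (metis (mono_tags, lifting) eventually_conj eventually_happens trivial_limit_at_right_real)
    obtain a b where ab: "a \<in> k" "b \<in> p" "norm a < \<delta>" "norm b < \<delta>" "ex (t *\<^sub>R \<xi>) = ex a \<otimes> ex b"
      using N(3)[of "ex (t *\<^sub>R \<xi>)"] t(1) x by (auto simp: lie_iff)
    let ?x = "a + b"
    have dom: "ex a \<in> dom" "ex b \<in> dom" using ab rd by (auto simp: \<delta>_def)
    have Fx: "F ?x = \<phi> (ex (t *\<^sub>R \<xi>))" unfolding F_def Pkp[OF ab(1,2)] m_def ab(5) by (simp add: psi_phi dom)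
    have F0: "F 0 = 0" using F by (simp add: strict_diff_def)
    have nx: "norm ?x < \<rho>2" using norm_triangle_ineq[of a b] ab by (simp add: \<delta>_def)
    have 1: "norm (F ?x - ?x) \<le> e * norm ?x" using r2(2)[OF nx, of 0] r2(1) Pkp[OF ab(1,2)] F0 by simp
    have 2: "norm (F ?x - t *\<^sub>R \<xi>) \<le> min e (norm \<xi>) * t" using r1(2)[of t 0] t r1(1) by (simp add: Fx phi_one)
    have 3: "norm ?x \<le> 4 * t * norm \<xi>"
    proof -
      have "norm ?x \<le> norm (F ?x - ?x) + norm (F ?x)" using norm_triangle_ineq4[of "F ?x" "F ?x - ?x"] by (simp add: add.commute)
      moreover have "norm (F ?x) \<le> norm (F ?x - t *\<^sub>R \<xi>) + t * norm \<xi>"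
        using norm_triangle_ineq[of "F ?x - t *\<^sub>R \<xi>" "t *\<^sub>R \<xi>"] t(2) by simp
      moreover have "e * norm ?x \<le> 1/2 * norm ?x" using e by (intro mult_right_mono) auto
      moreover have "min e (norm \<xi>) * t \<le> norm \<xi> * t" using t(2) by (intro mult_right_mono) auto
      then have "norm (F ?x - t *\<^sub>R \<xi>) \<le> t * norm \<xi>" using 2 by (simp only: mult.commute[of t])
      ultimately have "norm ?x \<le> 4 * (t * norm \<xi>)" using 1 by linarith
      then show ?thesis by (simp add: mult.assoc)
    qed
    have "t *\<^sub>R \<xi> - ?x = (F ?x - ?x) - (F ?x - t *\<^sub>R \<xi>)" by simp
    then have "norm (t *\<^sub>R \<xi> - ?x) \<le> norm (F ?x - ?x) + norm (F ?x - t *\<^sub>R \<xi>)" by (metis norm_triangle_ineq4)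
    also have "\<dots> \<le> e * (4 * t * norm \<xi>) + e * t"
    proof (rule add_mono)
      show "norm (F ?x - ?x) \<le> e * (4 * t * norm \<xi>)" using 1 mult_left_mono[OF 3, of e] e(1) by linarith
      have "min e (norm \<xi>) * t \<le> e * t" using t(2) by (intro mult_right_mono) auto
      then show "norm (F ?x - t *\<^sub>R \<xi>) \<le> e * t" using 2 by linarith
    qed
    finally have 4: "norm (t *\<^sub>R \<xi> - ?x) \<le> t * (e * (1 + 4 * norm \<xi>))" by (simp add: algebra_simps)
    have "P 2 ?x = 0" using Psum[of ?x] Pkp[OF ab(1,2)] by simp
    then have "t * norm (P 2 \<xi>) = norm (P 2 (t *\<^sub>R \<xi> - ?x))" using t(2) by (simp add: linear_diff[OF P(1)] linear_cmul[OF P(1)])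
    also have "\<dots> \<le> norm (t *\<^sub>R \<xi> - ?x) * M" by (rule M(2))
    also have "\<dots> \<le> t * (e * (1 + 4 * norm \<xi>)) * M" using 4 M(1) by (intro mult_right_mono) auto
    finally have "norm (P 2 \<xi>) \<le> e * (1 + 4 * norm \<xi>) * M" using t(2) by (simp add: mult.assoc)
    also have "\<dots> \<le> norm (P 2 \<xi>) / 2"
    proof -
      have "e \<le> norm (P 2 \<xi>) / (M * (1 + 4 * norm \<xi>) * 2)" by (simp add: e_def)
      then have "e * (M * (1 + 4 * norm \<xi>) * 2) \<le> norm (P 2 \<xi>)" using M(1) by (simp add: pos_le_divide_eq add_pos_nonneg)
      then show ?thesis by (simp add: mult_ac)
    qed
    finally show False using c by simp
  qed
  then have "\<xi> = P 0 \<xi> + P 1 \<xi>" using Psum[of \<xi>] by simp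
  then show ?thesis using P0 P1 by blast
qed

end

section \<open>Compatible real forms and gradient flows of momentum maps\<close>

lemma smooth_on_subset_continuous:
  fixes f :: "'m::t2_space \<Rightarrow> 'n::topological_space"
  assumes "smooth_on_subset A B S f" shows "continuous_on S f"
  unfolding continuous_on_def
proof
  fix p assume p: "p \<in> S"
  obtain W F where W: "p \<in> W" "open W" "continuous_on W F" "\<And>q. q \<in> S \<inter> W \<Longrightarrow> F q = f q"
    using assms p unfolding smooth_on_subset_def smooth_on_open_def by meson
  have "isCont F p" using W by (simp add: continuous_on_eq_continuous_at)
  then have "(F \<longlongrightarrow> F p) (at p within S)" by (auto simp: isCont_def intro: tendsto_within_subset)
  moreover have "\<forall>\<^sub>F q in at p within S. F q = f q"
    unfolding eventually_at_topological using W by (intro exI[of _ W]) auto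
  ultimately have "(f \<longlongrightarrow> F p) (at p within S)" by (rule Lim_transform_eventually)
  then show "(f \<longlongrightarrow> f p) (at p within S)" using W(4)[of p] W(1) p by simp
qed

locale real_form_action = Lie_action L A B act
  for L :: "'g::{t2_space,second_countable_topology} monoid" (structure)
    and A :: "('g, 'e::fin_dim_complex) atlas"
    and B :: "('z::{t2_space,second_countable_topology}, 'f::fin_dim_complex) atlas"
    and act :: "'g \<Rightarrow> 'z \<Rightarrow> 'z" +
  fixes U G :: "'g set" and \<omega> :: "'z \<Rightarrow> 'f \<Rightarrow> 'f \<Rightarrow> real" and \<mu> :: "'z \<Rightarrow> 'e \<Rightarrow> real"
  assumes cx: "complexification_of L A U" and connU: "connected U"
    and comp: "compatible_subgroup L A U G" and rf: "real_form L A U G"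
    and kae: "Kaehler_manifold B \<omega>" and mom: "momentum_map L A U B \<omega> act \<mu>"
begin

abbreviation iu where "iu \<equiv> times_i ` lie U"
abbreviation K where "K \<equiv> compact_part U G"
abbreviation pp where "pp \<equiv> noncompact_part L A U G"

lemma subU: "subgroup U L" and compU: "compact U" and sub_u: "subspace (lie U)"
  and u_iu: "lie U \<inter> iu = {0}" and split_u: "\<exists>a\<in>lie U. \<exists>b\<in>iu. x = a + b"
  and polar: "bij_betw (\<lambda>(u, \<eta>). u \<otimes> ex \<eta>) (U \<times> iu) UNIV"
proof -
  show "subgroup U L" "compact U" "subspace (lie U)" "lie U \<inter> iu = {0}" "bij_betw (\<lambda>(u, \<eta>). u \<otimes> ex \<eta>) (U \<times> iu) UNIV"
    using cx by (simp_all add: complexification_of_def is_direct_sum_def diffeomorphism_def)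
  have "UNIV = {a + b |a b. a \<in> lie U \<and> b \<in> iu}" using cx by (simp add: complexification_of_def is_direct_sum_def)
  then show "\<exists>a\<in>lie U. \<exists>b\<in>iu. x = a + b" by blast
qed

lemma subG: "subgroup G L" and clG: "closed G" and polarG: "bij_betw (\<lambda>(k, \<beta>). k \<otimes> ex \<beta>) (K \<times> pp) G"
  and polarG_cont: "continuous_on G (inv_into (K \<times> pp) (\<lambda>(k, \<beta>). k \<otimes> ex \<beta>))"
  using comp smooth_on_subset_continuous unfolding compatible_subgroup_def diffeomorphism_def by blast+

lemma clU: "closed U" by (rule compact_imp_closed[OF compU])

lemma K_eq: "K = G \<inter> U" by (simp add: compact_part_def)
lemma pp_eq: "pp = lie G \<inter> iu" by (simp add: noncompact_part_def)

lemma subK: "subgroup K L" and clK: "closed K" and compK: "compact K"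
  unfolding K_eq using subgroups_Inter_pair[OF subG subU] clG clU compU by (auto intro: closed_Int_compact)

lemma iu_iff: "\<eta> \<in> iu \<longleftrightarrow> times_i \<eta> \<in> lie U"
proof
  assume "\<eta> \<in> iu" then show "times_i \<eta> \<in> lie U" using subspace_neg[OF sub_u] by (auto simp: times_i_times_i)
next
  assume h: "times_i \<eta> \<in> lie U"
  have "\<eta> = times_i (- times_i \<eta>)" by (simp add: times_i_all)
  then show "\<eta> \<in> iu" using subspace_neg[OF sub_u h] by blast
qed

lemma sub_iu: "subspace iu" using linear_subspace_image[OF linear_times_i sub_u] .

lemma lieK: "lie K = lie G \<inter> lie U" by (auto simp: lie_iff K_eq)

lemma sub_k: "subspace (lie K)" and sub_p: "subspace pp" and split_real_form: "x \<in> lie U \<Longrightarrow> \<exists>a\<in>lie K. \<exists>b\<in>pp. x = a + times_i b"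
proof -
  have r: "subspace (lie K)" "subspace (times_i ` pp)" "lie U = {a + b |a b. a \<in> lie K \<and> b \<in> times_i ` pp}"
    using rf by (simp_all add: real_form_def is_direct_sum_def)
  show "subspace (lie K)" by (rule r)
  have "pp = (\<lambda>x. times_i (- x)) ` (times_i ` pp)" by (simp add: image_image times_i_all)
  moreover have "linear (\<lambda>x::'e. times_i (- x))"
    using linear_times_i by (auto intro!: linearI simp: times_i_all)
  ultimately show "subspace pp" using linear_subspace_image[OF _ r(2)] by metis
  show "x \<in> lie U \<Longrightarrow> \<exists>a\<in>lie K. \<exists>b\<in>pp. x = a + times_i b" unfolding r(3) by blast
qed

lemma pp_iu: "\<beta> \<in> pp \<Longrightarrow> \<beta> \<in> iu" and pp_lieG: "\<beta> \<in> pp \<Longrightarrow> \<beta> \<in> lie G" by (auto simp: pp_eq)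

lemma k_pp: "lie K \<inter> pp = {0}"
  using u_iu subspace_0[OF sub_k] subspace_0[OF sub_p] by (auto simp: lieK pp_eq)

lemma sub_kp: "subspace (lie K + pp)"
proof -
  have "lie K + pp = {x + y |x y. x \<in> lie K \<and> y \<in> pp}" by (auto simp: set_plus_def)
  then show ?thesis using subspace_sums[OF sub_k sub_p] by (simp only:)
qed

text \<open>The polar decomposition is given on the group only. Its inverse is continuous, so
  elements of \<open>G\<close> near the unit factor into small exponentials from
  \<open>lie K\<close> and \<open>pp\<close>, which is the hypothesis of
  \<open>lie_subset_sum\<close>.\<close>

lemma lieG_split: "x \<in> lie G \<Longrightarrow> \<exists>a\<in>lie K. \<exists>b\<in>pp. x = a + b"
proof (rule lie_subset_sum[OF sub_kp sub_k sub_p _ k_pp])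
  fix \<delta> :: real assume d: "\<delta> > 0"
  let ?f = "\<lambda>(k, \<beta>). k \<otimes> ex \<beta>" and ?S = "K \<times> pp"
  obtain N1 where N1: "open N1" "\<one> \<in> N1"
    "\<And>g. g \<in> N1 \<Longrightarrow> g \<in> K \<Longrightarrow> \<exists>a\<in>lie K. \<exists>b\<in>{0}. \<exists>c\<in>{0}. norm a < \<delta> \<and> norm b < \<delta> \<and> norm c < \<delta> \<and> g = ex a \<otimes> (ex b \<otimes> ex c)"
    by (rule closed_subgroup_product[OF clK subK sub_k sub_k, of "{0}" "{0}" \<delta>])
      (use d subspace_0[OF sub_k] in \<open>auto simp: subspace_def\<close>)
  have one: "(\<one>, 0) \<in> ?S" using subgroup_one[OF subK] subspace_0[OF sub_p] by simp
  have inj: "inj_on ?f ?S" using polarG by (simp add: bij_betw_def)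
  have i1: "inv_into ?S ?f \<one> = (\<one>, 0)" using inv_into_f_f[OF inj one] by simp
  have "open (N1 \<times> ball (0::'e) \<delta>)" using N1(1) by (intro open_Times) auto
  then obtain T where T: "open T" "T \<inter> G = inv_into ?S ?f -` (N1 \<times> ball 0 \<delta>) \<inter> G"
    using polarG_cont unfolding continuous_on_open_invariant by (metis (no_types, lifting))
  have "\<one> \<in> T" using T(2) i1 N1(2) d subgroup_one[OF subG] by auto
  moreover have "\<exists>a\<in>lie K. \<exists>b\<in>pp. norm a < \<delta> \<and> norm b < \<delta> \<and> g = ex a \<otimes> ex b" if g: "g \<in> G \<inter> T" for g
  proof -
    obtain k \<beta> where kb: "inv_into ?S ?f g = (k, \<beta>)" by (cases "inv_into ?S ?f g")
    have gi: "g \<in> ?f ` ?S" using g polarG by (auto simp: bij_betw_def)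
    have kS: "k \<in> K" "\<beta> \<in> pp" using inv_into_into[OF gi] kb by auto
    have ge: "g = k \<otimes> ex \<beta>" using f_inv_into_f[OF gi] kb by simp
    have "g \<in> T \<inter> G" using g by simp
    then have "inv_into ?S ?f g \<in> N1 \<times> ball 0 \<delta>" unfolding T(2) by simp
    then have "k \<in> N1" "norm \<beta> < \<delta>" unfolding kb by auto
    then obtain a where "a \<in> lie K" "norm a < \<delta>" "k = ex a" using N1(3)[of k] kS by auto
    then show ?thesis using kS(2) ge \<open>norm \<beta> < \<delta>\<close> by blast
  qed
  ultimately show "\<exists>N. open N \<and> \<one> \<in> N \<and> (\<forall>g\<in>G \<inter> N. \<exists>a\<in>lie K. \<exists>b\<in>pp. norm a < \<delta> \<and> norm b < \<delta> \<and> g = ex a \<otimes> ex b)"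
    using T(1) by blast
qed

lemma sub_g: "subspace (lie G)" by (rule subspace_lie[OF clG subG])

end

section \<open>The complexified real form and gradient curves of momentum components\<close>

context real_form_action
begin

lemma conn_L: "connected (UNIV :: 'g set)"
proof -
  have "continuous_on (U \<times> iu) (\<lambda>(u, \<eta>). u \<otimes> ex \<eta>)"
    unfolding case_prod_beta by (intro continuous_on_mult_group continuous_on_ex continuous_intros)
  moreover have "connected (U \<times> iu)"
    using connU convex_connected[OF subspace_imp_convex[OF sub_iu]] by (rule connected_Times)
  ultimately have "connected ((\<lambda>(u, \<eta>). u \<otimes> ex \<eta>) ` (U \<times> iu))" by (rule connected_continuous_image)
  then show ?thesis using polar by (simp add: bij_betw_def)
qed

lemma hyperbolic_iu: "\<beta> \<in> iu \<Longrightarrow> hyperbolic \<beta>"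
  unfolding hyperbolic_def using compU by (auto simp: iu_iff lie_iff)

text \<open>The real form splitting of \<open>lie U\<close> is inserted into both summands of
  \<open>lie U\<close> plus \<open>iu\<close>, and the terms are collected.\<close>

lemma lieG_complex_split: obtains a b where "a \<in> lie G" "b \<in> lie G" "x = a + times_i b"
proof -
  obtain u1 u2 where u: "u1 \<in> lie U" "u2 \<in> lie U" "x = u1 + times_i u2" using split_u[of x] by blast
  obtain a1 b1 where 1: "a1 \<in> lie K" "b1 \<in> pp" "u1 = a1 + times_i b1" using split_real_form[OF u(1)] by blast
  obtain a2 b2 where 2: "a2 \<in> lie K" "b2 \<in> pp" "u2 = a2 + times_i b2" using split_real_form[OF u(2)] by blast
  have "a1 - b2 \<in> lie G" "b1 + a2 \<in> lie G"
    using 1 2 pp_lieG lieK by (auto intro!: subspace_diff[OF sub_g] subspace_add[OF sub_g])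
  moreover have "x = (a1 - b2) + times_i (b1 + a2)"
    using u 1 2 by (simp add: times_i_all)
  ultimately show ?thesis by (rule that)
qed

lemma ad_lie: "subgroup H L \<Longrightarrow> closed H \<Longrightarrow> \<xi> \<in> lie H \<Longrightarrow> v \<in> lie H \<Longrightarrow> ad \<xi> v \<in> lie H"
  by (rule ad_subspace[OF subspace_lie]) (auto intro!: AD_lie simp: lie_iff)

text \<open>\<open>ad\<close> is complex linear in its first argument, so \<open>ad \<beta>\<close>
  is, up to \<open>times_i\<close>, the bracket with an element of \<open>lie U\<close>.\<close>

lemma ad_iu: assumes b: "\<beta> \<in> iu" shows "v \<in> lie U \<Longrightarrow> ad \<beta> v \<in> iu" "v \<in> iu \<Longrightarrow> ad \<beta> v \<in> lie U"
proof -
  have 1: "times_i (ad \<beta> v) \<in> lie U" if "v \<in> lie U" for v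
    using ad_lie[OF subU clU _ that, of "times_i \<beta>"] b by (simp add: iu_iff ad_times_i_left)
  then show "v \<in> lie U \<Longrightarrow> ad \<beta> v \<in> iu" by (simp add: iu_iff)
  show "v \<in> iu \<Longrightarrow> ad \<beta> v \<in> lie U" using 1 by (auto simp: ad_times_i)
qed

lemma ad_pp: assumes b: "\<beta> \<in> pp"
  shows "v \<in> lie G \<Longrightarrow> ad \<beta> v \<in> lie G" "v \<in> lie K \<Longrightarrow> ad \<beta> v \<in> pp" "v \<in> pp \<Longrightarrow> ad \<beta> v \<in> lie K"
  using ad_lie[OF subG clG pp_lieG[OF b]] ad_iu[OF pp_iu[OF b]] by (auto simp: lieK pp_eq)

abbreviation f where "f \<equiv> momentum_p \<mu>"

lemma iu_lie: "\<beta> \<in> iu \<Longrightarrow> - times_i \<beta> \<in> lie U" using subspace_neg[OF sub_u] by (simp add: iu_iff)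

lemma f_linear: assumes "\<beta> \<in> iu" "\<gamma> \<in> iu" shows "f (a *\<^sub>R \<beta> + b *\<^sub>R \<gamma>) z = a * f \<beta> z + b * f \<gamma> z"
proof -
  have "\<mu> z (a *\<^sub>R (- times_i \<beta>) + b *\<^sub>R (- times_i \<gamma>)) = a * \<mu> z (- times_i \<beta>) + b * \<mu> z (- times_i \<gamma>)"
    using mom iu_lie[OF assms(1)] iu_lie[OF assms(2)] unfolding momentum_map_def by blast
  moreover have "a *\<^sub>R (- times_i \<beta>) + b *\<^sub>R (- times_i \<gamma>) = - times_i (a *\<^sub>R \<beta> + b *\<^sub>R \<gamma>)"
    by (simp add: times_i_all)
  ultimately show ?thesis by (simp add: momentum_p_def)
qed

lemma f_add: "\<beta> \<in> iu \<Longrightarrow> \<gamma> \<in> iu \<Longrightarrow> f (\<beta> + \<gamma>) z = f \<beta> z + f \<gamma> z" using f_linear[of \<beta> \<gamma> 1 1] by simp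
lemma f_scale: "\<beta> \<in> iu \<Longrightarrow> f (a *\<^sub>R \<beta>) z = a * f \<beta> z" using f_linear[of \<beta> \<beta> a 0] by simp
lemma f_zero: "f 0 z = 0" using f_scale[OF subspace_0[OF sub_iu], of 0] by simp
lemma f_sum: "finite I \<Longrightarrow> (\<And>i. i \<in> I \<Longrightarrow> e i \<in> iu) \<Longrightarrow> f (\<Sum>i\<in>I. c i *\<^sub>R e i) z = (\<Sum>i\<in>I. c i * f (e i) z)"
proof (induction I rule: finite_induct)
  case (insert i I)
  have "(\<Sum>i\<in>I. c i *\<^sub>R e i) \<in> iu" using insert by (auto intro!: subspace_sum[OF sub_iu] subspace_scale[OF sub_iu])
  then show ?case using insert by (simp add: f_add f_scale subspace_scale[OF sub_iu])
qed (simp add: f_zero)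

lemma f_continuous: assumes "\<beta> \<in> iu" shows "continuous_on S (f \<beta>)"
  using mom iu_lie[OF assms] continuous_on_subset[of UNIV "f \<beta>" S]
  unfolding momentum_map_def smooth_on_open_def momentum_p_def by blast

lemma f_tendsto: "\<beta> \<in> iu \<Longrightarrow> (k \<longlongrightarrow> z) F \<Longrightarrow> ((\<lambda>x. f \<beta> (k x)) \<longlongrightarrow> f \<beta> z) F"
  using f_continuous[of \<beta> UNIV] by (rule continuous_on_tendsto_compose) auto

lemma chart_at_vector_space: "chart_at vector_space_atlas p = (UNIV, id)"
  unfolding chart_at_def vector_space_atlas_def by (rule some_equality) auto

lemma f_mderiv: assumes "\<beta> \<in> iu"
  shows "has_mderiv B vector_space_atlas (f \<beta>) z (\<omega> z (rho z (- times_i \<beta>)))"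
proof -
  let ?\<eta> = "- times_i \<beta>" and ?c = "chart_at B z"
  note c = chart_at[OF atlasB, of z]
  have sm: "smooth_on_open B vector_space_atlas UNIV (\<lambda>z. \<mu> z ?\<eta>)"
    and tm: "tangent_map B vector_space_atlas (\<lambda>z. \<mu> z ?\<eta>) z v = \<omega> z (rho z ?\<eta>) v" for v
    using mom iu_lie[OF assms] by (auto simp: momentum_map_def fundamental_field_rho)
  have "\<forall>c\<in>B. Cinf_on (\<lambda>x. \<mu> (chart_inv c x) ?\<eta>) (snd c ` fst c)"
    using sm by (simp add: smooth_on_open_def vector_space_atlas_def o_def)
  then have "Ck_on (Suc 0) (\<lambda>x. \<mu> (chart_inv ?c x) ?\<eta>) (snd ?c ` fst ?c)" using c(1) unfolding Cinf_on_def by blast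
  then have d: "(\<lambda>x. \<mu> (chart_inv ?c x) ?\<eta>) differentiable (at (snd ?c z))" using c(2) by simp
  have "tangent_map B vector_space_atlas (\<lambda>z. \<mu> z ?\<eta>) z = frechet_derivative (\<lambda>x. \<mu> (chart_inv ?c x) ?\<eta>) (at (snd ?c z))"
    by (simp add: tangent_map_def chart_at_vector_space o_def)
  then have "frechet_derivative (\<lambda>x. \<mu> (chart_inv ?c x) ?\<eta>) (at (snd ?c z)) = \<omega> z (rho z ?\<eta>)" using tm by auto
  then show ?thesis using d[unfolded frechet_derivative_works]
    by (simp add: has_mderiv_def chart_at_vector_space momentum_p_def)
qed

lemma f_deriv: fixes z :: 'z and \<xi> :: 'e assumes "\<beta> \<in> iu"
  defines "w t \<equiv> act (ex (t *\<^sub>R \<xi>)) z"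
  shows "((\<lambda>t. f \<beta> (w t)) has_real_derivative \<omega> (w t) (rho (w t) (- times_i \<beta>)) (rho (w t) \<xi>)) (at t)"
proof -
  have "has_cderiv B (\<lambda>s. act (ex ((s - t) *\<^sub>R \<xi>)) (w t)) t (rho (w t) \<xi>)"
    by (rule has_cderiv_shift[OF rho_cderiv])
  moreover have "act (ex ((s - t) *\<^sub>R \<xi>)) (w t) = w s" for s
    by (simp add: w_def flip: act_mult ex_add)
  ultimately have c: "has_cderiv B w t (rho (w t) \<xi>)" by simp
  have "continuous_on UNIV w" unfolding w_def by (rule continuous_on_curve)
  from has_cderiv_compose[OF atlasB this c f_mderiv[OF assms(1)]]
  show ?thesis by (simp add: has_cderiv_def chart_at_vector_space has_real_derivative_iff_has_vector_derivative)
qed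

lemma om_bilinear: "bilinear (\<omega> p)" and om_self: "\<omega> p v v = 0"
  and om_pos: "v \<noteq> 0 \<Longrightarrow> \<omega> p v (times_i v) > 0"
  using kae by (auto simp: Kaehler_manifold_def smooth_2form_def)

lemma om_neg: "\<omega> p (- times_i v) v = \<omega> p v (times_i v)"
proof -
  have "\<omega> p (times_i v + v) (times_i v + v) = 0" by (rule om_self)
  then show ?thesis using om_self[of p v] om_self[of p "times_i v"]
    by (simp add: bilinear_ladd[OF om_bilinear] bilinear_radd[OF om_bilinear] bilinear_lneg[OF om_bilinear])
qed

text \<open>The derivative is the squared Kaehler norm of the fundamental field of
  \<open>\<beta>\<close>: orbit curves of \<open>ex (t *\<^sub>R \<beta>)\<close> are gradient
  curves of \<open>f \<beta>\<close>.\<close>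

lemma f_deriv_self: fixes z :: 'z assumes "\<beta> \<in> iu"
  defines "w t \<equiv> act (ex (t *\<^sub>R \<beta>)) z"
  shows "((\<lambda>t. f \<beta> (w t)) has_real_derivative \<omega> (w t) (rho (w t) \<beta>) (times_i (rho (w t) \<beta>))) (at t)"
proof -
  have "rho (w t) (- times_i \<beta>) = - times_i (rho (w t) \<beta>)"
    by (simp add: linear_neg[OF linear_rho] rho_times_i)
  then show ?thesis using f_deriv[OF assms(1), of \<beta> z t] om_neg by (simp add: w_def)
qed

lemma f_mono: assumes b: "\<beta> \<in> iu" and st: "s \<le> t" shows "f \<beta> (act (ex (s *\<^sub>R \<beta>)) z) \<le> f \<beta> (act (ex (t *\<^sub>R \<beta>)) z)"
proof (rule DERIV_nonneg_imp_nondecreasing[OF st])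
  fix t :: real
  let ?w = "act (ex (t *\<^sub>R \<beta>)) z"
  have "\<omega> ?w v (times_i v) \<ge> 0" for v using om_pos[of v ?w] om_self[of ?w 0] by (cases "v = 0") (auto simp: times_i_all)
  then show "\<exists>y. ((\<lambda>t. f \<beta> (act (ex (t *\<^sub>R \<beta>)) z)) has_real_derivative y) (at t) \<and> 0 \<le> y"
    using f_deriv_self[OF b, of z t] by blast
qed

text \<open>Monotonicity makes \<open>f \<beta>\<close> constant between \<open>s\<close> and
  \<open>t\<close>. At the midpoint the squared norm of the field vanishes, and the isotropy found
  there is carried back to \<open>z\<close>.\<close>

lemma f_strict: assumes b: "\<beta> \<in> iu" and st: "s < t" and le: "f \<beta> (act (ex (t *\<^sub>R \<beta>)) z) \<le> f \<beta> (act (ex (s *\<^sub>R \<beta>)) z)"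
  shows "\<beta> \<in> stab z"
proof -
  let ?w = "\<lambda>t. act (ex (t *\<^sub>R \<beta>)) z"
  define c where "c = (s + t) / 2"
  have c: "s < c" "c < t" using st by (auto simp: c_def field_simps)
  have loc: "\<forall>r. \<bar>c - r\<bar> < (t - s) / 2 \<longrightarrow> f \<beta> (?w c) = f \<beta> (?w r)"
  proof (intro allI impI)
    fix r assume "\<bar>c - r\<bar> < (t - s) / 2"
    then have r: "s \<le> r" "r \<le> t" by (auto simp: c_def abs_less_iff field_simps)
    show "f \<beta> (?w c) = f \<beta> (?w r)"
      using f_mono[OF b r(1), of z] f_mono[OF b r(2), of z] le f_mono[OF b less_imp_le[OF c(1)], of z] f_mono[OF b less_imp_le[OF c(2)], of z]
      by linarith
  qed
  have "\<omega> (?w c) (rho (?w c) \<beta>) (times_i (rho (?w c) \<beta>)) = 0"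
    by (rule DERIV_local_const[OF f_deriv_self[OF b, of z c] _ loc]) (use st in simp)
  then have "\<beta> \<in> stab (?w c)" using om_pos[of "rho (?w c) \<beta>" "?w c"] by (auto simp: stab_def)
  from stab_act[OF this, of "ex (- (c *\<^sub>R \<beta>))"]
  show ?thesis using AD_ex_self[of "-c" \<beta>] by simp
qed

lemma max_fixed: assumes b: "\<beta> \<in> iu" and z: "z \<in> max_set Y (f \<beta>)" and Y: "act (ex \<beta>) z \<in> Y"
  shows "\<beta> \<in> stab z"
  using f_strict[OF b, of 0 1 z] z Y by (auto simp: max_set_def)

text \<open>The gradient curve decreases towards its limit, so starting no higher than the limit it is constant.\<close>

lemma push: assumes b: "\<beta> \<in> iu" and lim: "((\<lambda>t. act (ex (t *\<^sub>R \<beta>)) w) \<longlongrightarrow> c) at_bot" and le: "f \<beta> w \<le> f \<beta> c"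
  shows "w = c"
proof -
  let ?w = "\<lambda>t. act (ex (t *\<^sub>R \<beta>)) w"
  have "f \<beta> c \<le> f \<beta> (?w (-1))"
  proof (rule tendsto_upperbound[OF f_tendsto[OF b lim]])
    show "\<forall>\<^sub>F t in at_bot. f \<beta> (?w t) \<le> f \<beta> (?w (-1))"
      using eventually_le_at_bot[of "-1::real"] by eventually_elim (rule f_mono[OF b])
  qed simp
  then have "\<beta> \<in> stab w" using f_strict[OF b, of "-1" 0 w] le by simp
  then have "?w t = w" for t by (simp add: stab_iff)
  with lim have "((\<lambda>t::real. w) \<longlongrightarrow> c) at_bot" by simp
  then show ?thesis by (simp add: tendsto_const_iff)
qed

text \<open>Elements commuting with \<open>\<beta>\<close> preserve its fixed points, and at a fixed
  point the differential of \<open>f \<beta>\<close> vanishes.\<close>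

lemma centralizer_step: assumes b: "\<beta> \<in> iu" and z: "\<beta> \<in> stab z" and x: "\<xi> \<in> eig \<beta> 0"
  shows "\<beta> \<in> stab (act (ex \<xi>) z)" "f \<beta> (act (ex \<xi>) z) = f \<beta> z"
proof -
  have st: "\<beta> \<in> stab (act (ex (t *\<^sub>R \<xi>)) z)" for t
    using stab_act[OF z, of "ex (t *\<^sub>R \<xi>)"] eig0_sym[OF x] by (simp add: eig0_iff)
  from st[of 1] show "\<beta> \<in> stab (act (ex \<xi>) z)" by simp
  have "((\<lambda>t. f \<beta> (act (ex (t *\<^sub>R \<xi>)) z)) has_real_derivative 0) (at t)" for t
  proof -
    let ?w = "act (ex (t *\<^sub>R \<xi>)) z"
    have "- times_i \<beta> \<in> stab ?w" by (intro subspace_neg[OF subspace_stab] stab_times_i st)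
    then have "rho ?w (- times_i \<beta>) = 0" by (simp add: stab_def)
    then show ?thesis using f_deriv[OF b, of \<xi> z t] by (simp add: bilinear_lzero[OF om_bilinear])
  qed
  then have "(\<lambda>t. f \<beta> (act (ex (t *\<^sub>R \<xi>)) z)) 1 = (\<lambda>t. f \<beta> (act (ex (t *\<^sub>R \<xi>)) z)) 0"
    by (intro DERIV_isconst_all) blast
  then show "f \<beta> (act (ex \<xi>) z) = f \<beta> z" by simp
qed

lemma centralizer_gen: assumes b: "\<beta> \<in> iu" and z: "\<beta> \<in> stab z" and g: "\<gamma> \<in> gen (eig \<beta> 0)"
  shows "\<beta> \<in> stab (act \<gamma> z) \<and> f \<beta> (act \<gamma> z) = f \<beta> z"
  using g by induction (auto simp: z act_mult centralizer_step[OF b])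

end

section \<open>Maximal sets of momentum components\<close>

locale compact_orbit = real_form_action L A B act U G \<omega> \<mu>
  for L :: "'g::{t2_space,second_countable_topology} monoid" (structure)
    and A :: "('g, 'e::fin_dim_complex) atlas"
    and B :: "('z::{t2_space,second_countable_topology}, 'f::fin_dim_complex) atlas"
    and act U G \<omega> \<mu> +
  fixes X :: "'z set"
  assumes X_ne: "X \<noteq> {}" and X_comp: "compact X"
    and X_act: "y \<in> X \<Longrightarrow> act g y \<in> X" and X_trans: "y \<in> X \<Longrightarrow> z \<in> X \<Longrightarrow> \<exists>g. z = act g y"
begin

abbreviation MX where "MX \<beta> \<equiv> max_set X (f \<beta>)"

lemma MX_fixed: "\<beta> \<in> iu \<Longrightarrow> y \<in> MX \<beta> \<Longrightarrow> \<beta> \<in> stab y"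
  by (rule max_fixed) (auto simp: max_set_def X_act)

lemma max_set_nonempty: assumes b: "\<beta> \<in> iu" and Y: "compact Y" "Y \<noteq> {}" shows "\<exists>y. y \<in> max_set Y (f \<beta>)"
  using continuous_attains_sup[OF Y f_continuous[OF b]] by (auto simp: max_set_def)

lemma closed_max_set: assumes b: "\<beta> \<in> iu" and Y: "closed Y" shows "closed (max_set Y (f \<beta>))"
proof -
  have "max_set Y (f \<beta>) = Y \<inter> (\<Inter>z\<in>Y. {p. f \<beta> z \<le> f \<beta> p})" by (auto simp: max_set_def)
  then show ?thesis using Y f_continuous[OF b] by (auto intro!: closed_Int closed_INT closed_Collect_le continuous_on_const)
qed

lemma MX_gen: "\<beta> \<in> iu \<Longrightarrow> y \<in> MX \<beta> \<Longrightarrow> \<gamma> \<in> gen (eig \<beta> 0) \<Longrightarrow> act \<gamma> y \<in> MX \<beta>"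
  using centralizer_gen[OF _ MX_fixed] X_act by (auto simp: max_set_def)

lemma MX_ex: "\<beta> \<in> iu \<Longrightarrow> y \<in> MX \<beta> \<Longrightarrow> v \<in> eig \<beta> 0 \<Longrightarrow> act (ex v) y \<in> MX \<beta>"
  by (rule MX_gen[OF _ _ gen_ex])

lemma act_ex_shift: "act (ex (t *\<^sub>R \<beta>)) (act (ex v) y) = act (ex (AD (ex (t *\<^sub>R \<beta>)) v)) (act (ex (t *\<^sub>R \<beta>)) y)"
  by (simp add: ex_conj'[of "ex (t *\<^sub>R \<beta>)" v] flip: act_mult)

lemma fixed_shift_tendsto:
  assumes y: "\<beta> \<in> stab y" and l: "((\<lambda>t. AD (ex (t *\<^sub>R \<beta>)) v) \<longlongrightarrow> w) F"
  shows "((\<lambda>t. act (ex (t *\<^sub>R \<beta>)) (act (ex v) y)) \<longlongrightarrow> act (ex w) y) F"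
proof -
  have "act (ex (t *\<^sub>R \<beta>)) y = y" for t using y by (simp add: stab_iff)
  then show ?thesis unfolding act_ex_shift using tendsto_act[OF ex_tendsto[OF l] tendsto_const[of y F]] by simp
qed

text \<open>The backward flow of \<open>\<beta>\<close> carries \<open>act (ex v) y\<close> to
  \<open>act (ex w) y\<close>, again a maximizer because \<open>w\<close> commutes with
  \<open>\<beta>\<close>; by \<open>push\<close> the two points are equal.\<close>

lemma max_set_parabolic:
  assumes b: "\<beta> \<in> iu" and S: "subspace S" and v: "v \<in> Eg S \<beta> {0..}"
  obtains w where "w \<in> eig \<beta> 0" "w \<in> S" "((\<lambda>t. AD (ex (t *\<^sub>R \<beta>)) v) \<longlongrightarrow> w) at_bot" "\<And>y. y \<in> MX \<beta> \<Longrightarrow> act (ex v) y = act (ex w) y"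
proof -
  obtain w where w: "w \<in> eig \<beta> 0" "w \<in> S" "((\<lambda>t. AD (ex (t *\<^sub>R \<beta>)) v) \<longlongrightarrow> w) at_bot"
  proof (rule Eg_limit[OF S v])
    show "((\<lambda>t. exp (t * x)) \<longlongrightarrow> (if x = 0 then 1 else 0)) at_bot" if "x \<in> {0..}" for x :: real
      using that by (intro exp_scale_tendsto(2)) simp
  qed
  show ?thesis
  proof (rule that[OF w])
    fix y assume y: "y \<in> MX \<beta>"
    show "act (ex v) y = act (ex w) y"
    proof (rule push[OF b fixed_shift_tendsto[OF MX_fixed[OF b y] w(3)]])
      show "f \<beta> (act (ex v) y) \<le> f \<beta> (act (ex w) y)"
        using MX_ex[OF b y w(1)] X_act[of y] y by (auto simp: max_set_def)
    qed
  qed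
qed

text \<open>Here the backward limit is \<open>y\<close> itself. \<open>Y\<close> only has to contain
  the curve, since the lemma is applied to subsets of \<open>X\<close> that are not invariant under
  the whole group.\<close>

lemma positive_stab:
  assumes b: "\<beta> \<in> iu" and y: "y \<in> max_set Y (f \<beta>)" and fy: "\<beta> \<in> stab y" and v: "v \<in> eig \<beta> x" "x > 0"
    and Y: "\<And>t::real. act (ex (t *\<^sub>R v)) y \<in> Y"
  shows "v \<in> stab y"
proof -
  have "act (ex (t *\<^sub>R v)) y = y" for t :: real
  proof -
    have tv: "t *\<^sub>R v \<in> eig \<beta> x" by (rule subspace_scale[OF subspace_eig v(1)])
    have "((\<lambda>s. exp (s * x) *\<^sub>R (t *\<^sub>R v)) \<longlongrightarrow> 0 *\<^sub>R (t *\<^sub>R v)) at_bot"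
      using exp_scale_tendsto(2)[of x] v(2) by (intro tendsto_scaleR tendsto_const) auto
    then have "((\<lambda>s. AD (ex (s *\<^sub>R \<beta>)) (t *\<^sub>R v)) \<longlongrightarrow> 0) at_bot" by (simp add: AD_eig[OF tv])
    from fixed_shift_tendsto[OF fy this]
    have "((\<lambda>s. act (ex (s *\<^sub>R \<beta>)) (act (ex (t *\<^sub>R v)) y)) \<longlongrightarrow> y) at_bot" by simp
    then show ?thesis by (rule push[OF b]) (use y Y in \<open>auto simp: max_set_def\<close>)
  qed
  then show ?thesis by (simp add: stab_iff)
qed

lemma MX_positive: "\<beta> \<in> iu \<Longrightarrow> y \<in> MX \<beta> \<Longrightarrow> v \<in> eig \<beta> x \<Longrightarrow> x > 0 \<Longrightarrow> v \<in> stab y"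
  by (rule positive_stab[where Y = X]) (auto intro: MX_fixed X_act simp: max_set_def)

lemma transv_of_positive:
  assumes b: "\<beta> \<in> iu" and p: "\<And>v x. v \<in> eig \<beta> x \<Longrightarrow> x > 0 \<Longrightarrow> v \<in> stab y"
  shows "transv (Eg UNIV \<beta> {..0}) y"
  unfolding transv_def
proof
  fix v
  have "{..0} \<union> {0<..} = (UNIV :: real set)" by auto
  then have "v \<in> Eg UNIV \<beta> ({..0} \<union> {0<..})" using Eg_UNIV[OF hyperbolic_iu[OF b], of UNIV] by simp
  from Eg_Un[OF this] obtain a c where "a \<in> Eg UNIV \<beta> {..0}" "c \<in> Eg UNIV \<beta> {0<..}" "v = a + c" by blast
  moreover have "Eg UNIV \<beta> {0<..} \<subseteq> stab y"
    unfolding Eg_def by (rule span_minimal[OF _ subspace_stab]) (use p in auto)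
  ultimately show "\<exists>a\<in>Eg UNIV \<beta> {..0}. \<exists>b\<in>stab y. v = a + b" by blast
qed

lemma MX_transv: "\<beta> \<in> iu \<Longrightarrow> y \<in> MX \<beta> \<Longrightarrow> transv (Eg UNIV \<beta> {..0}) y"
  by (rule transv_of_positive) (auto intro: MX_positive)

text \<open>The spectral projection commutes with \<open>times_i\<close> and preserves
  \<open>lie G\<close>, so it can be applied to both terms of
  \<open>lieG_complex_split\<close>.\<close>

lemma eig_lieG_split:
  assumes b: "\<beta> \<in> pp" and v: "v \<in> eig \<beta> x"
  obtains a c where "a \<in> lie G" "c \<in> lie G" "a \<in> eig \<beta> x" "c \<in> eig \<beta> x" "v = a + times_i c"
proof -
  obtain \<Lambda> P where P: "finite \<Lambda>" "\<And>x. linear (P x)" "\<And>x v. P x v \<in> eig \<beta> x"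
    "\<And>x v S. subspace S \<Longrightarrow> ad \<beta> ` S \<subseteq> S \<Longrightarrow> v \<in> S \<Longrightarrow> P x v \<in> S"
    "\<And>x v. v \<in> eig \<beta> x \<Longrightarrow> P x v = v"
    "\<And>x v T. linear T \<Longrightarrow> (\<And>v. ad \<beta> (T v) = T (ad \<beta> v)) \<Longrightarrow> P x (T v) = T (P x v)"
    by (rule spectral_hyperbolic[OF hyperbolic_iu[OF pp_iu[OF b]]]) blast
  obtain a c where ac: "a \<in> lie G" "c \<in> lie G" "v = a + times_i c" by (rule lieG_complex_split)
  have "P x a \<in> lie G" "P x c \<in> lie G" using ac ad_pp(1)[OF b] by (auto intro!: P(4) sub_g)
  moreover have "P x (times_i c) = times_i (P x c)" by (rule P(6)[OF linear_times_i ad_times_i])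
  then have "v = P x a + times_i (P x c)" using P(5)[OF v] by (simp add: ac(3) linear_add[OF P(2)])
  ultimately show ?thesis using that P(3) by blast
qed

text \<open>At a maximizer over \<open>Y\<close> the positive weight vectors of \<open>lie G\<close>
  are isotropic and, by complex linearity, so are all positive ones. This suffices for
  \<open>same_centralizer_orbit\<close> to join the point to a maximizer over \<open>X\<close>, and
  \<open>f \<beta>\<close> is constant on that centralizer orbit.\<close>

lemma MX_meets:
  assumes b: "\<beta> \<in> iu" and Y: "compact Y" "Y \<noteq> {}" "Y \<subseteq> X" and \<beta>Y: "\<And>y. y \<in> Y \<Longrightarrow> act (ex \<beta>) y \<in> Y"
    and v: "\<And>v x y. v \<in> eig \<beta> x \<Longrightarrow> x > 0 \<Longrightarrow> v \<in> lie G \<Longrightarrow> y \<in> Y \<Longrightarrow> act (ex v) y \<in> Y" and bp: "\<beta> \<in> pp"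
  shows "\<exists>y\<in>Y. y \<in> MX \<beta>"
proof -
  obtain y where y: "y \<in> max_set Y (f \<beta>)" using max_set_nonempty[OF b Y(1,2)] by blast
  then have yY: "y \<in> Y" by (simp add: max_set_def)
  have fy: "\<beta> \<in> stab y" by (rule max_fixed[OF b y \<beta>Y[OF yY]])
  have sg: "v \<in> stab y" if "v \<in> eig \<beta> x" "x > 0" "v \<in> lie G" for v x
    by (rule positive_stab[OF b y fy that(1,2)]) (auto intro!: v[OF _ that(2) _ yY] subspace_scale[OF subspace_eig that(1)] lie_scale[OF that(3)])
  have "v \<in> stab y" if v: "v \<in> eig \<beta> x" "x > 0" for v x
  proof -
    obtain a c where "a \<in> lie G" "c \<in> lie G" "a \<in> eig \<beta> x" "c \<in> eig \<beta> x" "v = a + times_i c"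
      by (rule eig_lieG_split[OF bp v(1)])
    then show ?thesis using sg[OF _ v(2)] by (auto intro: subspace_add[OF subspace_stab] stab_times_i)
  qed
  then have ty: "transv (Eg UNIV \<beta> {..0}) y" by (rule transv_of_positive[OF b])
  obtain c where c: "c \<in> MX \<beta>" using max_set_nonempty[OF b X_comp X_ne] by blast
  have "y \<in> X" "c \<in> X" using yY Y c by (auto simp: max_set_def)
  then obtain g where g: "c = act g y" using X_trans by blast
  obtain \<gamma> where \<gamma>: "\<gamma> \<in> gen (eig \<beta> 0)" "c = act \<gamma> y"
    using same_centralizer_orbit[OF conn_L ty MX_transv[OF b c] g fy MX_fixed[OF b c]] by blast
  then have "f \<beta> y = f \<beta> c" using centralizer_gen[OF b fy \<gamma>(1)] by simp
  then have "y \<in> MX \<beta>" using c \<open>y \<in> X\<close> by (simp add: max_set_def)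
  then show ?thesis using yY by blast
qed

lemma fixed_same_level:
  assumes b: "\<beta> \<in> iu" and y: "y \<in> MX \<beta>" and c: "c = act g y" and fc: "\<beta> \<in> stab c" and tc: "transv (Eg UNIV \<beta> {..0}) c"
  shows "\<exists>\<gamma>\<in>gen (eig \<beta> 0). c = act \<gamma> y"
  by (rule same_centralizer_orbit[OF conn_L MX_transv[OF b y] tc c MX_fixed[OF b y] fc])

lemma MX_orbit: assumes b: "\<beta> \<in> iu" and y: "y \<in> MX \<beta>" and c: "c \<in> MX \<beta>"
  shows "\<exists>\<gamma>\<in>gen (eig \<beta> 0). c = act \<gamma> y"
proof -
  have "y \<in> X" "c \<in> X" using y c by (auto simp: max_set_def)
  then obtain g where "c = act g y" using X_trans by blast
  then show ?thesis by (rule fixed_same_level[OF b y _ MX_fixed[OF b c] MX_transv[OF b c]])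
qed

text \<open>
  The direction \<open>b1\<close> is the restricted momentum vector itself at a point where its norm is
  maximal on \<open>Y\<close>; equality in the Cauchy--Schwarz inequality shows that all maximizers of
  \<open>f b1\<close> have this same restricted momentum vector.
\<close>

lemma max_norm:
  assumes V: "subspace V" "V \<subseteq> iu" and Y: "compact Y" "Y \<noteq> {}" and inv: "\<And>v y. v \<in> V \<Longrightarrow> y \<in> Y \<Longrightarrow> act (ex v) y \<in> Y"
  obtains b1 where "b1 \<in> V" "\<And>c v. c \<in> max_set Y (f b1) \<Longrightarrow> v \<in> V \<Longrightarrow> v \<in> eig b1 0 \<Longrightarrow> v \<in> stab c"
proof -
  obtain E where E: "finite E" "E \<subseteq> V" "V \<subseteq> span E"
  proof -
    obtain C :: "'e set" where C: "finite C" "span C = UNIV" by (rule fin_dim_basis)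
    obtain E where E: "E \<subseteq> V" "independent E" "V \<subseteq> span E" by (rule maximal_independent_subset)
    have "finite E" using independent_span_bound[OF C(1) E(2)] C(2) by simp
    then show ?thesis using that E by blast
  qed
  have Eiu: "e \<in> iu" if "e \<in> E" for e using that E V by blast
  let ?N = "\<lambda>z. \<Sum>e\<in>E. (f e z)\<^sup>2"
  have "continuous_on Y ?N" by (intro continuous_intros f_continuous Eiu)
  from continuous_attains_sup[OF Y this] obtain y1 where y1: "y1 \<in> Y" "\<And>z. z \<in> Y \<Longrightarrow> ?N z \<le> ?N y1" by blast
  define b1 where "b1 = (\<Sum>e\<in>E. f e y1 *\<^sub>R e)"
  have b1V: "b1 \<in> V" unfolding b1_def using E by (auto intro!: subspace_sum[OF V(1)] subspace_scale[OF V(1)])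
  then have b1: "b1 \<in> iu" using V by blast
  have fb1: "f b1 z = (\<Sum>e\<in>E. f e y1 * f e z)" for z unfolding b1_def by (rule f_sum[OF E(1) Eiu])
  have same: "f v c = f v y1" if c: "c \<in> max_set Y (f b1)" and v: "v \<in> V" for c v
  proof -
    have "(\<Sum>e\<in>E. (f e y1 - f e c)\<^sup>2) = ?N y1 + ?N c - 2 * f b1 c"
      unfolding fb1 by (simp add: power2_diff sum.distrib sum_subtractf sum_distrib_left mult.assoc)
    also have "f b1 y1 = ?N y1" unfolding fb1 by (simp add: power2_eq_square)
    then have "?N y1 + ?N c - 2 * f b1 c \<le> 0" using c y1 by (force simp: max_set_def)
    finally have "(\<Sum>e\<in>E. (f e y1 - f e c)\<^sup>2) = 0" by (simp add: order_antisym sum_nonneg)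
    then have eq: "\<forall>e\<in>E. f e y1 = f e c" using E(1) by (simp add: sum_nonneg_eq_0_iff)
    have "v \<in> span E" using v E(3) by blast
    then obtain r where "v = (\<Sum>e\<in>E. r e *\<^sub>R e)" unfolding span_finite[OF E(1)] by blast
    then show ?thesis using eq by (simp add: f_sum[OF E(1) Eiu])
  qed
  show ?thesis
  proof (rule that[OF b1V])
    fix c v assume c: "c \<in> max_set Y (f b1)" and v: "v \<in> V" "v \<in> eig b1 0"
    have cY: "c \<in> Y" using c by (simp add: max_set_def)
    have fc: "b1 \<in> stab c" by (rule max_fixed[OF b1 c inv[OF b1V cY]])
    \<comment> \<open>Both ends of the curve maximize \<open>f b1\<close>, so they have equal
      \<open>f v\<close>; as \<open>f v\<close> increases strictly off the fixed points of
      \<open>v\<close>, the point is fixed.\<close>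
    have "act (ex v) c \<in> max_set Y (f b1)"
      using centralizer_step(2)[OF b1 fc v(2)] inv[OF v(1) cY] c by (simp add: max_set_def)
    then have "f v (act (ex v) c) = f v c" using same[OF _ v(1)] c by simp
    moreover have "v \<in> iu" using v V by blast
    ultimately show "v \<in> stab c" using f_strict[of v 0 1 c] by simp
  qed
qed

end

text \<open>As \<open>ad b\<close> exchanges \<open>k\<close> and \<open>p\<close>, the reflection
  \<open>c - y\<close> of a weight vector \<open>c + y\<close> has the opposite weight. For nonzero
  weight one of the two lies in \<open>q\<close> and expresses \<open>y\<close> modulo
  \<open>k\<close>; for weight 0, \<open>y\<close> itself lies in \<open>q\<close>. With an isotropy
  algebra as \<open>q\<close> this is an Iwasawa-type statement: \<open>p\<close> moves the point no
  further than \<open>k\<close>.\<close>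

lemma (in complex_Lie) positive_part_decomposition:
  assumes h: "hyperbolic b" and k: "subspace k" and p: "subspace p" and q: "subspace q" and kp: "k \<inter> p \<subseteq> {0}"
    and bk: "\<And>v. v \<in> k \<Longrightarrow> ad b v \<in> p" and bp: "\<And>v. v \<in> p \<Longrightarrow> ad b v \<in> k"
    and pos: "\<And>v x. v \<in> eig b x \<Longrightarrow> x > 0 \<Longrightarrow> v \<in> k + p \<Longrightarrow> v \<in> q" and zero: "\<And>v. v \<in> p \<Longrightarrow> v \<in> eig b 0 \<Longrightarrow> v \<in> q"
    and v: "v \<in> p"
  shows "\<exists>a\<in>k. \<exists>c\<in>q. v = a + c"
proof -
  let ?kq = "{a + c |a c. a \<in> k \<and> c \<in> q}"
  have sq: "subspace ?kq" by (rule subspace_sums[OF k q])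
  have kpe: "k + p = {x + y |x y. x \<in> k \<and> y \<in> p}" by (auto simp: set_plus_def)
  have skp: "subspace (k + p)" unfolding kpe by (rule subspace_sums[OF k p])
  have inv: "ad b ` (k + p) \<subseteq> k + p"
  proof (rule image_subsetI)
    fix u assume "u \<in> k + p"
    then obtain x y where xy: "x \<in> k" "y \<in> p" "u = x + y" by (auto simp: kpe)
    then have "ad b u = ad b y + ad b x" by (simp add: linear_add[OF linear_ad])
    then show "ad b u \<in> k + p" using set_plus_intro[OF bp[OF xy(2)] bk[OF xy(1)]] by simp
  qed
  \<comment> \<open>Requiring the second component to stay in \<open>p\<close> allows the
    \<open>k\<close>-component of an element of \<open>p\<close> to be discarded at the end, because
    \<open>k\<close> and \<open>p\<close> meet only in 0.\<close>
  define R where "R = {x + y |x y. x \<in> k \<and> y \<in> p \<inter> ?kq}"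
  have R: "subspace R" unfolding R_def by (rule subspace_sums[OF k subspace_inter[OF p sq]])
  have "eig b x \<inter> (k + p) \<subseteq> R" for x
  proof
    fix u assume u: "u \<in> eig b x \<inter> (k + p)"
    then obtain c y where cy: "c \<in> k" "y \<in> p" "u = c + y" by (auto simp: kpe)
    have "ad b c + ad b y = x *\<^sub>R c + x *\<^sub>R y" using u cy by (simp add: eig_def linear_add[OF linear_ad] scaleR_add_right)
    then have e: "ad b y - x *\<^sub>R c = x *\<^sub>R y - ad b c" by (simp add: algebra_simps)
    have "ad b y - x *\<^sub>R c \<in> k" "x *\<^sub>R y - ad b c \<in> p"
      using cy bk bp by (auto intro!: subspace_diff subspace_scale k p)
    then have "ad b y - x *\<^sub>R c = 0" "x *\<^sub>R y - ad b c = 0" using e kp by auto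
    then have a: "ad b y = x *\<^sub>R c" "ad b c = x *\<^sub>R y" by simp_all
    have c2: "c - y \<in> eig b (- x)" using a by (simp add: eig_def linear_diff[OF linear_ad] scaleR_diff_right)
    have "y \<in> ?kq"
    proof (cases x "0::real" rule: linorder_cases)
      case less
      have "c - y \<in> k + p" using cy subspace_neg[OF p] by (force simp: kpe)
      then have "c - y \<in> q" using pos[OF c2] less by simp
      then have "c + - (c - y) \<in> ?kq" using cy(1) subspace_neg[OF q] by blast
      then show ?thesis by simp
    next
      case equal
      then have "y \<in> q" using zero[OF cy(2)] a by (simp add: eig_def)
      then have "0 + y \<in> ?kq" using subspace_0[OF k] by blast
      then show ?thesis by simp
    next
      case greater
      then have "u \<in> q" using pos u by blast
      then have "- c + u \<in> ?kq" using cy(1) subspace_neg[OF k] by blast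
      then show ?thesis using cy by simp
    qed
    then show "u \<in> R" unfolding R_def using cy by blast
  qed
  then have "Eg (k + p) b UNIV \<subseteq> R" unfolding Eg_def by (intro span_minimal R) blast
  moreover have "v \<in> k + p" using subspace_0[OF k] v by (force simp: kpe)
  ultimately have "v \<in> R" using Eg_UNIV[OF h skp inv] by blast
  then obtain x y where xy: "x \<in> k" "y \<in> p" "y \<in> ?kq" "v = x + y" unfolding R_def by blast
  have "x = v - y" using xy by simp
  then have "x \<in> p" using subspace_diff[OF p v xy(2)] by simp
  then have "x = 0" using kp xy(1) by blast
  then show ?thesis using xy by auto
qed

section \<open>Commuting hyperbolic elements and their joint weights\<close>

context complex_Lie
begin

lemma AD_ex_commute:
  assumes "b1 \<in> eig b 0"
  shows "AD (ex (s *\<^sub>R b)) (AD (ex (t *\<^sub>R b1)) v) = AD (ex (t *\<^sub>R b1)) (AD (ex (s *\<^sub>R b)) v)"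
  using eig0_commute[OF subspace_scale[OF subspace_eig assms, of t], of s] by (simp flip: AD_mult)

lemma eig_invariant:
  assumes "b1 \<in> eig b 0" "v \<in> eig b x"
  shows "AD (ex (t *\<^sub>R b1)) v \<in> eig b x" "ad b1 v \<in> eig b x"
proof -
  have 1: "AD (ex (t *\<^sub>R b1)) v \<in> eig b x" if "v \<in> eig b x" for t v
    by (rule eigI) (simp add: AD_ex_commute[OF assms(1)] AD_eig[OF that] AD_scaleR)
  show "AD (ex (t *\<^sub>R b1)) v \<in> eig b x" by (rule 1[OF assms(2)])
  show "ad b1 v \<in> eig b x" by (rule ad_subspace[OF subspace_eig _ assms(2)]) (use 1 in blast)
qed

lemma joint_eig:
  assumes "b1 \<in> eig b 0" "v \<in> eig b x" "v \<in> eig b1 y" shows "v \<in> eig (b + e *\<^sub>R b1) (x + e * y)"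
proof (rule eigI)
  fix t :: real
  have "AD (ex (s *\<^sub>R (t *\<^sub>R b))) ((t * e) *\<^sub>R b1) = (t * e) *\<^sub>R b1" for s
    using assms(1) by (simp add: eig0_iff AD_scaleR)
  then have "ex (t *\<^sub>R b + (t * e) *\<^sub>R b1) = ex (t *\<^sub>R b) \<otimes> ex ((t * e) *\<^sub>R b1)" by (rule ex_add_commute)
  then have "AD (ex (t *\<^sub>R (b + e *\<^sub>R b1))) v = AD (ex (t *\<^sub>R b)) (AD (ex ((t * e) *\<^sub>R b1)) v)"
    by (simp add: scaleR_add_right AD_mult)
  also have "\<dots> = exp (t * e * y) *\<^sub>R exp (t * x) *\<^sub>R v" by (simp add: AD_eig[OF assms(3)] AD_eig[OF assms(2)] AD_scaleR)
  also have "\<dots> = exp (t * (x + e * y)) *\<^sub>R v" by (simp add: algebra_simps flip: exp_add)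
  finally show "AD (ex (t *\<^sub>R (b + e *\<^sub>R b1))) v = exp (t * (x + e * y)) *\<^sub>R v" .
qed

text \<open>A joint weight vector of weights \<open>x\<close> and \<open>y\<close> has weight
  \<open>x + e * y\<close> for the perturbed element. If
  \<open>e * \<bar>y\<bar> < \<bar>x\<bar>\<close> for the finitely many pairs with
  \<open>x \<noteq> 0\<close>, that number has the sign of \<open>x\<close>. So weight 0 forces
  \<open>x = y = 0\<close>, and positive weight forces \<open>x \<ge> 0\<close>.\<close>

lemma small_perturbation:
  assumes b: "hyperbolic b" and b1: "hyperbolic b1" and h: "\<And>e. hyperbolic (b + e *\<^sub>R b1)" and c: "b1 \<in> eig b 0"
  obtains e where "e > 0" "eig (b + e *\<^sub>R b1) 0 \<subseteq> eig b 0 \<inter> eig b1 0"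
    "\<And>S v x. subspace S \<Longrightarrow> ad b ` S \<subseteq> S \<Longrightarrow> ad b1 ` S \<subseteq> S \<Longrightarrow> v \<in> S \<Longrightarrow> v \<in> eig (b + e *\<^sub>R b1) x \<Longrightarrow> x > 0 \<Longrightarrow> v \<in> Eg S b {0..}"
proof -
  obtain \<Lambda> P where P: "finite \<Lambda>" "\<And>v. v = (\<Sum>x\<in>\<Lambda>. P x v)" "\<And>x v. P x v \<in> eig b x"
    "\<And>x v S. subspace S \<Longrightarrow> ad b ` S \<subseteq> S \<Longrightarrow> v \<in> S \<Longrightarrow> P x v \<in> S"
    by (rule spectral_hyperbolic[OF b]) blast
  obtain M Q where Q: "finite M" "\<And>v. v = (\<Sum>x\<in>M. Q x v)" "\<And>x v. Q x v \<in> eig b1 x"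
    "\<And>x v S. subspace S \<Longrightarrow> ad b1 ` S \<subseteq> S \<Longrightarrow> v \<in> S \<Longrightarrow> Q x v \<in> S"
    by (rule spectral_hyperbolic[OF b1]) blast
  have "\<forall>\<^sub>F e::real in at_right 0. \<forall>x\<in>\<Lambda> - {0}. \<forall>y\<in>M. e * \<bar>y\<bar> < \<bar>x\<bar>"
  proof (intro eventually_ball_finite ballI)
    fix x y :: real assume "x \<in> \<Lambda> - {0}"
    moreover have "((\<lambda>e::real. e * \<bar>y\<bar>) \<longlongrightarrow> 0 * \<bar>y\<bar>) (at_right 0)" by (intro tendsto_intros)
    ultimately show "\<forall>\<^sub>F e::real in at_right 0. e * \<bar>y\<bar> < \<bar>x\<bar>" by (intro order_tendstoD(2)) auto
  qed (use P(1) Q(1) in auto)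
  from eventually_happens'[OF trivial_limit_at_right_real eventually_conj[OF eventually_at_right_less[of 0] this]]
  obtain e :: real where e: "e > 0" "\<And>x y. x \<in> \<Lambda> \<Longrightarrow> x \<noteq> 0 \<Longrightarrow> y \<in> M \<Longrightarrow> e * \<bar>y\<bar> < \<bar>x\<bar>" by blast
  let ?b = "b + e *\<^sub>R b1"
  obtain N R where R: "finite N" "\<And>x. linear (R x)" "\<And>x v. v \<in> eig ?b x \<Longrightarrow> R x v = v"
    "\<And>x y v. v \<in> eig ?b x \<Longrightarrow> x \<noteq> y \<Longrightarrow> R y v = 0"
    by (rule spectral_hyperbolic[OF h[of e]]) blast
  have joint: "Q y (P x v) \<in> eig b x" "Q y (P x v) \<in> eig b1 y" for x y v
    by (rule Q(4)[OF subspace_eig _ P(3)]) (use eig_invariant(2)[OF c] Q(3) in auto)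
  \<comment> \<open>An eigenvector of the sum is recovered from the joint components of combined
    weight \<open>l\<close>: the projection \<open>R l\<close> keeps those and kills the
    others.\<close>
  have key: "v \<in> T" if T: "subspace T" and v: "v \<in> eig ?b l"
    and w: "\<And>x y. x \<in> \<Lambda> \<Longrightarrow> y \<in> M \<Longrightarrow> x + e * y = l \<Longrightarrow> Q y (P x v) \<in> T" for T v l
  proof -
    have "v = (\<Sum>x\<in>\<Lambda>. P x v)" by (rule P(2))
    also have "\<dots> = (\<Sum>x\<in>\<Lambda>. \<Sum>y\<in>M. Q y (P x v))" by (intro sum.cong refl Q(2))
    finally have "R l v = R l (\<Sum>x\<in>\<Lambda>. \<Sum>y\<in>M. Q y (P x v))" by (rule arg_cong)
    then have "R l v = (\<Sum>x\<in>\<Lambda>. \<Sum>y\<in>M. R l (Q y (P x v)))" by (simp only: linear_sum[OF R(2)])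
    moreover have "R l (Q y (P x v)) \<in> T" if "x \<in> \<Lambda>" "y \<in> M" for x y
    proof (cases "x + e * y = l")
      case True
      have "R (x + e * y) (Q y (P x v)) = Q y (P x v)" by (rule R(3)[OF joint_eig[OF c joint]])
      then show ?thesis using w[OF that True] unfolding True by simp
    next
      case False
      show ?thesis using R(4)[OF joint_eig[OF c joint] False] subspace_0[OF T] by simp
    qed
    ultimately have "R l v \<in> T" by (auto intro!: subspace_sum[OF T])
    then show ?thesis using R(3)[OF v] by simp
  qed
  show ?thesis
  proof (rule that[OF e(1)])
    show "eig ?b 0 \<subseteq> eig b 0 \<inter> eig b1 0"
    proof
      fix v assume v: "v \<in> eig ?b 0"
      show "v \<in> eig b 0 \<inter> eig b1 0"
      proof (rule key[OF subspace_inter[OF subspace_eig subspace_eig] v])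
        fix x y assume xy: "x \<in> \<Lambda>" "y \<in> M" "x + e * y = 0"
        then have "\<bar>x\<bar> = e * \<bar>y\<bar>" using e(1) by (simp add: abs_mult eq_neg_iff_add_eq_0[symmetric])
        then have "x = 0" using e(2)[OF xy(1) _ xy(2)] by force
        moreover then have "y = 0" using xy(3) e(1) by simp
        ultimately show "Q y (P x v) \<in> eig b 0 \<inter> eig b1 0" using joint[of y x v] by simp
      qed
    qed
    fix S v l assume S: "subspace S" "ad b ` S \<subseteq> S" "ad b1 ` S \<subseteq> S" "v \<in> S" and v: "v \<in> eig ?b l" and l: "l > 0"
    show "v \<in> Eg S b {0..}"
    proof (rule key[OF subspace_Eg v])
      fix x y assume xy: "x \<in> \<Lambda>" "y \<in> M" "x + e * y = l"
      have "x \<ge> 0"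
      proof (rule ccontr)
        assume n: "\<not> x \<ge> 0"
        then have "e * \<bar>y\<bar> < \<bar>x\<bar>" using e(2)[OF xy(1) _ xy(2)] by simp
        moreover have "e * y \<le> e * \<bar>y\<bar>" using e(1) by (intro mult_left_mono) auto
        ultimately show False using xy(3) l n by linarith
      qed
      moreover have "Q y (P x v) \<in> S" by (intro Q(4) P(4) S)
      ultimately show "Q y (P x v) \<in> Eg S b {0..}" by (intro eig_in_Eg[OF joint(1)]) auto
    qed
  qed
qed

end

context Lie_action
begin

text \<open>A factor \<open>ex v\<close> passes \<open>h\<close> at the price of replacing
  \<open>v\<close> by \<open>AD (inv h) v\<close>. As \<open>\<Gamma>\<close> lies in a compact set,
  one bound on \<open>v\<close> serves all \<open>h\<close>; small exponentials generate, so the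
  local statement at \<open>y\<close> spreads along the \<open>gen S\<close>-orbit.\<close>

lemma local_orbit_extends:
  assumes \<Gamma>: "\<And>g h. g \<in> \<Gamma> \<Longrightarrow> h \<in> \<Gamma> \<Longrightarrow> g \<otimes> h \<in> \<Gamma>" "\<And>g. g \<in> \<Gamma> \<Longrightarrow> inv g \<in> \<Gamma>" "\<Gamma> \<subseteq> Q" "compact Q"
    and S: "subspace S" "\<And>h v. h \<in> \<Gamma> \<Longrightarrow> v \<in> S \<Longrightarrow> AD h v \<in> S"
    and d: "\<delta> > 0" "\<And>v. v \<in> S \<Longrightarrow> norm v < \<delta> \<Longrightarrow> \<exists>h\<in>\<Gamma>. act (ex v) y = act h y"
    and g: "g \<in> gen S" and h: "h \<in> \<Gamma>"
  shows "\<exists>h'\<in>\<Gamma>. act (g \<otimes> h) y = act h' y"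
proof -
  define H where "H = {g. \<forall>h\<in>\<Gamma>. \<exists>h'\<in>\<Gamma>. act (g \<otimes> h) y = act h' y}"
  obtain \<eta> where \<eta>: "\<eta> > 0" "\<And>k \<xi>. k \<in> Q \<Longrightarrow> norm \<xi> < \<eta> \<Longrightarrow> norm (AD k \<xi>) < \<delta>"
    by (rule AD_small[OF \<Gamma>(4) d(1)]) blast
  have "gen S \<subseteq> H"
  proof (rule ex_small_imp_gen[OF _ _ S(1) \<eta>(1)])
    fix g1 g2 assume g: "g1 \<in> H" "g2 \<in> H"
    show "g1 \<otimes> g2 \<in> H" unfolding H_def
    proof (intro CollectI ballI)
      fix h assume "h \<in> \<Gamma>"
      then obtain h2 where h2: "h2 \<in> \<Gamma>" "act (g2 \<otimes> h) y = act h2 y" using g(2) unfolding H_def by blast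
      obtain h1 where "h1 \<in> \<Gamma>" "act (g1 \<otimes> h2) y = act h1 y" using g(1) h2(1) unfolding H_def by blast
      then show "\<exists>h'\<in>\<Gamma>. act (g1 \<otimes> g2 \<otimes> h) y = act h' y" using h2(2) by (auto simp: act_mult)
    qed
  next
    fix v assume v: "v \<in> S" "norm v < \<eta>"
    show "ex v \<in> H" unfolding H_def
    proof (intro CollectI ballI)
      fix h assume h: "h \<in> \<Gamma>"
      then have "inv h \<in> Q" using \<Gamma> by blast
      then have "AD (inv h) v \<in> S" "norm (AD (inv h) v) < \<delta>" using S(2)[OF \<Gamma>(2)[OF h] v(1)] \<eta>(2) v(2) by auto
      then obtain h' where h': "h' \<in> \<Gamma>" "act (ex (AD (inv h) v)) y = act h' y" using d(2) by blast
      have "ex v \<otimes> h = h \<otimes> ex (AD (inv h) v)" using ex_conj'[of h "AD (inv h) v"] by simp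
      then show "\<exists>h'\<in>\<Gamma>. act (ex v \<otimes> h) y = act h' y" using h' \<Gamma>(1)[OF h h'(1)]
        by (intro bexI[of _ "h \<otimes> h'"]) (simp_all add: act_mult)
    qed
  qed (auto simp: H_def)
  then show ?thesis using g h unfolding H_def by blast
qed

lemma gen_subgroup: assumes "subgroup H L" "S \<subseteq> lie H" shows "gen S \<subseteq> H"
proof
  fix g assume "g \<in> gen S" then show "g \<in> H"
    by induction (use assms in \<open>auto intro: subgroup_one subgroup_mult ex_lie\<close>)
qed

lemma AD_gen_subspace:
  assumes "h \<in> gen S" "v \<in> T" "\<And>u v. u \<in> S \<Longrightarrow> v \<in> T \<Longrightarrow> AD (ex u) v \<in> T"
  shows "AD h v \<in> T"
  using assms(1) by induction (auto simp: AD_mult assms)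

lemma AD_ex_eig0: "u \<in> eig \<beta> 0 \<Longrightarrow> v \<in> eig \<beta> x \<Longrightarrow> AD (ex u) v \<in> eig \<beta> x"
  using eig_invariant(1)[of u \<beta> v x 1] by simp

end

section \<open>The perturbed element and the special point\<close>

context compact_orbit
begin

lemma compact_MX: "\<beta> \<in> iu \<Longrightarrow> compact (MX \<beta>)"
  using compact_Int_closed[OF X_comp closed_max_set[of \<beta> X]] compact_imp_closed[OF X_comp]
  by (simp add: max_set_def Int_absorb1 Collect_mono_iff Int_def conj_ac cong: conj_cong)

lemma MX_nonempty: "\<beta> \<in> iu \<Longrightarrow> MX \<beta> \<noteq> {}"
  using max_set_nonempty[OF _ X_comp X_ne] by blast

text \<open>\<open>ad \<beta>\<close> maps one component into \<open>pp\<close> and the other into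
  \<open>lie K\<close>, so the two images cannot cancel.\<close>

lemma eig0_lieG_split:
  assumes b: "\<beta> \<in> pp" and v: "v \<in> lie G" "v \<in> eig \<beta> 0"
  obtains k p where "k \<in> lie K" "k \<in> eig \<beta> 0" "p \<in> pp" "p \<in> eig \<beta> 0" "v = k + p"
proof -
  obtain k p where kp: "k \<in> lie K" "p \<in> pp" "v = k + p" using lieG_split[OF v(1)] by blast
  have "ad \<beta> k + ad \<beta> p = 0" using v(2) kp by (simp add: eig_def linear_add[OF linear_ad])
  then have e: "ad \<beta> k = - ad \<beta> p" by (simp add: eq_neg_iff_add_eq_0)
  have "ad \<beta> k \<in> pp" "ad \<beta> p \<in> lie K" using ad_pp[OF b] kp by auto
  then have "ad \<beta> k \<in> lie K \<inter> pp" using e subspace_neg[OF sub_k] by simp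
  then have "ad \<beta> k = 0" using k_pp by blast
  then show ?thesis using that kp e by (simp add: eig_def)
qed

lemma ex_small: assumes "open N" "\<one> \<in> N" obtains \<delta> where "\<delta> > 0" "\<And>v. norm v < \<delta> \<Longrightarrow> ex v \<in> N"
  by (rule conj_nbhd[of "{\<one>}", OF _ assms]) auto

text \<open>The forward flow of \<open>\<beta>\<close> contracts \<open>n\<close> and moves
  \<open>act (ex n) y\<close> to \<open>y\<close>, but it also fixes that point.\<close>

lemma negative_fixed:
  assumes y: "\<beta> \<in> stab y" and S: "subspace S" and n: "n \<in> Eg S \<beta> {..<0}" and fn: "\<beta> \<in> stab (act (ex n) y)"
  shows "act (ex n) y = y"
proof -
  have F: "((\<lambda>t. exp (t * x)) \<longlongrightarrow> (if x = 0 then 1 else 0)) at_top" if "x \<in> {..<0}" for x :: real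
    using that by (intro exp_scale_tendsto(1)) simp
  obtain w where w: "((\<lambda>t. AD (ex (t *\<^sub>R \<beta>)) n) \<longlongrightarrow> w) at_top" "w = 0"
    by (rule Eg_limit[OF S n F]) auto
  have "((\<lambda>t. act (ex (t *\<^sub>R \<beta>)) (act (ex n) y)) \<longlongrightarrow> y) at_top"
    using fixed_shift_tendsto[OF y w(1)] w(2) by simp
  moreover have "act (ex (t *\<^sub>R \<beta>)) (act (ex n) y) = act (ex n) y" for t using fn by (simp add: stab_iff)
  ultimately show ?thesis by (simp add: tendsto_const_iff)
qed

text \<open>Modulo the isotropy of \<open>y\<close>, the algebra is spanned by compact centralizer
  directions and negative weights. A small centralizer element moves \<open>y\<close> to a fixed
  point of \<open>b\<close>, so by \<open>negative_fixed\<close> its negative factor acts trivially.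
  \<open>local_orbit_extends\<close> makes the resulting local statement global.\<close>

lemma centralizer_orbit:
  assumes b: "b \<in> pp" and y: "y \<in> MX b" and p0: "\<And>v. v \<in> pp \<Longrightarrow> v \<in> eig b 0 \<Longrightarrow> v \<in> stab y"
    and ik: "\<And>v. v \<in> lie K \<Longrightarrow> v \<in> eig b 0 \<Longrightarrow> \<exists>a\<in>lie K \<inter> eig b 0. \<exists>c\<in>stab y. times_i v = a + c"
    and c: "c \<in> MX b"
  shows "\<exists>h\<in>gen (lie K \<inter> eig b 0). c = act h y"
proof -
  let ?k = "lie K \<inter> eig b 0"
  note biu = pp_iu[OF b]
  have sk: "subspace ?k" by (rule subspace_inter[OF sub_k subspace_eig])
  have fy: "b \<in> stab y" by (rule MX_fixed[OF biu y])
  have dec0: "\<exists>a\<in>?k. \<exists>d\<in>stab y. v = a + d" if v: "v \<in> eig b 0" for v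
  proof -
    obtain a c where ac: "a \<in> lie G" "c \<in> lie G" "a \<in> eig b 0" "c \<in> eig b 0" "v = a + times_i c"
      by (rule eig_lieG_split[OF b v])
    obtain k1 p1 where 1: "k1 \<in> lie K" "k1 \<in> eig b 0" "p1 \<in> pp" "p1 \<in> eig b 0" "a = k1 + p1"
      by (rule eig0_lieG_split[OF b ac(1,3)])
    obtain k2 p2 where 2: "k2 \<in> lie K" "k2 \<in> eig b 0" "p2 \<in> pp" "p2 \<in> eig b 0" "c = k2 + p2"
      by (rule eig0_lieG_split[OF b ac(2,4)])
    obtain k3 d where 3: "k3 \<in> ?k" "d \<in> stab y" "times_i k2 = k3 + d" using ik[OF 2(1,2)] by blast
    have "k1 + k3 \<in> ?k" using 1 3 by (intro subspace_add[OF sk]) auto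
    moreover have "p1 + (d + times_i p2) \<in> stab y"
      using 1 2 3 p0 by (intro subspace_add[OF subspace_stab] stab_times_i) auto
    moreover have "v = (k1 + k3) + (p1 + (d + times_i p2))" using ac(5) 1(5) 2(5) 3(3) by (simp add: times_i_all algebra_simps)
    ultimately show ?thesis by blast
  qed
  have sneg: "subspace (Eg UNIV b {..<0})" by (rule subspace_Eg)
  have sp: "\<exists>a\<in>?k. \<exists>n\<in>Eg UNIV b {..<0}. \<exists>d\<in>stab y. \<exists>z\<in>{0}. x = a + n + (d + z)" for x
  proof -
    have "{..<0} \<union> ({0} \<union> {0<..}) = (UNIV :: real set)" by auto
    then have "x \<in> Eg UNIV b ({..<0} \<union> ({0} \<union> {0<..}))" using Eg_UNIV[OF hyperbolic_iu[OF biu], of UNIV] by simp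
    then obtain n r where n: "n \<in> Eg UNIV b {..<0}" "r \<in> Eg UNIV b ({0} \<union> {0<..})" "x = n + r" using Eg_Un by blast
    then obtain v q where v: "v \<in> Eg UNIV b {0}" "q \<in> Eg UNIV b {0<..}" "r = v + q" using Eg_Un by blast
    have "Eg UNIV b {0<..} \<subseteq> stab y"
      unfolding Eg_def by (rule span_minimal[OF _ subspace_stab]) (use MX_positive[OF biu y] in auto)
    moreover obtain a d where a: "a \<in> ?k" "d \<in> stab y" "v = a + d" using dec0[of v] v(1) by (auto simp: Eg_zero)
    ultimately have "d + q \<in> stab y" using v(2) by (intro subspace_add[OF subspace_stab]) auto
    moreover have "x = a + n + ((d + q) + 0)" using n(3) v(3) a(3) by simp
    ultimately show ?thesis using a(1) n(1) by blast
  qed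
  obtain N where N: "open N" "\<one> \<in> N"
    "\<And>g. g \<in> N \<Longrightarrow> \<exists>a\<in>?k. \<exists>n\<in>Eg UNIV b {..<0}. \<exists>d\<in>stab y. \<exists>z\<in>{0}. norm a < 1 \<and> norm n < 1 \<and> norm d < 1 \<and> norm z < 1 \<and>
       g = ex a \<otimes> ex n \<otimes> (ex d \<otimes> ex z)"
    by (rule local_product[OF sk sneg subspace_stab subspace_single_0 sp, of 1]) auto
  obtain \<delta> where \<delta>: "\<delta> > 0" "\<And>v. norm v < \<delta> \<Longrightarrow> ex v \<in> N" by (rule ex_small[OF N(1,2)]) blast
  obtain \<gamma> where \<gamma>: "\<gamma> \<in> gen (eig b 0)" "c = act \<gamma> y" using MX_orbit[OF biu y c] by blast
  have "\<exists>h'\<in>gen ?k. act (\<gamma> \<otimes> \<one>) y = act h' y"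
  proof (rule local_orbit_extends[OF gen_mult gen_inv[OF sk] gen_subgroup[OF subK] compK subspace_eig _ \<delta>(1) _ \<gamma>(1) gen.one])
    show "lie K \<inter> eig b 0 \<subseteq> lie K" by simp
    fix h v assume "h \<in> gen ?k" "v \<in> eig b 0"
    then show "AD h v \<in> eig b 0" by (rule AD_gen_subspace) (auto intro: AD_ex_eig0)
  next
    fix v assume v: "v \<in> eig b 0" "norm v < \<delta>"
    obtain a n d where g: "a \<in> ?k" "n \<in> Eg UNIV b {..<0}" "d \<in> stab y" "ex v = ex a \<otimes> ex n \<otimes> (ex d \<otimes> ex 0)"
      using N(3)[OF \<delta>(2)[OF v(2)]] by blast
    have e: "act (ex v) y = act (ex a) (act (ex n) y)" using act_stab[OF g(3)] by (simp add: g(4) act_mult)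
    have "- a \<in> eig b 0" using g(1) subspace_neg[OF subspace_eig] by blast
    then have "act (ex (- a)) (act (ex v) y) \<in> MX b" by (intro MX_ex[OF biu] v y)
    then have "b \<in> stab (act (ex n) y)" using MX_fixed[OF biu] by (simp add: e)
    then have "act (ex n) y = y" by (rule negative_fixed[OF fy subspace_UNIV g(2)])
    then show "\<exists>h\<in>gen ?k. act (ex v) y = act h y" using gen_ex[OF g(1)] e by auto
  qed
  then show ?thesis using \<gamma>(2) by simp
qed

lemma special_point_exists:
  assumes b: "\<beta> \<in> pp"
  obtains b' y where "b' \<in> pp" "b' \<in> eig \<beta> 0" "eig b' 0 \<subseteq> eig \<beta> 0"
    "\<And>v x. v \<in> lie G \<Longrightarrow> v \<in> eig b' x \<Longrightarrow> x > 0 \<Longrightarrow> v \<in> Eg (lie G) \<beta> {0..}"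
    "y \<in> MX b'" "y \<in> MX \<beta>" "\<And>v. v \<in> pp \<Longrightarrow> v \<in> eig b' 0 \<Longrightarrow> v \<in> stab y"
    "\<And>c. c \<in> MX b' \<Longrightarrow> \<exists>h\<in>gen (lie K \<inter> eig b' 0). c = act h y"
proof -
  note biu = pp_iu[OF b]
  define V where "V = pp \<inter> eig \<beta> 0"
  have sV: "subspace V" unfolding V_def by (rule subspace_inter[OF sub_p subspace_eig])
  have Viu: "V \<subseteq> iu" using pp_iu by (auto simp: V_def)
  obtain b1 where b1: "b1 \<in> V" "\<And>c v. c \<in> max_set (MX \<beta>) (f b1) \<Longrightarrow> v \<in> V \<Longrightarrow> v \<in> eig b1 0 \<Longrightarrow> v \<in> stab c"
    by (rule max_norm[OF sV Viu compact_MX[OF biu] MX_nonempty[OF biu]]) (auto simp: V_def intro: MX_ex[OF biu])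
  have b1p: "b1 \<in> pp" "b1 \<in> eig \<beta> 0" using b1(1) by (auto simp: V_def)
  have pe: "\<beta> + e *\<^sub>R b1 \<in> pp" for e by (intro subspace_add[OF sub_p] subspace_scale[OF sub_p] b b1p)
  obtain e where e: "e > 0" "eig (\<beta> + e *\<^sub>R b1) 0 \<subseteq> eig \<beta> 0 \<inter> eig b1 0"
    "\<And>S v x. subspace S \<Longrightarrow> ad \<beta> ` S \<subseteq> S \<Longrightarrow> ad b1 ` S \<subseteq> S \<Longrightarrow> v \<in> S \<Longrightarrow> v \<in> eig (\<beta> + e *\<^sub>R b1) x \<Longrightarrow> x > 0 \<Longrightarrow> v \<in> Eg S \<beta> {0..}"
    by (rule small_perturbation[OF hyperbolic_iu[OF biu] hyperbolic_iu[OF pp_iu[OF b1p(1)]] hyperbolic_iu[OF pp_iu[OF pe]] b1p(2)]) blast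
  define b' where "b' = \<beta> + e *\<^sub>R b1"
  have b'p: "b' \<in> pp" unfolding b'_def by (rule pe)
  note b'iu = pp_iu[OF b'p]
  have b'0: "b' \<in> eig \<beta> 0" unfolding b'_def by (intro subspace_add[OF subspace_eig] subspace_scale[OF subspace_eig] self_eig0 b1p)
  have sub0: "eig b' 0 \<subseteq> eig \<beta> 0" "eig b' 0 \<subseteq> eig b1 0" using e(2) by (auto simp: b'_def)
  have pos: "v \<in> Eg (lie G) \<beta> {0..}" if "v \<in> lie G" "v \<in> eig b' x" "x > 0" for v x
    by (rule e(3)[OF sub_g]) (use that ad_pp(1)[OF b] ad_pp(1)[OF b1p(1)] in \<open>auto simp: b'_def\<close>)
  \<comment> \<open>\<open>MX \<beta>\<close> is invariant under what \<open>MX_meets\<close> asks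
    for: positive weights of \<open>b'\<close> are non-negative for \<open>\<beta>\<close>, and by
    \<open>max_set_parabolic\<close> such directions act on maximizers as centralizer elements
    do.\<close>
  have "\<exists>y\<in>MX \<beta>. y \<in> MX b'"
  proof (rule MX_meets[OF b'iu compact_MX[OF biu] MX_nonempty[OF biu] _ MX_ex[OF biu _ b'0] _ b'p])
    show "MX \<beta> \<subseteq> X" by (auto simp: max_set_def)
    fix v x y assume v: "v \<in> eig b' x" "x > 0" "v \<in> lie G" and y: "y \<in> MX \<beta>"
    obtain w where "w \<in> eig \<beta> 0" "\<And>y. y \<in> MX \<beta> \<Longrightarrow> act (ex v) y = act (ex w) y"
      by (rule max_set_parabolic[OF biu sub_g pos[OF v(3,1,2)]]) blast
    then show "act (ex v) y \<in> MX \<beta>" using MX_ex[OF biu y] y by simp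
  qed
  then obtain y0 where y0: "y0 \<in> MX \<beta>" "y0 \<in> MX b'" by blast
  \<comment> \<open>\<open>MX b'\<close> is a single orbit of the centralizer of \<open>b'\<close>,
    which lies in that of \<open>\<beta>\<close>; so one common point is enough.\<close>
  have sub: "c \<in> MX \<beta>" if c: "c \<in> MX b'" for c
  proof -
    obtain \<gamma> where "\<gamma> \<in> gen (eig b' 0)" "c = act \<gamma> y0" using MX_orbit[OF b'iu y0(2) c] by blast
    then show ?thesis using MX_gen[OF biu y0(1)] gen_mono[OF sub0(1)] by blast
  qed
  have fb': "f b' z = f \<beta> z + e * f b1 z" for z
    using f_linear[OF biu pp_iu[OF b1p(1)], of 1 e] by (simp add: b'_def)
  have p0: "v \<in> stab c" if c: "c \<in> MX b'" and v: "v \<in> pp" "v \<in> eig b' 0" for c v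
  proof (rule b1(2))
    show "v \<in> V" "v \<in> eig b1 0" using v sub0 by (auto simp: V_def)
    have cb: "c \<in> MX \<beta>" by (rule sub[OF c])
    \<comment> \<open>\<open>f \<beta>\<close> is constant on \<open>MX \<beta>\<close>, so there
      maximality of \<open>f b'\<close> amounts to maximality of \<open>f b1\<close>.\<close>
    have "f b1 z \<le> f b1 c" if z: "z \<in> MX \<beta>" for z
    proof -
      have "f b' z \<le> f b' c" "f \<beta> z = f \<beta> c" using z c cb by (auto simp: max_set_def intro: order_antisym)
      then have "e * f b1 z \<le> e * f b1 c" by (simp add: fb')
      then show ?thesis using e(1) by simp
    qed
    then show "c \<in> max_set (MX \<beta>) (f b1)" using cb by (simp add: max_set_def)
  qed
  define k where "k = lie K \<inter> eig b' 0"
  have sk: "subspace k" unfolding k_def by (rule subspace_inter[OF sub_k subspace_eig])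
  \<comment> \<open>These are the directions of the complex centralizer of \<open>b'\<close> not
    settled by \<open>p0\<close>. They need not lie in \<open>lie G\<close>, but they preserve
    \<open>MX b'\<close>.\<close>
  let ?V = "times_i ` k"
  have sV2: "subspace ?V" by (rule linear_subspace_image[OF linear_times_i sk])
  have ku: "k \<subseteq> lie U" by (auto simp: k_def lieK)
  then have Viu2: "?V \<subseteq> iu" by blast
  have V0: "v \<in> eig b' 0" if "v \<in> ?V" for v using that by (auto simp: k_def intro: eig_times_i)
  obtain b2 where b2: "b2 \<in> ?V" "\<And>c v. c \<in> max_set (MX b') (f b2) \<Longrightarrow> v \<in> ?V \<Longrightarrow> v \<in> eig b2 0 \<Longrightarrow> v \<in> stab c"
    by (rule max_norm[OF sV2 Viu2 compact_MX[OF b'iu] MX_nonempty[OF b'iu]]) (auto intro: MX_ex[OF b'iu] V0)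
  have b2iu: "b2 \<in> iu" using b2(1) Viu2 by blast
  obtain y where ym: "y \<in> max_set (MX b') (f b2)"
    using max_set_nonempty[OF b2iu compact_MX[OF b'iu] MX_nonempty[OF b'iu]] by blast
  then have y: "y \<in> MX b'" by (simp add: max_set_def)
  obtain \<kappa> where \<kappa>: "\<kappa> \<in> k" "b2 = times_i \<kappa>" using b2(1) by blast
  have adk: "ad \<kappa> v \<in> k" if "v \<in> k" for v
    using that \<kappa>(1) ad_lie[OF subK clK] eig_invariant(2)[of \<kappa> b' v 0] by (auto simp: k_def)
  have fy: "b2 \<in> stab y" by (rule max_fixed[OF b2iu ym MX_ex[OF b'iu y V0[OF b2(1)]]])
  \<comment> \<open>\<open>times_i\<close> times \<open>k\<close> takes the role of
    \<open>p\<close>: \<open>ad b2\<close> is \<open>times_i\<close> times the bracket with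
    \<open>\<kappa>\<close>, which preserves \<open>k\<close>, so it exchanges the two
    spaces.\<close>
  have dec: "\<exists>a\<in>k. \<exists>c\<in>stab y. times_i v = a + c" if v: "v \<in> k" for v
  proof (rule positive_part_decomposition[OF hyperbolic_iu[OF b2iu] sk sV2 subspace_stab])
    show "k \<inter> ?V \<subseteq> {0}" using ku u_iu by blast
    show "ad b2 u \<in> ?V" if "u \<in> k" for u using adk[OF that] by (simp add: \<kappa>(2) ad_times_i_left)
    show "ad b2 u \<in> k" if "u \<in> ?V" for u
      using that adk subspace_neg[OF sk] by (auto simp: \<kappa>(2) ad_times_i_left ad_times_i times_i_times_i)
    show "u \<in> stab y" if u: "u \<in> eig b2 x" "x > 0" "u \<in> k + ?V" for u x
    proof (rule positive_stab[OF b2iu ym fy u(1,2)])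
      have "u \<in> eig b' 0" using u(3) V0 by (auto simp: set_plus_def k_def intro!: subspace_add[OF subspace_eig])
      then show "act (ex (t *\<^sub>R u)) y \<in> MX b'" for t :: real
        by (intro MX_ex[OF b'iu y] subspace_scale[OF subspace_eig])
    qed
    show "u \<in> stab y" if "u \<in> ?V" "u \<in> eig b2 0" for u by (rule b2(2)[OF ym that])
    show "times_i v \<in> ?V" using v by blast
  qed
  have orb: "\<exists>h\<in>gen (lie K \<inter> eig b' 0). c = act h y" if "c \<in> MX b'" for c
    by (rule centralizer_orbit[OF b'p y p0[OF y] _ that]) (use dec in \<open>auto simp: k_def\<close>)
  show ?thesis by (rule that[OF b'p b'0 sub0(1) pos y sub[OF y] p0[OF y] orb])
qed

end

section \<open>The closed orbit of the parabolic subgroup\<close>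

locale special_point = compact_orbit L A B act U G \<omega> \<mu> X
  for L :: "'g::{t2_space,second_countable_topology} monoid" (structure)
    and A :: "('g, 'e::fin_dim_complex) atlas"
    and B :: "('z::{t2_space,second_countable_topology}, 'f::fin_dim_complex) atlas"
    and act U G \<omega> \<mu> X +
  fixes \<beta> b' :: 'e and y :: 'z and \<O> :: "'z set"
  assumes bp: "\<beta> \<in> pp" and b'p: "b' \<in> pp" and b'0: "b' \<in> eig \<beta> 0" and eig_sub: "eig b' 0 \<subseteq> eig \<beta> 0"
    and pos: "\<And>v x. v \<in> lie G \<Longrightarrow> v \<in> eig b' x \<Longrightarrow> x > 0 \<Longrightarrow> v \<in> Eg (lie G) \<beta> {0..}"
    and yb': "y \<in> MX b'" and yb: "y \<in> MX \<beta>" and p0: "\<And>v. v \<in> pp \<Longrightarrow> v \<in> eig b' 0 \<Longrightarrow> v \<in> stab y"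
    and orb: "\<And>c. c \<in> MX b' \<Longrightarrow> \<exists>h\<in>gen (lie K \<inter> eig b' 0). c = act h y"
    and O_closed: "closed \<O>" and O_ne: "\<O> \<noteq> {}" and O_X: "\<O> \<subseteq> X" and O_act: "\<And>g z. g \<in> G \<Longrightarrow> z \<in> \<O> \<Longrightarrow> act g z \<in> \<O>"
    and O_trans: "\<And>z w. z \<in> \<O> \<Longrightarrow> w \<in> \<O> \<Longrightarrow> \<exists>g\<in>G. w = act g z"
begin

lemma biu: "\<beta> \<in> iu" and b'iu: "b' \<in> iu" using bp b'p by (auto intro: pp_iu)

lemma compact_subset_X: "closed Y \<Longrightarrow> Y \<subseteq> X \<Longrightarrow> compact Y"
  using compact_Int_closed[OF X_comp, of Y] by (simp add: Int_absorb1)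

text \<open>\<open>Y\<close> meets \<open>MX b'\<close> by \<open>MX_meets\<close>, and
  \<open>MX b'\<close> is one orbit of a group that preserves \<open>Y\<close>. Invariance is
  required only for \<open>b'\<close>, its positive weights and its compact centralizer, so the
  lemma serves \<open>\<O>\<close>, orbit closures inside \<open>max_set\<close> and closed orbits
  of \<open>G_beta_plus\<close> alike.\<close>

lemma point_in_invariant:
  assumes Y: "closed Y" "Y \<noteq> {}" "Y \<subseteq> X" and b': "\<And>y. y \<in> Y \<Longrightarrow> act (ex b') y \<in> Y"
    and v: "\<And>v x y. v \<in> eig b' x \<Longrightarrow> x > 0 \<Longrightarrow> v \<in> lie G \<Longrightarrow> y \<in> Y \<Longrightarrow> act (ex v) y \<in> Y"
    and k: "\<And>v y. v \<in> lie K \<Longrightarrow> v \<in> eig b' 0 \<Longrightarrow> y \<in> Y \<Longrightarrow> act (ex v) y \<in> Y"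
  shows "y \<in> Y"
proof -
  have "\<exists>c\<in>Y. c \<in> MX b'"
    by (rule MX_meets[OF b'iu compact_subset_X[OF Y(1,3)] Y(2,3) b' v b'p])
  then obtain c where c: "c \<in> Y" "c \<in> MX b'" by blast
  obtain h where h: "h \<in> gen (lie K \<inter> eig b' 0)" "c = act h y" using orb[OF c(2)] by blast
  have "inv h \<in> gen (lie K \<inter> eig b' 0)" by (rule gen_inv[OF subspace_inter[OF sub_k subspace_eig] h(1)])
  then have "act (inv h) c \<in> Y" by induction (auto simp: c act_mult k)
  then show ?thesis using h(2) by simp
qed

lemma k_G: "v \<in> lie K \<Longrightarrow> v \<in> lie G" by (simp add: lieK)

lemma y_O: "y \<in> \<O>"
  by (rule point_in_invariant[OF O_closed O_ne O_X]) (blast intro: O_act[OF ex_lie] pp_lieG b'p k_G)+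

lemma y_X: "y \<in> X" using y_O O_X by blast

abbreviation M where "M \<equiv> max_set \<O> (f \<beta>)"

text \<open>The point \<open>y\<close> of \<open>\<O>\<close> already attains the maximum over
  \<open>X\<close>.\<close>

lemma M_iff: "z \<in> M \<longleftrightarrow> z \<in> \<O> \<and> z \<in> MX \<beta>"
proof -
  have "\<forall>w\<in>X. f \<beta> w \<le> f \<beta> y" using yb by (simp add: max_set_def)
  then show ?thesis using y_O O_X by (force simp: max_set_def)
qed

lemma y_M: "y \<in> M" by (simp add: M_iff y_O yb)

lemma closed_M: "closed M" by (rule closed_max_set[OF biu O_closed])

lemma fixed_y: "\<beta> \<in> stab y" by (rule MX_fixed[OF biu yb])

text \<open>The decomposition lemma with the isotropy algebra of \<open>y\<close> as
  \<open>q\<close>: the directions of \<open>pp\<close> move \<open>y\<close> no further than those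
  of \<open>lie K\<close>.\<close>

lemma pp_split_stab: "v \<in> pp \<Longrightarrow> \<exists>a\<in>lie K. \<exists>c\<in>stab y. v = a + c"
  by (rule positive_part_decomposition[OF hyperbolic_iu[OF b'iu] sub_k sub_p subspace_stab])
    (use k_pp ad_pp[OF b'p] MX_positive[OF b'iu yb'] p0 in auto)

text \<open>The same inside the centralizer of \<open>\<beta>\<close>, which \<open>ad b'\<close>
  preserves because \<open>b'\<close> commutes with \<open>\<beta>\<close>.\<close>

lemma pp_centralizer_split:
  assumes "v \<in> pp" "v \<in> eig \<beta> 0" shows "\<exists>a\<in>lie K \<inter> eig \<beta> 0. \<exists>c\<in>stab y. v = a + c"
  by (rule positive_part_decomposition[OF hyperbolic_iu[OF b'iu] subspace_inter[OF sub_k subspace_eig] subspace_inter[OF sub_p subspace_eig] subspace_stab])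
    (use k_pp ad_pp[OF b'p] MX_positive[OF b'iu yb'] p0 eig_invariant(2)[OF b'0] assms in auto)

lemma AD_K: "h \<in> K \<Longrightarrow> v \<in> pp \<Longrightarrow> AD h v \<in> pp"
  using AD_lie[OF subG, of h v] AD_lie[OF subU, of h "times_i v"] by (auto simp: pp_eq K_eq iu_iff AD_times_i)

text \<open>By \<open>pp_split_stab\<close>, small elements of \<open>G\<close> move
  \<open>y\<close> along its \<open>K\<close>-orbit. \<open>local_orbit_extends\<close> with the
  compact group \<open>K\<close> spreads this to \<open>ex p\<close>, and the polar decomposition to
  all of \<open>G\<close>.\<close>

lemma O_eq: assumes "z \<in> \<O>" shows "\<exists>h\<in>K. z = act h y"
proof -
  let ?q = "lie G \<inter> stab y"
  have sp: "\<exists>a\<in>lie K. \<exists>b\<in>?q. \<exists>c\<in>{0}. x = a + (b + c)" if x: "x \<in> lie G" for x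
  proof -
    obtain a p where a: "a \<in> lie K" "p \<in> pp" "x = a + p" using lieG_split[OF x] by blast
    obtain a' c where c: "a' \<in> lie K" "c \<in> stab y" "p = a' + c" using pp_split_stab[OF a(2)] by blast
    have "c = p - a'" using c(3) by simp
    then have "c \<in> lie G" using subspace_diff[OF sub_g pp_lieG[OF a(2)] k_G[OF c(1)]] by simp
    moreover have "x = (a + a') + (c + 0)" using a c by simp
    ultimately show ?thesis using subspace_add[OF sub_k a(1) c(1)] c(2) by blast
  qed
  obtain N where N: "open N" "\<one> \<in> N"
    "\<And>g. g \<in> N \<Longrightarrow> g \<in> G \<Longrightarrow> \<exists>a\<in>lie K. \<exists>b\<in>?q. \<exists>c\<in>{0}. norm a < 1 \<and> norm b < 1 \<and> norm c < 1 \<and> g = ex a \<otimes> (ex b \<otimes> ex c)"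
    by (rule closed_subgroup_product[OF clG subG sub_g sub_k subspace_inter[OF sub_g subspace_stab] subspace_single_0 _ _ _ sp, of 1])
      (use k_G subspace_0[OF sub_g] in auto)
  obtain \<delta> where \<delta>: "\<delta> > 0" "\<And>v. norm v < \<delta> \<Longrightarrow> ex v \<in> N" by (rule ex_small[OF N(1,2)]) blast
  obtain g where g: "g \<in> G" "z = act g y" using O_trans[OF y_O assms] by blast
  have "g \<in> (\<lambda>(k, \<beta>). k \<otimes> ex \<beta>) ` (K \<times> pp)" using g(1) polarG by (simp add: bij_betw_def)
  then obtain kp where "kp \<in> K \<times> pp" "g = fst kp \<otimes> ex (snd kp)" by (auto simp: case_prod_beta)
  then obtain k p where kp: "k \<in> K" "p \<in> pp" "g = k \<otimes> ex p" using that by (auto simp: mem_Times_iff)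
  have "\<exists>h'\<in>K. act (ex p \<otimes> \<one>) y = act h' y"
  proof (rule local_orbit_extends[OF subgroup_mult[OF subK] subgroup_inv[OF subK] order_refl compK sub_p AD_K \<delta>(1) _ gen_ex[OF kp(2)] subgroup_one[OF subK]])
    fix v assume v: "v \<in> pp" "norm v < \<delta>"
    obtain a b where ab: "a \<in> lie K" "b \<in> ?q" "ex v = ex a \<otimes> (ex b \<otimes> ex 0)"
      using N(3)[OF \<delta>(2)[OF v(2)] ex_lie[OF pp_lieG[OF v(1)]]] by blast
    then have "act (ex v) y = act (ex a) y" using act_stab[of b y] by (simp add: act_mult)
    then show "\<exists>h\<in>K. act (ex v) y = act h y" using ex_lie[OF ab(1)] by blast
  qed
  then obtain h where "h \<in> K" "act (ex p) y = act h y" by auto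
  then have "z = act (k \<otimes> h) y" "k \<otimes> h \<in> K" using g kp by (auto simp: act_mult intro: subgroup_mult[OF subK])
  then show ?thesis by blast
qed

abbreviation kb where "kb \<equiv> lie K \<inter> eig \<beta> 0"
abbreviation gb where "gb \<equiv> lie G \<inter> eig \<beta> 0"

lemma sub_kb: "subspace kb" and sub_gb: "subspace gb"
  by (auto intro: subspace_inter sub_k sub_g subspace_eig)

lemma M_gen: "g \<in> gen gb \<Longrightarrow> z \<in> M \<Longrightarrow> act g z \<in> M"
proof (induction rule: gen.induct)
  case (step v g)
  then have "act g z \<in> M" by blast
  then have "act (ex v) (act g z) \<in> M" using step(1) MX_ex[OF biu] O_act[OF ex_lie] by (auto simp: M_iff)
  then show ?case by (simp add: act_mult)
qed auto

text \<open>\<open>lie G\<close> is spanned by \<open>kb\<close>, negative weights and the isotropy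
  of \<open>y\<close>. If \<open>act g y\<close> is still a maximizer, undoing \<open>ex a\<close>
  leaves a fixed point of \<open>\<beta>\<close>, and \<open>negative_fixed\<close> removes the
  negative factor.\<close>

lemma M_local:
  obtains N where "open N" "\<one> \<in> N" "\<And>g. g \<in> N \<Longrightarrow> g \<in> G \<Longrightarrow> act g y \<in> M \<Longrightarrow> \<exists>h\<in>gen kb. act g y = act h y"
proof -
  let ?q = "lie G \<inter> stab y" and ?n = "Eg (lie G) \<beta> {..<0}"
  have sn: "?n \<subseteq> lie G" by (rule Eg_subset[OF sub_g])
  have sp: "\<exists>a\<in>kb. \<exists>b\<in>?n. \<exists>c\<in>?q. x = a + (b + c)" if x: "x \<in> lie G" for x
  proof -
    have "{..<0} \<union> ({0} \<union> {0<..}) = (UNIV :: real set)" by auto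
    then have "x \<in> Eg (lie G) \<beta> ({..<0} \<union> ({0} \<union> {0<..}))"
      using Eg_UNIV[OF hyperbolic_iu[OF biu] sub_g] ad_pp(1)[OF bp] x by auto
    then obtain n r where n: "n \<in> ?n" "r \<in> Eg (lie G) \<beta> ({0} \<union> {0<..})" "x = n + r" using Eg_Un by blast
    then obtain v q where v: "v \<in> Eg (lie G) \<beta> {0}" "q \<in> Eg (lie G) \<beta> {0<..}" "r = v + q" using Eg_Un by blast
    have "Eg (lie G) \<beta> {0<..} \<subseteq> stab y"
      unfolding Eg_def by (rule span_minimal[OF _ subspace_stab]) (use MX_positive[OF biu yb] in auto)
    then have q: "q \<in> ?q" using v(2) Eg_subset[OF sub_g] by blast
    have "v \<in> lie G" "v \<in> eig \<beta> 0" using v(1) by (auto simp: Eg_zero[OF sub_g])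
    then obtain k p where kp: "k \<in> lie K" "k \<in> eig \<beta> 0" "p \<in> pp" "p \<in> eig \<beta> 0" "v = k + p"
      by (rule eig0_lieG_split[OF bp])
    obtain k2 c where c: "k2 \<in> kb" "c \<in> stab y" "p = k2 + c" using pp_centralizer_split[OF kp(3,4)] by blast
    have "c = p - k2" using c(3) by simp
    then have "c \<in> ?q" using subspace_diff[OF sub_g pp_lieG[OF kp(3)] k_G[of k2]] c by simp
    then have "c + q \<in> ?q" by (intro subspace_add[OF subspace_inter[OF sub_g subspace_stab]] q)
    moreover have "x = (k + k2) + (n + (c + q))" using n v kp c by simp
    moreover have "k + k2 \<in> kb" using kp c by (intro subspace_add[OF sub_kb]) auto
    ultimately show ?thesis using n(1) by blast
  qed
  obtain N where N: "open N" "\<one> \<in> N"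
    "\<And>g. g \<in> N \<Longrightarrow> g \<in> G \<Longrightarrow> \<exists>a\<in>kb. \<exists>b\<in>?n. \<exists>c\<in>?q. norm a < 1 \<and> norm b < 1 \<and> norm c < 1 \<and> g = ex a \<otimes> (ex b \<otimes> ex c)"
    by (rule closed_subgroup_product[OF clG subG sub_g sub_kb subspace_Eg subspace_inter[OF sub_g subspace_stab] _ sn _ sp, of 1])
      (use k_G in auto)
  show ?thesis
  proof (rule that[OF N(1,2)])
    fix g assume g: "g \<in> N" "g \<in> G" "act g y \<in> M"
    obtain a n c where a: "a \<in> kb" "n \<in> ?n" "c \<in> ?q" "g = ex a \<otimes> (ex n \<otimes> ex c)" using N(3)[OF g(1,2)] by blast
    have e: "act g y = act (ex a) (act (ex n) y)" using a act_stab[of c y] by (simp add: act_mult)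
    have "- a \<in> eig \<beta> 0" using a(1) subspace_neg[OF subspace_eig] by blast
    then have "act (ex (- a)) (act g y) \<in> MX \<beta>" using g(3) by (intro MX_ex[OF biu]) (auto simp: M_iff)
    then have "\<beta> \<in> stab (act (ex n) y)" using MX_fixed[OF biu] by (simp add: e)
    then have "act (ex n) y = y" by (rule negative_fixed[OF fixed_y sub_g a(2)])
    then show "\<exists>h\<in>gen kb. act g y = act h y" using gen_ex[OF a(1)] e by auto
  qed
qed

lemma gen_kb_K: "gen kb \<subseteq> K" by (rule gen_subgroup[OF subK]) auto

lemma gen_gb_orbit: assumes "g \<in> gen gb" "h \<in> gen kb" shows "\<exists>h'\<in>gen kb. act (g \<otimes> h) y = act h' y"
proof -
  obtain N where N: "open N" "\<one> \<in> N" "\<And>g. g \<in> N \<Longrightarrow> g \<in> G \<Longrightarrow> act g y \<in> M \<Longrightarrow> \<exists>h\<in>gen kb. act g y = act h y"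
    by (rule M_local) blast
  obtain \<delta> where \<delta>: "\<delta> > 0" "\<And>v. norm v < \<delta> \<Longrightarrow> ex v \<in> N" by (rule ex_small[OF N(1,2)]) blast
  show ?thesis
  proof (rule local_orbit_extends[OF gen_mult gen_inv[OF sub_kb] gen_kb_K compK sub_gb _ \<delta>(1) _ assms])
    fix h v assume h: "h \<in> gen kb" "v \<in> gb"
    then show "AD h v \<in> gb"
    proof (rule AD_gen_subspace)
      fix u v assume "u \<in> kb" "v \<in> gb"
      then show "AD (ex u) v \<in> gb" using AD_lie[OF subG ex_lie[OF k_G[of u]]] AD_ex_eig0 by auto
    qed
  next
    fix v assume v: "v \<in> gb" "norm v < \<delta>"
    show "\<exists>h\<in>gen kb. act (ex v) y = act h y"
      using v by (intro N(3) \<delta>(2) ex_lie M_gen[OF gen_ex y_M]) auto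
  qed
qed

text \<open>
  The closure of a \<open>gen gb\<close>-orbit in \<open>M\<close> contains \<open>y\<close>, and near \<open>y\<close> the set \<open>M\<close> is
  contained in the \<open>gen kb\<close>-orbit of \<open>y\<close>; so the orbit itself reaches that of \<open>y\<close>.
\<close>

lemma M_eq: assumes p: "p \<in> M" shows "\<exists>h\<in>gen kb. p = act h y"
proof -
  let ?T = "{act g p |g. g \<in> gen gb}"
  have TM: "?T \<subseteq> M" using M_gen[OF _ p] by blast
  have YM: "closure ?T \<subseteq> M" by (rule closure_minimal[OF TM closed_M])
  have gT: "act (ex v) z \<in> closure ?T" if v: "v \<in> gb" and z: "z \<in> closure ?T" for v z
  proof -
    have "act (ex v) ` closure ?T \<subseteq> closure ?T"
    proof (rule image_closure_subset)
      show "continuous_on (closure ?T) (act (ex v))" by (intro continuous_on_act continuous_intros)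
      have "act (ex v) ` ?T \<subseteq> ?T"
      proof (rule image_subsetI)
        fix u assume "u \<in> ?T"
        then obtain g where g: "g \<in> gen gb" "u = act g p" by blast
        have "act (ex v) u = act (ex v \<otimes> g) p" by (simp add: g(2) act_mult)
        then show "act (ex v) u \<in> ?T" using gen_mult[OF gen_ex[OF v] g(1)] by blast
      qed
      then show "act (ex v) ` ?T \<subseteq> closure ?T" using closure_subset[of ?T] by (rule subset_trans)
    qed simp
    then show ?thesis using z by blast
  qed
  have "y \<in> closure ?T"
  proof (rule point_in_invariant)
    have "p \<in> ?T" using gen.one by (auto intro!: exI[of _ \<one>])
    then show "closure ?T \<noteq> {}" using closure_subset[of ?T] by blast
    show "closure ?T \<subseteq> X" using YM O_X M_iff by blast
    show "act (ex b') z \<in> closure ?T" if "z \<in> closure ?T" for z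
      using b'0 pp_lieG[OF b'p] by (intro gT[OF _ that]) auto
    show "act (ex v) z \<in> closure ?T" if "v \<in> lie K" "v \<in> eig b' 0" "z \<in> closure ?T" for v z
      using that eig_sub k_G by (intro gT[OF _ that(3)]) auto
    show "act (ex v) z \<in> closure ?T" if v: "v \<in> eig b' x" "x > 0" "v \<in> lie G" and z: "z \<in> closure ?T" for v x z
    proof -
      obtain w where "w \<in> eig \<beta> 0" "w \<in> lie G" "\<And>y. y \<in> MX \<beta> \<Longrightarrow> act (ex v) y = act (ex w) y"
        by (rule max_set_parabolic[OF biu sub_g pos[OF v(3,1,2)]]) blast
      moreover have "z \<in> MX \<beta>" using z YM M_iff by blast
      ultimately show ?thesis using gT[OF _ z, of w] by simp
    qed
  qed simp
  then have yT: "y \<in> closure ?T" .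
  obtain N where N: "open N" "\<one> \<in> N" "\<And>g. g \<in> N \<Longrightarrow> g \<in> G \<Longrightarrow> act g y \<in> M \<Longrightarrow> \<exists>h\<in>gen kb. act g y = act h y"
    by (rule M_local) blast
  \<comment> \<open>Those elements of \<open>K\<close> that cannot be brought into \<open>N\<close>
    by the isotropy of \<open>y\<close> in \<open>K\<close>. Their images of \<open>y\<close> form a
    compact set missing \<open>y\<close>, so points of \<open>\<O>\<close> close to \<open>y\<close>
    have a representative in \<open>N\<close>.\<close>
  define Q where "Q = {k \<in> K. \<forall>s\<in>K. act s y = y \<longrightarrow> k \<otimes> s \<notin> N}"
  have cQ: "compact Q"
  proof -
    have "closed {k. k \<otimes> s \<notin> N}" for s
    proof -
      have "continuous_on UNIV (\<lambda>k. k \<otimes> s)" by (intro continuous_on_mult_group continuous_intros)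
      then have "open ((\<lambda>k. k \<otimes> s) -` N)" using N(1) by (simp add: continuous_on_open_vimage)
      then have "closed (- ((\<lambda>k. k \<otimes> s) -` N))" by (rule closed_Compl)
      moreover have "{k. k \<otimes> s \<notin> N} = - ((\<lambda>k. k \<otimes> s) -` N)" by auto
      ultimately show ?thesis by (simp only:)
    qed
    moreover have "Q = K \<inter> (\<Inter>s\<in>{s \<in> K. act s y = y}. {k. k \<otimes> s \<notin> N})" by (auto simp: Q_def)
    ultimately show ?thesis using compK by (auto intro!: compact_Int_closed closed_INT)
  qed
  let ?Z = "(\<lambda>k. act k y) ` Q"
  have "compact ?Z" by (intro compact_continuous_image continuous_on_act continuous_intros cQ)
  then have op: "open (- ?Z)" using compact_imp_closed by blast
  have "y \<in> - ?Z"
  proof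
    assume "y \<in> ?Z"
    then obtain k where k: "k \<in> Q" "act k y = y" by auto
    then have "inv k \<in> K" "act (inv k) y = y"
      using subgroup_inv[OF subK, of k] act_inv_cancel(1)[of k y] by (auto simp: Q_def)
    then have "k \<otimes> inv k \<notin> N" using k(1) unfolding Q_def by blast
    then show False using N(2) by simp
  qed
  then have "- ?Z \<inter> closure ?T \<noteq> {}" using yT by blast
  then have "- ?Z \<inter> ?T \<noteq> {}" by (simp only: open_Int_closure_eq_empty[OF op] not_False_eq_True)
  then obtain z where z: "z \<in> ?T" "z \<in> - ?Z" by blast
  have zM: "z \<in> M" using z(1) TM by blast
  obtain k where k: "k \<in> K" "z = act k y" using O_eq[of z] zM by (auto simp: M_iff)
  then have "k \<notin> Q" using z(2) by blast
  then obtain s where s: "s \<in> K" "act s y = y" "k \<otimes> s \<in> N" using k(1) unfolding Q_def by blast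
  have ks: "act (k \<otimes> s) y = z" using s k by (simp add: act_mult)
  have "k \<otimes> s \<in> G" using subgroup_mult[OF subK k(1) s(1)] by (simp add: K_eq)
  then obtain h where h: "h \<in> gen kb" "z = act h y" using N(3)[OF s(3)] ks zM by auto
  obtain g where g: "g \<in> gen gb" "z = act g p" using z(1) by blast
  have "p = act (inv g \<otimes> h) y" using g(2) h(2) by (metis act_inv_cancel(1) act_mult)
  then show ?thesis using gen_gb_orbit[OF gen_inv[OF sub_gb g(1)] h(1)] by metis
qed

text \<open>The limit \<open>l\<close> commutes with \<open>\<beta>\<close> but is not known to lie
  in \<open>gen (eig \<beta> 0)\<close>. So \<open>act l z\<close> is recognized as a maximizer by
  its isotropy: \<open>\<beta>\<close> and all positive weight vectors fix it, and
  \<open>fixed_same_level\<close> puts it on the centralizer orbit of \<open>z\<close>. Then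
  \<open>push\<close> identifies it with \<open>act g z\<close>.\<close>

lemma M_parabolic:
  assumes g: "g \<in> G" and l: "((\<lambda>t. ex (t *\<^sub>R \<beta>) \<otimes> g \<otimes> ex (- t *\<^sub>R \<beta>)) \<longlongrightarrow> l) at_bot" and z: "z \<in> M"
  shows "act g z \<in> M"
proof -
  have zX: "z \<in> MX \<beta>" "z \<in> \<O>" using z by (auto simp: M_iff)
  have fz: "\<beta> \<in> stab z" by (rule MX_fixed[OF biu zX(1)])
  have lc: "AD l \<beta> = \<beta>" unfolding AD_fix_iff
  proof
    fix s :: real
    let ?c = "\<lambda>t. ex (t *\<^sub>R \<beta>) \<otimes> g \<otimes> ex (- t *\<^sub>R \<beta>)"
    \<comment> \<open>Shifting time by \<open>s\<close> conjugates the curve by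
      \<open>ex (s *\<^sub>R \<beta>)\<close> without changing its limit; hence \<open>l\<close>
      commutes with that element.\<close>
    have "filterlim (\<lambda>t. s + t) at_bot (at_bot :: real filter)"
      by (subst filterlim_tendsto_add_at_bot_iff[OF tendsto_const]) (rule filterlim_ident)
    from filterlim_compose[OF l this] have "((\<lambda>t. ?c (s + t)) \<longlongrightarrow> l) at_bot" .
    moreover have "?c (s + t) = ex (s *\<^sub>R \<beta>) \<otimes> ?c t \<otimes> ex (- s *\<^sub>R \<beta>)" for t
    proof -
      have "ex ((s + t) *\<^sub>R \<beta>) = ex (s *\<^sub>R \<beta>) \<otimes> ex (t *\<^sub>R \<beta>)" "ex (- (s + t) *\<^sub>R \<beta>) = ex (- t *\<^sub>R \<beta>) \<otimes> ex (- s *\<^sub>R \<beta>)"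
      proof -
        have "- (s + t) = - t + - s" by simp
        then show "ex (- (s + t) *\<^sub>R \<beta>) = ex (- t *\<^sub>R \<beta>) \<otimes> ex (- s *\<^sub>R \<beta>)" by (simp only: ex_add)
      qed (rule ex_add)
      then show ?thesis by (simp add: m_assoc)
    qed
    moreover have "((\<lambda>t. ex (s *\<^sub>R \<beta>) \<otimes> ?c t \<otimes> ex (- s *\<^sub>R \<beta>)) \<longlongrightarrow> ex (s *\<^sub>R \<beta>) \<otimes> l \<otimes> ex (- s *\<^sub>R \<beta>)) at_bot"
      by (intro tendsto_mult_group tendsto_const l)
    ultimately have "l = ex (s *\<^sub>R \<beta>) \<otimes> l \<otimes> ex (- s *\<^sub>R \<beta>)"
      using tendsto_unique[OF trivial_limit_at_bot_linorder] by simp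
    then have "l \<otimes> ex (s *\<^sub>R \<beta>) = ex (s *\<^sub>R \<beta>) \<otimes> l \<otimes> ex (- s *\<^sub>R \<beta>) \<otimes> ex (s *\<^sub>R \<beta>)" by (rule arg_cong)
    then show "l \<otimes> ex (s *\<^sub>R \<beta>) = ex (s *\<^sub>R \<beta>) \<otimes> l" by (simp add: m_assoc)
  qed
  have fl: "\<beta> \<in> stab (act l z)" using stab_act[OF fz, of l] lc by simp
  have tl: "transv (Eg UNIV \<beta> {..0}) (act l z)"
  proof (rule transv_of_positive[OF biu])
    fix v x assume v: "v \<in> eig \<beta> x" "(x::real) > 0"
    have il: "AD (inv l) \<beta> = \<beta>" using AD_inv_cancel(2)[of l \<beta>] lc by simp
    have "AD (inv l) v \<in> eig \<beta> x"
    proof (rule eigI)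
      fix t :: real
      have c: "inv l \<otimes> ex (t *\<^sub>R \<beta>) = ex (t *\<^sub>R \<beta>) \<otimes> inv l" using il unfolding AD_fix_iff by blast
      have "AD (ex (t *\<^sub>R \<beta>)) (AD (inv l) v) = AD (inv l) (AD (ex (t *\<^sub>R \<beta>)) v)" by (simp add: c flip: AD_mult)
      then show "AD (ex (t *\<^sub>R \<beta>)) (AD (inv l) v) = exp (t * x) *\<^sub>R AD (inv l) v" by (simp add: AD_eig[OF v(1)] AD_scaleR)
    qed
    from stab_act[OF MX_positive[OF biu zX(1) this v(2)], of l] show "v \<in> stab (act l z)" by simp
  qed
  obtain \<gamma> where \<gamma>: "\<gamma> \<in> gen (eig \<beta> 0)" "act l z = act \<gamma> z" using fixed_same_level[OF biu zX(1) refl fl tl] by blast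
  have lM: "act l z \<in> MX \<beta>" unfolding \<gamma>(2) by (rule MX_gen[OF biu zX(1) \<gamma>(1)])
  have "((\<lambda>t. act (ex (t *\<^sub>R \<beta>) \<otimes> g \<otimes> ex (- t *\<^sub>R \<beta>)) z) \<longlongrightarrow> act l z) at_bot" by (intro tendsto_act l tendsto_const)
  moreover have "act (ex (- t *\<^sub>R \<beta>)) z = z" for t using fz unfolding stab_iff by blast
  ultimately have "((\<lambda>t. act (ex (t *\<^sub>R \<beta>)) (act g z)) \<longlongrightarrow> act l z) at_bot" by (simp add: act_mult)
  then have "act g z = act l z"
    by (rule push[OF biu]) (use lM X_act zX(2) O_X in \<open>auto simp: max_set_def\<close>)
  then show ?thesis using lM O_act[OF g zX(2)] by (simp add: M_iff)
qed

end

section \<open>The parabolic group and its closed orbit\<close>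

context special_point
begin

abbreviation P where "P \<equiv> G_beta_plus L A G \<beta>"

lemma P_iff: "g \<in> P \<longleftrightarrow> g \<in> G \<and> (\<exists>l\<in>G. ((\<lambda>t. ex (t *\<^sub>R \<beta>) \<otimes> g \<otimes> ex (- t *\<^sub>R \<beta>)) \<longlongrightarrow> l) at_bot)"
  by (simp add: G_beta_plus_def)

lemma P_E:
  assumes "g \<in> P"
  obtains l where "g \<in> G" "l \<in> G" "((\<lambda>t. ex (t *\<^sub>R \<beta>) \<otimes> g \<otimes> ex (- t *\<^sub>R \<beta>)) \<longlongrightarrow> l) at_bot"
  using assms unfolding P_iff by (elim conjE bexE)

lemma P_I: "g \<in> G \<Longrightarrow> l \<in> G \<Longrightarrow> ((\<lambda>t. ex (t *\<^sub>R \<beta>) \<otimes> g \<otimes> ex (- t *\<^sub>R \<beta>)) \<longlongrightarrow> l) at_bot \<Longrightarrow> g \<in> P"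
  unfolding P_iff by (intro conjI bexI[of _ l])

lemma P_mult: assumes "g \<in> P" "h \<in> P" shows "g \<otimes> h \<in> P"
proof -
  obtain k where k: "g \<in> G" "k \<in> G" "((\<lambda>t. ex (t *\<^sub>R \<beta>) \<otimes> g \<otimes> ex (- t *\<^sub>R \<beta>)) \<longlongrightarrow> k) at_bot"
    by (rule P_E[OF assms(1)])
  obtain l where l: "h \<in> G" "l \<in> G" "((\<lambda>t. ex (t *\<^sub>R \<beta>) \<otimes> h \<otimes> ex (- t *\<^sub>R \<beta>)) \<longlongrightarrow> l) at_bot"
    by (rule P_E[OF assms(2)])
  have "ex (t *\<^sub>R \<beta>) \<otimes> g \<otimes> ex (- t *\<^sub>R \<beta>) \<otimes> (ex (t *\<^sub>R \<beta>) \<otimes> h \<otimes> ex (- t *\<^sub>R \<beta>)) = ex (t *\<^sub>R \<beta>) \<otimes> (g \<otimes> h) \<otimes> ex (- t *\<^sub>R \<beta>)" for t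
    by (simp add: m_assoc ex_minus)
  then have "((\<lambda>t. ex (t *\<^sub>R \<beta>) \<otimes> (g \<otimes> h) \<otimes> ex (- t *\<^sub>R \<beta>)) \<longlongrightarrow> k \<otimes> l) at_bot"
    using tendsto_mult_group[OF k(3) l(3)] by simp
  then show ?thesis by (rule P_I[OF subgroup_mult[OF subG k(1) l(1)] subgroup_mult[OF subG k(2) l(2)]])
qed

lemma P_inv: assumes "g \<in> P" shows "inv g \<in> P"
proof -
  obtain k where k: "g \<in> G" "k \<in> G" "((\<lambda>t. ex (t *\<^sub>R \<beta>) \<otimes> g \<otimes> ex (- t *\<^sub>R \<beta>)) \<longlongrightarrow> k) at_bot"
    by (rule P_E[OF assms(1)])
  have "inv (ex (t *\<^sub>R \<beta>) \<otimes> g \<otimes> ex (- t *\<^sub>R \<beta>)) = ex (t *\<^sub>R \<beta>) \<otimes> inv g \<otimes> ex (- t *\<^sub>R \<beta>)" for t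
    by (simp add: m_assoc ex_minus inv_mult_group)
  then have "((\<lambda>t. ex (t *\<^sub>R \<beta>) \<otimes> inv g \<otimes> ex (- t *\<^sub>R \<beta>)) \<longlongrightarrow> inv k) at_bot"
    using tendsto_inv_group[OF k(3)] by simp
  then show ?thesis by (rule P_I[OF subgroup_inv[OF subG k(1)] subgroup_inv[OF subG k(2)]])
qed

lemma P_ex: assumes v: "v \<in> Eg (lie G) \<beta> {0..}" shows "ex v \<in> P"
proof -
  obtain w where w: "w \<in> lie G" "((\<lambda>t. AD (ex (t *\<^sub>R \<beta>)) v) \<longlongrightarrow> w) at_bot"
    by (rule max_set_parabolic[OF biu sub_g v]) blast
  have "ex (t *\<^sub>R \<beta>) \<otimes> ex v \<otimes> ex (- t *\<^sub>R \<beta>) = ex (AD (ex (t *\<^sub>R \<beta>)) v)" for t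
    using ex_conj[of "ex (t *\<^sub>R \<beta>)" v] by (simp add: ex_minus)
  then have "((\<lambda>t. ex (t *\<^sub>R \<beta>) \<otimes> ex v \<otimes> ex (- t *\<^sub>R \<beta>)) \<longlongrightarrow> ex w) at_bot"
    using ex_tendsto[OF w(2)] by simp
  moreover have "v \<in> lie G" using v Eg_subset[OF sub_g] by blast
  ultimately show ?thesis by (intro P_I[OF ex_lie[of v G] ex_lie[OF w(1)]])
qed

lemma P_ex0: "v \<in> gb \<Longrightarrow> ex v \<in> P"
  by (rule P_ex[OF eig_in_Eg[of v \<beta> 0]]) auto

lemma gen_gb_P: "g \<in> gen gb \<Longrightarrow> g \<in> P"
proof (induction rule: gen.induct)
  case one
  show ?case using P_ex0[OF subspace_0[OF sub_gb]] by simp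
qed (auto intro: P_mult P_ex0)

text \<open>\<open>gen kb\<close> is already transitive on \<open>M\<close> and lies in the
  parabolic group through \<open>gen gb\<close>; the converse inclusion is
  \<open>M_parabolic\<close>.\<close>

lemma M_P_orbit: "M = {act g y |g. g \<in> P}"
proof (intro equalityI subsetI)
  fix z assume "z \<in> M"
  then obtain h where "h \<in> gen kb" "z = act h y" using M_eq by blast
  moreover have "gen kb \<subseteq> gen gb" by (rule gen_mono) (use k_G in auto)
  ultimately show "z \<in> {act g y |g. g \<in> P}" using gen_gb_P by blast
next
  fix z assume "z \<in> {act g y |g. g \<in> P}"
  then obtain g where g: "g \<in> P" "z = act g y" by blast
  show "z \<in> M" unfolding g(2) by (rule P_E[OF g(1)]) (rule M_parabolic[OF _ _ y_M])
qed

text \<open>A closed orbit of the parabolic group meets the requirements of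
  \<open>point_in_invariant\<close>, so it contains \<open>y\<close>; orbits with a common point
  coincide.\<close>

lemma closed_P_orbit:
  assumes z: "z \<in> X" and cl: "closed {act g z |g. g \<in> P}" shows "{act g z |g. g \<in> P} = M"
proof -
  let ?S = "{act g z |g. g \<in> P}"
  have inv: "act (ex v) w \<in> ?S" if v: "ex v \<in> P" and w: "w \<in> ?S" for v w
  proof -
    obtain g where g: "g \<in> P" "w = act g z" using w by blast
    then have "act (ex v) w = act (ex v \<otimes> g) z" by (simp add: act_mult)
    then show ?thesis using P_mult[OF v g(1)] by blast
  qed
  have "y \<in> ?S"
  proof (rule point_in_invariant[OF cl])
    have "\<one> \<in> P" using gen_gb_P[OF gen.one] .
    then show "?S \<noteq> {}" by blast
    show "?S \<subseteq> X" using X_act[OF z] by blast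
    show "act (ex b') w \<in> ?S" if "w \<in> ?S" for w
      by (rule inv[OF P_ex0 that]) (use b'0 pp_lieG[OF b'p] in auto)
    show "act (ex v) w \<in> ?S" if "v \<in> eig b' x" "x > 0" "v \<in> lie G" "w \<in> ?S" for v x w
      by (rule inv[OF P_ex[OF pos[OF that(3,1,2)]] that(4)])
    show "act (ex v) w \<in> ?S" if "v \<in> lie K" "v \<in> eig b' 0" "w \<in> ?S" for v w
      by (rule inv[OF P_ex0 that(3)]) (use that eig_sub k_G in auto)
  qed
  then obtain g where g: "g \<in> P" "y = act g z" by blast
  then have "M = {act h (act g z) |h. h \<in> P}" using M_P_orbit by simp
  also have "\<dots> = ?S"
  proof (intro equalityI subsetI)
    fix w assume "w \<in> {act h (act g z) |h. h \<in> P}"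
    then obtain h where "h \<in> P" "w = act (h \<otimes> g) z" by (auto simp: act_mult)
    then show "w \<in> ?S" using P_mult[OF _ g(1)] by blast
  next
    fix w assume "w \<in> ?S"
    then obtain h where h: "h \<in> P" "w = act h z" by blast
    then have "w = act (h \<otimes> inv g) (act g z)" by (simp add: act_mult)
    then show "w \<in> {act h (act g z) |h. h \<in> P}" using P_mult[OF h(1) P_inv[OF g(1)]] by blast
  qed
  finally show ?thesis by simp
qed

abbreviation Kb where "Kb \<equiv> K_beta L A K \<beta>"

text \<open>\<open>v\<close> commutes with \<open>\<beta>\<close>, so the curve
  \<open>ex (t *\<^sub>R v) \<otimes> g\<close> joins \<open>g\<close> to
  \<open>ex v \<otimes> g\<close> inside \<open>Kb\<close>.\<close>

lemma gen_kb_component: "g \<in> gen kb \<Longrightarrow> g \<in> identity_component L Kb"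
proof (induction rule: gen.induct)
  case one
  have "\<one> \<in> Kb" using subgroup_one[OF subK] by (simp add: K_beta_def)
  then show ?case by (simp add: identity_component_def connected_component_refl)
next
  case (step v g)
  let ?c = "\<lambda>t::real. ex (t *\<^sub>R v) \<otimes> g"
  have g: "connected_component Kb \<one> g" using step by (simp add: identity_component_def)
  then have gK: "g \<in> K" "AD g \<beta> = \<beta>" using connected_component_in[OF g] by (auto simp: K_beta_def)
  have "\<beta> \<in> eig v 0" using step(1) eig0_sym by blast
  then have "AD (ex (t *\<^sub>R v)) \<beta> = \<beta>" for t by (simp add: eig0_iff)
  moreover have "ex (t *\<^sub>R v) \<in> K" for t using step(1) by (simp add: lie_iff)
  ultimately have "range ?c \<subseteq> Kb" using gK by (auto simp: K_beta_def AD_mult intro: subgroup_mult[OF subK])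
  moreover have "connected (range ?c)"
    by (intro connected_continuous_image continuous_on_mult_group continuous_on_ex continuous_intros) simp
  moreover have "?c 0 \<in> range ?c" "?c 1 \<in> range ?c" by blast+
  ultimately have "connected_component Kb g (ex v \<otimes> g)" unfolding connected_component_def by (intro exI[of _ "range ?c"]) simp
  with g show ?case unfolding identity_component_def by (auto intro: connected_component_trans)
qed

text \<open>An element commuting with \<open>\<beta>\<close> is its own limit under conjugation by
  the flow, so \<open>M_parabolic\<close> gives the inclusion into \<open>M\<close>; the other one
  comes from the factors in \<open>gen kb\<close>.\<close>

lemma M_component_orbit: "M = {act g y |g. g \<in> identity_component L Kb}"
proof (intro equalityI subsetI)
  fix z assume "z \<in> M"
  then show "z \<in> {act g y |g. g \<in> identity_component L Kb}" using M_eq gen_kb_component by blast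
next
  fix z assume "z \<in> {act g y |g. g \<in> identity_component L Kb}"
  then obtain g where "connected_component Kb \<one> g" "z = act g y" by (auto simp: identity_component_def)
  then have g: "g \<in> K" "AD g \<beta> = \<beta>" "z = act g y" using connected_component_in[of Kb \<one> g] by (auto simp: K_beta_def)
  have "ex (t *\<^sub>R \<beta>) \<otimes> g \<otimes> ex (- t *\<^sub>R \<beta>) = g" for t
  proof -
    have "g \<otimes> ex (t *\<^sub>R \<beta>) = ex (t *\<^sub>R \<beta>) \<otimes> g" using g(2) unfolding AD_fix_iff by blast
    then have "ex (t *\<^sub>R \<beta>) \<otimes> g \<otimes> ex (- t *\<^sub>R \<beta>) = g \<otimes> ex (t *\<^sub>R \<beta>) \<otimes> ex (- t *\<^sub>R \<beta>)" by simp
    then show ?thesis by (simp add: m_assoc ex_minus)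
  qed
  then have lim: "((\<lambda>t. ex (t *\<^sub>R \<beta>) \<otimes> g \<otimes> ex (- t *\<^sub>R \<beta>)) \<longlongrightarrow> g) at_bot" by simp
  show "z \<in> M" unfolding g(3) by (rule M_parabolic[OF _ lim y_M]) (use g(1) in \<open>simp add: K_eq\<close>)
qed

lemma connected_M: "connected M"
proof -
  have "M = (\<lambda>g. act g y) ` identity_component L Kb" using M_component_orbit by blast
  moreover have "connected (identity_component L Kb)" by (simp add: identity_component_def)
  ultimately show ?thesis
    using connected_continuous_image[OF continuous_on_act[OF continuous_on_id continuous_on_const]] by metis
qed

lemma unique_closed_P_orbit: "unique_closed_orbit L act P X M"
proof -
  have cX: "closed X" using X_comp by (rule compact_imp_closed)
  have "closed_orbit L act P X M"
    unfolding closed_orbit_def orbits_def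
  proof
    show "M \<in> {orbit (L\<lparr>carrier := P\<rparr>) act z |z. z \<in> X}" using M_P_orbit y_X by (auto simp: orbit_def)
    show "closedin (top_of_set X) M" using closed_M M_iff O_X by (auto intro!: closed_subset)
  qed
  moreover have "S = M" if S: "closed_orbit L act P X S" for S
  proof -
    obtain z where z: "z \<in> X" "S = {act g z |g. g \<in> P}"
      using S by (auto simp: closed_orbit_def orbits_def orbit_def)
    have "closedin (top_of_set X) S" using S by (simp add: closed_orbit_def)
    then have "closed {act g z |g. g \<in> P}" using closedin_closed_trans[OF _ cX] z(2) by metis
    then show ?thesis using closed_P_orbit[OF z(1)] z(2) by simp
  qed
  ultimately show ?thesis unfolding unique_closed_orbit_def by blast
qed

end

theorem theorem2:
  fixes L :: "'g::{t2_space,second_countable_topology} monoid"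
    and A :: "('g, 'e::fin_dim_complex) atlas"
    and U G :: "'g set"
    and B :: "('z::{t2_space,second_countable_topology}, 'f::fin_dim_complex) atlas"
    and \<omega> :: "'z \<Rightarrow> 'f \<Rightarrow> 'f \<Rightarrow> real"
    and act :: "'g \<Rightarrow> 'z \<Rightarrow> 'z"
    and \<mu> :: "'z \<Rightarrow> 'e \<Rightarrow> real"
    and x :: 'z and X \<O> :: "'z set" and \<beta> :: 'e
  assumes "complexification_of L A U" and "connected U"
    and "compatible_subgroup L A U G" and "connected G" and "real_form L A U G"
    and "Kaehler_manifold B \<omega>"
    and "holomorphic_action L A B act"
    and "invariant_2form B act U \<omega>"
    and "momentum_map L A U B \<omega> act \<mu>"
    and "X = orbit L act x" and "compact X"
    and "unique_closed_orbit L act G X \<O>"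
    and "\<beta> \<in> noncompact_part L A U G"
  shows "unique_closed_orbit L act (G_beta_plus L A G \<beta>) X (max_set \<O> (momentum_p \<mu> \<beta>)) \<and>
    connected (max_set \<O> (momentum_p \<mu> \<beta>)) \<and>
    (\<exists>p. max_set \<O> (momentum_p \<mu> \<beta>) =
       orbit (L\<lparr>carrier := identity_component L (K_beta L A (compact_part U G) \<beta>)\<rparr>) act p)"
proof -
  interpret Lie_action L A B act
    by standard (use assms(1,6,7) in \<open>simp_all add: complexification_of_def Kaehler_manifold_def\<close>)
  have X: "X = {act g x |g. True}" using assms(10) by (simp add: orbit_def)
  have X_act: "act g y \<in> X" if y: "y \<in> X" for g y
  proof -
    obtain h where "y = act h x" using y X by blast
    then have "act g y = act (g \<otimes>\<^bsub>L\<^esub> h) x" by (simp add: act_mult)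
    then show ?thesis using X by blast
  qed
  have X_trans: "\<exists>g. z = act g y" if yz: "y \<in> X" "z \<in> X" for y z
  proof -
    obtain h k where "y = act h x" "z = act k x" using yz X by blast
    then have "z = act (k \<otimes>\<^bsub>L\<^esub> inv\<^bsub>L\<^esub> h) y" by (simp add: act_mult)
    then show ?thesis by blast
  qed
  have "X \<noteq> {}" using X by blast
  interpret compact_orbit L A B act U G \<omega> \<mu> X
    by standard (fact assms(1-3,5,6,9,11) X_act X_trans \<open>X \<noteq> {}\<close>)+
  have O: "closed_orbit L act G X \<O>" using assms(12) by (simp add: unique_closed_orbit_def)
  then obtain q where q: "q \<in> X" "\<O> = {act g q |g. g \<in> G}"
    by (auto simp: closed_orbit_def orbits_def orbit_def)
  have O_act: "act g z \<in> \<O>" if gz: "g \<in> G" "z \<in> \<O>" for g z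
  proof -
    obtain h where h: "h \<in> G" "z = act h q" using gz(2) q(2) by blast
    then have "act g z = act (g \<otimes>\<^bsub>L\<^esub> h) q" by (simp add: act_mult)
    then show ?thesis using q(2) subgroup_mult[OF subG gz(1) h(1)] by blast
  qed
  have O_trans: "\<exists>g\<in>G. w = act g z" if zw: "z \<in> \<O>" "w \<in> \<O>" for z w
  proof -
    obtain h k where h: "h \<in> G" "z = act h q" "k \<in> G" "w = act k q" using zw q(2) by blast
    then have "w = act (k \<otimes>\<^bsub>L\<^esub> inv\<^bsub>L\<^esub> h) z" by (simp add: act_mult)
    then show ?thesis using subgroup_mult[OF subG h(3) subgroup_inv[OF subG h(1)]] by blast
  qed
  have "closedin (top_of_set X) \<O>" using O by (simp add: closed_orbit_def)
  then have O_closed: "closed \<O>" using closedin_closed_trans compact_imp_closed[OF X_comp] by blast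
  have "q \<in> \<O>" using q(2) subgroup_one[OF subG] by (auto intro!: exI[of _ "\<one>\<^bsub>L\<^esub>"])
  then have O_ne: "\<O> \<noteq> {}" by blast
  have O_X: "\<O> \<subseteq> X" using q X_act by blast
  \<comment> \<open>\<open>b'\<close> and \<open>y\<close> are constructed from
    \<open>\<beta>\<close> and \<open>X\<close> alone, before \<open>\<O>\<close> enters; that
    \<open>y\<close> lies in \<open>\<O>\<close> is derived afterwards in
    \<open>y_O\<close>.\<close>
  obtain b' y where p: "b' \<in> pp" "b' \<in> eig \<beta> 0" "eig b' 0 \<subseteq> eig \<beta> 0"
    "\<And>v x. v \<in> lie G \<Longrightarrow> v \<in> eig b' x \<Longrightarrow> x > 0 \<Longrightarrow> v \<in> Eg (lie G) \<beta> {0..}"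
    "y \<in> MX b'" "y \<in> MX \<beta>" "\<And>v. v \<in> pp \<Longrightarrow> v \<in> eig b' 0 \<Longrightarrow> v \<in> stab y"
    "\<And>c. c \<in> MX b' \<Longrightarrow> \<exists>h\<in>gen (lie K \<inter> eig b' 0). c = act h y"
    by (rule special_point_exists[OF assms(13)]) blast
  interpret special_point L A B act U G \<omega> \<mu> X \<beta> b' y \<O>
    by standard (fact assms(13) p O_closed O_ne O_X O_act O_trans)+
  show ?thesis
  proof (intro conjI exI)
    show "max_set \<O> (f \<beta>) = orbit (L\<lparr>carrier := identity_component L (K_beta L A K \<beta>)\<rparr>) act y"
      using M_component_orbit by (simp add: orbit_def)
  qed (rule unique_closed_P_orbit connected_M)+
qed

end
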